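(* Consider the branching random walk on $\mathbb{Z}^d$ described in the context, with $\beta^*>0$, and suppose that the variance of jumps of the underlying random walk is finite, i.e. $\sum_{z\in\mathbb{Z}^d}|z|^2a(z)<\infty$. Then there exist positive functions $C(x,y)$ and $C(x)$ of $x,y\in\mathbb{Z}^d$ such that, for all $x,y\in\mathbb{Z}^d$, as $t\to\infty$, $$m_1(t,x,y)\sim C(x,y)\,u^*(t),\qquad m_1(t,x)\sim C(x)\,v^*(t),$$ where the functions $u^*$ and $v^*$ have the following form: (a) for $\beta^*>\beta_c$: $u^*(t)=e^{\lambda_{\mathcal{E}}t}$, $v^*(t)=e^{\lambda_{\mathcal{E}}t}$; (b) for $\beta^*=\beta_c$: - if $d=3$: $u^*(t)=t^{-1/2}e^{-b_0t}$, $v^*(t)=t^{1/2}e^{-b_0t}$; - if $d=4$: $u^*(t)=(\ln t)^{-1}e^{-b_0t}$, $v^*(t)=t(\ln t)^{-1}e^{-b_0t}$; - if $d\ge5$: $u^*(t)=e^{-b_0t}$, $v^*(t)=t\,e^{-b_0t}$; (c) for $\beta^*<\beta_c$, $d\ge3$: $u^*(t)=t^{-d/2}e^{-b_0t}$, $v^*(t)=e^{-b_0t}$.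
   Context: **Random walk.** Let $d\in\mathbb{N}$. The underlying continuous-time random walk on $\mathbb{Z}^d$ has transition intensity matrix $A=(a(x,y))_{x,y\in\mathbb{Z}^d}$ with $a(x,y)\ge0$ for $x\ne y$, $a(x,x)<0$, and is regular ($\sum_y a(x,y)=0$), symmetric ($a(x,y)=a(y,x)$), spatially homogeneous ($a(x,y)=a(y-x)$, regarded as a function of one argument), time homogeneous and irreducible (every lattice point can be reached from every other). Its transition probabilities are $p(t,x,y)$; $p(h,x,y)=a(x,y)h+o(h)$ for $x\neq y$ and $p(h,x,x)=1+a(x,x)h+o(h)$ as $h\to0$. The Green's function is $G_\lambda(x,y)=\int_0^\infty e^{-\lambda t}p(t,x,y)\,dt$, $\lambda\ge0$, and $\beta_c:=1/G_0(0,0)$ (with $\beta_c=0$ if $G_0(0,0)=\infty$). $|\cdot|$ is the Euclidean norm. **Branching and absorption.** Let $f(u)=\sum_{n\ge0}b_nu^n$, $0\le u\le1$, with $b_n\ge0$ for $n\ne1$, $b_1<0$, $\sum_nb_n=0$. A particle at $x$ during a short time $dt$ jumps to $y\ne x$ with probability $a(x,y)dt+o(dt)$, dies with probability $b_0dt+o(dt)$ (at every lattice point $x$), and, only if $x=0$, is replaced by $n>1$ particles at $0$ (itself included) with probability $b_ndt+o(dt)$; otherwise it stays unchanged. Particles evolve independently of each other and of the past. Put $\beta^*:=\sum_{n>1}(n-1)b_n$ (finite); throughout $\beta^*>0$. **Moments.** $\mu(t,y)$ is the number of particles at $y\in\mathbb{Z}^d$ at time $t$, and $\mu(t)=\sum_y\mu(t,y)$.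 $\mathsf{E}_x$ is expectation when the process starts at time $0$ with one particle at $x$. $m_n(t,x,y):=\mathsf{E}_x\mu^n(t,y)$, $m_n(t,x):=\mathsf{E}_x\mu^n(t)$. **Evolution operator.** $(\mathcal{A}\varphi)(x)=\sum_ya(x-y)\varphi(y)$, $\Delta_0=\delta_0\delta_0^T$ (so $(\Delta_0\varphi)(x)=\varphi(0)$ if $x=0$ and $0$ otherwise), $\mathcal{E}=\mathcal{A}+\beta^*\Delta_0-b_0I$. When $\beta^*>\beta_c$, $\lambda_0>0$ denotes the unique isolated positive eigenvalue of $\mathcal{A}+\beta^*\Delta_0$ on $l^2(\mathbb{Z}^d)$, i.e. the solution of $\beta^*G_\lambda(0,0)=1$, and $\lambda_{\mathcal{E}}:=\lambda_0-b_0$. The symbol $\sim$ denotes asymptotic equivalence (the ratio tends to $1$). *)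

theory Defs
  imports "HOL-Probability.Probability" "HOL-Library.Landau_Symbols" "HOL-Library.Multiset"
begin

text \<open>
  The lattice is \<open>int ^ 'd\<close> with \<open>d = CARD('d)\<close>. All state spaces are countable, so transition
  functions are semigroups of probability mass functions. Their values at negative times are
  irrelevant.
\<close>

definition lattice_norm :: "int ^ 'd \<Rightarrow> real" where
  "lattice_norm z = norm ((\<chi> i. real_of_int (z $ i)) :: real ^ 'd)"

definition transition_semigroup :: "(real \<Rightarrow> 's \<Rightarrow> 's pmf) \<Rightarrow> bool" where
  "transition_semigroup K \<longleftrightarrow>
     (\<forall>x. K 0 x = return_pmf x) \<and>
     (\<forall>s t x. 0 \<le> s \<longrightarrow> 0 \<le> t \<longrightarrow> K (s + t) x = bind_pmf (K s x) (K t))"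


subsection \<open>The underlying random walk\<close>

definition walk_intensities :: "(int ^ 'd \<Rightarrow> int ^ 'd \<Rightarrow> real) \<Rightarrow> bool" where
  "walk_intensities a \<longleftrightarrow>
     (\<forall>x y. x \<noteq> y \<longrightarrow> 0 \<le> a x y) \<and>
     (\<forall>x. a x x < 0) \<and>
     (\<forall>x. ((\<lambda>y. a x y) has_sum 0) UNIV) \<and>
     (\<forall>x y. a x y = a y x) \<and>
     (\<forall>x y. a x y = a 0 (y - x)) \<and>
     (\<forall>x y. (x, y) \<in> {(u, v). u \<noteq> v \<and> 0 < a u v}\<^sup>*)"

definition walk_transitions ::
    "(int ^ 'd \<Rightarrow> int ^ 'd \<Rightarrow> real) \<Rightarrow> (real \<Rightarrow> int ^ 'd \<Rightarrow> (int ^ 'd) pmf) \<Rightarrow> bool" where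
  "walk_transitions a p \<longleftrightarrow>
     transition_semigroup p \<and>
     (\<forall>x y. x \<noteq> y \<longrightarrow> (\<lambda>h. pmf (p h x) y - a x y * h) \<in> o[at_right 0](\<lambda>h. h)) \<and>
     (\<forall>x. (\<lambda>h. pmf (p h x) x - (1 + a x x * h)) \<in> o[at_right 0](\<lambda>h. h))"

definition Green ::
    "(real \<Rightarrow> int ^ 'd \<Rightarrow> (int ^ 'd) pmf) \<Rightarrow> real \<Rightarrow> int ^ 'd \<Rightarrow> int ^ 'd \<Rightarrow> ennreal" where
  "Green p lam x y = (\<integral>\<^sup>+ t \<in> {0..}. ennreal (exp (- lam * t) * pmf (p t x) y) \<partial>lborel)"

definition beta_crit :: "(real \<Rightarrow> int ^ 'd \<Rightarrow> (int ^ 'd) pmf) \<Rightarrow> real" where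
  "beta_crit p = (if Green p 0 0 0 = \<infinity> then 0 else 1 / enn2real (Green p 0 0 0))"


subsection \<open>The branching random walk\<close>

definition branching_intensities :: "(nat \<Rightarrow> real) \<Rightarrow> bool" where
  "branching_intensities b \<longleftrightarrow>
     (\<forall>n. n \<noteq> 1 \<longrightarrow> 0 \<le> b n) \<and> b 1 < 0 \<and> b sums 0 \<and>
     (\<lambda>n. (real n - 1) * b n) summable_on {2..}"

definition beta_star :: "(nat \<Rightarrow> real) \<Rightarrow> real" where
  "beta_star b = (\<Sum>\<^sub>\<infinity>n\<in>{2..}. (real n - 1) * b n)"

text \<open>
  A state is the finite multiset of the positions of the particles. The second clause says that
  the particles evolve independently of each other: the descendants of \<open>\<eta> + \<eta>'\<close> are the union of
  independent descendants of \<open>\<eta>\<close> and of \<open>\<eta>'\<close>. The remaining clauses give the evolution of a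
  single particle during a short time. The intensities in them add up to zero, so that every other
  transition has probability \<open>o(h)\<close>; at the origin the total intensity of death and
  splitting is \<open>b 0 + (\<Sum>n. b (n + 2)) = - b 1\<close>.
\<close>

definition branching_transitions ::
    "(int ^ 'd \<Rightarrow> int ^ 'd \<Rightarrow> real) \<Rightarrow> (nat \<Rightarrow> real) \<Rightarrow>
     (real \<Rightarrow> (int ^ 'd) multiset \<Rightarrow> (int ^ 'd) multiset pmf) \<Rightarrow> bool" where
  "branching_transitions a b K \<longleftrightarrow>
     transition_semigroup K \<and>
     (\<forall>t \<eta> \<eta>'. 0 \<le> t \<longrightarrow>
        K t (\<eta> + \<eta>') = map_pmf (\<lambda>(\<zeta>, \<zeta>'). \<zeta> + \<zeta>') (pair_pmf (K t \<eta>) (K t \<eta>'))) \<and>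
     (\<forall>x y. x \<noteq> y \<longrightarrow>
        (\<lambda>h. pmf (K h {#x#}) {#y#} - a x y * h) \<in> o[at_right 0](\<lambda>h. h)) \<and>
     (\<forall>x. (\<lambda>h. pmf (K h {#x#}) {#} - b 0 * h) \<in> o[at_right 0](\<lambda>h. h)) \<and>
     (\<forall>n>1. (\<lambda>h. pmf (K h {#0#}) (replicate_mset n 0) - b n * h) \<in> o[at_right 0](\<lambda>h. h)) \<and>
     (\<lambda>h. pmf (K h {#0#}) {#0#} - (1 + (a 0 0 + b 1) * h)) \<in> o[at_right 0](\<lambda>h. h) \<and>
     (\<forall>x. x \<noteq> 0 \<longrightarrow>
        (\<lambda>h. pmf (K h {#x#}) {#x#} - (1 + (a x x - b 0) * h)) \<in> o[at_right 0](\<lambda>h. h))"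

text \<open>
  The probability that a Markov process with transition function \<open>K\<close> that is in \<open>\<eta>\<close> at time \<open>s\<close>
  visits the listed states at the listed times (in increasing order, the first one not before \<open>s\<close>).
\<close>

fun path_prob :: "(real \<Rightarrow> 's \<Rightarrow> 's pmf) \<Rightarrow> real \<Rightarrow> 's \<Rightarrow> (real \<times> 's) list \<Rightarrow> real" where
  "path_prob K s \<eta> [] = 1"
| "path_prob K s \<eta> ((t, \<zeta>) # ps) = pmf (K (t - s) \<eta>) \<zeta> * path_prob K t \<zeta> ps"

text \<open>
  \<open>M x\<close> is the probability measure of the process that starts with one particle at \<open>x\<close>, and
  \<open>X t\<close> is the configuration at time \<open>t\<close>. Independence of the past is the Markov property, stated
  by means of the finite-dimensional distributions. These include \<open>X 0 = {#x#}\<close>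
  almost surely, because \<open>K 0\<close> is the identity kernel.
\<close>

definition branching_random_walk ::
    "(int ^ 'd \<Rightarrow> int ^ 'd \<Rightarrow> real) \<Rightarrow> (nat \<Rightarrow> real) \<Rightarrow>
     (int ^ 'd \<Rightarrow> 'w measure) \<Rightarrow> (real \<Rightarrow> 'w \<Rightarrow> (int ^ 'd) multiset) \<Rightarrow> bool" where
  "branching_random_walk a b M X \<longleftrightarrow>
     (\<forall>x. prob_space (M x)) \<and>
     (\<forall>x t. 0 \<le> t \<longrightarrow> X t \<in> measurable (M x) (count_space UNIV)) \<and>
     (\<exists>K. branching_transitions a b K \<and>
        (\<forall>x ps. sorted (0 # map fst ps) \<longrightarrow>
           measure (M x) {\<omega> \<in> space (M x). \<forall>(t, \<zeta>) \<in> set ps. X t \<omega> = \<zeta>}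
             = path_prob K 0 {#x#} ps))"

definition local_moment ::
    "(int ^ 'd \<Rightarrow> 'w measure) \<Rightarrow> (real \<Rightarrow> 'w \<Rightarrow> (int ^ 'd) multiset) \<Rightarrow>
     nat \<Rightarrow> real \<Rightarrow> int ^ 'd \<Rightarrow> int ^ 'd \<Rightarrow> real" where
  "local_moment M X n t x y = (\<integral>\<omega>. real (count (X t \<omega>) y) ^ n \<partial>M x)"

definition total_moment ::
    "(int ^ 'd \<Rightarrow> 'w measure) \<Rightarrow> (real \<Rightarrow> 'w \<Rightarrow> (int ^ 'd) multiset) \<Rightarrow>
     nat \<Rightarrow> real \<Rightarrow> int ^ 'd \<Rightarrow> real" where
  "total_moment M X n t x = (\<integral>\<omega>. real (size (X t \<omega>)) ^ n \<partial>M x)"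


subsection \<open>The leading eigenvalue\<close>

definition l2 :: "('s \<Rightarrow> real) set" where
  "l2 = {\<phi>. (\<lambda>x. (\<phi> x)\<^sup>2) summable_on UNIV}"

definition eigenvalue_l2 :: "(('s \<Rightarrow> real) \<Rightarrow> 's \<Rightarrow> real) \<Rightarrow> real \<Rightarrow> bool" where
  "eigenvalue_l2 T lam \<longleftrightarrow> (\<exists>\<phi>\<in>l2. \<phi> \<noteq> (\<lambda>x. 0) \<and> T \<phi> = (\<lambda>x. lam * \<phi> x))"

text \<open>
  The operators below are bounded and self-adjoint. Hence their spectrum is real and can be computed
  over the real scalars, and by the bounded inverse theorem bijectivity suffices for a
  bounded inverse.
\<close>

definition spectrum_l2 :: "(('s \<Rightarrow> real) \<Rightarrow> 's \<Rightarrow> real) \<Rightarrow> real set" where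
  "spectrum_l2 T = {lam. \<not> bij_betw (\<lambda>\<phi> x. T \<phi> x - lam * \<phi> x) l2 l2}"

definition walk_operator ::
    "(int ^ 'd \<Rightarrow> int ^ 'd \<Rightarrow> real) \<Rightarrow> (int ^ 'd \<Rightarrow> real) \<Rightarrow> int ^ 'd \<Rightarrow> real" where
  "walk_operator a \<phi> x = (\<Sum>\<^sub>\<infinity>y. a x y * \<phi> y)"

definition perturbed_operator ::
    "(int ^ 'd \<Rightarrow> int ^ 'd \<Rightarrow> real) \<Rightarrow> real \<Rightarrow> (int ^ 'd \<Rightarrow> real) \<Rightarrow> int ^ 'd \<Rightarrow> real" where
  "perturbed_operator a \<beta> \<phi> x = walk_operator a \<phi> x + \<beta> * (if x = 0 then \<phi> 0 else 0)"

definition lambda_0 :: "(int ^ 'd \<Rightarrow> int ^ 'd \<Rightarrow> real) \<Rightarrow> real \<Rightarrow> real" where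
  "lambda_0 a \<beta> = (THE lam. lam > 0 \<and> eigenvalue_l2 (perturbed_operator a \<beta>) lam \<and>
     lam isolated_in spectrum_l2 (perturbed_operator a \<beta>))"

definition lambda_E :: "(int ^ 'd \<Rightarrow> int ^ 'd \<Rightarrow> real) \<Rightarrow> (nat \<Rightarrow> real) \<Rightarrow> real" where
  "lambda_E a b = lambda_0 a (beta_star b) - b 0"

end

theory Submission
 imports Defs "HOL-Real_Asymp.Real_Asymp"
begin

text \<open>
  Multiplied by \<open>exp (b 0 * t)\<close>, the mean number of particles at the origin satisfies a renewal
  equation \<open>w = p + \<beta> * (p convolved with w)\<close>, where \<open>p\<close> is the return probability of the walk and
  \<open>\<beta> = beta_star b\<close> (\<open>first_moment_renewal\<close>). It is derived from the backward equation of generating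
  functions, since the moments are not known to be finite beforehand. All other first moments
  arise from \<open>w\<close> by convolutions with transition probabilities (\<open>first_moment_structure\<close>), so the theorem
  reduces to the asymptotics of \<open>w\<close>.

  The kernel \<open>\<beta> * p\<close> has total mass \<open>\<beta> / beta_crit p\<close>. Its decay is given by the local limit theorem, a
  consequence of the Fourier representation and of finite variance (\<open>local_limit\<close>). If the mass is less
  than one, \<open>w\<close> decays like \<open>p\<close> (\<open>subcritical_renewal\<close>). If it equals one, \<open>\<beta> * p\<close> is the density of a waiting
  time with survival function of order \<open>t powr (1 - d / 2)\<close>: the mean is finite for \<open>d \<ge> 5\<close>
  (\<open>finite_mean\<close>), diverges logarithmically for \<open>d = 4\<close> (\<open>tail_inverse\<close>) and like a square root for
  \<open>d = 3\<close> (\<open>tail_sqrt\<close>). If it exceeds one, there is a unique \<open>mu > 0\<close> at which the Laplace transform of \<open>\<beta> * p\<close>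
  equals one; tilting by \<open>exp (- mu * t)\<close> reduces this case to a waiting time of finite mean.

  Two facts stem from the symmetry of the walk. The tilted \<open>w\<close> is logarithmically convex and bounded, hence
  nonincreasing, and for nonincreasing \<open>w\<close> the identity \<open>conv_tail\<close> determines the asymptotics by elementary
  means. And the number \<open>mu\<close> is the leading eigenvalue \<open>lambda_0\<close>: on the positive half line,
  the operator perturbed at one site is invertible except where \<open>\<beta>\<close> times the Green's function equals one
  (\<open>rank_one_eigenvalue\<close>, \<open>rank_one_bijective\<close>, \<open>lambda_0_eq\<close>).
\<close>

section \<open>Short-time expansions and the backward equation\<close>

lemma summable_on_bounded:
 fixes f B :: "'i => real"
 assumes "B summable_on A" and "!!i. i \<in> A ==> \<bar>f i\<bar> <= B i"
 shows "f summable_on A"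
proof -
 have "(%i. norm (f i)) summable_on A"
  by (rule summable_on_comparison_test[OF assms(1)]) (use assms(2) in auto)
 then show ?thesis using summable_on_iff_abs_summable_on_real by blast
qed

lemma uniform_limit_infsum:
 fixes f :: "'i => 't => real"
 assumes bound: "!!i t. i \<in> A ==> t \<in> U ==> \<bar>f i t\<bar> <= B i"
  and summ: "B summable_on A"
 shows "uniform_limit U (%F t. \<Sum>i\<in>F. f i t) (%t. \<Sum>\<^sub>\<infinity>i\<in>A. f i t) (finite_subsets_at_top A)"
 unfolding uniform_limit_iff
proof (intro allI impI)
 fix e :: real assume "e > 0"
 have "((%F. sum B F) \<longlongrightarrow> infsum B A) (finite_subsets_at_top A)"
  using summ by (rule infsum_tendsto)
 then have "\<forall>\<^sub>F F in finite_subsets_at_top A. dist (sum B F) (infsum B A) < e"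
  using \<open>e > 0\<close> by (rule tendstoD)
 moreover have "\<forall>\<^sub>F F in finite_subsets_at_top A. finite F & F \<subseteq> A"
  by (simp add: eventually_finite_subsets_at_top_weakI)
 ultimately show "\<forall>\<^sub>F F in finite_subsets_at_top A. \<forall>t\<in>U. dist (\<Sum>i\<in>F. f i t) (\<Sum>\<^sub>\<infinity>i\<in>A. f i t) < e"
 proof eventually_elim
  case (elim F)
  have sB: "B summable_on (A - F)" using summ by (rule summable_on_subset) auto
  show ?case
  proof
   fix t assume t: "t \<in> U"
   have s: "(%i. f i t) summable_on A"
    by (rule summable_on_bounded[OF summ]) (use bound t in auto)
   have s': "(%i. f i t) summable_on (A - F)"
    by (rule summable_on_bounded[OF sB]) (use bound t in auto)
   have 1: "infsum (%i. f i t) A = (\<Sum>i\<in>F. f i t) + infsum (%i. f i t) (A - F)"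
    using infsum_Un_disjoint[of "%i. f i t" F "A - F"] elim s
    by (simp add: Un_absorb1 summable_on_subset[OF s])
   have 2: "infsum B A = sum B F + infsum B (A - F)"
    using infsum_Un_disjoint[of B F "A - F"] elim sB by (simp add: Un_absorb1)
   have "\<bar>infsum (%i. f i t) (A - F)\<bar> <= infsum B (A - F)"
    using norm_infsum_le[OF has_sum_infsum[OF s'] has_sum_infsum[OF sB]]
     bound t by auto
   then show "dist (\<Sum>i\<in>F. f i t) (\<Sum>\<^sub>\<infinity>i\<in>A. f i t) < e"
    using 1 2 elim by (auto simp: dist_real_def)
  qed
 qed
qed

lemma continuous_on_infsum:
 fixes f :: "'i => 't::topological_space => real"
 assumes cont: "!!i. i \<in> A ==> continuous_on U (f i)"
  and bound: "!!i t. i \<in> A ==> t \<in> U ==> \<bar>f i t\<bar> <= B i"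
  and summ: "B summable_on A"
 shows "continuous_on U (%t. \<Sum>\<^sub>\<infinity>i\<in>A. f i t)"
proof (rule uniform_limit_theorem)
 show "finite_subsets_at_top A ~= bot" by simp
 show "uniform_limit U (%F t. \<Sum>i\<in>F. f i t) (%t. \<Sum>\<^sub>\<infinity>i\<in>A. f i t) (finite_subsets_at_top A)"
  by (rule uniform_limit_infsum[OF bound summ])
 show "\<forall>\<^sub>F F in finite_subsets_at_top A. continuous_on U (%t. \<Sum>i\<in>F. f i t)"
  by (rule eventually_finite_subsets_at_top_weakI) (auto intro!: continuous_on_sum cont)
qed

text \<open>The error is uniform in the test function because the positive intensities outside a finite set are small in
total: the finitely many states inside contribute the expansion, and conservation of mass bounds what all other
states can carry.\<close>
lemma short_time_expansion:
 fixes \<pi> :: "real => 's pmf" and L :: "'s => real"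
 assumes x0: "x0 \<in> S"
  and nonneg: "!!eta. eta \<in> S ==> eta ~= x0 ==> 0 <= L eta"
  and rate: "!!eta. eta \<in> S ==>
   (%h. pmf (\<pi> h) eta - (indicator {x0} eta + L eta * h)) \<in> o[at_right 0](%h. h)"
  and total: "(L has_sum 0) S"
  and "\<epsilon> > 0"
 shows "\<exists>\<delta>>0. \<forall>h. 0 < h --> h < \<delta> --> (\<forall>g. (\<forall>eta. \<bar>g eta\<bar> <= 1) -->
  \<bar>measure_pmf.expectation (\<pi> h) g - g x0 - h * (\<Sum>\<^sub>\<infinity>eta\<in>S. L eta * g eta)\<bar> <= \<epsilon> * h)"
proof -
 define err where "err h eta = \<bar>pmf (\<pi> h) eta - (indicator {x0} eta + L eta * h)\<bar>" for h eta
 have "(sum L \<longlongrightarrow> 0) (finite_subsets_at_top S)" using total by (simp add: has_sum_def)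
 then have "\<forall>\<^sub>F F in finite_subsets_at_top S. dist (sum L F) 0 < \<epsilon>/4"
  using \<open>\<epsilon> > 0\<close> by (intro tendstoD) auto
 then obtain F0 where F0: "finite F0" "F0 \<subseteq> S"
  "!!F. finite F ==> F0 \<subseteq> F ==> F \<subseteq> S ==> \<bar>sum L F\<bar> < \<epsilon>/4"
  unfolding eventually_finite_subsets_at_top by (auto simp: dist_real_def)
 define F where "F = insert x0 F0"
 have F: "finite F" "F \<subseteq> S" "x0 \<in> F" "\<bar>sum L F\<bar> < \<epsilon>/4"
  using F0(1,2) x0 F0(3)[of "insert x0 F0"] by (auto simp: F_def)
 have "\<forall>\<^sub>F h in at_right 0. \<forall>eta\<in>F. err h eta <= \<epsilon> / (4 * card F) * h"
 proof (rule eventually_ball_finite[OF \<open>finite F\<close>], intro ballI)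
  fix eta assume "eta \<in> F"
  then have "eta \<in> S" using F by auto
  have "card F > 0" using F by (auto simp: card_gt_0_iff)
  then have "\<epsilon> / (4 * card F) > 0" using \<open>\<epsilon> > 0\<close> by simp
  from landau_o.smallD[OF rate[OF \<open>eta \<in> S\<close>] this]
  have "\<forall>\<^sub>F h in at_right 0. norm (pmf (\<pi> h) eta - (indicator {x0} eta + L eta * h)) <= \<epsilon> / (4 * card F) * norm (h::real)" .
  moreover have "\<forall>\<^sub>F h in at_right (0::real). h > 0" by (simp add: eventually_at_right_less)
  ultimately show "\<forall>\<^sub>F h in at_right 0. err h eta <= \<epsilon> / (4 * card F) * h"
   by eventually_elim (simp add: err_def)
 qed
 then obtain \<delta> where "\<delta> > 0" and \<delta>: "!!h eta. 0 < h ==> h < \<delta> ==> eta \<in> F ==> err h eta <= \<epsilon> / (4 * card F) * h"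
  unfolding eventually_at_right_field by auto
 show ?thesis
 proof (intro exI[of _ \<delta>] conjI allI impI)
  fix h and g :: "'s => real" assume h: "0 < h" "h < \<delta>" and g: "\<forall>eta. \<bar>g eta\<bar> <= 1"
  let ?P = "measure_pmf (\<pi> h)"
  have int_g: "integrable ?P g"
   by (rule measure_pmf.integrable_const_bound[where B=1]) (use g in auto)
  have "(\<Sum>eta\<in>F. err h eta) <= card F * (\<epsilon> / (4 * card F) * h)"
   using \<delta>[OF h] by (intro sum_bounded_above) auto
  also have "... = \<epsilon>/4 * h" using F by (auto simp: card_gt_0_iff)
  finally have err: "(\<Sum>eta\<in>F. err h eta) <= \<epsilon>/4 * h" .
  have split: "measure_pmf.expectation (\<pi> h) g
    = (\<Sum>eta\<in>F. pmf (\<pi> h) eta * g eta) + (\<integral>eta. g eta * indicator (- F) eta \<partial>?P)"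
  proof -
   have "g = (%eta. g eta * indicator F eta + g eta * indicator (-F) eta)"
    by (auto simp: indicator_def)
   then have "measure_pmf.expectation (\<pi> h) g
     = (\<integral>eta. g eta * indicator F eta + g eta * indicator (-F) eta \<partial>?P)" by simp
   also have "... = (\<integral>eta. g eta * indicator F eta \<partial>?P) + (\<integral>eta. g eta * indicator (-F) eta \<partial>?P)"
    by (intro Bochner_Integration.integral_add integrable_real_mult_indicator) (auto intro: int_g)
   also have "(\<integral>eta. g eta * indicator F eta \<partial>?P) = (\<Sum>eta\<in>F. pmf (\<pi> h) eta * g eta)"
    by (subst integral_measure_pmf_real[where A=F]) (use F in \<open>auto simp: indicator_def mult_ac intro!: sum.cong split: if_splits\<close>)
   finally show ?thesis .
  qed
  have rest: "\<bar>\<integral>eta. g eta * indicator (- F) eta \<partial>?P\<bar> <= 1 - (\<Sum>eta\<in>F. pmf (\<pi> h) eta)"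
  proof -
   have "\<bar>\<integral>eta. g eta * indicator (- F) eta \<partial>?P\<bar> <= (\<integral>eta. indicator (-F) eta \<partial>?P)"
    by (rule order_trans[OF integral_abs_bound], rule integral_mono)
     (use g in \<open>auto simp: indicator_def intro!: integrable_real_mult_indicator int_g
       measure_pmf.integrable_const_bound[where B=1]\<close>)
   also have "... = 1 - measure ?P F"
    by (simp add: measure_pmf.prob_compl[symmetric] Compl_eq_Diff_UNIV)
   also have "measure ?P F = (\<Sum>eta\<in>F. pmf (\<pi> h) eta)" using F by (simp add: measure_measure_pmf_finite)
   finally show ?thesis .
  qed
  have sumone: "(\<Sum>eta\<in>F. indicator {x0} eta + L eta * h) = 1 + h * sum L F"
   using F by (simp add: sum.distrib sum_distrib_left mult.commute indicator_def)
  have "\<bar>(\<Sum>eta\<in>F. pmf (\<pi> h) eta) - (1 + h * sum L F)\<bar> <= (\<Sum>eta\<in>F. err h eta)"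
   unfolding sumone[symmetric] sum_subtractf[symmetric] err_def by (rule sum_abs)
  then have rest': "\<bar>\<integral>eta. g eta * indicator (- F) eta \<partial>?P\<bar> <= \<epsilon>/4 * h + h * \<bar>sum L F\<bar>"
   using rest err mult_left_mono[OF abs_ge_minus_self[of "sum L F"], of h] h by auto
  have "\<bar>(\<Sum>eta\<in>F. pmf (\<pi> h) eta * g eta) - (g x0 + h * (\<Sum>eta\<in>F. L eta * g eta))\<bar> <= (\<Sum>eta\<in>F. err h eta)"
  proof -
   have "g x0 + h * (\<Sum>eta\<in>F. L eta * g eta) = (\<Sum>eta\<in>F. (indicator {x0} eta + L eta * h) * g eta)"
    using F by (simp add: sum.distrib distrib_right sum_distrib_left mult.assoc mult.left_commute indicator_def)
   then have "\<bar>(\<Sum>eta\<in>F. pmf (\<pi> h) eta * g eta) - (g x0 + h * (\<Sum>eta\<in>F. L eta * g eta))\<bar>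
     = \<bar>\<Sum>eta\<in>F. (pmf (\<pi> h) eta - (indicator {x0} eta + L eta * h)) * g eta\<bar>"
    by (simp add: sum_subtractf[symmetric] left_diff_distrib)
   also have "... <= (\<Sum>eta\<in>F. \<bar>(pmf (\<pi> h) eta - (indicator {x0} eta + L eta * h)) * g eta\<bar>)" by (rule sum_abs)
   also have "... <= (\<Sum>eta\<in>F. err h eta)"
    unfolding err_def abs_mult by (intro sum_mono mult_left_le) (use g in auto)
   finally show ?thesis .
  qed
  note main = this
  have tail: "\<bar>(\<Sum>\<^sub>\<infinity>eta\<in>S. L eta * g eta) - (\<Sum>eta\<in>F. L eta * g eta)\<bar> <= \<bar>sum L F\<bar>"
  proof -
   have L: "L summable_on S" using total by (rule has_sum_imp_summable)
   have Lg: "(%eta. L eta * g eta) summable_on S"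
   proof -
    have "(%x. norm (L x)) summable_on S" using L summable_on_iff_abs_summable_on_real by blast
    then show ?thesis
     by (rule summable_on_bounded) (use g in \<open>auto simp: abs_mult intro!: mult_left_le\<close>)
   qed
   have LF: "L summable_on (S - F)" by (rule summable_on_subset[OF L]) auto
   have LgF: "(%eta. L eta * g eta) summable_on (S - F)" by (rule summable_on_subset[OF Lg]) auto
   have "(\<Sum>\<^sub>\<infinity>eta\<in>S. L eta * g eta) = (\<Sum>eta\<in>F. L eta * g eta) + (\<Sum>\<^sub>\<infinity>eta\<in>S-F. L eta * g eta)"
    using infsum_Un_disjoint[of "%eta. L eta * g eta" F "S - F"] F LgF by (simp add: Un_absorb1)
   moreover have "0 = sum L F + infsum L (S - F)"
    using infsum_Un_disjoint[of L F "S - F"] F LF infsumI[OF total] by (simp add: Un_absorb1)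
   moreover have "\<bar>\<Sum>\<^sub>\<infinity>eta\<in>S-F. L eta * g eta\<bar> <= infsum L (S - F)"
   proof -
    have "norm (L x * g x) <= L x" if "x \<in> S - F" for x
    proof -
     have "0 <= L x" using nonneg[of x] that F(3) by auto
     then show ?thesis using g by (simp add: abs_mult mult_left_le)
    qed
    from norm_infsum_le[OF has_sum_infsum[OF LgF] has_sum_infsum[OF LF] this]
    show ?thesis by simp
   qed
   ultimately show ?thesis by linarith
  qed
  have "\<bar>h * (\<Sum>\<^sub>\<infinity>eta\<in>S. L eta * g eta) - h * (\<Sum>eta\<in>F. L eta * g eta)\<bar> <= h * \<bar>sum L F\<bar>"
   using tail h by (simp add: right_diff_distrib[symmetric] abs_mult)
  moreover have "h * \<bar>sum L F\<bar> <= \<epsilon>/4 * h"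
   using F h by (simp add: mult.commute)
  ultimately have "\<bar>measure_pmf.expectation (\<pi> h) g - g x0 - h * (\<Sum>\<^sub>\<infinity>eta\<in>S. L eta * g eta)\<bar>
    <= 4 * (\<epsilon>/4 * h)"
   using split rest' main err by linarith
  then show "\<bar>measure_pmf.expectation (\<pi> h) g - g x0 - h * (\<Sum>\<^sub>\<infinity>eta\<in>S. L eta * g eta)\<bar> <= \<epsilon> * h" by simp
 qed fact
qed

text \<open>A one-sided difference quotient that converges uniformly to a continuous function already yields the two-sided
derivative. This is what allows to differentiate a semigroup whose generator is known only from right-hand
limits at time zero.\<close>
lemma has_real_derivative_of_uniform_increments:
 fixes u D :: "real => real"
 assumes incr: "!!\<epsilon>. \<epsilon> > 0 ==> \<exists>\<delta>>0. \<forall>h t. 0 < h --> h < \<delta> --> 0 <= t -->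
   \<bar>u (t + h) - u t - h * D t\<bar> <= \<epsilon> * h"
  and D: "continuous_on {0..} D" and "0 <= t"
 shows "(u has_real_derivative D t) (at t within {0..})"
 unfolding has_field_derivative_iff tendsto_iff dist_real_def
proof (intro allI impI)
 fix e :: real assume "e > 0"
 from incr[of "e/3"] \<open>e > 0\<close> obtain d where d: "d > 0"
  "!!h t. 0 < h ==> h < d ==> 0 <= t ==> \<bar>u (t + h) - u t - h * D t\<bar> <= e/3 * h" by auto
 have "continuous (at t within {0..}) D"
  using D \<open>0 <= t\<close> by (simp add: continuous_on_eq_continuous_within)
 then have "\<forall>\<^sub>F s in at t within {0..}. \<bar>D s - D t\<bar> < e/3"
  unfolding continuous_within tendsto_iff dist_real_def
  using \<open>e > 0\<close> by (metis zero_less_divide_iff zero_less_numeral)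
 moreover have "\<forall>\<^sub>F s in at t within {0..}. dist s t < d"
  using d(1) tendsto_ident_at[of t "{0..}"] by (auto simp: tendsto_iff)
 moreover have "\<forall>\<^sub>F s in at t within {0..}. s \<in> {0..} & s ~= t"
  by (simp add: eventually_at_filter)
 ultimately show "\<forall>\<^sub>F s in at t within {0..}. \<bar>(u s - u t) / (s - t) - D t\<bar> < e"
 proof eventually_elim
  case (elim s)
  show ?case
  proof (cases "s > t")
   case True
   then have "\<bar>u s - u t - (s - t) * D t\<bar> <= e/3 * (s - t)"
    using d(2)[of "s - t" t] elim \<open>0 <= t\<close> by (simp add: dist_real_def)
   moreover have "(u s - u t) / (s - t) - D t = (u s - u t - (s - t) * D t) / (s - t)"
    using True by (simp add: field_simps)
   ultimately have "\<bar>(u s - u t) / (s - t) - D t\<bar> <= e/3"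
    using True by (simp add: abs_divide pos_divide_le_eq)
   then show ?thesis using \<open>e > 0\<close> by simp
  next
   case False
   then have st: "s < t" using elim by auto
   then have "\<bar>u t - u s - (t - s) * D s\<bar> <= e/3 * (t - s)"
    using d(2)[of "t - s" s] elim by (simp add: dist_real_def)
   moreover have "(u s - u t) / (s - t) - D s = (u t - u s - (t - s) * D s) / (t - s)"
    using st by (simp add: field_simps)
   ultimately have "\<bar>(u s - u t) / (s - t) - D s\<bar> <= e/3"
    using st by (simp add: abs_divide pos_divide_le_eq)
   with elim(1) \<open>e > 0\<close> show ?thesis by linarith
  qed
 qed
qed

text \<open>Only the transition rates out of \<open>x0\<close> enter, which is why the statement fits both the walk and the
branching process: for the latter the rates are known for one-particle states only.\<close>
lemma backward_equation:
 fixes K :: "real => 's => 's pmf" and g :: "'s => real"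
 defines "u \<equiv> %t eta. measure_pmf.expectation (K t eta) g"
 assumes K: "transition_semigroup K"
  and g: "\<forall>eta. \<bar>g eta\<bar> <= 1"
  and x0: "x0 \<in> S"
  and nonneg: "\<forall>eta\<in>S. eta ~= x0 --> 0 <= L eta"
  and rate: "\<forall>eta\<in>S.
   (%h. pmf (K h x0) eta - (indicator {x0} eta + L eta * h)) \<in> o[at_right 0](%h. h)"
  and total: "(L has_sum 0) S"
 shows "continuous_on {0..} (%t. u t x0)"
  and "[|\<forall>eta\<in>S. continuous_on {0..} (%t. u t eta); 0 <= t|] ==>
   ((%t. u t x0) has_real_derivative (\<Sum>\<^sub>\<infinity>eta\<in>S. L eta * u t eta)) (at t within {0..})"
proof -
 note g = g[rule_format] and nonneg = nonneg[rule_format] and rate = rate[rule_format]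
 have u1: "\<bar>u t eta\<bar> <= 1" for t eta
 proof -
  have "\<bar>u t eta\<bar> <= measure_pmf.expectation (K t eta) (%eta. \<bar>g eta\<bar>)"
   unfolding u_def by (rule integral_abs_bound)
  also have "... <= measure_pmf.expectation (K t eta) (%eta. 1)"
   by (rule integral_mono) (use g in \<open>auto intro!: measure_pmf.integrable_const_bound[where B=1]\<close>)
  finally show ?thesis by simp
 qed
 have Ls: "(%eta. \<bar>L eta\<bar>) summable_on S"
  using has_sum_imp_summable[OF total] summable_on_iff_abs_summable_on_real[of L S] by simp
 define B where "B = (\<Sum>\<^sub>\<infinity>eta\<in>S. \<bar>L eta\<bar>)"
 have LB: "\<bar>\<Sum>\<^sub>\<infinity>eta\<in>S. L eta * f eta\<bar> <= B" if f: "!!eta. \<bar>f eta\<bar> <= 1" for f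
 proof -
  have bd: "\<bar>L eta * f eta\<bar> <= \<bar>L eta\<bar>" for eta using f by (simp add: abs_mult mult_left_le)
  have "(%eta. L eta * f eta) summable_on S" by (rule summable_on_bounded[OF Ls bd])
  from norm_infsum_le[OF has_sum_infsum[OF this] has_sum_infsum[OF Ls]] bd
  show ?thesis by (simp add: B_def)
 qed
 have semi: "u (t + h) x0 = measure_pmf.expectation (K h x0) (u t)" if "0 <= h" "0 <= t" for t h
 proof -
  have "u (t + h) x0 = measure_pmf.expectation (bind_pmf (K h x0) (K t)) g"
   using K that by (simp add: u_def transition_semigroup_def add.commute)
  also have "... = measure_pmf.expectation (K h x0) (u t)"
   unfolding u_def measure_pmf_bind
   by (subst integral_bind[where K="count_space UNIV" and B=1 and B'=1])
    (use g in \<open>auto simp: measure_pmf_in_subprob_algebra\<close>)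
  finally show ?thesis .
 qed
 have incr: "\<exists>\<delta>>0. \<forall>h t. 0 < h --> h < \<delta> --> 0 <= t -->
   \<bar>u (t + h) x0 - u t x0 - h * (\<Sum>\<^sub>\<infinity>eta\<in>S. L eta * u t eta)\<bar> <= \<epsilon> * h" if "\<epsilon> > 0" for \<epsilon>
 proof -
  from short_time_expansion[OF x0 nonneg rate total \<open>\<epsilon> > 0\<close>] obtain \<delta> where "\<delta> > 0"
   "!!h g. 0 < h ==> h < \<delta> ==> (\<forall>eta. \<bar>g eta\<bar> <= 1) ==>
    \<bar>measure_pmf.expectation (K h x0) g - g x0 - h * (\<Sum>\<^sub>\<infinity>eta\<in>S. L eta * g eta)\<bar> <= \<epsilon> * h" by blast
  then show ?thesis using semi u1 by (intro exI[of _ \<delta>]) auto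
 qed
 show cont: "continuous_on {0..} (%t. u t x0)"
 proof -
  from incr[of 1] obtain d where d: "d > 0" "!!h t. 0 < h ==> h < d ==> 0 <= t ==>
   \<bar>u (t + h) x0 - u t x0 - h * (\<Sum>\<^sub>\<infinity>eta\<in>S. L eta * u t eta)\<bar> <= 1 * h" by auto
  have lip: "\<bar>u (t + h) x0 - u t x0\<bar> <= (B + 1) * h" if "0 < h" "h < d" "0 <= t" for t h
  proof -
   have "\<bar>h * (\<Sum>\<^sub>\<infinity>eta\<in>S. L eta * u t eta)\<bar> <= h * B"
    using LB[of "u t"] u1 \<open>0 < h\<close> by (simp add: abs_mult)
   then show ?thesis using d(2)[OF that] by (simp add: algebra_simps)
  qed
  have "B \<ge> 0" unfolding B_def by (rule infsum_nonneg) auto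
  show ?thesis
   unfolding continuous_on_iff
  proof (intro ballI allI impI)
   fix t e :: real assume t: "t \<in> {0..}" and "e > 0"
   show "\<exists>da>0. \<forall>t'\<in>{0..}. dist t' t < da --> dist (u t' x0) (u t x0) < e"
   proof (intro exI[of _ "min d (e / (B + 1))"] conjI ballI impI)
    show "0 < min d (e / (B + 1))" using d(1) \<open>e > 0\<close> \<open>B \<ge> 0\<close> by auto
    fix t' :: real assume t': "t' \<in> {0..}" "dist t' t < min d (e / (B + 1))"
    have "\<bar>u t' x0 - u t x0\<bar> <= (B + 1) * \<bar>t' - t\<bar>"
     using lip[of "t' - t" t] lip[of "t - t'" t'] t t'
     by (cases "t' = t"; cases "t' < t") (auto simp: dist_real_def abs_minus_commute)
    also have "... < e" using t' \<open>B \<ge> 0\<close> by (simp add: dist_real_def pos_less_divide_eq mult.commute)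
    finally show "dist (u t' x0) (u t x0) < e" by (simp add: dist_real_def)
   qed
  qed
 qed
 assume cu: "\<forall>eta\<in>S. continuous_on {0..} (%t. u t eta)" and "0 <= t"
 show "((%t. u t x0) has_real_derivative (\<Sum>\<^sub>\<infinity>eta\<in>S. L eta * u t eta)) (at t within {0..})"
 proof (rule has_real_derivative_of_uniform_increments[OF incr _ \<open>0 <= t\<close>])
  show "continuous_on {0..} (%t. \<Sum>\<^sub>\<infinity>eta\<in>S. L eta * u t eta)"
   by (rule continuous_on_infsum[OF _ _ Ls])
    (use u1 in \<open>auto intro!: continuous_intros cu[rule_format] simp: abs_mult mult_left_le\<close>)
 qed
qed

lemma nn_integral_count_space_has_sum:
 fixes f :: "'i => real"
 assumes "(f has_sum s) A" and "!!i. i \<in> A ==> 0 <= f i"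
 shows "(\<integral>\<^sup>+i. ennreal (f i) \<partial>count_space A) = ennreal s"
proof -
 have "f summable_on A" using assms(1) by (rule has_sum_imp_summable)
 then have "(%i. norm (f i)) summable_on A" using summable_on_iff_abs_summable_on_real by blast
 then have *: "Infinite_Set_Sum.abs_summable_on f A" by (rule abs_summable_equivalent[THEN iffD1])
 show ?thesis
  using nn_integral_conv_infsetsum[OF *] assms(2) infsetsum_infsum[OF *] infsumI[OF assms(1)] by simp
qed

lemma has_sum_of_nn_integral_count_space:
 fixes f :: "'i => real"
 assumes "(\<integral>\<^sup>+i. ennreal (f i) \<partial>count_space A) = ennreal s" and "!!i. i \<in> A ==> 0 <= f i" "0 <= s"
 shows "(f has_sum s) A"
proof -
 have "integrable (count_space A) f"
  by (rule integrableI_nonneg) (use assms in \<open>auto simp: AE_count_space\<close>)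
 then have *: "Infinite_Set_Sum.abs_summable_on f A" by (simp add: Infinite_Set_Sum.abs_summable_on_def)
 then have "(%i. norm (f i)) summable_on A" by (rule abs_summable_equivalent[THEN iffD2])
 then have "f summable_on A" using summable_on_iff_abs_summable_on_real by blast
 moreover have "infsum f A = s"
  using nn_integral_conv_infsetsum[OF *] assms infsetsum_infsum[OF *]
  by (simp add: infsum_nonneg)
 ultimately show ?thesis by (simp add: has_sum_iff)
qed

lemma at_within_halfline: "0 < s ==> at (s::real) within {0..} = at s"
 by (rule at_within_nhd[where S="{0<..}"]) auto

lemma power_over_fact_tendsto_0: "(%n. (x::real) ^ n / fact n) \<longlonglongrightarrow> 0"
 using summable_LIMSEQ_zero[OF summable_exp[of x]] by (simp add: field_simps)

lemma DERIV_power_over_fact: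
 fixes c :: real
 shows "((%s. (c * s) ^ Suc n / fact (Suc n)) has_real_derivative c * (c * t) ^ n / fact n) (at t within S)"
proof -
 have "((%s. c * s) has_real_derivative c) (at t within S)"
  by (auto intro!: derivative_eq_intros)
 from DERIV_cdivide[OF DERIV_power_Suc[OF this]]
 have "((%s. (c * s) ^ Suc n / fact (Suc n)) has_real_derivative
   (1 + of_nat n) * (c * (c * t) ^ n) / fact (Suc n)) (at t within S)" .
 moreover have "(1 + of_nat n) * (c * (c * t) ^ n) / fact (Suc n) = c * (c * t) ^ n / fact n"
 proof -
  have "(1 + real n) ~= 0" by simp
  then show ?thesis
   unfolding fact_Suc of_nat_Suc by (rule nonzero_mult_divide_mult_cancel_left)
 qed
 ultimately show ?thesis by simp
qed

section \<open>Uniqueness for bounded solutions\<close>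

text \<open>Picard iteration: a bounded solution with zero initial value is bounded by \<open>B * (c * t) ^ n / fact
n\<close> for every \<open>n\<close>.\<close>
lemma bounded_solution_zero:
 fixes Q :: "'x => 'x => real" and v :: "real => 'x => real"
 assumes Q: "!!x y. 0 <= Q x y" "!!x. Q x summable_on UNIV" "!!x. (\<Sum>\<^sub>\<infinity>y. Q x y) <= c"
  and deriv: "!!t x. 0 <= t ==>
   ((%t. v t x) has_real_derivative (\<Sum>\<^sub>\<infinity>y. Q x y * v t y)) (at t within {0..})"
  and bound: "!!t x. 0 <= t ==> t <= T ==> \<bar>v t x\<bar> <= B"
  and init: "!!x. v 0 x = 0" and "0 <= T"
 shows "v T x = 0"
proof -
 have c0: "0 <= c" using Q(3)[of x] infsum_nonneg[of UNIV "Q x"] Q(1) by fastforce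
 have B0: "0 <= B" using bound[of 0 x] \<open>0 <= T\<close> by auto
 have iter: "\<bar>v t x\<bar> <= B * (c * t) ^ n / fact n" if "0 <= t" "t <= T" for n t x
  using that
 proof (induction n arbitrary: t x)
  case 0
  then show ?case using bound[of t x] by simp
 next
  case (Suc n)
  define w where "w s = B * (c * s) ^ Suc n / fact (Suc n)" for s :: real
  have dw: "(w has_real_derivative c * (B * (c * s) ^ n / fact n)) (at s)" for s
   using DERIV_cmult[OF DERIV_power_over_fact[of c n s UNIV], of B]
   by (simp add: w_def[abs_def] mult.left_commute)
  have cv: "continuous_on {0..t} (%s. v s x)"
   by (rule continuous_on_subset[OF DERIV_continuous_on[OF deriv]]) auto
  have cw: "continuous_on {0..t} w"
   by (rule DERIV_continuous_on) (use dw in \<open>auto intro: has_field_derivative_at_within\<close>)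
  have dv: "((%s. v s x) has_real_derivative (\<Sum>\<^sub>\<infinity>y. Q x y * v s y)) (at s)" if "0 < s" for s
   using deriv[of s x] that unfolding at_within_halfline[OF that] by auto
  have bd: "\<bar>\<Sum>\<^sub>\<infinity>y. Q x y * v s y\<bar> <= c * (B * (c * s) ^ n / fact n)" if s: "0 < s" "s < t" for s
  proof -
   let ?m = "B * (c * s) ^ n / fact n"
   have m: "\<bar>v s y\<bar> <= ?m" for y using Suc.IH[of s y] Suc.prems s by auto
   have m0: "0 <= ?m" using c0 B0 s by auto
   have q: "(%y. Q x y * ?m) summable_on UNIV" using Q(2) by (rule summable_on_cmult_left)
   have le: "\<bar>Q x y * v s y\<bar> <= Q x y * ?m" for y
    unfolding abs_mult using Q(1)[of x y] m[of y] by (simp add: mult_left_mono del: times_divide_eq_right)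
   have "norm (\<Sum>\<^sub>\<infinity>y. Q x y * v s y) <= (\<Sum>\<^sub>\<infinity>y. Q x y * ?m)"
    by (rule norm_infsum_le[OF has_sum_infsum[OF summable_on_bounded[OF q le]] has_sum_infsum[OF q]])
     (use le in auto)
   also have "... = (\<Sum>\<^sub>\<infinity>y. Q x y) * ?m" by (rule infsum_cmult_left) (simp add: Q)
   also have "... <= c * ?m" using Q(3) m0 by (rule mult_right_mono)
   finally show ?thesis by simp
  qed
  have "w 0 - v 0 x <= w t - v t x"
  proof (rule DERIV_nonneg_imp_increasing_open[where f="%s. w s - v s x"])
   fix s assume s: "0 < s" "s < t"
   show "\<exists>y. DERIV (%t. w t - v t x) s :> y & 0 <= y"
    using DERIV_diff[OF dw dv[OF s(1)]] bd[OF s] by (intro exI conjI) auto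
  qed (use Suc.prems cv cw in \<open>auto intro!: continuous_intros\<close>)
  moreover have "w 0 + v 0 x <= w t + v t x"
  proof (rule DERIV_nonneg_imp_increasing_open[where f="%s. w s + v s x"])
   fix s assume s: "0 < s" "s < t"
   show "\<exists>y. DERIV (%t. w t + v t x) s :> y & 0 <= y"
    using DERIV_add[OF dw dv[OF s(1)]] bd[OF s] by (intro exI conjI) auto
  qed (use Suc.prems cv cw in \<open>auto intro!: continuous_intros\<close>)
  ultimately have "\<bar>v t x\<bar> <= w t" using init by (simp add: w_def)
  then show ?case by (simp add: w_def)
 qed
 have "(%n. B * ((c * T) ^ n / fact n)) \<longlonglongrightarrow> B * 0"
  by (intro tendsto_mult tendsto_const power_over_fact_tendsto_0)
 then have "\<bar>v T x\<bar> <= B * 0"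
  by (rule LIMSEQ_le_const) (use iter[of T] \<open>0 <= T\<close> in auto)
 then show ?thesis by simp
qed

section \<open>Convolution on the half line\<close>

text \<open>Functions of time are extended by zero to negative times, so that the convolution over the whole line is the
convolution on the half line and inherits commutativity and associativity from Fubini's theorem.\<close>
definition halfline :: "(real => real) => real => ennreal" where
 "halfline f t = ennreal (indicator {0..} t * f t)"

definition econv :: "(real => ennreal) => (real => ennreal) => real => ennreal" where
 "econv f g t = (\<integral>\<^sup>+s. f (t - s) * g s \<partial>lborel)"

definition heaviside :: "real => ennreal" where
 "heaviside = indicator {0..}"

lemma heaviside_measurable [measurable]: "heaviside \<in> borel_measurable borel"
 unfolding heaviside_def by measurable

lemma econv_measurable [measurable]:
 assumes [measurable]: "f \<in> borel_measurable borel" "g \<in> borel_measurable borel"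
 shows "econv f g \<in> borel_measurable borel"
 unfolding econv_def by measurable

lemma econv_commute:
 assumes [measurable]: "f \<in> borel_measurable borel" "g \<in> borel_measurable borel"
 shows "econv f g = econv g f"
proof
 fix t
 have "econv f g t = (\<integral>\<^sup>+s. f (t - (t + - 1 * s)) * g (t + - 1 * s) \<partial>lborel)"
  unfolding econv_def by (subst nn_integral_real_affine[where c="-1" and t=t]) auto
 then show "econv f g t = econv g f t" by (simp add: econv_def mult.commute)
qed

lemma econv_assoc:
 assumes [measurable]: "f \<in> borel_measurable borel" "g \<in> borel_measurable borel" "h \<in> borel_measurable borel"
 shows "econv (econv f g) h = econv f (econv g h)"
proof
 fix t
 have "econv (econv f g) h t = (\<integral>\<^sup>+s. (\<integral>\<^sup>+r. f (t - s - r) * g r * h s \<partial>lborel) \<partial>lborel)"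
  unfolding econv_def by (simp add: nn_integral_multc)
 also have "... = (\<integral>\<^sup>+s. (\<integral>\<^sup>+r. f (t - r) * g (r - s) * h s \<partial>lborel) \<partial>lborel)"
 proof (rule nn_integral_cong)
  fix s
  show "(\<integral>\<^sup>+r. f (t - s - r) * g r * h s \<partial>lborel) = (\<integral>\<^sup>+r. f (t - r) * g (r - s) * h s \<partial>lborel)"
   by (subst nn_integral_real_affine[where c=1 and t="-s"]) (auto simp: algebra_simps)
 qed
 also have "... = (\<integral>\<^sup>+r. (\<integral>\<^sup>+s. f (t - r) * g (r - s) * h s \<partial>lborel) \<partial>lborel)"
  by (rule lborel_pair.Fubini') simp
 also have "... = econv f (econv g h) t"
  unfolding econv_def by (simp add: nn_integral_cmult mult.assoc)
 finally show "econv (econv f g) h t = econv f (econv g h) t" .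
qed

lemma econv_add_left:
 assumes [measurable]: "f \<in> borel_measurable borel" "f' \<in> borel_measurable borel" "g \<in> borel_measurable borel"
 shows "econv (%t. f t + f' t) g t = econv f g t + econv f' g t"
 unfolding econv_def by (simp add: distrib_right nn_integral_add)

lemma econv_add_right:
 assumes [measurable]: "f \<in> borel_measurable borel" "g \<in> borel_measurable borel" "g' \<in> borel_measurable borel"
 shows "econv f (%t. g t + g' t) t = econv f g t + econv f g' t"
 unfolding econv_def by (simp add: distrib_left nn_integral_add)

lemma econv_cmult_left:
 assumes [measurable]: "f \<in> borel_measurable borel" "g \<in> borel_measurable borel"
 shows "econv (%t. c * f t) g t = c * econv f g t"
 unfolding econv_def by (simp add: nn_integral_cmult mult.assoc)

lemma econv_cmult_right:
 assumes [measurable]: "f \<in> borel_measurable borel" "g \<in> borel_measurable borel"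
 shows "econv f (%t. c * g t) t = c * econv f g t"
 unfolding econv_def by (simp add: nn_integral_cmult mult.left_commute)

lemma econv_mono_halfline:
 assumes "!!s. s < 0 ==> f s = 0" "!!s. s < 0 ==> g s = 0" "!!s. s < 0 ==> g' s = 0"
  "!!s. s <= t ==> g s <= g' s"
 shows "econv f g t <= econv f g' t"
 unfolding econv_def
proof (intro nn_integral_mono)
 fix s show "f (t - s) * g s <= f (t - s) * g' s"
  using assms(1)[of "t - s"] assms(4)[of s] by (cases "s <= t") (auto intro: mult_left_mono)
qed

lemma econv_nn_integral_count_space:
 fixes f :: "'i::countable => real => ennreal"
 assumes [measurable]: "!!i. f i \<in> borel_measurable borel" "g \<in> borel_measurable borel"
 shows "econv (%t. \<integral>\<^sup>+i. f i t \<partial>count_space UNIV) g t = (\<integral>\<^sup>+i. econv (f i) g t \<partial>count_space UNIV)"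
proof -
 interpret pair_sigma_finite "count_space (UNIV::'i set)" lborel
  by (intro pair_sigma_finite.intro sigma_finite_measure_count_space_countable sigma_finite_lborel) auto
 have "econv (%t. \<integral>\<^sup>+i. f i t \<partial>count_space UNIV) g t
   = (\<integral>\<^sup>+s. (\<integral>\<^sup>+i. f i (t - s) * g s \<partial>count_space UNIV) \<partial>lborel)"
  unfolding econv_def by (simp add: nn_integral_multc)
 also have "... = (\<integral>\<^sup>+i. econv (f i) g t \<partial>count_space UNIV)"
  unfolding econv_def
  by (rule Fubini') (rule measurable_pair_measure_countable1, auto)
 finally show ?thesis .
qed

lemma econv_heaviside:
 "econv heaviside g t = (\<integral>\<^sup>+s. indicator {..t} s * g s \<partial>lborel)"
 unfolding econv_def heaviside_def by (intro nn_integral_cong) (auto simp: indicator_def)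

lemma halfline_FTC:
 assumes deriv: "!!t. 0 <= t ==> (f has_real_derivative f' t) (at t within {0..})"
  and cont: "!!T. continuous_on {0..T} f'" and nonneg: "!!t. 0 <= t ==> 0 <= f' t" and f0: "0 <= f 0"
 shows "halfline f t = ennreal (f 0) * heaviside t + econv heaviside (halfline f') t"
proof (cases "0 <= t")
 case True
 have "has_bochner_integral lborel (%s. indicator {0..t} s *\<^sub>R f' s) (f t - f 0)"
 proof (rule has_bochner_integral_FTC_Icc[OF True])
  show "(f has_vector_derivative f' s) (at s within {0..t})" if "0 <= s" "s <= t" for s
   using deriv[OF that(1)] has_field_derivative_subset
   by (intro has_real_derivative_iff_has_vector_derivative[THEN iffD1]) (auto elim!: has_field_derivative_subset)
  show "continuous_on {0..t} f'" by (rule cont)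
 qed
 then have "(\<integral>\<^sup>+s. ennreal (indicator {0..t} s *\<^sub>R f' s) \<partial>lborel) = ennreal (f t - f 0)"
  by (subst nn_integral_eq_integral)
   (auto simp: has_bochner_integral_iff nonneg indicator_def)
 moreover have eq: "(\<integral>\<^sup>+s. ennreal (indicator {0..t} s *\<^sub>R f' s) \<partial>lborel) = econv heaviside (halfline f') t"
  unfolding econv_heaviside halfline_def by (intro nn_integral_cong) (auto simp: indicator_def)
 moreover have "f 0 <= f t"
 proof (rule DERIV_nonneg_imp_increasing_open[OF True])
  show "\<exists>y. DERIV f s :> y & 0 <= y" if "0 < s" for s
   using deriv[of s] nonneg[of s] that unfolding at_within_halfline[OF that] by auto
  show "continuous_on {0..t} f"
   by (rule continuous_on_subset[OF DERIV_continuous_on[OF deriv]]) auto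
 qed
 ultimately show ?thesis
  using True f0 ennreal_plus[of "f 0" "f t - f 0"] unfolding eq by (simp add: halfline_def heaviside_def)
next
 case False
 have "(%s. indicator {..t} s * halfline f' s) = (%_. 0)"
  using False by (auto simp: halfline_def indicator_def fun_eq_iff)
 with False show ?thesis
  by (simp add: halfline_def econv_heaviside) (simp add: heaviside_def)
qed

lemma nn_integral_power_fact:
 assumes "0 <= c"
 shows "econv heaviside (halfline (%s. c * (c * s) ^ n / fact n)) t
  = halfline (%s. (c * s) ^ Suc n / fact (Suc n)) t"
proof -
 have "halfline (%s. (c * s) ^ Suc n / fact (Suc n)) t = ennreal ((c * 0) ^ Suc n / fact (Suc n)) * heaviside t
   + econv heaviside (halfline (%s. c * (c * s) ^ n / fact n)) t"
  by (rule halfline_FTC[OF DERIV_power_over_fact]) (use assms in \<open>auto intro!: continuous_intros\<close>)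
 then show ?thesis by simp
qed

text \<open>Iterating the sub-solution against the super-solution leaves a remainder of order \<open>(c * t) ^ n / fact
n\<close>.\<close>
lemma volterra_le:
 fixes U V F :: "'x::countable => real => ennreal" and Q :: "'x => 'x => ennreal"
 assumes [measurable]: "!!x. U x \<in> borel_measurable borel" "!!x. V x \<in> borel_measurable borel"
  and neg: "!!x t. t < 0 ==> U x t = 0" "!!x t. t < 0 ==> V x t = 0"
  and U: "!!x t. U x t <= F x t + econv heaviside (%s. \<integral>\<^sup>+y. Q x y * U y s \<partial>count_space UNIV) t"
  and V: "!!x t. F x t + econv heaviside (%s. \<integral>\<^sup>+y. Q x y * V y s \<partial>count_space UNIV) t <= V x t"
  and bound: "!!x t. t <= T ==> U x t <= ennreal B" "0 <= B"
  and Q: "!!x. (\<integral>\<^sup>+y. Q x y \<partial>count_space UNIV) <= ennreal c" "0 <= c"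
 shows "U x T <= V x T"
proof -
 define e where "e n = halfline (%s. B * ((c * s) ^ n / fact n))" for n
 have [measurable]: "e n \<in> borel_measurable borel" for n
  unfolding e_def halfline_def by measurable
 have iter: "U x t <= V x t + e n t" if "t <= T" for n t x
  using that
 proof (induction n arbitrary: t x)
  case 0
  show ?case
  proof (cases "t < 0")
   case False
   then have "U x t <= e 0 t" using bound(1)[OF 0] by (simp add: e_def halfline_def)
   from add_mono[OF zero_le[of "V x t"] this] show ?thesis by simp
  qed (simp add: neg)
 next
  case (Suc n)
  have [measurable]: "(%s. \<integral>\<^sup>+y. Q x y * U y s \<partial>count_space UNIV) \<in> borel_measurable borel"
    "(%s. \<integral>\<^sup>+y. Q x y * V y s \<partial>count_space UNIV) \<in> borel_measurable borel" for x
   by (intro sigma_finite_measure.borel_measurable_nn_integral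
      sigma_finite_measure_count_space_countable measurable_pair_measure_countable1
      measurable_compose[OF measurable_snd]; simp)+
  have "U x t <= F x t + econv heaviside (%s. \<integral>\<^sup>+y. Q x y * U y s \<partial>count_space UNIV) t" by (rule U)
  also have "econv heaviside (%s. \<integral>\<^sup>+y. Q x y * U y s \<partial>count_space UNIV) t
    <= econv heaviside (%s. (\<integral>\<^sup>+y. Q x y * V y s \<partial>count_space UNIV) + ennreal c * e n s) t"
  proof (rule econv_mono_halfline)
   fix s assume "s <= t"
   then have "s <= T" using Suc.prems by simp
   have "(\<integral>\<^sup>+y. Q x y * U y s \<partial>count_space UNIV) <= (\<integral>\<^sup>+y. Q x y * V y s + Q x y * e n s \<partial>count_space UNIV)"
    by (intro nn_integral_mono) (use Suc.IH[OF \<open>s <= T\<close>] in \<open>simp add: distrib_left[symmetric] mult_left_mono\<close>)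
   also have "... = (\<integral>\<^sup>+y. Q x y * V y s \<partial>count_space UNIV) + (\<integral>\<^sup>+y. Q x y \<partial>count_space UNIV) * e n s"
    by (simp add: nn_integral_add nn_integral_multc)
   also have "... <= (\<integral>\<^sup>+y. Q x y * V y s \<partial>count_space UNIV) + ennreal c * e n s"
    by (intro add_left_mono mult_right_mono Q) auto
   finally show "(\<integral>\<^sup>+y. Q x y * U y s \<partial>count_space UNIV)
    <= (\<integral>\<^sup>+y. Q x y * V y s \<partial>count_space UNIV) + ennreal c * e n s" .
  qed (auto simp: heaviside_def neg e_def halfline_def)
  also have "... = econv heaviside (%s. \<integral>\<^sup>+y. Q x y * V y s \<partial>count_space UNIV) t
    + econv heaviside (%s. ennreal c * e n s) t"
   by (rule econv_add_right) auto
  also have "(%s. ennreal c * e n s) = (%s. ennreal B * halfline (%s. c * (c * s) ^ n / fact n) s)"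
   unfolding e_def halfline_def using \<open>0 <= B\<close> Q(2)
   by (intro ext) (simp add: ennreal_mult'[symmetric] mult_ac)
  also have "econv heaviside (%s. ennreal B * halfline (%s. c * (c * s) ^ n / fact n) s) t = e (Suc n) t"
  proof -
   have [measurable]: "halfline (%s. c * (c * s) ^ n / fact n) \<in> borel_measurable borel"
    unfolding halfline_def by measurable
   show ?thesis
    unfolding e_def econv_cmult_right[OF heaviside_measurable \<open>halfline _ \<in> _\<close>] nn_integral_power_fact[OF Q(2)]
    using \<open>0 <= B\<close> by (simp add: halfline_def ennreal_mult'[symmetric] mult_ac)
  qed
  finally have "U x t <= F x t + econv heaviside (%s. \<integral>\<^sup>+y. Q x y * V y s \<partial>count_space UNIV) t + e (Suc n) t"
   by (simp add: add.assoc add_left_mono)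
  also have "... <= V x t + e (Suc n) t" by (rule add_right_mono[OF V])
  finally show ?case .
 qed
 have "(%n. ennreal (indicator {0..} T * (B * ((c * T) ^ n / fact n)))) \<longlonglongrightarrow> ennreal (indicator {0..} T * (B * 0))"
  by (intro tendsto_ennrealI tendsto_mult tendsto_const power_over_fact_tendsto_0)
 then have "(%n. V x T + e n T) \<longlonglongrightarrow> V x T + 0"
  by (intro tendsto_intros) (simp add: e_def halfline_def)
 then have "U x T <= V x T + 0"
  by (rule LIMSEQ_le_const) (use iter[of T] in auto)
 then show ?thesis by simp
qed

text \<open>A source acting at the single site \<open>z\<close> adds the convolution of its strength with the fundamental
solution started at \<open>z\<close>. Both sides solve the same integral equation, so comparison in both
directions proves equality.\<close>
lemma duhamel:
 fixes Q :: "'x::countable => 'x => real" and u r k :: "real => 'x => real"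
 assumes Q: "!!x y. 0 <= Q x y" "!!x. Q x summable_on UNIV" "!!x. (\<Sum>\<^sub>\<infinity>y. Q x y) <= c"
  and u: "!!t x. 0 <= t ==> ((%t. u t x) has_real_derivative
   (\<Sum>\<^sub>\<infinity>y. Q x y * u t y) + (if x = z then g t else 0)) (at t within {0..})"
  and r: "!!t x. 0 <= t ==> ((%t. r t x) has_real_derivative (\<Sum>\<^sub>\<infinity>y. Q x y * r t y)) (at t within {0..})"
  and k: "!!t x. 0 <= t ==> ((%t. k t x) has_real_derivative (\<Sum>\<^sub>\<infinity>y. Q x y * k t y)) (at t within {0..})"
  and init: "!!x. u 0 x = r 0 x" "!!x. k 0 x = (if x = z then 1 else 0)"
  and nonneg: "!!t x. 0 <= t ==> 0 <= u t x" "!!t x. 0 <= t ==> 0 <= r t x" "!!t x. 0 <= t ==> 0 <= k t x"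
  and bounded: "!!T. \<exists>B. \<forall>t\<in>{0..T}. \<forall>x. u t x <= B" "!!T. \<exists>B. \<forall>t\<in>{0..T}. \<forall>x. r t x <= B"
   "!!T. \<exists>B. \<forall>t\<in>{0..T}. \<forall>x. k t x <= B"
  and g: "continuous_on {0..} g" "!!t. 0 <= t ==> 0 <= g t"
 shows "halfline (%t. u t x) T = halfline (%t. r t x) T + econv (halfline (%t. k t x)) (halfline g) T"
proof -
 define QE where "QE x y = ennreal (Q x y)" for x y
 have c0: "0 <= c" using Q(3)[of z] infsum_nonneg[of UNIV "Q z"] Q(1) by fastforce
 have QE: "(\<integral>\<^sup>+y. QE x y \<partial>count_space UNIV) <= ennreal c" for x
  unfolding QE_def using nn_integral_count_space_has_sum[OF has_sum_infsum[OF Q(2)[of x]]] Q(1,3)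
  by (simp add: ennreal_leI)
 have sumQ: "(%y. Q x y * w t y) summable_on UNIV"
  and boundQ: "\<exists>B. \<forall>t\<in>{0..T}. \<forall>y. \<bar>Q x y * w t y\<bar> <= Q x y * B"
  if w: "!!t x. 0 <= t ==> 0 <= w t x" "!!T. \<exists>B. \<forall>t\<in>{0..T}. \<forall>x. w t x <= B" and t: "0 <= t"
  for w :: "real => 'x => real" and t T x
 proof -
  have *: "\<exists>B. \<forall>t\<in>{0..T}. \<forall>y. \<bar>Q x y * w t y\<bar> <= Q x y * B" for T
  proof -
   obtain B where "\<forall>t\<in>{0..T}. \<forall>x. w t x <= B" using w(2)[of T] by auto
   then show ?thesis using w(1) Q(1) by (intro exI[of _ B]) (auto simp: abs_mult intro!: mult_left_mono)
  qed
  then show "\<exists>B. \<forall>t\<in>{0..T}. \<forall>y. \<bar>Q x y * w t y\<bar> <= Q x y * B" .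
  from *[of t] obtain B where "\<forall>t\<in>{0..t}. \<forall>y. \<bar>Q x y * w t y\<bar> <= Q x y * B" by blast
  then have "\<bar>Q x y * w t y\<bar> <= Q x y * B" for y using t by simp
  then show "(%y. Q x y * w t y) summable_on UNIV"
   by (rule summable_on_bounded[OF summable_on_cmult_left[OF Q(2)[of x]]])
 qed
 have half: "halfline (%t. \<Sum>\<^sub>\<infinity>y. Q x y * w t y) t = (\<integral>\<^sup>+y. QE x y * halfline (%t. w t y) t \<partial>count_space UNIV)"
  if w: "!!t x. 0 <= t ==> 0 <= w t x" "!!T. \<exists>B. \<forall>t\<in>{0..T}. \<forall>x. w t x <= B"
  for w :: "real => 'x => real" and t x
 proof (cases "0 <= t")
  case True
  from nn_integral_count_space_has_sum[OF has_sum_infsum[OF sumQ[OF w True]]] w(1)[OF True] Q(1)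
  show ?thesis using True by (simp add: halfline_def QE_def ennreal_mult')
 qed (simp add: halfline_def)
 have cont: "continuous_on {0..T} (%t. \<Sum>\<^sub>\<infinity>y. Q x y * w t y)"
  if w: "!!t x. 0 <= t ==> 0 <= w t x" "!!T. \<exists>B. \<forall>t\<in>{0..T}. \<forall>x. w t x <= B"
   "!!x. continuous_on {0..} (%t. w t x)"
  for w :: "real => 'x => real" and x T
 proof -
  from boundQ[OF w(1,2), of 0 T x] obtain B where B: "\<forall>t\<in>{0..T}. \<forall>y. \<bar>Q x y * w t y\<bar> <= Q x y * B" by auto
  show ?thesis
   by (rule continuous_on_infsum[where B="%y. Q x y * B"])
    (use B in \<open>auto intro!: continuous_intros continuous_on_subset[OF w(3)] summable_on_cmult_left Q(2)\<close>)
 qed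
 have nn: "0 <= (\<Sum>\<^sub>\<infinity>y. Q x y * w t y)" if "!!t x. 0 <= t ==> 0 <= w t x" "0 <= t"
  for w :: "real => 'x => real" and t x
  using that Q(1) by (intro infsum_nonneg) auto
 have cu: "continuous_on {0..} (%t. u t x)" and cr: "continuous_on {0..} (%t. r t x)"
  and ck: "continuous_on {0..} (%t. k t x)" for x
  by (rule DERIV_continuous_on, rule u r k, simp)+
 have meas: "halfline f \<in> borel_measurable borel" if "continuous_on {0..} f" for f
 proof -
  have "(%t. indicator {0..} t *\<^sub>R f t) \<in> borel_measurable borel"
   by (rule borel_measurable_continuous_on_indicator[OF _ that]) simp
  then show ?thesis unfolding halfline_def by simp
 qed
 define U where "U x = halfline (%t. u t x)" for x
 define R where "R x = halfline (%t. r t x)" for x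
 define k' where "k' x = halfline (%t. k t x)" for x
 define G where "G = halfline g"
 note [measurable] = meas[OF cu, folded U_def] meas[OF cr, folded R_def] meas[OF ck, folded k'_def] meas[OF g(1), folded G_def]
 have mQ [measurable]: "(%s. \<integral>\<^sup>+y. QE x y * W y s \<partial>count_space UNIV) \<in> borel_measurable borel"
  if [measurable]: "!!y. W y \<in> borel_measurable borel" for W x
  by (intro sigma_finite_measure.borel_measurable_nn_integral
     sigma_finite_measure_count_space_countable measurable_pair_measure_countable1
     measurable_compose[OF measurable_snd]; simp)
 define \<delta> :: "'x => ennreal" where "\<delta> x = (if x = z then 1 else 0)" for x
 define F where "F x t = ennreal (u 0 x) * heaviside t + \<delta> x * econv heaviside G t" for x t
 have eqU: "U x t = F x t + econv heaviside (%s. \<integral>\<^sup>+y. QE x y * U y s \<partial>count_space UNIV) t" for x t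
 proof -
  have "halfline (%t. u t x) t = ennreal (u 0 x) * heaviside t
   + econv heaviside (halfline (%t. (\<Sum>\<^sub>\<infinity>y. Q x y * u t y) + (if x = z then g t else 0))) t"
  proof (rule halfline_FTC[OF u])
   have "continuous_on {0..T} (%t. if x = z then g t else 0)" for T
    by (cases "x = z") (auto intro!: continuous_on_subset[OF g(1)])
   then show "continuous_on {0..T} (%t. (\<Sum>\<^sub>\<infinity>y. Q x y * u t y) + (if x = z then g t else 0))" for T
    by (intro continuous_on_add cont bounded(1) cu nonneg(1))
  qed (use nonneg(1) nn[of u] g in auto)
  also have "halfline (%t. (\<Sum>\<^sub>\<infinity>y. Q x y * u t y) + (if x = z then g t else 0))
   = (%s. (\<integral>\<^sup>+y. QE x y * U y s \<partial>count_space UNIV) + \<delta> x * G s)"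
  proof
   fix s
   have "halfline (%t. (\<Sum>\<^sub>\<infinity>y. Q x y * u t y) + (if x = z then g t else 0)) s
    = halfline (%t. \<Sum>\<^sub>\<infinity>y. Q x y * u t y) s + \<delta> x * halfline g s"
    using nn[of u s x] nonneg(1) g(2)[of s] by (cases "0 <= s") (auto simp: halfline_def \<delta>_def ennreal_plus)
   then show "halfline (%t. (\<Sum>\<^sub>\<infinity>y. Q x y * u t y) + (if x = z then g t else 0)) s
    = (\<integral>\<^sup>+y. QE x y * U y s \<partial>count_space UNIV) + \<delta> x * G s"
    using half[of u x s] nonneg(1) bounded(1) by (simp add: U_def G_def)
  qed
  finally show ?thesis
   by (simp add: econv_add_right econv_cmult_right F_def U_def[symmetric] add_ac)
 qed
 have eqR: "R x t = ennreal (r 0 x) * heaviside t + econv heaviside (%s. \<integral>\<^sup>+y. QE x y * R y s \<partial>count_space UNIV) t" for x t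
 proof -
  have "halfline (%t. r t x) t = ennreal (r 0 x) * heaviside t + econv heaviside (halfline (%t. \<Sum>\<^sub>\<infinity>y. Q x y * r t y)) t"
   by (rule halfline_FTC[OF r]) (use nonneg nn[of r] in \<open>auto intro!: cont bounded cr\<close>)
  also have "halfline (%t. \<Sum>\<^sub>\<infinity>y. Q x y * r t y) = (%s. \<integral>\<^sup>+y. QE x y * R y s \<partial>count_space UNIV)"
   using half[of r x] nonneg(2) bounded(2) by (auto simp: R_def)
  finally show ?thesis by (simp add: R_def)
 qed
 have eqk: "k' x t = \<delta> x * heaviside t + econv heaviside (%s. \<integral>\<^sup>+y. QE x y * k' y s \<partial>count_space UNIV) t" for x t
 proof -
  have "halfline (%t. k t x) t = ennreal (k 0 x) * heaviside t + econv heaviside (halfline (%t. \<Sum>\<^sub>\<infinity>y. Q x y * k t y)) t"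
   by (rule halfline_FTC[OF k]) (use nonneg nn[of k] in \<open>auto intro!: cont bounded ck\<close>)
  also have "halfline (%t. \<Sum>\<^sub>\<infinity>y. Q x y * k t y) = (%s. \<integral>\<^sup>+y. QE x y * k' y s \<partial>count_space UNIV)"
   using half[of k x] nonneg(3) bounded(3) by (auto simp: k'_def)
  finally show ?thesis by (simp add: k'_def init \<delta>_def)
 qed
 define V where "V x t = R x t + econv (k' x) G t" for x t
 have [measurable]: "V x \<in> borel_measurable borel" for x unfolding V_def[abs_def] by measurable
 have eqV: "V x t = F x t + econv heaviside (%s. \<integral>\<^sup>+y. QE x y * V y s \<partial>count_space UNIV) t" for x t
 proof -
  have "econv (k' x) G t = econv (%t. \<delta> x * heaviside t + econv heaviside (%s. \<integral>\<^sup>+y. QE x y * k' y s \<partial>count_space UNIV) t) G t"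
   unfolding eqk[of x, symmetric] ..
  also have "... = \<delta> x * econv heaviside G t
    + econv heaviside (econv (%s. \<integral>\<^sup>+y. QE x y * k' y s \<partial>count_space UNIV) G) t"
   by (simp add: econv_add_left econv_cmult_left econv_assoc)
  also have "econv (%s. \<integral>\<^sup>+y. QE x y * k' y s \<partial>count_space UNIV) G
    = (%s. \<integral>\<^sup>+y. QE x y * econv (k' y) G s \<partial>count_space UNIV)"
   by (intro ext, subst econv_nn_integral_count_space) (simp_all add: econv_cmult_left)
  finally have *: "econv (k' x) G t = \<delta> x * econv heaviside G t
    + econv heaviside (%s. \<integral>\<^sup>+y. QE x y * econv (k' y) G s \<partial>count_space UNIV) t" .
  have "(%s. \<integral>\<^sup>+y. QE x y * V y s \<partial>count_space UNIV) =
    (%s. (\<integral>\<^sup>+y. QE x y * R y s \<partial>count_space UNIV) + (\<integral>\<^sup>+y. QE x y * econv (k' y) G s \<partial>count_space UNIV))"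
   unfolding V_def by (simp add: distrib_left nn_integral_add)
  then have "econv heaviside (%s. \<integral>\<^sup>+y. QE x y * V y s \<partial>count_space UNIV) t =
    econv heaviside (%s. \<integral>\<^sup>+y. QE x y * R y s \<partial>count_space UNIV) t
    + econv heaviside (%s. \<integral>\<^sup>+y. QE x y * econv (k' y) G s \<partial>count_space UNIV) t"
   by (simp add: econv_add_right)
  then show ?thesis
   unfolding V_def[of x] using eqR[of x t] * by (simp add: F_def init add_ac)
 qed
 have neg: "U x t = 0" "V x t = 0" if "t < 0" for x t
 proof -
  have "(%s. k' x (t - s) * G s) = (%s. 0)"
   using that by (auto simp: fun_eq_iff k'_def G_def halfline_def indicator_def)
  then show "U x t = 0" "V x t = 0"
   using that by (simp_all add: U_def V_def R_def halfline_def econv_def)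
 qed
 from bounded(1)[of T] obtain Bu where "\<forall>t\<in>{0..T}. \<forall>x. u t x <= Bu" by blast
 then have Bu: "u t x <= Bu" if "0 <= t" "t <= T" for t x using that by simp
 from bounded(2)[of T] obtain Br where "\<forall>t\<in>{0..T}. \<forall>x. r t x <= Br" by blast
 then have Br: "r t x <= Br" if "0 <= t" "t <= T" for t x using that by simp
 from bounded(3)[of T] obtain Bk where "\<forall>t\<in>{0..T}. \<forall>x. k t x <= Bk" by blast
 then have Bk: "k t x <= Bk" if "0 <= t" "t <= T" for t x using that by simp
 have "compact (g ` {0..T})"
  by (rule compact_continuous_image) (auto intro: continuous_on_subset[OF g(1)])
 then have "bounded (g ` {0..T})" by (rule compact_imp_bounded)
 then obtain Bg where "\<forall>t\<in>{0..T}. \<bar>g t\<bar> <= Bg" by (auto simp: bounded_iff)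
 then have Bg: "g t <= Bg" if "0 <= t" "t <= T" for t using that by force
 define BU where "BU = \<bar>Bu\<bar>"
 define BV where "BV = \<bar>Br\<bar> + \<bar>Bk\<bar> * \<bar>Bg\<bar> * \<bar>T\<bar>"
 have boundU: "U x t <= ennreal BU" if "t <= T" for x t
  unfolding U_def halfline_def BU_def using Bu[of t x] that
  by (intro ennreal_leI) (auto simp: indicator_def)
 have boundV: "V x t <= ennreal BV" if "t <= T" for x t
 proof -
  have 1: "R x t <= ennreal \<bar>Br\<bar>"
   unfolding R_def halfline_def using Br[of t x] that by (intro ennreal_leI) (auto simp: indicator_def)
  have "econv (k' x) G t <= (\<integral>\<^sup>+s. ennreal (\<bar>Bk\<bar> * \<bar>Bg\<bar>) * indicator {0..T} s \<partial>lborel)"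
   unfolding econv_def
  proof (intro nn_integral_mono)
   fix s
   show "k' x (t - s) * G s <= ennreal (\<bar>Bk\<bar> * \<bar>Bg\<bar>) * indicator {0..T} s"
   proof (cases "0 <= s & s <= t")
    case True
    then have "k (t - s) x <= \<bar>Bk\<bar>" "g s <= \<bar>Bg\<bar>" "0 <= g s"
     using Bk[of "t - s" x] Bg[of s] g(2)[of s] that by auto
    then have "k (t - s) x * g s <= \<bar>Bk\<bar> * \<bar>Bg\<bar>" by (intro mult_mono) auto
    then show ?thesis
     using True that nonneg(3) g(2) by (simp add: k'_def G_def halfline_def ennreal_mult'[symmetric] ennreal_leI)
   qed (auto simp: k'_def G_def halfline_def indicator_def)
  qed
  also have "... <= ennreal (\<bar>Bk\<bar> * \<bar>Bg\<bar> * \<bar>T\<bar>)"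
   by (cases "0 <= T") (simp_all add: nn_integral_cmult_indicator ennreal_mult'[symmetric])
  finally show ?thesis
   unfolding V_def BV_def using 1 by (subst ennreal_plus) (auto intro: add_mono)
 qed
 have "U x T <= V x T"
 proof (rule volterra_le[where F=F and Q=QE and B=BU and c=c])
  show "U x t <= F x t + econv heaviside (%s. \<integral>\<^sup>+y. QE x y * U y s \<partial>count_space UNIV) t" for x t
   unfolding eqU[symmetric] ..
  show "F x t + econv heaviside (%s. \<integral>\<^sup>+y. QE x y * V y s \<partial>count_space UNIV) t <= V x t" for x t
   unfolding eqV[symmetric] ..
   show "U x t <= ennreal BU" if "t <= T" for x t by (rule boundU[OF that])
 qed (simp_all add: neg QE c0 BU_def)
 moreover have "V x T <= U x T"
 proof (rule volterra_le[where F=F and Q=QE and B=BV and c=c])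
  show "V x t <= F x t + econv heaviside (%s. \<integral>\<^sup>+y. QE x y * V y s \<partial>count_space UNIV) t" for x t
   unfolding eqV[symmetric] ..
  show "F x t + econv heaviside (%s. \<integral>\<^sup>+y. QE x y * U y s \<partial>count_space UNIV) t <= U x t" for x t
   unfolding eqU[symmetric] ..
   show "V x t <= ennreal BV" if "t <= T" for x t by (rule boundV[OF that])
 qed (simp_all add: neg QE c0 BV_def)
 ultimately have "U x T = V x T" by (rule antisym)
 then show ?thesis by (simp add: U_def V_def R_def k'_def G_def)
qed

section \<open>Convolution of real functions\<close>

text \<open>The class of functions for which all convolutions below exist. Values at negative times are left arbitrary,
since transition functions carry no information there.\<close>
definition loc_bounded :: "(real => real) => bool" where
 "loc_bounded f \<longleftrightarrow> (%t. indicator {0..} t * f t) \<in> borel_measurable borel &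
  (\<forall>t\<ge>0. 0 <= f t) & (\<forall>T. \<exists>B. \<forall>t. 0 <= t --> t <= T --> f t <= B)"

definition conv :: "(real => real) => (real => real) => real => real" where
 "conv f g t = (\<integral>s. indicator {0..t} s * (f (t - s) * g s) \<partial>lborel)"

lemma loc_boundedD:
 assumes "loc_bounded f"
 shows "!!t. 0 <= t ==> 0 <= f t" "(%t. indicator {0..} t * f t) \<in> borel_measurable borel"
  "halfline f \<in> borel_measurable borel"
 using assms unfolding loc_bounded_def halfline_def by auto

lemma loc_bounded_bound:
 assumes "loc_bounded f"
 obtains B where "0 <= B" "!!t. 0 <= t ==> t <= T ==> f t <= B"
proof -
 from assms obtain B where "!!t. 0 <= t ==> t <= T ==> f t <= B" unfolding loc_bounded_def by blast
 then show thesis using that[of "\<bar>B\<bar>"] by force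
qed

lemma continuous_on_halfline_measurable:
 assumes "continuous_on {0..} f"
 shows "(%t::real. indicator {0..} t * (f t :: real)) \<in> borel_measurable borel"
proof -
 have "(%t. indicator {0..} t *\<^sub>R f t) \<in> borel_measurable borel"
  by (rule borel_measurable_continuous_on_indicator[OF _ assms]) simp
 then show ?thesis by simp
qed

lemma continuous_on_loc_bounded:
 assumes "continuous_on {0..} f" "!!t. 0 <= t ==> 0 <= f t"
 shows "loc_bounded f"
proof -
 have "\<exists>B. \<forall>t. 0 <= t --> t <= T --> f t <= B" for T
 proof -
  have "compact (f ` {0..T})"
   by (rule compact_continuous_image) (auto intro: continuous_on_subset[OF assms(1)])
  then have "bounded (f ` {0..T})" by (rule compact_imp_bounded)
  then obtain B where "\<forall>t\<in>{0..T}. \<bar>f t\<bar> <= B" by (auto simp: bounded_iff)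
  then show ?thesis by (intro exI[of _ B]) force
 qed
 then show ?thesis
  using assms continuous_on_halfline_measurable[OF assms(1)] by (simp add: loc_bounded_def)
qed

lemma loc_bounded_mult:
 assumes f: "loc_bounded f" and g: "loc_bounded g"
 shows "loc_bounded (%t. f t * g t)"
 unfolding loc_bounded_def
proof (intro conjI allI impI)
 have "(%t. indicator {0..} t * (f t * g t)) = (%t. (indicator {0..} t * f t) * (indicator {0..} t * g t))"
  by (auto simp: indicator_def)
 then show "(%t. indicator {0..} t * (f t * g t)) \<in> borel_measurable borel"
  using loc_boundedD(2)[OF f] loc_boundedD(2)[OF g] by simp
 fix T
 obtain A where "0 <= A" "!!t. 0 <= t ==> t <= T ==> f t <= A" using loc_bounded_bound[OF f, of T] by metis
 moreover obtain B where "0 <= B" "!!t. 0 <= t ==> t <= T ==> g t <= B" using loc_bounded_bound[OF g, of T] by metis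
 ultimately show "\<exists>B. \<forall>t. 0 <= t --> t <= T --> f t * g t <= B"
  using loc_boundedD(1)[OF f] loc_boundedD(1)[OF g] by (intro exI[of _ "A * B"]) (auto intro!: mult_mono)
qed (use loc_boundedD(1)[OF f] loc_boundedD(1)[OF g] in auto)

lemma loc_bounded_add:
 assumes f: "loc_bounded f" and g: "loc_bounded g"
 shows "loc_bounded (%t. f t + g t)"
 unfolding loc_bounded_def
proof (intro conjI allI impI)
 show "(%t. indicator {0..} t * (f t + g t)) \<in> borel_measurable borel"
  unfolding distrib_left using loc_boundedD(2)[OF f] loc_boundedD(2)[OF g] by simp
 fix T
 obtain A where "0 <= A" "!!t. 0 <= t ==> t <= T ==> f t <= A" using loc_bounded_bound[OF f, of T] by metis
 moreover obtain B where "0 <= B" "!!t. 0 <= t ==> t <= T ==> g t <= B" using loc_bounded_bound[OF g, of T] by metis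
 ultimately show "\<exists>B. \<forall>t. 0 <= t --> t <= T --> f t + g t <= B"
  by (intro exI[of _ "A + B"]) (auto intro!: add_mono)
qed (use loc_boundedD(1)[OF f] loc_boundedD(1)[OF g] in auto)

lemma loc_bounded_const: "0 <= c ==> loc_bounded (%t. c)"
 by (rule continuous_on_loc_bounded) auto

lemma loc_bounded_exp: "loc_bounded (%t. exp (c * t))"
 by (rule continuous_on_loc_bounded) (auto intro!: continuous_intros)

lemma loc_bounded_cmult: "0 <= c ==> loc_bounded f ==> loc_bounded (%t. c * f t)"
 using loc_bounded_mult[OF loc_bounded_const] by blast

lemma conv_measurable_integrand:
 assumes f: "loc_bounded f" and g: "loc_bounded g"
 shows "(%s. indicator {0..t} s * (f (t - s) * g s)) \<in> borel_measurable borel"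
proof -
 have "(%s. indicator {0..t} s * (f (t - s) * g s))
  = (%s. (%r. indicator {0..} r * f r) (t - s) * (indicator {0..} s * g s))"
  by (auto simp: indicator_def)
 also have "... \<in> borel_measurable borel"
  by (rule borel_measurable_times[OF measurable_compose[OF _ loc_boundedD(2)[OF f]] loc_boundedD(2)[OF g]]) simp
 finally show ?thesis .
qed

lemma conv_integrable:
 assumes f: "loc_bounded f" and g: "loc_bounded g"
 shows "integrable lborel (%s. indicator {0..t} s * (f (t - s) * g s))"
proof -
 obtain A where A: "0 <= A" "!!s. 0 <= s ==> s <= t ==> f s <= A" using loc_bounded_bound[OF f, of t] by metis
 obtain B where B: "0 <= B" "!!s. 0 <= s ==> s <= t ==> g s <= B" using loc_bounded_bound[OF g, of t] by metis
 have "integrable lborel (%s. indicator {0..t} s *\<^sub>R (A * B))"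
  by (intro integrable_scaleR_left integrable_real_indicator) (auto simp: emeasure_lborel_Icc_eq)
 then show ?thesis
 proof (rule Bochner_Integration.integrable_bound)
  have "norm (indicator {0..t} s * (f (t - s) * g s)) <= norm (indicator {0..t} s *\<^sub>R (A * B))" for s
  proof (cases "0 <= s & s <= t")
   case True
   have "0 <= f (t - s)" "f (t - s) <= A" "0 <= g s" "g s <= B"
    using True A(2)[of "t - s"] B(2)[of s] loc_boundedD(1)[OF f, of "t - s"] loc_boundedD(1)[OF g, of s] by auto
   then have "\<bar>f (t - s) * g s\<bar> <= \<bar>A * B\<bar>" using A(1) B(1) by (simp add: abs_mult mult_mono)
   then show ?thesis using True by simp
  qed simp
  then show "AE s in lborel. norm (indicator {0..t} s * (f (t - s) * g s)) <= norm (indicator {0..t} s *\<^sub>R (A * B))"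
   by simp
 qed (use conv_measurable_integrand[OF f g] in simp)
qed

lemma ennreal_conv:
 assumes f: "loc_bounded f" and g: "loc_bounded g"
 shows "ennreal (conv f g t) = econv (halfline f) (halfline g) t"
proof -
 have "econv (halfline f) (halfline g) t = (\<integral>\<^sup>+s. ennreal (indicator {0..t} s * (f (t - s) * g s)) \<partial>lborel)"
  unfolding econv_def halfline_def
  by (intro nn_integral_cong)
   (use loc_boundedD(1)[OF f] loc_boundedD(1)[OF g] in \<open>auto simp: indicator_def ennreal_mult'[symmetric]\<close>)
 also have "... = ennreal (conv f g t)"
  unfolding conv_def
  by (rule nn_integral_eq_integral[OF conv_integrable[OF f g]])
   (use loc_boundedD(1)[OF f] loc_boundedD(1)[OF g] in \<open>auto simp: indicator_def\<close>)
 finally show ?thesis ..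
qed

lemma conv_nonneg:
 assumes "loc_bounded f" "loc_bounded g"
 shows "0 <= conv f g t"
 unfolding conv_def
 by (intro Bochner_Integration.integral_nonneg) (use loc_boundedD(1)[OF assms(1)] loc_boundedD(1)[OF assms(2)] in \<open>auto simp: indicator_def\<close>)

lemma halfline_conv:
 assumes f: "loc_bounded f" and g: "loc_bounded g"
 shows "halfline (conv f g) = econv (halfline f) (halfline g)"
proof
 fix t show "halfline (conv f g) t = econv (halfline f) (halfline g) t"
  using ennreal_conv[OF f g, of t] by (cases "0 <= t") (auto simp: halfline_def conv_def)
qed

lemma conv_mono:
 assumes f: "loc_bounded f" "loc_bounded f'" and g: "loc_bounded g" "loc_bounded g'"
  and le: "!!s. 0 <= s ==> s <= t ==> f s <= f' s" "!!s. 0 <= s ==> s <= t ==> g s <= g' s"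
 shows "conv f g t <= conv f' g' t"
 unfolding conv_def
proof (rule integral_mono[OF conv_integrable[OF f(1) g(1)] conv_integrable[OF f(2) g(2)]])
 fix s
 show "indicator {0..t} s * (f (t - s) * g s) <= indicator {0..t} s * (f' (t - s) * g' s)"
 proof (cases "0 <= s & s <= t")
  case True
  have "f (t - s) * g s <= f' (t - s) * g' s"
   using True le(1)[of "t - s"] le(2)[of s] loc_boundedD(1)[OF f(2), of "t - s"] loc_boundedD(1)[OF g(1), of s]
   by (intro mult_mono) auto
  then show ?thesis using True by simp
 qed simp
qed

lemma conv_cong:
 assumes "!!s. 0 <= s ==> s <= t ==> f s = f' s" "!!s. 0 <= s ==> s <= t ==> g s = g' s"
 shows "conv f g t = conv f' g' t"
 unfolding conv_def by (intro Bochner_Integration.integral_cong) (auto simp: indicator_def assms)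

lemma loc_bounded_conv:
 assumes f: "loc_bounded f" and g: "loc_bounded g"
 shows "loc_bounded (conv f g)"
 unfolding loc_bounded_def
proof (intro conjI allI impI)
 have "(%t. indicator {0..} t * conv f g t) = (%t. enn2real (econv (halfline f) (halfline g) t))"
 proof
  fix t show "indicator {0..} t * conv f g t = enn2real (econv (halfline f) (halfline g) t)"
   using ennreal_conv[OF f g, of t, symmetric] conv_nonneg[OF f g]
   by (cases "0 <= t") (auto simp: conv_def)
 qed
 also have "... \<in> borel_measurable borel"
  using econv_measurable[OF loc_boundedD(3)[OF f] loc_boundedD(3)[OF g]] by measurable
 finally show "(%t. indicator {0..} t * conv f g t) \<in> borel_measurable borel" .
 fix T
 obtain A where A: "0 <= A" "!!s. 0 <= s ==> s <= T ==> f s <= A" using loc_bounded_bound[OF f, of T] by metis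
 obtain B where B: "0 <= B" "!!s. 0 <= s ==> s <= T ==> g s <= B" using loc_bounded_bound[OF g, of T] by metis
 have "conv f g t <= A * B * T" if t: "0 <= t" "t <= T" for t
 proof -
  have "conv f g t <= conv (%_. A) (%_. B) t"
   by (rule conv_mono) (use f g A B t loc_bounded_const in auto)
  also have "... = A * B * t" using t by (simp add: conv_def)
  also have "... <= A * B * T" using A B t by (intro mult_left_mono) auto
  finally show ?thesis .
 qed
 then show "\<exists>B. \<forall>t. 0 <= t --> t <= T --> conv f g t <= B" by blast
qed (rule conv_nonneg[OF f g])

lemma conv_commute:
 assumes f: "loc_bounded f" and g: "loc_bounded g"
 shows "conv f g t = conv g f t"
 using ennreal_conv[OF f g, of t] ennreal_conv[OF g f, of t] conv_nonneg[OF f g] conv_nonneg[OF g f]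
  econv_commute[OF loc_boundedD(3)[OF f] loc_boundedD(3)[OF g]]
 by (metis ennreal_inj)

lemma conv_assoc:
 assumes f: "loc_bounded f" and g: "loc_bounded g" and h: "loc_bounded h"
 shows "conv (conv f g) h t = conv f (conv g h) t"
proof -
 have "ennreal (conv (conv f g) h t) = ennreal (conv f (conv g h) t)"
  unfolding ennreal_conv[OF loc_bounded_conv[OF f g] h] ennreal_conv[OF f loc_bounded_conv[OF g h]]
   halfline_conv[OF f g] halfline_conv[OF g h]
  by (simp add: econv_assoc loc_boundedD(3) f g h)
 then show ?thesis
  using conv_nonneg[OF loc_bounded_conv[OF f g] h] conv_nonneg[OF f loc_bounded_conv[OF g h]]
  by simp
qed

lemma conv_add_right:
 assumes f: "loc_bounded f" and g: "loc_bounded g" and h: "loc_bounded h"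
 shows "conv f (%t. g t + h t) t = conv f g t + conv f h t"
 using Bochner_Integration.integral_add[OF conv_integrable[OF f g] conv_integrable[OF f h]]
 unfolding conv_def by (simp add: distrib_left)

lemma conv_cmult_right: "conv f (%t. c * g t) t = c * conv f g t"
 unfolding conv_def by (simp add: mult.left_commute)

lemma conv_cmult_left: "conv (%t. c * f t) g t = c * conv f g t"
 unfolding conv_def by (simp add: mult.left_commute mult.assoc)

lemma conv_exp: "conv (%t. exp (c * t) * f t) (%t. exp (c * t) * g t) t = exp (c * t) * conv f g t"
proof -
 have "exp (c * (t - s)) * exp (c * s) = exp (c * t)" for s
  by (simp add: exp_add[symmetric] algebra_simps)
 then have "exp (c * (t - s)) * f (t - s) * (exp (c * s) * g s) = exp (c * t) * (f (t - s) * g s)" for s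
  by (metis mult.assoc mult.left_commute)
 then have "conv (%t. exp (c * t) * f t) (%t. exp (c * t) * g t) t
  = (\<integral>s. exp (c * t) * (indicator {0..t} s * (f (t - s) * g s)) \<partial>lborel)"
  unfolding conv_def by (simp only: mult.left_commute)
 then show ?thesis unfolding conv_def by (simp only: integral_mult_right_zero)
qed

lemma integral_exp_Icc:
 fixes c t :: real
 assumes "0 <= t" "c ~= 0"
 shows "(\<integral>s. indicator {0..t} s * exp (c * s) \<partial>lborel) = (exp (c * t) - 1) / c"
proof -
 have "has_bochner_integral lborel (%s. indicator {0..t} s *\<^sub>R exp (c * s)) (exp (c * t) / c - exp (c * 0) / c)"
  by (rule has_bochner_integral_FTC_Icc[OF assms(1)])
   (use assms(2) in \<open>auto intro!: continuous_intros derivative_eq_intros simp: has_real_derivative_iff_has_vector_derivative[symmetric]\<close>)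
 then show ?thesis by (simp add: has_bochner_integral_iff diff_divide_distrib)
qed

text \<open>In the norm weighted with an exponential of large rate the kernel halves distances, so iterating the two
inequalities drives the excess of \<open>u\<close> over \<open>v\<close> to zero.\<close>
lemma volterra_comparison:
 assumes k: "loc_bounded k" and u: "loc_bounded u" and v: "loc_bounded v"
  and le_u: "!!t. 0 <= t ==> u t <= f t + conv k u t"
  and le_v: "!!t. 0 <= t ==> f t + conv k v t <= v t"
  and "0 <= T"
 shows "u T <= v T"
proof -
 obtain P where P: "0 <= P" "!!s. 0 <= s ==> s <= T ==> k s <= P" using loc_bounded_bound[OF k, of T] by metis
 obtain B where B: "0 <= B" "!!s. 0 <= s ==> s <= T ==> u s <= B" using loc_bounded_bound[OF u, of T] by metis
 define K where "K = 2 * P + 1"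
 have K: "0 < K" "P / K <= 1 / 2" using P(1) by (auto simp: K_def field_simps)
 define e where "e n s = B / 2 ^ n * exp (K * s)" for n :: nat and s
 have e: "loc_bounded (e n)" for n
  unfolding e_def[abs_def] by (intro loc_bounded_cmult loc_bounded_exp) (use B in auto)
 have iter: "u t <= v t + e n t" if "0 <= t" "t <= T" for t n
  using that
 proof (induction n arbitrary: t)
  case 0
  have "u t <= B" using B 0 by auto
  also have "B <= B * exp (K * t)" using B(1) 0 K by (simp add: mult_le_cancel_left1)
  also have "... <= v t + e 0 t" using loc_boundedD(1)[OF v 0(1)] by (simp add: e_def)
  finally show ?case .
 next
  case (Suc n)
  have "conv k (e n) t <= conv (%_. P) (e n) t"
   by (rule conv_mono) (use k e P Suc.prems loc_bounded_const in auto)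
  also have "... = P * (B / 2 ^ n) * (\<integral>s. indicator {0..t} s * exp (K * s) \<partial>lborel)"
   unfolding conv_def e_def integral_mult_right_zero[symmetric]
   by (intro Bochner_Integration.integral_cong) auto
  also have "... = (P / K) * (B / 2 ^ n * (exp (K * t) - 1))"
   using K(1) by (subst integral_exp_Icc[OF Suc.prems(1)]) (simp_all add: mult_ac)
  also have "... <= (1 / 2) * (B / 2 ^ n * exp (K * t))"
   by (intro mult_mono[OF K(2)] mult_left_mono) (use K B(1) P(1) Suc.prems in auto)
  also have "... = e (Suc n) t" by (simp add: e_def)
  finally have step: "conv k (e n) t <= e (Suc n) t" .
  have "u t <= f t + conv k u t" by (rule le_u) fact
  also have "conv k u t <= conv k (%s. v s + e n s) t"
   by (rule conv_mono) (use k u v e loc_bounded_add Suc in auto)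
  also have "... = conv k v t + conv k (e n) t" by (rule conv_add_right[OF k v e])
  finally show ?case using le_v[OF Suc.prems(1)] step by simp
 qed
 have "(%n. v T + B * exp (K * T) * (1 / 2) ^ n) \<longlonglongrightarrow> v T + B * exp (K * T) * 0"
  by (intro tendsto_intros LIMSEQ_power_zero) simp
 then have "u T <= v T + B * exp (K * T) * 0"
  by (rule LIMSEQ_le_const) (use iter[of T] \<open>0 <= T\<close> in \<open>auto simp: e_def power_one_over field_simps\<close>)
 then show ?thesis by simp
qed

lemma volterra_unique:
 assumes "loc_bounded k" "loc_bounded u" "loc_bounded v"
  and "!!t. 0 <= t ==> u t = f t + conv k u t" "!!t. 0 <= t ==> v t = f t + conv k v t" "0 <= T"
 shows "u T = v T"
 using volterra_comparison[of k u v f T] volterra_comparison[of k v u f T] assms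
 by (simp add: antisym)

lemma gronwall_exp:
 assumes k: "loc_bounded k" and u: "loc_bounded u" and "0 < b"
  and "!!t. 0 <= t ==> k t <= b" and "!!t. 0 <= t ==> u t <= 1 + conv k u t" and "0 <= T"
 shows "u T <= exp (b * T)"
proof (rule volterra_comparison[OF loc_bounded_const[of b] u loc_bounded_exp, where f="%_. 1"])
 fix t :: real assume t: "0 <= t"
 have "u t <= 1 + conv k u t" using t by (rule assms(5))
 also have "conv k u t <= conv (%_. b) u t"
  by (rule conv_mono) (use k u assms loc_bounded_const in auto)
 finally show "u t <= 1 + conv (%_. b) u t" by simp
 have "conv (%_. b) (%t. exp (b * t)) t = b * (\<integral>s. indicator {0..t} s * exp (b * s) \<partial>lborel)"
  unfolding conv_def integral_mult_right_zero[symmetric] by (intro Bochner_Integration.integral_cong) auto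
 then show "1 + conv (%_. b) (%t. exp (b * t)) t <= exp (b * t)"
  using t \<open>0 < b\<close> by (simp add: integral_exp_Icc)
qed (use assms in auto)

section \<open>The random walk\<close>

text \<open>The off-diagonal part of the generator: it is nonnegative, so sums and integrals over it can be exchanged by
monotone convergence.\<close>
definition jump_rate :: "(int ^ 'd => int ^ 'd => real) => int ^ 'd => int ^ 'd => real" where
 "jump_rate a x y = (if x = y then 0 else a x y)"

lemma walk_intensities_diag: "walk_intensities a ==> a x x = a 0 0"
 unfolding walk_intensities_def by (metis diff_self)

lemma jump_rate_nonneg: "walk_intensities a ==> 0 <= jump_rate a x y"
 unfolding walk_intensities_def jump_rate_def by auto

lemma jump_rate_has_sum:
 assumes "walk_intensities a"
 shows "(jump_rate a x has_sum - a 0 0) UNIV"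
proof -
 have 1: "(a x has_sum 0) UNIV" using assms unfolding walk_intensities_def by auto
 have 2: "((%y. if y = x then - a x x else 0) has_sum - a x x) UNIV"
  using has_sum_finite[of "{x}" "%y. - a x x"]
  by (subst has_sum_cong_neutral[where T="{x}" and g="%y. - a x x"]) auto
 have "jump_rate a x = (%y. a x y + (if y = x then - a x x else 0))"
  by (auto simp: jump_rate_def)
 then show ?thesis using has_sum_add[OF 1 2] walk_intensities_diag[OF assms, of x] by simp
qed

lemma walk_generator_eq:
 assumes a: "walk_intensities a" and f: "!!y. \<bar>f y\<bar> <= B"
 shows "(%y. jump_rate a x y * f y) summable_on UNIV"
  and "((%y. a x y * f y) has_sum (\<Sum>\<^sub>\<infinity>y. jump_rate a x y * f y) + a 0 0 * f x) UNIV"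
proof -
 have "\<bar>jump_rate a x y * f y\<bar> <= jump_rate a x y * B" for y
  using f[of y] jump_rate_nonneg[OF a, of x y] by (simp add: abs_mult mult_left_mono)
 then show s: "(%y. jump_rate a x y * f y) summable_on UNIV"
  by (rule summable_on_bounded[OF summable_on_cmult_left[OF has_sum_imp_summable[OF jump_rate_has_sum[OF a]]]])
 have 2: "((%y. if y = x then a x x * f x else 0) has_sum a x x * f x) UNIV"
  using has_sum_finite[of "{x}" "%y. a x x * f x"]
  by (subst has_sum_cong_neutral[where T="{x}" and g="%y. a x x * f x"]) auto
 have "(%y. a x y * f y) = (%y. jump_rate a x y * f y + (if y = x then a x x * f x else 0))"
  by (auto simp: jump_rate_def)
 then show "((%y. a x y * f y) has_sum (\<Sum>\<^sub>\<infinity>y. jump_rate a x y * f y) + a 0 0 * f x) UNIV"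
  using has_sum_add[OF has_sum_infsum[OF s] 2] walk_intensities_diag[OF a, of x] by simp
qed

text \<open>The factor \<open>exp (- a 0 0 * t)\<close> removes the diagonal of the generator and leaves an equation with
nonnegative coefficients.\<close>
lemma walk_backward:
 fixes a :: "int ^ 'd => int ^ 'd => real" and g :: "int ^ 'd => real"
 assumes a: "walk_intensities a" and p: "walk_transitions a p" and g: "!!y. \<bar>g y\<bar> <= 1" and t: "0 <= t"
 shows "((%t. exp (- a 0 0 * t) * measure_pmf.expectation (p t x) g) has_real_derivative
  (\<Sum>\<^sub>\<infinity>y. jump_rate a x y * (exp (- a 0 0 * t) * measure_pmf.expectation (p t y) g))) (at t within {0..})"
proof -
 let ?u = "%t x. measure_pmf.expectation (p t x) g"
 have semi: "transition_semigroup p" using p by (simp add: walk_transitions_def)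
 have nonneg: "!!x. \<forall>y\<in>UNIV. y ~= x --> 0 <= a x y" and tot: "!!x. (a x has_sum 0) UNIV"
  using a unfolding walk_intensities_def by auto
 have "(%h. pmf (p h x) y - (indicator {x} y + a x y * h)) \<in> o[at_right 0](%h. h)" for x y
  using p unfolding walk_transitions_def by (cases "x = y") auto
 then have rate: "\<forall>y\<in>UNIV. (%h. pmf (p h x) y - (indicator {x} y + a x y * h)) \<in> o[at_right 0](%h. h)" for x
  by blast
 note bwd = backward_equation[OF semi allI[OF g] UNIV_I nonneg rate tot]
 have D: "((%t. ?u t x) has_real_derivative (\<Sum>\<^sub>\<infinity>y. a x y * ?u t y)) (at t within {0..})"
  using bwd(2)[OF ballI[OF bwd(1)] t] .
 have u1: "\<bar>?u t y\<bar> <= 1" for y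
 proof -
  have "\<bar>?u t y\<bar> <= measure_pmf.expectation (p t y) (%eta. \<bar>g eta\<bar>)" by (rule integral_abs_bound)
  also have "... <= measure_pmf.expectation (p t y) (%eta. 1)"
   by (rule integral_mono) (use g in \<open>auto intro!: measure_pmf.integrable_const_bound[where B=1]\<close>)
  finally show ?thesis by simp
 qed
 have "(\<Sum>\<^sub>\<infinity>y. a x y * ?u t y) = (\<Sum>\<^sub>\<infinity>y. jump_rate a x y * ?u t y) + a 0 0 * ?u t x"
  using infsumI[OF walk_generator_eq(2)[OF a u1]] .
 moreover have "(\<Sum>\<^sub>\<infinity>y. jump_rate a x y * (exp (- a 0 0 * t) * ?u t y)) = exp (- a 0 0 * t) * (\<Sum>\<^sub>\<infinity>y. jump_rate a x y * ?u t y)"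
  by (subst infsum_cmult_right[symmetric]) (auto simp: mult.left_commute intro: walk_generator_eq(1)[OF a u1])
 ultimately show ?thesis
  using D by (auto intro!: derivative_eq_intros simp: algebra_simps)
qed

section \<open>The branching process\<close>

definition pop :: "(int ^ 'd) set => (int ^ 'd) multiset => nat" where
 "pop B eta = size (filter_mset (%z. z \<in> B) eta)"

definition gen_fun :: "(real => (int ^ 'd) multiset => (int ^ 'd) multiset pmf) => (int ^ 'd) set =>
  real => real => (int ^ 'd) multiset => real" where
 "gen_fun K B s t eta = measure_pmf.expectation (K t eta) (%\<zeta>. (1 - s) ^ pop B \<zeta>)"

lemma gen_fun_bounds:
 assumes "0 < s" "s < 1"
 shows "0 < gen_fun K B s t eta" "gen_fun K B s t eta <= 1" "integrable (K t eta) (%\<zeta>. (1 - s) ^ pop B \<zeta>)"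
proof -
 show int: "integrable (K t eta) (%\<zeta>. (1 - s) ^ pop B \<zeta>)"
  by (rule measure_pmf.integrable_const_bound[where B=1]) (use assms in \<open>auto simp: power_le_one\<close>)
 have "gen_fun K B s t eta <= measure_pmf.expectation (K t eta) (%\<zeta>. 1)"
  unfolding gen_fun_def by (rule integral_mono[OF int]) (use assms in \<open>auto simp: power_le_one\<close>)
 then show "gen_fun K B s t eta <= 1" by simp
 have "gen_fun K B s t eta ~= 0"
 proof
  assume "gen_fun K B s t eta = 0"
  then have "AE \<zeta> in K t eta. (1 - s) ^ pop B \<zeta> = 0"
   using integral_nonneg_eq_0_iff_AE[OF int] assms by (auto simp: gen_fun_def)
  then have "\<forall>\<zeta>\<in>set_pmf (K t eta). (1 - s) ^ pop B \<zeta> = 0" by (simp add: AE_measure_pmf_iff)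
  then show False using assms set_pmf_not_empty[of "K t eta"] by auto
 qed
 moreover have "0 <= gen_fun K B s t eta"
  unfolding gen_fun_def by (rule Bochner_Integration.integral_nonneg) (use assms in auto)
 ultimately show "0 < gen_fun K B s t eta" by simp
qed

lemma gen_fun_add:
 assumes K: "branching_transitions a b K" and s: "0 < s" "s < 1" and t: "0 <= t"
 shows "gen_fun K B s t (eta + eta') = gen_fun K B s t eta * gen_fun K B s t eta'"
proof -
 have nonneg: "0 <= gen_fun K B s t eta" for eta using less_imp_le[OF gen_fun_bounds(1)[OF s]] .
 have nn: "(\<integral>\<^sup>+\<zeta>. ennreal ((1 - s) ^ pop B \<zeta>) \<partial>K t eta) = ennreal (gen_fun K B s t eta)" for eta
  unfolding gen_fun_def by (rule nn_integral_eq_integral[OF gen_fun_bounds(3)[OF s]]) (use s in auto)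
 have "ennreal (gen_fun K B s t (eta + eta'))
   = (\<integral>\<^sup>+\<zeta>. ennreal ((1 - s) ^ pop B \<zeta>) \<partial>map_pmf (%(\<zeta>, \<zeta>'). \<zeta> + \<zeta>') (pair_pmf (K t eta) (K t eta')))"
  using K t by (simp add: nn[symmetric] branching_transitions_def)
 also have "... = (\<integral>\<^sup>+\<zeta>. (\<integral>\<^sup>+\<zeta>'. ennreal ((1 - s) ^ pop B \<zeta>) * ennreal ((1 - s) ^ pop B \<zeta>') \<partial>K t eta') \<partial>K t eta)"
  using s by (simp add: nn_integral_pair_pmf' pop_def power_add ennreal_mult')
 also have "... = ennreal (gen_fun K B s t eta) * ennreal (gen_fun K B s t eta')"
  by (simp add: nn_integral_cmult nn_integral_multc nn)
 finally have "ennreal (gen_fun K B s t (eta + eta')) = ennreal (gen_fun K B s t eta * gen_fun K B s t eta')"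
  by (simp add: ennreal_mult' nonneg)
 then show ?thesis by (simp add: nonneg)
qed

lemma gen_fun_empty:
 assumes "branching_transitions a b K" "0 < s" "s < 1" "0 <= t"
 shows "gen_fun K B s t {#} = 1"
 using gen_fun_add[OF assms, of B "{#}" "{#}"] gen_fun_bounds(1)[OF assms(2,3), of K B t "{#}"] by simp

lemma gen_fun_replicate:
 assumes "branching_transitions a b K" "0 < s" "s < 1" "0 <= t"
 shows "gen_fun K B s t (replicate_mset n x) = gen_fun K B s t {#x#} ^ n"
proof (induction n)
 case (Suc n)
 then show ?case using gen_fun_add[OF assms, of B "{#x#}" "replicate_mset n x"] by simp
qed (simp add: gen_fun_empty[OF assms])

lemma branching_intensities_facts:
 assumes b: "branching_intensities b"
 shows "!!n. 2 <= n ==> 0 <= b n" "0 <= b 0" "(b has_sum - b 0 - b 1) {2..}"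
  "((%n. (real n - 1) * b n) has_sum beta_star b) {2..}"
proof -
 show nn: "0 <= b n" if "2 <= n" for n using b that unfolding branching_intensities_def by auto
 show "0 <= b 0" using b unfolding branching_intensities_def by auto
 show "((%n. (real n - 1) * b n) has_sum beta_star b) {2..}"
  using b unfolding branching_intensities_def beta_star_def by simp
 have sb: "b sums 0" using b unfolding branching_intensities_def by simp
 have "(%n. b (n + 2)) sums (0 - (\<Sum>n<2. b n))"
  by (rule sums_split_initial_segment[OF sb])
 then have "(%n. b (n + 2)) sums (- b 0 - b 1)" by (simp add: numeral_2_eq_2)
 then have *: "((%n. b (n + 2)) has_sum (- b 0 - b 1)) UNIV"
  by (rule sums_nonneg_imp_has_sum) (use nn in auto)
 have "(b has_sum (- b 0 - b 1)) ((%n. n + 2) ` UNIV)"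
  by (subst has_sum_reindex) (use * in \<open>auto simp: o_def inj_on_def\<close>)
 moreover have "range (%n::nat. n + 2) = {2..}"
 proof (intro set_eqI iffI)
  fix n :: nat assume "n \<in> {2..}"
  then have "n = (n - 2) + 2" by simp
  then show "n \<in> range (%n. n + 2)" by (rule range_eqI)
 qed auto
 ultimately show "(b has_sum - b 0 - b 1) {2..}" by simp
qed

definition split_term :: "(nat => real) => real => real" where
 "split_term b G = (\<Sum>\<^sub>\<infinity>n\<in>{2..}. b n * (G - G ^ n))"

lemma power_gap_bounds:
 fixes G :: real
 assumes "0 <= G" "G <= 1" "1 <= n"
 shows "0 <= G - G ^ n" "G - G ^ n <= (real n - 1) * (1 - G)" "G - G ^ n <= 1"
proof -
 have "G ^ n <= G ^ 1" by (rule power_decreasing) (use assms in auto)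
 then show "0 <= G - G ^ n" by simp
 obtain m where m: "n = Suc m" using assms(3) by (cases n) auto
 have "1 + real m * (G - 1) <= G ^ m"
  using Bernoulli_inequality[of "G - 1" m] assms by simp
 then have "G * (1 - G ^ m) <= 1 * (real m * (1 - G))"
  using assms by (intro mult_mono) (auto simp: algebra_simps power_le_one)
 then show "G - G ^ n <= (real n - 1) * (1 - G)" by (simp add: m algebra_simps)
 show "G - G ^ n <= 1" using assms by (smt (verit) zero_le_power)
qed

lemma split_term_bounds:
 assumes b: "branching_intensities b" and G: "0 <= G" "G <= 1"
 shows "(%n. b n * (G - G ^ n)) summable_on {2..}" "0 <= split_term b G" "split_term b G <= beta_star b * (1 - G)"
proof -
 note bf = branching_intensities_facts[OF b]
 have le: "b n * (G - G ^ n) <= (real n - 1) * b n * (1 - G)" "0 <= b n * (G - G ^ n)" if "2 <= n" for n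
  using mult_left_mono[OF power_gap_bounds(2)[OF G, of n] bf(1)[OF that]] power_gap_bounds(1)[OF G, of n] that bf(1)[OF that]
  by (auto simp: mult_ac)
 have B: "((%n. (real n - 1) * b n * (1 - G)) has_sum beta_star b * (1 - G)) {2..}"
  by (rule has_sum_cmult_left[OF bf(4)])
 show s: "(%n. b n * (G - G ^ n)) summable_on {2..}"
  by (rule summable_on_bounded[OF has_sum_imp_summable[OF B]]) (use le in auto)
 show "0 <= split_term b G" unfolding split_term_def by (rule infsum_nonneg) (use le in auto)
 show "split_term b G <= beta_star b * (1 - G)"
  unfolding split_term_def by (rule has_sum_mono[OF has_sum_infsum[OF s] B]) (use le in auto)
qed

text \<open>Generating functions of populations are bounded and multiplicative over independent particles. They therefore
satisfy a closed backward equation even before any moment is known to be finite.\<close>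
lemma gen_fun_backward:
 fixes a :: "int ^ 'd => int ^ 'd => real" and B :: "(int ^ 'd) set" and s :: real
 assumes a: "walk_intensities a" and b: "branching_intensities b" and K: "branching_transitions a b K"
  and s: "0 < s" "s < 1"
 defines "G \<equiv> %t x. gen_fun K B s t {#x#}"
 shows "continuous_on {0..} (%t. G t x)"
  and "0 <= t ==> ((%t. G t x) has_real_derivative
   (\<Sum>\<^sub>\<infinity>y. a x y * G t y) + b 0 * (1 - G t x) - (if x = 0 then split_term b (G t 0) else 0)) (at t within {0..})"
proof -
 note bf = branching_intensities_facts[OF b]
 define R where "R x = (if x = 0 then (%n. replicate_mset n (0 :: int ^ 'd)) ` {2..} else {})" for x :: "int ^ 'd"
 define S where "S x = {{#}} \<union> range (%y::int ^ 'd. {#y#}) \<union> R x" for x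
 define L where "L x eta = (if size eta = 0 then b 0
   else if size eta = 1 then (let y = (THE y. eta = {#y#}) in a x y + (if x = y then (if x = 0 then b 1 else - b 0) else 0))
   else b (size eta))" for x :: "int ^ 'd" and eta :: "(int ^ 'd) multiset"
 have L1: "L x {#y#} = a x y + (if x = y then (if x = 0 then b 1 else - b 0) else 0)" for x y
  by (simp add: L_def)
 have L0: "L x {#} = b 0" for x by (simp add: L_def)
 have L2: "L x (replicate_mset n 0) = b n" if "2 <= n" for x n
  using that by (auto simp: L_def)
 have semi: "transition_semigroup K" using K by (simp add: branching_transitions_def)
 have x0: "{#x#} \<in> S x" for x by (auto simp: S_def)
 have nonneg: "0 <= L x eta" if "eta \<in> S x" "eta ~= {#x#}" for x eta
  using that a bf(1,2) L0 L1 L2 unfolding S_def R_def walk_intensities_def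
  by (auto split: if_splits)
 have rate: "(%h. pmf (K h {#x#}) eta - (indicator {{#x#}} eta + L x eta * h)) \<in> o[at_right 0](%h. h)"
  if "eta \<in> S x" for x eta
 proof -
  from that consider "eta = {#}" | y where "eta = {#y#}" | n where "eta = replicate_mset n 0" "2 <= n" "x = 0"
   unfolding S_def R_def by (auto split: if_splits)
  then show ?thesis
  proof cases
   case 1
   then show ?thesis using K by (simp add: branching_transitions_def L0)
  next
   case (2 y)
   show ?thesis
   proof (cases "x = y")
    case True
    then show ?thesis using K 2 walk_intensities_diag[OF a]
     by (cases "x = 0") (simp_all add: branching_transitions_def L1)
   next
    case False
    then have "{#y#} ~= {#x#}" by auto
    with False 2 K show ?thesis by (simp add: branching_transitions_def L1)
   qed
  next
   case (3 n)
   then have "replicate_mset n 0 ~= {#0 :: int ^ 'd#}"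
    by (metis One_nat_def not_less_eq_eq numeral_2_eq_2 order_refl size_replicate_mset size_single)
   with 3 K show ?thesis by (simp add: branching_transitions_def L2)
  qed
 qed
 have sumS: "((%eta. L x eta * f eta) has_sum
   b 0 * f {#} + (A + (if x = 0 then b 1 else - b 0) * f {#x#}) + (if x = 0 then C else 0)) (S x)"
  if A: "((%y. a x y * f {#y#}) has_sum A) UNIV"
   and C: "x = 0 ==> ((%n. b n * f (replicate_mset n 0)) has_sum C) {2..}" for x f A C
 proof -
  have 1: "((%eta. L x eta * f eta) has_sum b 0 * f {#}) {{#}}"
   using has_sum_finite[of "{{#}}" "%eta. L x eta * f eta"] by (simp add: L0)
  have d: "((%y. if y = x then (if x = 0 then b 1 else - b 0) * f {#x#} else 0) has_sum
    (if x = 0 then b 1 else - b 0) * f {#x#}) UNIV"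
   using has_sum_finite[of "{x}" "%y. (if x = 0 then b 1 else - b 0) * f {#x#}"]
   by (subst has_sum_cong_neutral[where T="{x}" and g="%y. (if x = 0 then b 1 else - b 0) * f {#x#}"]) auto
  have "(%eta. L x eta * f eta) \<circ> (%y. {#y#})
    = (%y. a x y * f {#y#} + (if y = x then (if x = 0 then b 1 else - b 0) * f {#x#} else 0))"
   by (auto simp: L1 fun_eq_iff algebra_simps)
  then have 2: "((%eta. L x eta * f eta) has_sum (A + (if x = 0 then b 1 else - b 0) * f {#x#})) (range (%y. {#y#}))"
   using has_sum_add[OF A d] by (subst has_sum_reindex) (auto simp: inj_on_def)
  have 3: "((%eta. L x eta * f eta) has_sum (if x = 0 then C else 0)) (R x)"
  proof (cases "x = 0")
   case True
   have "((%eta. L 0 eta * f eta) has_sum C) ((%n. replicate_mset n 0) ` {2..})"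
   proof (subst has_sum_reindex)
    show "inj_on (%n. replicate_mset n (0 :: int ^ 'd)) {2..}"
     by (auto simp: inj_on_def) (metis size_replicate_mset)
    show "(((%eta. L 0 eta * f eta) \<circ> (%n. replicate_mset n 0)) has_sum C) {2..}"
     using C[OF True] by (subst has_sum_cong[where g="%n. b n * f (replicate_mset n 0)"]) (auto simp: L2)
   qed
   then show ?thesis using True by (simp add: R_def)
  qed (simp add: R_def)
  have dis: "{{#}} \<inter> range (%y::int ^ 'd. {#y#}) = {}" "({{#}} \<union> range (%y::int ^ 'd. {#y#})) \<inter> R x = {}"
  proof -
   show "({{#}} \<union> range (%y::int ^ 'd. {#y#})) \<inter> R x = {}"
   proof (rule ccontr)
    assume "({{#}} \<union> range (%y::int ^ 'd. {#y#})) \<inter> R x ~= {}"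
    then obtain eta where eta: "eta \<in> {{#}} \<union> range (%y::int ^ 'd. {#y#})" "eta \<in> R x" by blast
    from eta(1) have "size eta <= 1" by auto
    moreover from eta(2) have "2 <= size eta" by (auto simp: R_def split: if_splits)
    ultimately show False by simp
   qed
  qed auto
  show ?thesis
   unfolding S_def using has_sum_Un_disjoint[OF has_sum_Un_disjoint[OF 1 2 dis(1)] 3 dis(2)] .
 qed
 have total: "(L x has_sum 0) (S x)" for x
 proof -
  have "((%eta. L x eta * 1) has_sum b 0 * 1 + (0 + (if x = 0 then b 1 else - b 0) * 1) + (if x = 0 then - b 0 - b 1 else 0)) (S x)"
   by (rule sumS) (use a bf(3) in \<open>auto simp: walk_intensities_def\<close>)
  then show ?thesis by (auto split: if_splits)
 qed
 have g1: "\<bar>(1 - s) ^ pop B eta\<bar> <= 1" for eta using s by (simp add: power_le_one)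
 have nonneg': "\<forall>eta\<in>S x. eta ~= {#x#} --> 0 <= L x eta"
  and rate': "\<forall>eta\<in>S x. (%h. pmf (K h {#x#}) eta - (indicator {{#x#}} eta + L x eta * h)) \<in> o[at_right 0](%h. h)" for x
  using nonneg rate by blast+
 note bwd = backward_equation[where g="%eta. (1 - s) ^ pop B eta", OF semi allI[OF g1] x0 nonneg' rate' total, folded gen_fun_def]
 show cont: "continuous_on {0..} (%t. G t x)" for x unfolding G_def by (rule bwd(1))
 have contS: "continuous_on {0..} (%t. gen_fun K B s t eta)" if "eta \<in> S x" for eta x
 proof -
  from that consider "eta = {#}" | y where "eta = {#y#}" | n where "eta = replicate_mset n 0"
   unfolding S_def R_def by (auto split: if_splits)
  then show ?thesis
  proof cases
   case 1
   then show ?thesis by (subst continuous_on_cong[OF refl, where g="%_. 1"]) (auto simp: gen_fun_empty[OF K s])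
  next
   case (2 y) then show ?thesis using bwd(1) by simp
  next
   case (3 n)
   have "continuous_on {0..} (%t. gen_fun K B s t {#0#} ^ n)" by (intro continuous_intros bwd(1))
   then show ?thesis
    unfolding 3 by (subst continuous_on_cong[OF refl, where g="%t. gen_fun K B s t {#0#} ^ n"])
     (auto simp: gen_fun_replicate[OF K s])
  qed
 qed
 assume t: "0 <= t"
 have G01: "0 <= G t x" "G t x <= 1" for x
  using gen_fun_bounds(1,2)[OF s] less_imp_le unfolding G_def by blast+
 have "((%eta. L x eta * gen_fun K B s t eta) has_sum
   b 0 * gen_fun K B s t {#} + ((\<Sum>\<^sub>\<infinity>y. a x y * G t y) + (if x = 0 then b 1 else - b 0) * gen_fun K B s t {#x#})
   + (if x = 0 then (- b 0 - b 1) * G t 0 - split_term b (G t 0) else 0)) (S x)"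
 proof (rule sumS)
  have "(%y. a x y * G t y) summable_on UNIV"
   using walk_generator_eq(2)[OF a, where f="G t" and B=1 and x=x] G01 by (auto intro: has_sum_imp_summable)
  then show "((%y. a x y * gen_fun K B s t {#y#}) has_sum (\<Sum>\<^sub>\<infinity>y. a x y * G t y)) UNIV"
   unfolding G_def by (rule has_sum_infsum)
  have "((%n. b n * G t 0 - b n * (G t 0 - G t 0 ^ n)) has_sum (- b 0 - b 1) * G t 0 - split_term b (G t 0)) {2..}"
   unfolding split_term_def diff_conv_add_uminus[of "_ * _" "infsum _ _"] diff_conv_add_uminus[of "b _ * G t 0"]
   by (intro has_sum_add has_sum_uminus[THEN iffD2] has_sum_cmult_left bf(3)) (use split_term_bounds(1)[OF b G01] in auto)
  then show "((%n. b n * gen_fun K B s t (replicate_mset n 0)) has_sum (- b 0 - b 1) * G t 0 - split_term b (G t 0)) {2..}"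
   by (simp add: gen_fun_replicate[OF K s t] G_def algebra_simps)
 qed
 then have "(\<Sum>\<^sub>\<infinity>eta\<in>S x. L x eta * gen_fun K B s t eta)
   = (\<Sum>\<^sub>\<infinity>y. a x y * G t y) + b 0 * (1 - G t x) - (if x = 0 then split_term b (G t 0) else 0)"
  by (auto simp: infsumI gen_fun_empty[OF K s t] G_def algebra_simps)
 then show "((%t. G t x) has_real_derivative
   (\<Sum>\<^sub>\<infinity>y. a x y * G t y) + b 0 * (1 - G t x) - (if x = 0 then split_term b (G t 0) else 0)) (at t within {0..})"
  using bwd(2)[OF ballI[OF contS] t, of x] by (simp add: G_def)
qed

section \<open>The renewal equation of the first moments\<close>

lemma tendsto_infsum_dominated:
 fixes f :: "'k => 'i => real"
 assumes lim: "!!i. i \<in> A ==> ((%k. f k i) \<longlongrightarrow> l i) F"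
  and bound: "!!k i. i \<in> A ==> \<bar>f k i\<bar> <= B i" and B: "B summable_on A" and F: "F ~= bot"
 shows "((%k. \<Sum>\<^sub>\<infinity>i\<in>A. f k i) \<longlongrightarrow> (\<Sum>\<^sub>\<infinity>i\<in>A. l i)) F"
 unfolding tendsto_iff
proof (intro allI impI)
 fix e :: real assume "0 < e"
 have boundl: "\<bar>l i\<bar> <= B i" if "i \<in> A" for i
  by (rule tendsto_upperbound[OF tendsto_rabs[OF lim[OF that]] _ F]) (use bound that in auto)
 obtain S where S: "finite S" "S \<subseteq> A" "dist (sum B S) (infsum B A) <= e / 4"
  using has_sum_finite_approximation[OF has_sum_infsum[OF B], of "e/4"] \<open>0 < e\<close> by auto
 have BA: "B summable_on (A - S)" by (rule summable_on_subset[OF B]) auto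
 have tail: "infsum B (A - S) <= e / 4"
  using infsum_Un_disjoint[of B S "A - S"] S BA by (simp add: Un_absorb1 dist_real_def)
 have split: "\<bar>infsum g A - sum g S\<bar> <= e / 4" if g: "!!i. i \<in> A ==> \<bar>g i\<bar> <= B i" for g
 proof -
  have gA: "g summable_on (A - S)" by (rule summable_on_bounded[OF BA]) (use g in auto)
  have "infsum g A = sum g S + infsum g (A - S)"
   using infsum_Un_disjoint[of g S "A - S"] S gA by (simp add: Un_absorb1)
  moreover have "norm (infsum g (A - S)) <= infsum B (A - S)"
   by (rule norm_infsum_le[OF has_sum_infsum[OF gA] has_sum_infsum[OF BA]]) (use g in auto)
  ultimately show ?thesis using tail by simp
 qed
 have "((%k. \<Sum>i\<in>S. f k i) \<longlongrightarrow> (\<Sum>i\<in>S. l i)) F"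
  by (rule tendsto_sum) (use S lim in auto)
 then have "\<forall>\<^sub>F k in F. dist (\<Sum>i\<in>S. f k i) (\<Sum>i\<in>S. l i) < e / 4"
  using \<open>0 < e\<close> by (intro tendstoD) auto
 then show "\<forall>\<^sub>F k in F. dist (\<Sum>\<^sub>\<infinity>i\<in>A. f k i) (\<Sum>\<^sub>\<infinity>i\<in>A. l i) < e"
 proof eventually_elim
  case (elim k)
  have "\<bar>infsum (f k) A - sum (f k) S\<bar> <= e / 4" "\<bar>infsum l A - sum l S\<bar> <= e / 4"
   using split[of "f k"] split[of l] bound boundl by auto
  then show ?case using elim \<open>0 < e\<close> unfolding dist_real_def by linarith
 qed
qed

lemma walk_prob_continuous:
 assumes a: "walk_intensities a" and p: "walk_transitions a p"
 shows "continuous_on {0..} (%t. measure_pmf.prob (p t x) B)"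
proof -
 have "((%t. exp (- a 0 0 * t) * measure_pmf.prob (p t x) B) has_real_derivative
  (\<Sum>\<^sub>\<infinity>y. jump_rate a x y * (exp (- a 0 0 * t) * measure_pmf.prob (p t y) B))) (at t within {0..})"
  if "0 <= t" for t
  using walk_backward[OF a p, of "indicator B" t x] that by simp
 then have "continuous_on {0..} (%t. exp (- a 0 0 * t) * measure_pmf.prob (p t x) B)"
  by (intro DERIV_continuous_on) auto
 then have "continuous_on {0..} (%t. exp (a 0 0 * t) * (exp (- a 0 0 * t) * measure_pmf.prob (p t x) B))"
  by (rule continuous_on_mult[OF continuous_on_exp[OF continuous_on_mult[OF continuous_on_const continuous_on_id]]])
 moreover have "exp (a 0 0 * t) * (exp (- a 0 0 * t) * c) = c" for t c :: real
  by (simp add: exp_minus field_simps)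
 ultimately show ?thesis by (simp only:)
qed

lemma walk_kernel_loc_bounded:
 assumes "walk_intensities a" "walk_transitions a p"
 shows "loc_bounded (%t. pmf (p t x) y)"
 using continuous_on_loc_bounded[OF walk_prob_continuous[OF assms, of x "{y}"]]
 by (simp add: measure_pmf_single)

text \<open>The quotient \<open>(1 - gen_fun) / s\<close> increases to the mean population as \<open>s\<close> decreases to
zero; before the limit it solves the linear equation of the mean up to a source at the origin, which is
dominated by \<open>beta_star b\<close> times the solution itself.\<close>
lemma gen_fun_duhamel:
 fixes a :: "int ^ 'd => int ^ 'd => real" and B :: "(int ^ 'd) set" and s :: real
 assumes a: "walk_intensities a" and p: "walk_transitions a p"
  and b: "branching_intensities b" and K: "branching_transitions a b K"
  and s: "0 < s" "s < 1"
 defines "q \<equiv> %t x. (1 - gen_fun K B s t {#x#}) / s"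
  and "h \<equiv> %t. exp (b 0 * t) * (split_term b (gen_fun K B s t {#0#}) / s)"
 shows "0 <= t ==> exp (b 0 * t) * q t x = measure_pmf.prob (p t x) B + conv (%t. pmf (p t x) 0) h t"
  and "continuous_on {0..} h" "!!t. 0 <= t ==> 0 <= h t" "!!t. 0 <= t ==> h t <= beta_star b * (exp (b 0 * t) * q t 0)"
  and "continuous_on {0..} (%t. q t x)" "!!t. 0 <= q t x" "!!t. q t x <= 1 / s"
proof -
 define \<alpha> where "\<alpha> = - a 0 0"
 note G = gen_fun_bounds(1,2)[OF s, where K=K and B=B]
 note bwd = gen_fun_backward[OF a b K s, where B=B]
 have G01: "0 <= gen_fun K B s t eta" "gen_fun K B s t eta <= 1" for t eta using G[of t eta] by auto
 have G1: "\<bar>gen_fun K B s t eta\<bar> <= 1" for t eta using G01[of t eta] by simp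
 show q0: "0 <= q t x" for t x using s G01[of t "{#x#}"] by (simp add: q_def)
 show q1: "q t x <= 1 / s" for t x using s G01[of t "{#x#}"] by (simp add: q_def divide_right_mono)
 show cq: "continuous_on {0..} (%t. q t x)" for x
  unfolding q_def using s by (intro continuous_intros bwd(1)) auto
 have csplit: "continuous_on {0..} (%t. split_term b (gen_fun K B s t {#0#}))"
  unfolding split_term_def
 proof (rule continuous_on_infsum[OF _ _ has_sum_imp_summable[OF branching_intensities_facts(3)[OF b]]])
  fix n :: nat and t :: real assume n: "n \<in> {2..}"
  show "continuous_on {0..} (%t. b n * (gen_fun K B s t {#0#} - gen_fun K B s t {#0#} ^ n))"
   by (intro continuous_intros bwd(1))
  show "\<bar>b n * (gen_fun K B s t {#0#} - gen_fun K B s t {#0#} ^ n)\<bar> <= b n"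
   using power_gap_bounds(1,3)[OF G01, of n t "{#0#}"] n branching_intensities_facts(1)[OF b, of n]
   by (simp add: abs_mult mult_left_le)
 qed
 show ch: "continuous_on {0..} h" unfolding h_def using s by (intro continuous_intros csplit) auto
 show h0: "0 <= h t" for t unfolding h_def using split_term_bounds(2)[OF b G01] s by simp
 show "h t <= beta_star b * (exp (b 0 * t) * q t 0)" for t
 proof -
  have "split_term b (gen_fun K B s t {#0#}) / s <= beta_star b * q t 0"
   using divide_right_mono[OF split_term_bounds(3)[OF b G01, of t "{#0#}"], of s] s by (simp add: q_def)
  from mult_left_mono[OF this, of "exp (b 0 * t)"] show ?thesis by (simp add: h_def mult.left_commute)
 qed
 define u where "u t x = exp ((\<alpha> + b 0) * t) * q t x" for t x
 define r where "r t x = exp (\<alpha> * t) * measure_pmf.prob (p t x) B" for t x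
 define k where "k t x = exp (\<alpha> * t) * pmf (p t x) 0" for t x
 define g where "g t = exp (\<alpha> * t) * h t" for t
 have r: "((%t. r t x) has_real_derivative (\<Sum>\<^sub>\<infinity>y. jump_rate a x y * r t y)) (at t within {0..})" if "0 <= t" for t x
  using walk_backward[OF a p, of "indicator B" t x] that by (simp add: r_def \<alpha>_def)
 have k: "((%t. k t x) has_real_derivative (\<Sum>\<^sub>\<infinity>y. jump_rate a x y * k t y)) (at t within {0..})" if "0 <= t" for t x
  using walk_backward[OF a p, of "indicator {0}" t x] that by (simp add: k_def \<alpha>_def measure_pmf_single)
 have u: "((%t. u t x) has_real_derivative (\<Sum>\<^sub>\<infinity>y. jump_rate a x y * u t y) + (if x = 0 then g t else 0)) (at t within {0..})"
  if t: "0 <= t" for t x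
 proof -
  let ?G = "%t x. gen_fun K B s t {#x#}"
  have "(%y. jump_rate a x y * q t y) summable_on UNIV"
   by (rule walk_generator_eq(1)[OF a, where B="1/s"]) (use q0 q1 in \<open>simp add: abs_of_nonneg\<close>)
  then have jq: "((%y. jump_rate a x y * q t y) has_sum (\<Sum>\<^sub>\<infinity>y. jump_rate a x y * q t y)) UNIV" by (rule has_sum_infsum)
  have "((%y. jump_rate a x y + - s * (jump_rate a x y * q t y)) has_sum \<alpha> + - s * (\<Sum>\<^sub>\<infinity>y. jump_rate a x y * q t y)) UNIV"
   unfolding \<alpha>_def by (intro has_sum_add jump_rate_has_sum[OF a] has_sum_cmult_right jq)
  moreover have "jump_rate a x y + - s * (jump_rate a x y * q t y) = jump_rate a x y * ?G t y" for y
   using s by (simp add: q_def field_simps)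
  ultimately have "(\<Sum>\<^sub>\<infinity>y. jump_rate a x y * ?G t y) = \<alpha> - s * (\<Sum>\<^sub>\<infinity>y. jump_rate a x y * q t y)"
   by (simp add: infsumI)
  then have aG: "(\<Sum>\<^sub>\<infinity>y. a x y * ?G t y) = \<alpha> - s * (\<Sum>\<^sub>\<infinity>y. jump_rate a x y * q t y) - \<alpha> * ?G t x"
   using infsumI[OF walk_generator_eq(2)[OF a, where f="%y. ?G t y" and B=1 and x=x, OF G1]] by (simp add: \<alpha>_def)
  have "((%t. q t x) has_real_derivative
   - ((\<Sum>\<^sub>\<infinity>y. a x y * ?G t y) + b 0 * (1 - ?G t x) - (if x = 0 then split_term b (?G t 0) else 0)) / s) (at t within {0..})"
   unfolding q_def using DERIV_cdivide[OF DERIV_diff[OF DERIV_const[of 1] bwd(2)[OF t, of x]], of s] by simp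
  moreover have "- ((\<Sum>\<^sub>\<infinity>y. a x y * ?G t y) + b 0 * (1 - ?G t x) - (if x = 0 then split_term b (?G t 0) else 0)) / s
   = (\<Sum>\<^sub>\<infinity>y. jump_rate a x y * q t y) - (\<alpha> + b 0) * q t x + (if x = 0 then split_term b (?G t 0) / s else 0)"
   unfolding aG using s by (simp add: q_def field_simps)
  ultimately have dq: "((%t. q t x) has_real_derivative
   (\<Sum>\<^sub>\<infinity>y. jump_rate a x y * q t y) - (\<alpha> + b 0) * q t x + (if x = 0 then split_term b (?G t 0) / s else 0)) (at t within {0..})"
   by simp
  have de: "((%t. exp ((\<alpha> + b 0) * t)) has_real_derivative (\<alpha> + b 0) * exp ((\<alpha> + b 0) * t)) (at t within {0..})"
   by (auto intro!: derivative_eq_intros)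
  have "((%t. u t x) has_real_derivative (\<alpha> + b 0) * exp ((\<alpha> + b 0) * t) * q t x +
   ((\<Sum>\<^sub>\<infinity>y. jump_rate a x y * q t y) - (\<alpha> + b 0) * q t x + (if x = 0 then split_term b (?G t 0) / s else 0)) * exp ((\<alpha> + b 0) * t)) (at t within {0..})"
   unfolding u_def by (rule DERIV_mult'[OF de dq, THEN DERIV_cong]) (simp add: algebra_simps)
  moreover have "(\<Sum>\<^sub>\<infinity>y. jump_rate a x y * u t y) = exp ((\<alpha> + b 0) * t) * (\<Sum>\<^sub>\<infinity>y. jump_rate a x y * q t y)"
   using infsumI[OF has_sum_cmult_right[OF jq, of "exp ((\<alpha> + b 0) * t)"]] by (simp add: u_def mult.left_commute)
  moreover have "g t = exp ((\<alpha> + b 0) * t) * (split_term b (?G t 0) / s)"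
   by (simp add: g_def h_def distrib_right exp_add)
  ultimately show ?thesis by (simp add: algebra_simps split: if_splits)
 qed
 have K0: "K 0 eta = return_pmf eta" for eta using K by (simp add: branching_transitions_def transition_semigroup_def)
 have p0: "p 0 x = return_pmf x" for x using p by (simp add: walk_transitions_def transition_semigroup_def)
 have init: "u 0 x = r 0 x" "k 0 x = (if x = 0 then 1 else 0)" for x
  using s by (auto simp: u_def r_def k_def q_def gen_fun_def K0 p0 pop_def indicator_def)
 have expb: "exp (c * t) <= exp (\<bar>c\<bar> * \<bar>T\<bar>)" if "t \<in> {0..T}" for c t T :: real
 proof -
  have "c * t <= \<bar>c\<bar> * t" using that by (intro mult_right_mono) auto
  also have "... <= \<bar>c\<bar> * \<bar>T\<bar>" using that by (intro mult_left_mono) auto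
  finally show ?thesis by simp
 qed
 have bdd: "\<exists>B. \<forall>t\<in>{0..T}. \<forall>x. exp (c * t) * f t x <= B"
  if f: "!!t x. 0 <= f t x" "!!t x. f t x <= A" for c A T and f :: "real => int ^ 'd => real"
  by (intro exI[of _ "exp (\<bar>c\<bar> * \<bar>T\<bar>) * A"] ballI allI mult_mono[OF expb f(2) _ f(1)]) auto
 have bu: "\<exists>B. \<forall>t\<in>{0..T}. \<forall>x. u t x <= B" for T unfolding u_def by (rule bdd[OF q0 q1])
 have br: "\<exists>B. \<forall>t\<in>{0..T}. \<forall>x. r t x <= B" for T
  unfolding r_def by (rule bdd[OF measure_nonneg measure_pmf.prob_le_1])
 have bk: "\<exists>B. \<forall>t\<in>{0..T}. \<forall>x. k t x <= B" for T unfolding k_def by (rule bdd[OF pmf_nonneg pmf_le_1])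
 have g: "continuous_on {0..} g" "!!t. 0 <= t ==> 0 <= g t"
  unfolding g_def using h0 by (auto intro!: continuous_intros ch)
 have du: "halfline (%t. u t x) t = halfline (%t. r t x) t + econv (halfline (%t. k t x)) (halfline g) t" for t x
 proof (rule duhamel[where Q="jump_rate a" and c=\<alpha> and z=0, OF _ _ _ u r k _ _ _ _ _ bu br bk g])
  show "0 <= jump_rate a x y" for x y by (rule jump_rate_nonneg[OF a])
  show "jump_rate a x summable_on UNIV" "(\<Sum>\<^sub>\<infinity>y. jump_rate a x y) <= \<alpha>" for x
   using jump_rate_has_sum[OF a, of x] by (auto simp: has_sum_iff \<alpha>_def)
  show "0 <= u t x" for t x unfolding u_def using q0 by simp
  show "0 <= r t x" "0 <= k t x" for t x unfolding r_def k_def by simp_all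
 qed (simp_all add: init)
 have lk: "loc_bounded (%t. k t x)" for x
  by (rule continuous_on_loc_bounded) (auto simp: k_def intro!: DERIV_continuous_on[OF k, unfolded k_def])
 have lg: "loc_bounded g" using g by (rule continuous_on_loc_bounded)
 assume t: "0 <= t"
 have "ennreal (u t x) = ennreal (r t x) + ennreal (conv (%t. k t x) g t)"
  using du[of x t] t unfolding ennreal_conv[OF lk lg] by (simp add: halfline_def)
 then have "u t x = r t x + conv (%t. k t x) g t"
  using conv_nonneg[OF lk lg, of x t] q0[of t x] t
  by (simp add: u_def r_def ennreal_plus[symmetric] del: ennreal_plus)
 also have "conv (%t. k t x) g t = exp (\<alpha> * t) * conv (%t. pmf (p t x) 0) h t"
  unfolding k_def g_def by (rule conv_exp)
 finally have "exp (\<alpha> * t) * (exp (b 0 * t) * q t x) = exp (\<alpha> * t) * (measure_pmf.prob (p t x) B + conv (%t. pmf (p t x) 0) h t)"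
  by (simp add: u_def r_def distrib_right exp_add algebra_simps)
 then show "exp (b 0 * t) * q t x = measure_pmf.prob (p t x) B + conv (%t. pmf (p t x) 0) h t"
  by simp
qed

lemma one_minus_power_quotient:
 fixes s :: real
 assumes "s ~= 0"
 shows "(1 - (1 - s) ^ n) / s = (\<Sum>j<n. (1 - s) ^ j)"
 using one_diff_power_eq[of "1 - s" n] assms by simp

text \<open>Conditioning on the branching at the origin. Gronwall's inequality bounds the quotients \<open>(1 - gen_fun) /
s\<close> uniformly in \<open>s\<close>; monotone convergence then gives both integrability of the population
and the renewal equation, in which the death rate has been absorbed into the factor \<open>exp (b 0 *
t)\<close>.\<close>
lemma first_moment_renewal:
 fixes a :: "int ^ 'd => int ^ 'd => real" and B :: "(int ^ 'd) set"
 assumes a: "walk_intensities a" and p: "walk_transitions a p"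
  and b: "branching_intensities b" and K: "branching_transitions a b K" and beta: "0 < beta_star b"
 defines "w \<equiv> %t x. exp (b 0 * t) * measure_pmf.expectation (K t {#x#}) (%eta. real (pop B eta))"
 shows "0 <= t ==> integrable (K t {#x#}) (%eta. real (pop B eta))"
  and "loc_bounded (%t. w t x)"
  and "0 <= t ==> w t x = measure_pmf.prob (p t x) B + beta_star b * conv (%t. pmf (p t x) 0) (%t. w t 0) t"
proof -
 define \<beta> where "\<beta> = beta_star b"
 have \<beta>: "0 < \<beta>" using beta by (simp add: \<beta>_def)
 define \<sigma> where "\<sigma> k = 1 / (real k + 2)" for k :: nat
 have \<sigma>: "0 < \<sigma> k" "\<sigma> k < 1" for k by (auto simp: \<sigma>_def)
 have \<sigma>_lim: "\<sigma> \<longlonglongrightarrow> 0"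
  unfolding \<sigma>_def by (rule tendsto_divide_0[OF tendsto_const]) (auto intro!: filterlim_at_top_imp_at_infinity filterlim_tendsto_add_at_top[OF tendsto_const] filterlim_real_sequentially simp: add.commute[of _ 2])
 have \<sigma>_dec: "\<sigma> (Suc k) <= \<sigma> k" for k by (auto simp: \<sigma>_def field_simps)
 define G where "G k t x = gen_fun K B (\<sigma> k) t {#x#}" for k t and x :: "int ^ 'd"
 define q where "q k t x = (1 - G k t x) / \<sigma> k" for k t and x :: "int ^ 'd"
 define h where "h k t = exp (b 0 * t) * (split_term b (G k t 0) / \<sigma> k)" for k t
 define P where "P x = (%t. pmf (p t x) 0)" for x
 note D = gen_fun_duhamel[OF a p b K \<sigma>, where B=B, folded G_def, folded q_def, folded h_def, folded P_def \<beta>_def]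
 have lP: "loc_bounded (P x)" for x unfolding P_def by (rule walk_kernel_loc_bounded[OF a p])
 have lh: "loc_bounded (h k)" for k by (rule continuous_on_loc_bounded[OF D(2) D(3)])
 have lq: "loc_bounded (%t. exp (b 0 * t) * q k t x)" for k x
  by (rule loc_bounded_mult[OF loc_bounded_exp continuous_on_loc_bounded[OF D(5) D(6)]])
 have P1: "P x t <= 1" for x t unfolding P_def by (rule pmf_le_1)
 have bound0: "exp (b 0 * t) * q k t 0 <= exp (\<beta> * t)" if "0 <= t" for k t
 proof (rule gronwall_exp[OF loc_bounded_cmult[OF less_imp_le[OF \<beta>] lP] lq \<beta> _ _ that, of 0])
  fix t :: real assume t: "0 <= t"
  show "\<beta> * P 0 t <= \<beta>" using P1 \<beta> by (simp add: mult_left_le)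
  have "exp (b 0 * t) * q k t 0 = measure_pmf.prob (p t 0) B + conv (P 0) (h k) t" by (rule D(1)[OF t])
  also have "... <= 1 + conv (P 0) (%t. \<beta> * (exp (b 0 * t) * q k t 0)) t"
   by (intro add_mono measure_pmf.prob_le_1 conv_mono lP lh loc_bounded_cmult lq D(4)) (use \<beta> in auto)
  also have "... = 1 + conv (%t. \<beta> * P 0 t) (%t. exp (b 0 * t) * q k t 0) t"
   by (simp only: conv_cmult_left conv_cmult_right)
  finally show "exp (b 0 * t) * q k t 0 <= 1 + conv (%t. \<beta> * P 0 t) (%t. exp (b 0 * t) * q k t 0) t" .
 qed
 have h_le: "h k t <= \<beta> * exp (\<beta> * t)" if "0 <= t" for k t
  by (rule order_trans[OF D(4)[OF that] mult_left_mono[OF bound0[OF that] less_imp_le[OF \<beta>]]])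
 have bound: "exp (b 0 * t) * q k t x <= exp (\<beta> * t)" if t: "0 <= t" for k t x
 proof -
  have "exp (b 0 * t) * q k t x = measure_pmf.prob (p t x) B + conv (P x) (h k) t" by (rule D(1)[OF t])
  also have "... <= 1 + conv (%_. 1) (%t. \<beta> * exp (\<beta> * t)) t"
   by (intro add_mono measure_pmf.prob_le_1 conv_mono lP lh loc_bounded_cmult loc_bounded_exp loc_bounded_const P1 h_le) (use \<beta> in auto)
  also have "conv (%_. 1) (%t. \<beta> * exp (\<beta> * t)) t = \<beta> * (\<integral>s. indicator {0..t} s * exp (\<beta> * s) \<partial>lborel)"
   by (simp add: conv_cmult_right) (simp add: conv_def)
  also have "1 + ... = exp (\<beta> * t)" using \<beta> t by (simp add: integral_exp_Icc)
  finally show ?thesis .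
 qed
 define f where "f k eta = (\<Sum>j<pop B eta. (1 - \<sigma> k) ^ j)" for k eta
 have f0: "0 <= f k eta" for k eta unfolding f_def using \<sigma>(2)[of k] by (intro sum_nonneg) auto
 have f_lim: "(%k. f k eta) \<longlonglongrightarrow> real (pop B eta)" for eta
 proof -
  have "(%k. f k eta) \<longlonglongrightarrow> (\<Sum>j<pop B eta. (1 - 0) ^ j)"
   unfolding f_def by (intro tendsto_intros \<sigma>_lim)
  then show ?thesis by simp
 qed
 have f_inc: "incseq (%k. f k eta)" for eta
  by (rule incseq_SucI) (use \<sigma>(2) \<sigma>_dec in \<open>auto simp: f_def less_imp_le intro!: sum_mono power_mono\<close>)
 have f_le: "f k eta <= real (pop B eta)" for k eta by (rule incseq_le[OF f_inc f_lim])
 have q_eq: "q k t x = measure_pmf.expectation (K t {#x#}) (f k)" and f_int: "integrable (K t {#x#}) (f k)" for k t x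
 proof -
  have *: "f k eta = (1 - (1 - \<sigma> k) ^ pop B eta) / \<sigma> k" for eta
   unfolding f_def using one_minus_power_quotient \<sigma>(1)[of k] by (metis less_irrefl)
  show "integrable (K t {#x#}) (f k)"
   unfolding * by (intro Bochner_Integration.integrable_diff integrable_divide gen_fun_bounds(3)[OF \<sigma>]) auto
  show "q k t x = measure_pmf.expectation (K t {#x#}) (f k)"
   unfolding * q_def G_def gen_fun_def
   by (simp add: Bochner_Integration.integral_diff gen_fun_bounds(3)[OF \<sigma>])
 qed
 have pop_int: "integrable (K t {#x#}) (%eta. real (pop B eta))" if t: "0 <= t" for t x
 proof (rule integrableI_nonneg)
  have "(\<integral>\<^sup>+eta. ennreal (real (pop B eta)) \<partial>K t {#x#}) <= ennreal (exp (\<beta> * t - b 0 * t))"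
  proof (rule LIMSEQ_le_const2[OF nn_integral_LIMSEQ[where f="%k eta. ennreal (f k eta)"]])
   show "incseq (%k eta. ennreal (f k eta))"
    using f_inc by (auto simp: incseq_def le_fun_def intro!: ennreal_leI)
   show "(%k. ennreal (f k eta)) \<longlonglongrightarrow> ennreal (real (pop B eta))" for eta
    by (intro tendsto_ennrealI f_lim)
   show "\<exists>N. \<forall>n\<ge>N. (\<integral>\<^sup>+eta. ennreal (f n eta) \<partial>K t {#x#}) <= ennreal (exp (\<beta> * t - b 0 * t))"
   proof (intro exI allI impI)
    fix k
    have "(\<integral>\<^sup>+eta. ennreal (f k eta) \<partial>K t {#x#}) = ennreal (q k t x)"
     unfolding q_eq by (rule nn_integral_eq_integral[OF f_int]) (simp add: f0)
    also have "q k t x <= exp (\<beta> * t - b 0 * t)"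
     using bound[OF t, of k x] by (simp add: exp_diff field_simps)
    finally show "(\<integral>\<^sup>+eta. ennreal (f k eta) \<partial>K t {#x#}) <= ennreal (exp (\<beta> * t - b 0 * t))"
     by (simp add: ennreal_leI)
   qed
  qed simp
  then show "(\<integral>\<^sup>+eta. ennreal (real (pop B eta)) \<partial>K t {#x#}) < \<infinity>" by (auto simp: le_less_trans)
 qed auto
 then show "0 <= t ==> integrable (K t {#x#}) (%eta. real (pop B eta))" .
 define m where "m t x = measure_pmf.expectation (K t {#x#}) (%eta. real (pop B eta))" for t x
 have q_lim: "(%k. q k t x) \<longlonglongrightarrow> m t x" if "0 <= t" for t x
  unfolding q_eq m_def
  by (rule integral_dominated_convergence[where w="%eta. real (pop B eta)"])
   (use pop_int[OF that] f_lim f_le f0 in \<open>auto simp: abs_of_nonneg\<close>)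
 have m0: "0 <= m t x" for t x unfolding m_def by (rule Bochner_Integration.integral_nonneg) simp
 have wm: "w t x = exp (b 0 * t) * m t x" for t x by (simp add: w_def m_def)
 have w_le: "w t x <= exp (\<beta> * t)" if "0 <= t" for t x
  unfolding wm
  by (rule LIMSEQ_le_const2[OF tendsto_mult_left[OF q_lim[OF that]]]) (use bound[OF that] in auto)
 show lw: "loc_bounded (%t. w t x)" for x
  unfolding loc_bounded_def
 proof (intro conjI allI impI)
  show "(%t. indicator {0..} t * w t x) \<in> borel_measurable borel"
  proof (rule borel_measurable_LIMSEQ_real)
   show "(%t. indicator {0..} t * (exp (b 0 * t) * q k t x)) \<in> borel_measurable borel" for k
    by (rule loc_boundedD(2)[OF lq])
   show "(%k. indicator {0..} t * (exp (b 0 * t) * q k t x)) \<longlonglongrightarrow> indicator {0..} t * w t x" for t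
    unfolding wm by (cases "0 <= t") (auto intro!: tendsto_mult_left q_lim)
  qed
  show "\<exists>B. \<forall>t. 0 <= t --> t <= T --> w t x <= B" for T
  proof (intro exI[of _ "exp (\<beta> * T)"] allI impI)
   fix t assume "0 <= t" "t <= T"
   then show "w t x <= exp (\<beta> * T)" using w_le[of t x] \<beta> by (smt (verit) exp_le_cancel_iff mult_left_mono)
  qed
 qed (simp add: wm m0)
 have h_lim: "(%k. h k t) \<longlonglongrightarrow> \<beta> * w t 0" if t: "0 <= t" for t
 proof -
  define M where "M = exp (\<beta> * t - b 0 * t)"
  have qM: "q k t 0 <= M" for k using bound0[OF t, of k] by (simp add: M_def exp_diff field_simps)
  have G01: "0 <= G k t 0" "G k t 0 <= 1" for k
   using gen_fun_bounds(1,2)[OF \<sigma>, where K=K and B=B] unfolding G_def by (auto simp: less_imp_le)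
  have Gq: "G k t 0 = 1 - \<sigma> k * q k t 0" for k using \<sigma>(1)[of k] by (simp add: q_def)
  have "(%k. 1 - \<sigma> k * q k t 0) \<longlonglongrightarrow> 1 - 0 * m t 0"
   by (intro tendsto_intros \<sigma>_lim q_lim t)
  then have G_lim: "(%k. G k t 0) \<longlonglongrightarrow> 1" by (simp add: Gq)
  have term_eq: "(G k t 0 - G k t 0 ^ n) / \<sigma> k = G k t 0 * q k t 0 * (\<Sum>j<n-1. G k t 0 ^ j)" if "2 <= n" for n k
  proof -
   have "G k t 0 - G k t 0 ^ n = G k t 0 * (1 - G k t 0 ^ (n - 1))"
    using that by (cases n) (auto simp: algebra_simps)
   also have "... = G k t 0 * ((1 - G k t 0) * (\<Sum>j<n-1. G k t 0 ^ j))" by (simp only: one_diff_power_eq)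
   finally show ?thesis by (simp add: q_def)
  qed
  have "(%k. \<Sum>\<^sub>\<infinity>n\<in>{2..}. b n * ((G k t 0 - G k t 0 ^ n) / \<sigma> k)) \<longlonglongrightarrow> (\<Sum>\<^sub>\<infinity>n\<in>{2..}. (real n - 1) * b n * m t 0)"
  proof (rule tendsto_infsum_dominated)
   show "(%n. (real n - 1) * b n * M) summable_on {2..}"
    by (intro summable_on_cmult_left has_sum_imp_summable[OF branching_intensities_facts(4)[OF b]])
   fix n :: nat assume n: "n \<in> {2..}"
   have "(%k. b n * (G k t 0 * q k t 0 * (\<Sum>j<n-1. G k t 0 ^ j))) \<longlonglongrightarrow> b n * (1 * m t 0 * (\<Sum>j<n-1. 1 ^ j))"
    by (intro tendsto_intros G_lim q_lim t)
   then show "(%k. b n * ((G k t 0 - G k t 0 ^ n) / \<sigma> k)) \<longlonglongrightarrow> (real n - 1) * b n * m t 0"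
    using n by (simp add: term_eq of_nat_diff mult_ac)
   fix k
   have "(G k t 0 - G k t 0 ^ n) / \<sigma> k <= (real n - 1) * (1 - G k t 0) / \<sigma> k"
    using power_gap_bounds(2)[OF G01, of n k] n \<sigma>(1)[of k] by (intro divide_right_mono) auto
   also have "... = (real n - 1) * q k t 0" by (simp add: q_def)
   also have "... <= (real n - 1) * M" using n qM by (intro mult_left_mono) auto
   finally have "(G k t 0 - G k t 0 ^ n) / \<sigma> k <= (real n - 1) * M" .
   moreover have "0 <= (G k t 0 - G k t 0 ^ n) / \<sigma> k"
    using power_gap_bounds(1)[OF G01, of n k] n \<sigma>(1)[of k] by (simp add: less_imp_le)
   moreover have "\<bar>c * X\<bar> <= c * Y" if "0 <= c" "0 <= X" "X <= Y" for c X Y :: real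
    using that by (simp add: abs_mult mult_left_mono)
   moreover have "0 <= b n" using branching_intensities_facts(1)[OF b, of n] n by simp
   moreover have "(real n - 1) * b n * M = b n * ((real n - 1) * M)" by simp
   ultimately show "\<bar>b n * ((G k t 0 - G k t 0 ^ n) / \<sigma> k)\<bar> <= (real n - 1) * b n * M"
    by presburger
  qed simp
  moreover have "(\<Sum>\<^sub>\<infinity>n\<in>{2..}. b n * ((G k t 0 - G k t 0 ^ n) / \<sigma> k)) = split_term b (G k t 0) / \<sigma> k" for k
   unfolding split_term_def divide_inverse
   by (subst infsum_cmult_left[symmetric]) (use split_term_bounds(1)[OF b G01] in \<open>auto simp: mult_ac\<close>)
  moreover have "(\<Sum>\<^sub>\<infinity>n\<in>{2..}. (real n - 1) * b n * m t 0) = \<beta> * m t 0"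
   using infsumI[OF has_sum_cmult_left[OF branching_intensities_facts(4)[OF b], of "m t 0"]] by (simp add: \<beta>_def)
  ultimately have "(%k. split_term b (G k t 0) / \<sigma> k) \<longlonglongrightarrow> \<beta> * m t 0" by simp
  from tendsto_mult_left[OF this, of "exp (b 0 * t)"] show ?thesis by (simp add: h_def wm mult.left_commute)
 qed
 assume t: "0 <= t"
 have "(%k. conv (P x) (h k) t) \<longlonglongrightarrow> conv (P x) (%t. \<beta> * w t 0) t"
  unfolding conv_def
 proof (rule integral_dominated_convergence)
  show "(%s. indicator {0..t} s * (P x (t - s) * (\<beta> * w s 0))) \<in> borel_measurable lborel"
   "(%s. indicator {0..t} s * (P x (t - s) * h k s)) \<in> borel_measurable lborel" for k
   using conv_measurable_integrand[OF lP loc_bounded_cmult[OF less_imp_le[OF \<beta>] lw]] conv_measurable_integrand[OF lP lh]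
   by simp_all
  show "integrable lborel (%s. indicator {0..t} s * (1 * (\<beta> * exp (\<beta> * s))))"
   by (rule conv_integrable[where f="%_. 1" and g="%s. \<beta> * exp (\<beta> * s)"])
    (use \<beta> in \<open>auto intro!: loc_bounded_const loc_bounded_cmult loc_bounded_exp\<close>)
  show "AE s in lborel. (%k. indicator {0..t} s * (P x (t - s) * h k s)) \<longlonglongrightarrow> indicator {0..t} s * (P x (t - s) * (\<beta> * w s 0))"
   by (intro AE_I2) (auto simp: indicator_def intro!: tendsto_mult_left h_lim)
  show "AE s in lborel. norm (indicator {0..t} s * (P x (t - s) * h k s)) <= indicator {0..t} s * (1 * (\<beta> * exp (\<beta> * s)))" for k
  proof (intro AE_I2)
   fix s
   have "P x (t - s) * h k s <= 1 * (\<beta> * exp (\<beta> * s))" if "0 <= s"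
    by (intro mult_mono P1 h_le D(3) that) (use \<beta> in auto)
   then show "norm (indicator {0..t} s * (P x (t - s) * h k s)) <= indicator {0..t} s * (1 * (\<beta> * exp (\<beta> * s)))"
    using D(3)[of s k] by (cases "0 <= s") (auto simp: indicator_def abs_mult P_def)
  qed
 qed
 then have "(%k. measure_pmf.prob (p t x) B + conv (P x) (h k) t) \<longlonglongrightarrow> measure_pmf.prob (p t x) B + \<beta> * conv (P x) (%t. w t 0) t"
  by (intro tendsto_add tendsto_const) (simp add: conv_cmult_right)
 then have "(%k. exp (b 0 * t) * q k t x) \<longlonglongrightarrow> measure_pmf.prob (p t x) B + \<beta> * conv (P x) (%t. w t 0) t"
  by (simp only: D(1)[OF t])
 moreover have "(%k. exp (b 0 * t) * q k t x) \<longlonglongrightarrow> w t x"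
  unfolding wm by (intro tendsto_mult_left q_lim t)
 ultimately show "w t x = measure_pmf.prob (p t x) B + beta_star b * conv (%t. pmf (p t x) 0) (%t. w t 0) t"
  unfolding \<beta>_def P_def by (rule LIMSEQ_unique[symmetric])
qed

lemma has_sum_integral_cbox:
 fixes f :: "'i => 'a::euclidean_space => real"
 assumes cont: "!!i. continuous_on (cbox l u) (f i)"
  and bound: "!!i x. x \<in> cbox l u ==> \<bar>f i x\<bar> <= B i" and summ: "B summable_on UNIV"
 shows "((%i. integral (cbox l u) (f i)) has_sum integral (cbox l u) (%x. \<Sum>\<^sub>\<infinity>i. f i x)) UNIV"
proof -
 have unif: "uniform_limit (cbox l u) (%S x. \<Sum>i\<in>S. f i x) (%x. \<Sum>\<^sub>\<infinity>i. f i x) (finite_subsets_at_top UNIV)"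
  by (rule uniform_limit_infsum[OF bound summ]) auto
 have c: "continuous_on (cbox l u) (%x. \<Sum>i\<in>S. f i x)" for S
  by (intro continuous_on_sum cont)
 obtain I J where I: "!!S. ((%x. \<Sum>i\<in>S. f i x) has_integral I S) (cbox l u)"
  and J: "((%x. \<Sum>\<^sub>\<infinity>i. f i x) has_integral J) (cbox l u)" and lim: "(I \<longlongrightarrow> J) (finite_subsets_at_top UNIV)"
  using uniform_limit_integral_cbox[OF unif c] by auto
 have "I S = (\<Sum>i\<in>S. integral (cbox l u) (f i))" for S
 proof (cases "finite S")
  case True
  then have "((%x. \<Sum>i\<in>S. f i x) has_integral (\<Sum>i\<in>S. integral (cbox l u) (f i))) (cbox l u)"
   by (intro has_integral_sum integrable_integral integrable_continuous cont) auto
  with I[of S] show ?thesis by (rule has_integral_unique)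
 next
  case False
  then show ?thesis using has_integral_unique[OF I[of S], of 0] by simp
 qed
 then have "I = sum (%i. integral (cbox l u) (f i))" by (rule ext)
 then show ?thesis using lim integral_unique[OF J] unfolding has_sum_def by simp
qed

section \<open>The characteristic exponent\<close>

definition lattice_vec :: "int ^ 'd => real ^ 'd" where
 "lattice_vec z = (\<chi> i. real_of_int (z $ i))"

lemma lattice_vec_simps:
 "lattice_vec (x + y) = lattice_vec x + lattice_vec y" "lattice_vec (x - y) = lattice_vec x - lattice_vec y"
 "lattice_vec (- x) = - lattice_vec x" "lattice_vec 0 = 0"
 by (simp_all add: lattice_vec_def vec_eq_iff)

lemma norm_lattice_vec: "norm (lattice_vec z) = lattice_norm z"
 by (simp add: lattice_vec_def lattice_norm_def)

definition char_exponent :: "(int ^ 'd => int ^ 'd => real) => real ^ 'd => real" where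
 "char_exponent a k = (\<Sum>\<^sub>\<infinity>z. jump_rate a 0 z * (1 - cos (k \<bullet> lattice_vec z)))"

lemma one_minus_cos_eq: "1 - cos u = 2 * (sin (u / 2))\<^sup>2" for u :: real
 using cos_double_sin[of "u / 2"] by simp

lemma one_minus_cos_le: "1 - cos u <= u\<^sup>2 / 2" for u :: real
proof -
 have "(sin (u / 2))\<^sup>2 <= (u / 2)\<^sup>2"
  using abs_sin_x_le_abs_x[of "u / 2"] unfolding abs_le_square_iff .
 then show ?thesis by (simp add: one_minus_cos_eq power_divide)
qed

lemma one_minus_cos_add: "1 - cos (u + v) <= 2 * (1 - cos u) + 2 * (1 - cos v)" for u v :: real
proof -
 have "\<bar>sin ((u + v) / 2)\<bar> <= \<bar>sin (u / 2)\<bar> * \<bar>cos (v / 2)\<bar> + \<bar>cos (u / 2)\<bar> * \<bar>sin (v / 2)\<bar>"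
  by (simp add: add_divide_distrib sin_add abs_mult[symmetric] abs_triangle_ineq)
 also have "... <= \<bar>sin (u / 2)\<bar> + \<bar>sin (v / 2)\<bar>"
  by (intro add_mono mult_left_le mult_left_le_one_le) auto
 finally have "(sin ((u + v) / 2))\<^sup>2 <= (\<bar>sin (u / 2)\<bar> + \<bar>sin (v / 2)\<bar>)\<^sup>2"
  by (simp add: abs_le_square_iff[symmetric])
 also have "... <= 2 * (sin (u / 2))\<^sup>2 + 2 * (sin (v / 2))\<^sup>2"
  using sum_squares_bound[of "\<bar>sin (u / 2)\<bar>" "\<bar>sin (v / 2)\<bar>"] by (simp add: power2_sum)
 finally show ?thesis by (simp add: one_minus_cos_eq)
qed

lemma sin_ge_quarter:
 assumes "0 <= y" "y <= pi / 2"
 shows "y / 4 <= sin y"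
proof (cases "y <= pi / 3")
 case True
 have "sin 0 - 0 / 4 <= sin y - y / 4"
 proof (rule DERIV_nonneg_imp_increasing_open[where f="%y. sin y - y / 4"])
  fix x assume "0 < x" "x < y"
  then have "cos (pi / 3) <= cos x" using True by (intro cos_monotone_0_pi_le) auto
  then have "0 <= cos x - 1 / 4" by (simp add: cos_60)
  then show "\<exists>d. DERIV (%y. sin y - y / 4) x :> d & 0 <= d"
   by (intro exI[of _ "cos x - 1 / 4"]) (auto intro!: derivative_eq_intros)
 qed (use assms in \<open>auto intro!: continuous_intros\<close>)
 then show ?thesis by simp
next
 case False
 then have "sin (pi / 3) <= sin y" using assms by (intro sin_monotone_2pi_le) auto
 moreover have "1 <= sqrt 3" by simp
 ultimately have "1 / 2 <= sin y" unfolding sin_60 by linarith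
 then show ?thesis using assms pi_half_less_two by linarith
qed

lemma one_minus_cos_ge:
 fixes u :: real
 assumes "\<bar>u\<bar> <= pi"
 shows "u\<^sup>2 / 32 <= 1 - cos u"
proof -
 have "\<bar>u\<bar> / 2 / 4 <= sin (\<bar>u\<bar> / 2)" by (rule sin_ge_quarter) (use assms in auto)
 then have "(\<bar>u\<bar> / 2 / 4)\<^sup>2 <= (sin (\<bar>u\<bar> / 2))\<^sup>2" by (intro power_mono) auto
 moreover have "1 - cos u = 2 * (sin (\<bar>u\<bar> / 2))\<^sup>2" using one_minus_cos_eq[of "\<bar>u\<bar>"] by simp
 ultimately show ?thesis by (simp add: power_divide)
qed

lemma char_exponent_summable:
 assumes a: "walk_intensities a"
 shows "(%z. jump_rate a 0 z * (1 - cos (k \<bullet> lattice_vec z))) summable_on UNIV"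
  and "\<bar>jump_rate a 0 z * (1 - cos (k \<bullet> lattice_vec z))\<bar> <= jump_rate a 0 z * 2"
  and "(%z. jump_rate a 0 z * 2) summable_on UNIV"
proof -
 show 1: "\<bar>jump_rate a 0 z * (1 - cos (k \<bullet> lattice_vec z))\<bar> <= jump_rate a 0 z * 2" for z k
 proof -
  have "\<bar>1 - cos (k \<bullet> lattice_vec z)\<bar> <= 2" using cos_ge_minus_one[of "k \<bullet> lattice_vec z"] cos_le_one[of "k \<bullet> lattice_vec z"] by linarith
  then show ?thesis using jump_rate_nonneg[OF a, of 0 z] by (simp add: abs_mult mult_left_mono)
 qed
 show 2: "(%z. jump_rate a 0 z * 2) summable_on UNIV"
  by (intro summable_on_cmult_left has_sum_imp_summable[OF jump_rate_has_sum[OF a]])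
 show "(%z. jump_rate a 0 z * (1 - cos (k \<bullet> lattice_vec z))) summable_on UNIV" for k
  by (rule summable_on_bounded[OF 2 1])
qed

lemma char_exponent_nonneg: "walk_intensities a ==> 0 <= char_exponent a k"
 unfolding char_exponent_def by (intro infsum_nonneg mult_nonneg_nonneg jump_rate_nonneg) auto

lemma char_exponent_continuous:
 assumes a: "walk_intensities a"
 shows "continuous_on S (char_exponent a)"
proof -
 have "continuous_on S (%k. char_exponent a k)"
  unfolding char_exponent_def
  by (rule continuous_on_infsum[OF _ char_exponent_summable(2)[OF a] char_exponent_summable(3)[OF a]])
   (intro continuous_intros)
 then show ?thesis by simp
qed

text \<open>Irreducibility joins the origin to each unit vector by finitely many jumps. Since \<open>1 - cos\<close> of a
sum of phases is bounded by a multiple of the sum of the values of \<open>1 - cos\<close> at the summands, every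
\<open>1 - cos (k $ i)\<close> is at most a multiple of the exponent; and \<open>1 - cos\<close> is bounded
below by a quadratic function on the torus.\<close>
lemma char_exponent_ge:
 fixes a :: "int ^ 'd => int ^ 'd => real"
 assumes a: "walk_intensities a"
 obtains c where "0 < c" "!!k. (!!i. \<bar>k $ i\<bar> <= pi) ==> c * (norm k)\<^sup>2 <= char_exponent a k"
proof -
 have jump: "1 - cos (k \<bullet> lattice_vec z) <= (1 / a 0 z) * char_exponent a k" if z: "z ~= 0" "0 < a 0 z" for z k
 proof -
  have "(\<Sum>y\<in>{z}. jump_rate a 0 y * (1 - cos (k \<bullet> lattice_vec y))) <= char_exponent a k"
   unfolding char_exponent_def
   by (rule finite_sum_le_infsum[OF char_exponent_summable(1)[OF a]]) (auto intro!: mult_nonneg_nonneg jump_rate_nonneg a)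
  then show ?thesis using z by (simp add: jump_rate_def field_simps)
 qed
 have reach: "\<exists>C\<ge>0. \<forall>k. 1 - cos (k \<bullet> lattice_vec (y - x)) <= C * char_exponent a k"
  if "(x, y) \<in> {(u, v). u ~= v & 0 < a u v}\<^sup>*" for x y
  using that
 proof (induction rule: rtrancl_induct)
  case base
  then show ?case by (intro exI[of _ 0]) (simp add: lattice_vec_simps)
 next
  case (step y z)
  from step.IH obtain C where C: "C \<ge> 0" "!!k. 1 - cos (k \<bullet> lattice_vec (y - x)) <= C * char_exponent a k" by auto
  have yz: "z - y ~= 0" "0 < a 0 (z - y)"
   using step.hyps(2) a unfolding walk_intensities_def by auto
  show ?case
  proof (intro exI conjI allI)
   fix k
   have "k \<bullet> lattice_vec (z - x) = k \<bullet> lattice_vec (y - x) + k \<bullet> lattice_vec (z - y)"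
    by (simp add: lattice_vec_simps inner_diff_right)
   then have "1 - cos (k \<bullet> lattice_vec (z - x))
     <= 2 * (1 - cos (k \<bullet> lattice_vec (y - x))) + 2 * (1 - cos (k \<bullet> lattice_vec (z - y)))"
    using one_minus_cos_add by metis
   also have "... <= 2 * (C * char_exponent a k) + 2 * (1 / a 0 (z - y) * char_exponent a k)"
    by (intro add_mono mult_left_mono C(2) jump[OF yz]) simp_all
   finally show "1 - cos (k \<bullet> lattice_vec (z - x)) <= (2 * C + 2 / a 0 (z - y)) * char_exponent a k"
    by (simp add: algebra_simps)
  qed (use C yz in auto)
 qed
 have "\<exists>C\<ge>0. \<forall>k. 1 - cos (k $ i) <= C * char_exponent a k" for i
 proof -
  have "(0, axis i 1) \<in> {(u, v). u ~= v & 0 < a u v}\<^sup>*" using a unfolding walk_intensities_def by blast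
  moreover have "lattice_vec (axis i 1 :: int ^ 'd) = axis i 1" by (auto simp: lattice_vec_def axis_def vec_eq_iff)
  ultimately show ?thesis using reach[of 0 "axis i 1"] by (simp add: inner_axis)
 qed
 then obtain C where C: "!!i. 0 <= C i" "!!i k. 1 - cos (k $ i) <= C i * char_exponent a k" by metis
 define D where "D = 32 * (\<Sum>i\<in>UNIV. C i) + 1"
 have D: "0 < D" unfolding D_def using C(1) by (simp add: sum_nonneg add_nonneg_pos)
 show thesis
 proof (rule that[of "1 / D"])
  fix k :: "real ^ 'd" assume k: "!!i. \<bar>k $ i\<bar> <= pi"
  have "(norm k)\<^sup>2 = (\<Sum>i\<in>UNIV. (k $ i)\<^sup>2)" by (simp add: norm_vec_def L2_set_def sum_nonneg)
  also have "... <= (\<Sum>i\<in>UNIV. 32 * (C i * char_exponent a k))"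
  proof (rule sum_mono)
   fix i show "(k $ i)\<^sup>2 <= 32 * (C i * char_exponent a k)"
    using one_minus_cos_ge[OF k[of i]] C(2)[of k i] by simp
  qed
  also have "... = 32 * (\<Sum>i\<in>UNIV. C i) * char_exponent a k" by (simp add: sum_distrib_left sum_distrib_right mult.assoc)
  also have "... <= D * char_exponent a k"
   unfolding D_def using char_exponent_nonneg[OF a, of k] by (simp add: distrib_right)
  finally show "1 / D * (norm k)\<^sup>2 <= char_exponent a k" using D by (simp add: field_simps)
 qed (use D in simp)
qed

lemma char_exponent_scaling:
 fixes a :: "int ^ 'd => int ^ 'd => real"
 assumes a: "walk_intensities a" and var: "(%z. (lattice_norm z)\<^sup>2 * a 0 z) summable_on UNIV"
 shows "((%t. t * char_exponent a ((1 / sqrt t) *\<^sub>R k)) \<longlongrightarrow> (\<Sum>\<^sub>\<infinity>z. jump_rate a 0 z * ((k \<bullet> lattice_vec z)\<^sup>2 / 2))) at_top"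
proof -
 have pos: "\<forall>\<^sub>F t in at_top. (0::real) < t" by (rule eventually_gt_at_top)
 let ?f = "%t z. jump_rate a 0 z * (if 0 < t then t * (1 - cos (((1 / sqrt t) *\<^sub>R k) \<bullet> lattice_vec z)) else 0)"
 have "((%t. \<Sum>\<^sub>\<infinity>z. ?f t z) \<longlongrightarrow> (\<Sum>\<^sub>\<infinity>z. jump_rate a 0 z * ((k \<bullet> lattice_vec z)\<^sup>2 / 2))) at_top"
 proof (rule tendsto_infsum_dominated)
  have "(%z. (norm k)\<^sup>2 / 2 * ((lattice_norm z)\<^sup>2 * a 0 z)) summable_on UNIV" using var by (rule summable_on_cmult_right)
  moreover have "(%z. (norm k)\<^sup>2 / 2 * ((lattice_norm z)\<^sup>2 * a 0 z)) = (%z. jump_rate a 0 z * ((norm k)\<^sup>2 / 2 * (lattice_norm z)\<^sup>2))"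
   by (auto simp: jump_rate_def norm_lattice_vec[symmetric] lattice_vec_simps)
  ultimately show "(%z. jump_rate a 0 z * ((norm k)\<^sup>2 / 2 * (lattice_norm z)\<^sup>2)) summable_on UNIV" by (simp only:)
  fix z :: "int ^ 'd"
  let ?u = "k \<bullet> lattice_vec z"
  show "\<bar>?f t z\<bar> <= jump_rate a 0 z * ((norm k)\<^sup>2 / 2 * (lattice_norm z)\<^sup>2)" for t
  proof -
   have "\<bar>if 0 < t then t * (1 - cos (((1 / sqrt t) *\<^sub>R k) \<bullet> lattice_vec z)) else 0\<bar> <= (norm k)\<^sup>2 / 2 * (lattice_norm z)\<^sup>2"
   proof (cases "0 < t")
    case True
    have "t * (1 - cos (?u / sqrt t)) <= t * ((?u / sqrt t)\<^sup>2 / 2)"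
     using True one_minus_cos_le by (intro mult_left_mono) auto
    also have "... = ?u\<^sup>2 / 2" using True by (simp add: power_divide)
    also have "?u\<^sup>2 <= (norm k * lattice_norm z)\<^sup>2"
     using Cauchy_Schwarz_ineq2[of k "lattice_vec z"] by (simp add: norm_lattice_vec abs_le_square_iff[symmetric] abs_mult lattice_norm_def)
    finally show ?thesis using True by (simp add: power_mult_distrib)
   qed simp
   moreover have "\<bar>c * X\<bar> <= c * Y" if "0 <= c" "\<bar>X\<bar> <= Y" for c X Y :: real
    using that by (simp add: abs_mult mult_left_mono)
   ultimately show ?thesis using jump_rate_nonneg[OF a, of 0 z] by blast
  qed
  have "((%t. t * (1 - cos (?u / sqrt t))) \<longlongrightarrow> ?u * ?u / 2) at_top"
   by real_asymp
  then have "((%t. t * (1 - cos (?u / sqrt t))) \<longlongrightarrow> ?u\<^sup>2 / 2) at_top"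
   by (simp only: power2_eq_square)
  then have "((%t. if 0 < t then t * (1 - cos (((1 / sqrt t) *\<^sub>R k) \<bullet> lattice_vec z)) else 0) \<longlongrightarrow> ?u\<^sup>2 / 2) at_top"
   by (rule Lim_transform_eventually) (use pos in eventually_elim, simp)
  then show "((%t. ?f t z) \<longlongrightarrow> jump_rate a 0 z * (?u\<^sup>2 / 2)) at_top" by (intro tendsto_mult_left)
 qed simp
 moreover have "\<forall>\<^sub>F t in at_top. (\<Sum>\<^sub>\<infinity>z. ?f t z) = t * char_exponent a ((1 / sqrt t) *\<^sub>R k)"
  using pos
 proof eventually_elim
  case (elim t)
  have "(\<Sum>\<^sub>\<infinity>z. ?f t z) = (\<Sum>\<^sub>\<infinity>z. t * (jump_rate a 0 z * (1 - cos (((1 / sqrt t) *\<^sub>R k) \<bullet> lattice_vec z))))"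
   using elim by (simp add: mult.left_commute)
  also have "... = t * char_exponent a ((1 / sqrt t) *\<^sub>R k)"
   unfolding char_exponent_def by (rule infsum_cmult_right[OF char_exponent_summable(1)[OF a]])
  finally show ?case .
 qed
 ultimately show ?thesis by (rule Lim_transform_eventually)
qed

section \<open>Fourier representation\<close>

lemma integral_cis_interval:
 "(\<integral>x. indicator {-pi..pi} x *\<^sub>R cis (x * of_int n) \<partial>lborel) = (if n = 0 then of_real (2 * pi) else 0)"
proof (cases "n = 0")
 case True
 then show ?thesis by (simp add: scaleR_conv_of_real)
next
 case False
 define F where "F x = cis (x * of_int n) / (\<i> * of_int n)" for x
 have "has_bochner_integral lborel (%x. indicator {-pi..pi} x *\<^sub>R cis (x * of_int n)) (F pi - F (-pi))"
 proof (rule has_bochner_integral_FTC_Icc)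
  fix x :: real
  have "((%z. exp (\<i> * z * of_int n) / (\<i> * of_int n)) has_field_derivative exp (\<i> * of_real x * of_int n)) (at (of_real x))"
   using False by (auto intro!: derivative_eq_intros simp: field_simps)
  then have "((%x. exp (\<i> * of_real x * of_int n) / (\<i> * of_int n)) has_vector_derivative exp (\<i> * of_real x * of_int n)) (at x within {-pi..pi})"
   by (rule has_vector_derivative_real_field)
  then show "(F has_vector_derivative cis (x * of_int n)) (at x within {-pi..pi})"
   by (simp add: F_def[abs_def] cis_conv_exp mult.assoc)
 qed (auto intro!: continuous_intros)
 moreover have "F pi = F (- pi)"
 proof -
  have "cis (pi * of_int n) = cis (- pi * of_int n)"
   by (simp add: complex_eq_iff)
  then show ?thesis by (simp add: F_def)
 qed
 ultimately show ?thesis using False by (simp add: has_bochner_integral_iff)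
qed

definition torus :: "(real ^ 'd) set" where
 "torus = cbox (\<chi> i. - pi) (\<chi> i. pi)"

lemma mem_torus: "k \<in> torus \<longleftrightarrow> (\<forall>i. \<bar>k $ i\<bar> <= pi)"
 unfolding torus_def mem_box_cart by (auto simp: abs_le_iff minus_le_iff)

lemma torus_integral:
 fixes f :: "real ^ 'd => real"
 assumes "continuous_on torus f"
 shows "integral torus f = (\<integral>k. indicator torus k * f k \<partial>lborel)"
  "integrable lborel (%k. indicator torus k * f k)" "f integrable_on torus"
proof -
 have i: "set_integrable lborel torus f"
  unfolding set_integrable_def torus_def
  by (rule borel_integrable_compact) (use assms in \<open>auto simp: torus_def\<close>)
 then show "integrable lborel (%k. indicator torus k * f k)" by (simp add: set_integrable_def)
 show "f integrable_on torus" "integral torus f = (\<integral>k. indicator torus k * f k \<partial>lborel)"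
  using set_borel_integral_eq_integral[OF i] by (auto simp: set_lebesgue_integral_def)
qed

lemma torus_orthogonality:
 fixes z :: "int ^ 'd"
 shows "integral torus (%k. cos (k \<bullet> lattice_vec z)) = (if z = 0 then (2 * pi) ^ CARD('d) else 0)"
proof -
 let ?B = "Basis :: (real ^ 'd) set"
 interpret P: product_sigma_finite "%b :: real ^ 'd. lborel :: real measure" ..
 define h where "h b x = indicator {-pi..pi} x *\<^sub>R cis (x * (lattice_vec z \<bullet> b))" for b x
 have hint: "integrable lborel (h b)" for b
  unfolding h_def by (rule borel_integrable_compact) (auto intro!: continuous_intros)
 have prod: "indicator torus k *\<^sub>R cis (k \<bullet> lattice_vec z) = (\<Prod>b\<in>?B. h b (k \<bullet> b))" for k
 proof -
  have "indicator torus k = (\<Prod>b\<in>?B. indicator {-pi..pi} (k \<bullet> b) :: real)"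
  proof (cases "k \<in> torus")
   case True
   then have "indicator {-pi..pi} (k \<bullet> b) = (1::real)" if "b \<in> ?B" for b
    using that by (auto simp: mem_torus Basis_vec_def inner_axis abs_le_iff minus_le_iff indicator_def)
   then have "(\<Prod>b\<in>?B. indicator {-pi..pi} (k \<bullet> b) :: real) = 1" by (intro prod.neutral) auto
   then show ?thesis using True by simp
  next
   case False
   then obtain i where "\<not> \<bar>k $ i\<bar> <= pi" by (auto simp: mem_torus)
   then have "indicator {-pi..pi} (k \<bullet> axis i 1) = (0::real)" by (auto simp: inner_axis indicator_def)
   moreover have "axis i 1 \<in> ?B" by (auto simp: Basis_vec_def)
   ultimately have "(\<Prod>b\<in>?B. indicator {-pi..pi} (k \<bullet> b) :: real) = 0" by (intro prod_zero) auto
   then show ?thesis using False by simp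
  qed
  moreover have "cis (k \<bullet> lattice_vec z) = (\<Prod>b\<in>?B. cis ((k \<bullet> b) * (lattice_vec z \<bullet> b)))"
  proof -
   have e: "k \<bullet> lattice_vec z = (\<Sum>b\<in>?B. (k \<bullet> b) * (lattice_vec z \<bullet> b))" by (rule euclidean_inner)
   have "(\<Prod>b\<in>?B. cis ((k \<bullet> b) * (lattice_vec z \<bullet> b))) = exp (\<Sum>b\<in>?B. \<i> * of_real ((k \<bullet> b) * (lattice_vec z \<bullet> b)))"
    by (simp add: cis_conv_exp exp_sum)
   also have "(\<Sum>b\<in>?B. \<i> * of_real ((k \<bullet> b) * (lattice_vec z \<bullet> b))) = \<i> * of_real (k \<bullet> lattice_vec z)"
    by (subst e) (simp add: sum_distrib_left)
   finally show ?thesis by (simp add: cis_conv_exp)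
  qed
  ultimately show ?thesis
   by (simp add: h_def prod.distrib scaleR_conv_of_real)
 qed
 have one: "integral\<^sup>L lborel (h b) = (if lattice_vec z \<bullet> b = 0 then of_real (2 * pi) else 0)" if b: "b \<in> ?B" for b
 proof -
  obtain i where i: "b = axis i 1" using b by (auto simp: Basis_vec_def)
  then have *: "lattice_vec z \<bullet> b = of_int (z $ i)" by (simp add: inner_axis lattice_vec_def)
  show ?thesis unfolding h_def * using integral_cis_interval[of "z $ i"] by simp
 qed
 have meas: "(%k. \<Prod>b\<in>?B. h b (k \<bullet> b)) \<in> borel_measurable borel"
 proof (rule borel_measurable_prod)
  fix b
  have "h b \<in> borel_measurable borel" using borel_measurable_integrable[OF hint[of b]] by simp
  then show "(%k. h b (k \<bullet> b)) \<in> borel_measurable borel"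
   by (rule measurable_compose[rotated]) simp
 qed
 have "(\<integral>k. indicator torus k *\<^sub>R cis (k \<bullet> lattice_vec z) \<partial>lborel) = (\<integral>k. (\<Prod>b\<in>?B. h b (k \<bullet> b)) \<partial>lborel)"
  by (simp only: prod)
 also have "... = (\<integral>f. (\<Prod>b\<in>?B. h b ((\<Sum>b\<in>?B. f b *\<^sub>R b) \<bullet> b)) \<partial>(\<Pi>\<^sub>M b\<in>?B. lborel))"
  unfolding lborel_eq[where 'a="real ^ 'd"] by (rule integral_distr[OF _ meas]) simp
 also have "... = (\<integral>f. (\<Prod>b\<in>?B. h b (f b)) \<partial>(\<Pi>\<^sub>M b\<in>?B. lborel))"
  by (intro Bochner_Integration.integral_cong prod.cong refl) (simp add: inner_sum_left inner_Basis if_distrib[of "%x. _ * x"] cong: if_cong)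
 also have "... = (\<Prod>b\<in>?B. integral\<^sup>L lborel (h b))"
  by (rule P.product_integral_prod) (use hint in auto)
 also have "... = (\<Prod>b\<in>?B. if lattice_vec z \<bullet> b = 0 then of_real (2 * pi) else 0)"
  by (intro prod.cong refl one)
 also have "... = of_real (if z = 0 then (2 * pi) ^ CARD('d) else 0)"
 proof (cases "z = 0")
  case True
  then show ?thesis by (simp add: lattice_vec_simps)
 next
  case False
  then obtain i where "z $ i ~= 0" by (auto simp: vec_eq_iff)
  then have "lattice_vec z \<bullet> axis i 1 ~= 0" by (simp add: inner_axis lattice_vec_def)
  moreover have "axis i 1 \<in> ?B" by (auto simp: Basis_vec_def)
  ultimately show ?thesis using False by (auto intro!: prod_zero)
 qed
 finally have *: "(\<integral>k. indicator torus k *\<^sub>R cis (k \<bullet> lattice_vec z) \<partial>lborel) = of_real (if z = 0 then (2 * pi) ^ CARD('d) else 0)" .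
 have ci: "integrable lborel (%k. indicator torus k *\<^sub>R cis (k \<bullet> lattice_vec z))"
  unfolding torus_def by (rule borel_integrable_compact) (auto intro!: continuous_intros)
 have "integral torus (%k. cos (k \<bullet> lattice_vec z)) = (\<integral>k. Re (indicator torus k *\<^sub>R cis (k \<bullet> lattice_vec z)) \<partial>lborel)"
  by (subst torus_integral(1)) (auto intro!: continuous_intros)
 also have "... = Re (\<integral>k. indicator torus k *\<^sub>R cis (k \<bullet> lattice_vec z) \<partial>lborel)"
  by (rule integral_Re[OF ci])
 finally show ?thesis unfolding * by simp
qed

definition fourier_kernel :: "(int ^ 'd => int ^ 'd => real) => real => int ^ 'd => real" where
 "fourier_kernel a t z = integral torus (%k. exp (- t * char_exponent a k) * cos (k \<bullet> lattice_vec z)) / (2 * pi) ^ CARD('d)"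

lemma jump_rate_shift: "walk_intensities a ==> jump_rate a x (x + z) = jump_rate a 0 z"
 unfolding walk_intensities_def jump_rate_def by (auto) (metis add_diff_cancel_left')

lemma jump_rate_uminus: "walk_intensities a ==> jump_rate a 0 (- z) = jump_rate a 0 z"
 unfolding walk_intensities_def jump_rate_def by (auto) (metis diff_minus_eq_add add_0)

lemma char_exponent_eigen:
 fixes a :: "int ^ 'd => int ^ 'd => real"
 assumes a: "walk_intensities a"
 shows "(\<Sum>\<^sub>\<infinity>y. jump_rate a x y * cos (k \<bullet> lattice_vec (w - y)))
  = (- a 0 0 - char_exponent a k) * cos (k \<bullet> lattice_vec (w - x))"
proof -
 let ?J = "jump_rate a 0" and ?c = "%z. cos (k \<bullet> lattice_vec z)" and ?s = "%z. sin (k \<bullet> lattice_vec z)"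
 have J: "(?J has_sum - a 0 0) UNIV" by (rule jump_rate_has_sum[OF a])
 have sums: "(%z. ?J z * g z) summable_on UNIV" if "!!z. \<bar>g z\<bar> <= 1" for g
  by (rule summable_on_bounded[OF has_sum_imp_summable[OF J]])
   (use that jump_rate_nonneg[OF a, of 0] in \<open>auto simp: abs_mult intro!: mult_left_le\<close>)
 have C: "((%z. ?J z * ?c z) has_sum - a 0 0 - char_exponent a k) UNIV"
 proof -
  have "((%z. ?J z + - (?J z * (1 - ?c z))) has_sum - a 0 0 + - char_exponent a k) UNIV"
   unfolding char_exponent_def
   by (intro has_sum_add J has_sum_uminus[THEN iffD2]) (simp add: char_exponent_summable(1)[OF a])
  then show ?thesis by (simp add: right_diff_distrib)
 qed
 have S: "((%z. ?J z * ?s z) has_sum 0) UNIV"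
 proof -
  have 1: "((%z. ?J z * ?s z) has_sum (\<Sum>\<^sub>\<infinity>z. ?J z * ?s z)) UNIV" by (intro has_sum_infsum sums) simp
  have "((%z. ?J z * ?s z) has_sum (\<Sum>\<^sub>\<infinity>z. ?J z * ?s z)) (range uminus)"
   using 1 by simp
  then have "(((%z. ?J z * ?s z) \<circ> uminus) has_sum (\<Sum>\<^sub>\<infinity>z. ?J z * ?s z)) UNIV"
   by (subst (asm) has_sum_reindex) auto
  then have "((%z. - (?J z * ?s z)) has_sum (\<Sum>\<^sub>\<infinity>z. ?J z * ?s z)) UNIV"
   by (simp add: o_def jump_rate_uminus[OF a] lattice_vec_simps)
  then have "(\<Sum>\<^sub>\<infinity>z. ?J z * ?s z) = - (\<Sum>\<^sub>\<infinity>z. ?J z * ?s z)"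
   using has_sum_unique[OF _ has_sum_cmult_right[OF 1, of "-1"]] by simp
  with 1 show ?thesis by simp
 qed
 have "((%z. ?c (w - x) * (?J z * ?c z) + ?s (w - x) * (?J z * ?s z)) has_sum
   ?c (w - x) * (- a 0 0 - char_exponent a k) + ?s (w - x) * 0) UNIV"
  by (intro has_sum_add has_sum_cmult_right C S)
 moreover have "?c (w - x) * (?J z * ?c z) + ?s (w - x) * (?J z * ?s z) = jump_rate a x (x + z) * cos (k \<bullet> lattice_vec (w - (x + z)))" for z
 proof -
  have "k \<bullet> lattice_vec (w - (x + z)) = k \<bullet> lattice_vec (w - x) - k \<bullet> lattice_vec z"
   by (simp add: lattice_vec_simps inner_diff_right inner_add_right)
  then show ?thesis by (simp only: cos_diff jump_rate_shift[OF a]) (simp add: algebra_simps)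
 qed
 ultimately have "(((%y. jump_rate a x y * cos (k \<bullet> lattice_vec (w - y))) \<circ> (%z. x + z)) has_sum
   ?c (w - x) * (- a 0 0 - char_exponent a k)) UNIV" by (simp add: o_def)
 then have "((%y. jump_rate a x y * cos (k \<bullet> lattice_vec (w - y))) has_sum
   ?c (w - x) * (- a 0 0 - char_exponent a k)) (range (%z. x + z))"
  by (subst has_sum_reindex) (auto simp: inj_on_def)
 moreover have "range (%z. x + z) = UNIV" by (rule surj_plus)
 ultimately show ?thesis by (simp add: infsumI mult.commute)
qed

text \<open>The Fourier integral solves the backward equation with the right initial value, because characters are
eigenfunctions of a translation invariant generator; bounded solutions are unique.\<close>
lemma transition_fourier:
 fixes a :: "int ^ 'd => int ^ 'd => real"
 assumes a: "walk_intensities a" and p: "walk_transitions a p" and "0 <= t"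
 shows "pmf (p t x) w = fourier_kernel a t (w - x)"
proof -
 define \<alpha> where "\<alpha> = - a 0 0"
 define \<Phi> where "\<Phi> = char_exponent a"
 define N :: real where "N = (2 * pi) ^ CARD('d)"
 have N: "0 < N" by (simp add: N_def)
 define I where "I t x = integral torus (%k. exp (t * (\<alpha> - \<Phi> k)) * cos (k \<bullet> lattice_vec (w - x)))" for t x
 define k where "k t x = exp (\<alpha> * t) * pmf (p t x) w" for t x
 have \<alpha>0: "0 <= \<alpha>" using a by (simp add: \<alpha>_def walk_intensities_def less_imp_le)
 have c\<Phi>: "continuous_on S \<Phi>" for S unfolding \<Phi>_def by (rule char_exponent_continuous[OF a])
 have \<Phi>0: "0 <= \<Phi> k" for k unfolding \<Phi>_def by (rule char_exponent_nonneg[OF a])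
 have dk: "((%t. k t x) has_real_derivative (\<Sum>\<^sub>\<infinity>y. jump_rate a x y * k t y)) (at t within {0..})" if "0 <= t" for t x
  using walk_backward[OF a p, of "indicator {w}" t x] that by (simp add: k_def \<alpha>_def measure_pmf_single)
 have cint: "continuous_on torus (%k. exp (t * (\<alpha> - \<Phi> k)) * cos (k \<bullet> lattice_vec z))" for t z
  by (intro continuous_intros c\<Phi>)
 have dI: "((%t. I t x) has_real_derivative (\<Sum>\<^sub>\<infinity>y. jump_rate a x y * I t y)) (at t within {0..})" if t: "0 <= t" for t x
 proof -
  have "((%t. I t x) has_real_derivative
    integral torus (%k. (\<alpha> - \<Phi> k) * exp (t * (\<alpha> - \<Phi> k)) * cos (k \<bullet> lattice_vec (w - x)))) (at t within {0..})"
   unfolding I_def torus_def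
  proof (rule leibniz_rule_field_derivative)
   show "((%t. exp (t * (\<alpha> - \<Phi> k)) * cos (k \<bullet> lattice_vec (w - x))) has_real_derivative
     (\<alpha> - \<Phi> k) * exp (t * (\<alpha> - \<Phi> k)) * cos (k \<bullet> lattice_vec (w - x))) (at t within {0..})" for t k
    by (auto intro!: derivative_eq_intros)
   show "(%k. exp (t * (\<alpha> - \<Phi> k)) * cos (k \<bullet> lattice_vec (w - x))) integrable_on cbox (\<chi> i. - pi) (\<chi> i. pi)" for t
    by (rule integrable_continuous) (rule cint[unfolded torus_def])
   have "continuous_on ({0..} \<times> cbox (\<chi> i. - pi) (\<chi> i. pi)) (%z. \<Phi> (snd z))"
    by (rule continuous_on_compose2[OF c\<Phi>[of UNIV] continuous_on_snd[OF continuous_on_id]]) auto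
   then show "continuous_on ({0..} \<times> cbox (\<chi> i. - pi) (\<chi> i. pi))
     (%(t, k). (\<alpha> - \<Phi> k) * exp (t * (\<alpha> - \<Phi> k)) * cos (k \<bullet> lattice_vec (w - x)))"
    unfolding split_beta by (intro continuous_intros)
  qed (use t in auto)
  moreover have "((%y. integral torus (%k. jump_rate a x y * (exp (t * (\<alpha> - \<Phi> k)) * cos (k \<bullet> lattice_vec (w - y))))) has_sum
    integral torus (%k. \<Sum>\<^sub>\<infinity>y. jump_rate a x y * (exp (t * (\<alpha> - \<Phi> k)) * cos (k \<bullet> lattice_vec (w - y))))) UNIV"
   unfolding torus_def
  proof (rule has_sum_integral_cbox)
   show "(%y. jump_rate a x y * exp (t * \<alpha>)) summable_on UNIV"
    by (intro summable_on_cmult_left has_sum_imp_summable[OF jump_rate_has_sum[OF a]])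
   fix y
   show "continuous_on (cbox (\<chi> i. - pi) (\<chi> i. pi)) (%k. jump_rate a x y * (exp (t * (\<alpha> - \<Phi> k)) * cos (k \<bullet> lattice_vec (w - y))))"
    by (intro continuous_intros c\<Phi>)
   fix k
   have "exp (t * (\<alpha> - \<Phi> k)) * \<bar>cos (k \<bullet> lattice_vec (w - y))\<bar> <= exp (t * \<alpha>) * 1"
    by (intro mult_mono) (use t \<Phi>0[of k] in \<open>auto intro!: mult_left_mono\<close>)
   then show "\<bar>jump_rate a x y * (exp (t * (\<alpha> - \<Phi> k)) * cos (k \<bullet> lattice_vec (w - y)))\<bar> <= jump_rate a x y * exp (t * \<alpha>)"
    using jump_rate_nonneg[OF a, of x y] by (simp add: abs_mult mult_left_mono)
  qed
  moreover have "(\<Sum>\<^sub>\<infinity>y. jump_rate a x y * (exp (t * (\<alpha> - \<Phi> k)) * cos (k \<bullet> lattice_vec (w - y))))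
    = (\<alpha> - \<Phi> k) * exp (t * (\<alpha> - \<Phi> k)) * cos (k \<bullet> lattice_vec (w - x))" for k
  proof -
   have s: "(%y. jump_rate a x y * cos (k \<bullet> lattice_vec (w - y))) summable_on UNIV"
    by (rule walk_generator_eq(1)[OF a, where B=1]) simp
   have "(\<Sum>\<^sub>\<infinity>y. jump_rate a x y * (exp (t * (\<alpha> - \<Phi> k)) * cos (k \<bullet> lattice_vec (w - y))))
    = exp (t * (\<alpha> - \<Phi> k)) * (\<Sum>\<^sub>\<infinity>y. jump_rate a x y * cos (k \<bullet> lattice_vec (w - y)))"
    by (subst infsum_cmult_right[symmetric]) (auto simp: s mult.left_commute)
   then show ?thesis by (simp add: char_exponent_eigen[OF a] \<alpha>_def \<Phi>_def)
  qed
  ultimately show ?thesis by (simp add: I_def infsumI)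
 qed
 have Ibound: "\<bar>I t x\<bar> <= exp (t * \<alpha>) * N" if "0 <= t" for t x
 proof -
  have "norm (integral torus (%k. exp (t * (\<alpha> - \<Phi> k)) * cos (k \<bullet> lattice_vec (w - x)))) <= integral torus (%k :: real ^ 'd. exp (t * \<alpha>) * cos (k \<bullet> lattice_vec (0 :: int ^ 'd)))"
  proof (rule integral_norm_bound_integral)
   show "(%k. exp (t * (\<alpha> - \<Phi> k)) * cos (k \<bullet> lattice_vec (w - x))) integrable_on torus" by (rule torus_integral(3)[OF cint])
   show "(%k :: real ^ 'd. exp (t * \<alpha>) * cos (k \<bullet> lattice_vec (0 :: int ^ 'd))) integrable_on torus"
    by (intro torus_integral(3) continuous_intros)
   fix k :: "real ^ 'd"
   have "exp (t * (\<alpha> - \<Phi> k)) * \<bar>cos (k \<bullet> lattice_vec (w - x))\<bar> <= exp (t * \<alpha>) * 1"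
    by (intro mult_mono) (use that \<Phi>0[of k] in \<open>auto intro!: mult_left_mono\<close>)
   then show "norm (exp (t * (\<alpha> - \<Phi> k)) * cos (k \<bullet> lattice_vec (w - x))) <= exp (t * \<alpha>) * cos (k \<bullet> lattice_vec (0 :: int ^ 'd))"
    by (simp add: abs_mult lattice_vec_simps)
  qed
  also have "... = exp (t * \<alpha>) * N" by (subst integral_mult_right) (simp add: torus_orthogonality N_def)
  finally show ?thesis by (simp add: I_def)
 qed
 have "k t x - I t x / N = 0"
 proof (rule bounded_solution_zero[where v="%t x. k t x - I t x / N" and T=t and Q="jump_rate a" and c=\<alpha> and B="exp (\<alpha> * t) + exp (t * \<alpha>)"])
  show "0 <= jump_rate a x y" for x y by (rule jump_rate_nonneg[OF a])
  show Js: "jump_rate a x summable_on UNIV" "(\<Sum>\<^sub>\<infinity>y. jump_rate a x y) <= \<alpha>" for x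
   using jump_rate_has_sum[OF a, of x] by (auto simp: has_sum_iff \<alpha>_def)
  show "k 0 x - I 0 x / N = 0" for x
   using N p unfolding k_def I_def walk_transitions_def transition_semigroup_def
   by (auto simp: torus_orthogonality N_def indicator_def)
  show "\<bar>k s x - I s x / N\<bar> <= exp (\<alpha> * t) + exp (t * \<alpha>)" if s: "0 <= s" "s <= t" for s x
  proof -
   have "\<bar>k s x\<bar> <= exp (\<alpha> * s)" by (simp add: k_def abs_mult pmf_le_1)
   moreover have "\<bar>I s x / N\<bar> <= exp (s * \<alpha>)" using Ibound[OF s(1), of x] N by (simp add: abs_divide pos_divide_le_eq)
   moreover have "exp (\<alpha> * s) <= exp (\<alpha> * t)" "exp (s * \<alpha>) <= exp (t * \<alpha>)"
    using s \<alpha>0 by (auto intro!: mult_left_mono mult_right_mono)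
   ultimately show ?thesis by linarith
  qed
  fix s x assume s: "0 <= (s::real)"
  have 1: "(%y. jump_rate a x y * k s y) summable_on UNIV"
   by (rule walk_generator_eq(1)[OF a, where B="exp (\<alpha> * s)"]) (simp add: k_def abs_mult pmf_le_1)
  have 2: "(%y. jump_rate a x y * I s y) summable_on UNIV"
   by (rule walk_generator_eq(1)[OF a Ibound[OF s]])
  have "(\<Sum>\<^sub>\<infinity>y. jump_rate a x y * (k s y - I s y / N)) = (\<Sum>\<^sub>\<infinity>y. jump_rate a x y * k s y + - (1 / N) * (jump_rate a x y * I s y))"
   by (intro infsum_cong) (simp add: field_simps)
  also have "... = (\<Sum>\<^sub>\<infinity>y. jump_rate a x y * k s y) + - (1 / N) * (\<Sum>\<^sub>\<infinity>y. jump_rate a x y * I s y)"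
   using infsumI[OF has_sum_add[OF has_sum_infsum[OF 1] has_sum_cmult_right[OF has_sum_infsum[OF 2], of "- (1 / N)"]]] .
  finally show "((%s. k s x - I s x / N) has_real_derivative (\<Sum>\<^sub>\<infinity>y. jump_rate a x y * (k s y - I s y / N))) (at s within {0..})"
   using DERIV_diff[OF dk[OF s, of x] DERIV_cdivide[OF dI[OF s, of x], where c=N]] by simp
 qed (use assms in auto)
 moreover have "I t x = exp (\<alpha> * t) * integral torus (%k. exp (- t * \<Phi> k) * cos (k \<bullet> lattice_vec (w - x)))"
  unfolding I_def by (subst integral_mult_right[symmetric]) (simp add: mult.assoc[symmetric] exp_add[symmetric] algebra_simps)
 ultimately have "exp (\<alpha> * t) * pmf (p t x) w = exp (\<alpha> * t) * fourier_kernel a t (w - x)"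
  by (simp add: k_def fourier_kernel_def N_def \<Phi>_def)
 then show ?thesis by simp
qed

section \<open>The local limit theorem\<close>

lemma transition_symmetric:
 assumes "walk_intensities a" "walk_transitions a p" "0 <= t"
 shows "pmf (p t x) y = pmf (p t y) x"
proof -
 have "lattice_vec (x - y) = - lattice_vec (y - x)" by (simp add: lattice_vec_simps)
 then have "fourier_kernel a t (x - y) = fourier_kernel a t (y - x)" by (simp add: fourier_kernel_def)
 then show ?thesis by (simp add: transition_fourier[OF assms])
qed

lemma fourier_integrand_continuous:
 assumes "walk_intensities a"
 shows "continuous_on S (%k. exp (- t * char_exponent a k) * cos (k \<bullet> lattice_vec z))"
 by (intro continuous_intros char_exponent_continuous[OF assms])

text \<open>The Fourier kernel integrates a nonnegative function against a cosine, which is largest at displacement zero.\<close>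
lemma transition_le_return:
 fixes a :: "int ^ 'd => int ^ 'd => real"
 assumes a: "walk_intensities a" and p: "walk_transitions a p" and t: "0 <= t"
 shows "pmf (p t x) y <= pmf (p t 0) 0"
proof -
 have "integral torus (%k. exp (- t * char_exponent a k) * cos (k \<bullet> lattice_vec (y - x)))
  <= integral torus (%k. exp (- t * char_exponent a k) * cos (k \<bullet> lattice_vec (0 - 0 :: int ^ 'd)))"
  by (intro integral_le torus_integral(3) fourier_integrand_continuous a) (simp add: lattice_vec_simps)
 then show ?thesis unfolding transition_fourier[OF a p t] fourier_kernel_def by (simp add: divide_right_mono)
qed

lemma return_antimono:
 fixes a :: "int ^ 'd => int ^ 'd => real"
 assumes a: "walk_intensities a" and p: "walk_transitions a p" and "0 <= s" "s <= t"
 shows "pmf (p t 0) 0 <= pmf (p s 0) 0"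
proof -
 have "integral torus (%k. exp (- t * char_exponent a k) * cos (k \<bullet> lattice_vec (0 - 0 :: int ^ 'd)))
  <= integral torus (%k. exp (- s * char_exponent a k) * cos (k \<bullet> lattice_vec (0 - 0 :: int ^ 'd)))"
  by (intro integral_le torus_integral(3) fourier_integrand_continuous a)
   (use assms char_exponent_nonneg[OF a] in \<open>auto simp: lattice_vec_simps intro!: mult_right_mono\<close>)
 then show ?thesis using assms
  by (simp add: transition_fourier[OF a p] fourier_kernel_def divide_right_mono)
qed

lemma lborel_integral_scale:
 fixes g :: "'a::euclidean_space => real"
 assumes g: "g \<in> borel_measurable borel" and c: "0 < c"
 shows "(\<integral>x. g x \<partial>lborel) = c ^ DIM('a) * (\<integral>x. g (c *\<^sub>R x) \<partial>lborel)"
proof -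
 have "(\<integral>x. g x \<partial>lborel) = (\<integral>x. g x \<partial>density (distr lborel borel (%x. 0 + c *\<^sub>R x)) (%_. ennreal (\<bar>c\<bar> ^ DIM('a))))"
  using lborel_affine[of c "0::'a"] c by simp
 also have "... = (\<integral>x. \<bar>c\<bar> ^ DIM('a) *\<^sub>R g x \<partial>distr lborel borel (%x. 0 + c *\<^sub>R x))"
  by (rule integral_density) (use g c in auto)
 also have "... = (\<integral>x. \<bar>c\<bar> ^ DIM('a) *\<^sub>R g (0 + c *\<^sub>R x) \<partial>lborel)"
  by (rule integral_distr) (use g in auto)
 finally show ?thesis using c by simp
qed

lemma integrable_gaussian:
 assumes c: "0 < c"
 shows "integrable lborel (%x::'a::euclidean_space. exp (- c * (norm x)\<^sup>2))"
proof (rule integrableI_nonneg)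
 have one: "(\<integral>\<^sup>+x. ennreal (exp (- c * x\<^sup>2)) \<partial>lborel) < \<infinity>"
 proof -
  define \<sigma> where "\<sigma> = 1 / sqrt (2 * c)"
  have \<sigma>: "\<sigma>\<^sup>2 = 1 / (2 * c)" using c by (simp add: \<sigma>_def power_divide)
  have "exp (- c * x\<^sup>2) = sqrt (2 * pi * \<sigma>\<^sup>2) * normal_density 0 \<sigma> x" for x
   using c by (simp add: normal_density_def \<sigma> field_simps)
  moreover have "integrable lborel (%x. sqrt (2 * pi * \<sigma>\<^sup>2) * normal_density 0 \<sigma> x)"
   using c by (intro integrable_mult_right integrable_normal_density) (simp add: \<sigma>_def)
  ultimately have "integrable lborel (%x. exp (- c * x\<^sup>2))" by simp
  then show ?thesis by (simp add: integrable_iff_bounded)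
 qed
 have "exp (- c * (norm x)\<^sup>2) = (\<Prod>b\<in>Basis. exp (- c * (x \<bullet> b)\<^sup>2))" for x :: 'a
 proof -
  have "(norm x)\<^sup>2 = (\<Sum>b\<in>Basis. (x \<bullet> b)\<^sup>2)"
   unfolding power2_norm_eq_inner by (subst euclidean_inner) (simp add: power2_eq_square)
  then show ?thesis by (simp only: exp_sum[symmetric, OF finite_Basis] sum_distrib_left)
 qed
 then have "(\<integral>\<^sup>+x. ennreal (exp (- c * (norm (x::'a))\<^sup>2)) \<partial>lborel)
   = (\<integral>\<^sup>+x. (\<Prod>b\<in>Basis. ennreal (exp (- c * ((x::'a) \<bullet> b)\<^sup>2))) \<partial>lborel)"
  by (simp add: prod_ennreal)
 also have "... = (\<Prod>b\<in>(Basis::'a set). (\<integral>\<^sup>+x. ennreal (exp (- c * x\<^sup>2)) \<partial>lborel))"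
  by (rule nn_integral_lborel_prod) auto
 also have "... < \<infinity>"
  using one by (simp add: ennreal_prod_eq_top less_top[symmetric] power_eq_top_ennreal)
 finally show "(\<integral>\<^sup>+x. ennreal (exp (- c * (norm (x::'a))\<^sup>2)) \<partial>lborel) < \<infinity>" .
qed auto

text \<open>After rescaling the frequency by \<open>1 / sqrt t\<close> the integrand of the Fourier representation converges
to a Gaussian. The quadratic lower bound for the characteristic exponent dominates it, and finite variance gives
the quadratic limit.\<close>
lemma local_limit:
 fixes a :: "int ^ 'd => int ^ 'd => real"
 assumes a: "walk_intensities a" and p: "walk_transitions a p"
  and var: "(%z. (lattice_norm z)\<^sup>2 * a 0 z) summable_on UNIV"
 obtains c where "0 < c" "!!x y. ((%t. t powr (real CARD('d) / 2) * pmf (p t x) y) \<longlongrightarrow> c) at_top"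
proof -
 define \<Phi> where "\<Phi> = char_exponent a"
 define q where "q k = (\<Sum>\<^sub>\<infinity>z. jump_rate a 0 z * ((k \<bullet> lattice_vec z)\<^sup>2 / 2))" for k :: "real ^ 'd"
 have q: "((%t. t * \<Phi> ((1 / sqrt t) *\<^sub>R k)) \<longlongrightarrow> q k) at_top" for k
  unfolding q_def \<Phi>_def by (rule char_exponent_scaling[OF a var])
 obtain \<gamma> where \<gamma>: "0 < \<gamma>" "!!k. k \<in> torus ==> \<gamma> * (norm k)\<^sup>2 <= \<Phi> k"
  using char_exponent_ge[OF a] unfolding \<Phi>_def mem_torus by metis
 define f where "f t z k = indicator torus ((1 / sqrt t) *\<^sub>R k) * (exp (- t * \<Phi> ((1 / sqrt t) *\<^sub>R k)) * cos (((1 / sqrt t) *\<^sub>R k) \<bullet> lattice_vec z))"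
  for t z and k :: "real ^ 'd"
 have m\<Phi>: "\<Phi> \<in> borel_measurable borel"
  unfolding \<Phi>_def by (rule borel_measurable_continuous_onI[OF char_exponent_continuous[OF a]])
 have [measurable]: "torus \<in> sets (borel :: (real ^ 'd) measure)" by (simp add: torus_def)
 have mg: "(%k. indicator torus k * (exp (- t * \<Phi> k) * cos (k \<bullet> lattice_vec z))) \<in> borel_measurable borel" for t z
  using m\<Phi> by measurable
 have mf: "f t z \<in> borel_measurable borel" for t z
  unfolding f_def[abs_def] by (rule measurable_compose[OF _ mg]) measurable
 have scale: "t powr (real CARD('d) / 2) * fourier_kernel a t z = (\<integral>k. f t z k \<partial>lborel) / (2 * pi) ^ CARD('d)"
  if t: "0 < t" for t z
 proof -
  have "integral torus (%k. exp (- t * \<Phi> k) * cos (k \<bullet> lattice_vec z))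
    = (1 / sqrt t) ^ DIM(real ^ 'd) * (\<integral>k. f t z k \<partial>lborel)"
   unfolding torus_integral(1)[OF fourier_integrand_continuous[OF a], folded \<Phi>_def] f_def
   by (rule lborel_integral_scale[OF mg]) (use t in simp)
  moreover have "t powr (real CARD('d) / 2) * (1 / sqrt t) ^ CARD('d) = 1"
  proof -
   have "(1 / sqrt t) ^ CARD('d) = t powr (- (real CARD('d) / 2))"
    using t by (simp add: powr_half_sqrt[symmetric] powr_minus_divide[symmetric] powr_realpow[symmetric] powr_powr)
   then show ?thesis using t by (simp add: powr_add[symmetric])
  qed
  ultimately show ?thesis
   unfolding fourier_kernel_def \<Phi>_def[symmetric] by (simp add: mult.assoc[symmetric])
 qed
 have mq: "(%k. exp (- q k)) \<in> borel_measurable lborel"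
 proof -
  have "q \<in> borel_measurable borel"
  proof (rule borel_measurable_LIMSEQ_real)
   show "(%n. real n * \<Phi> ((1 / sqrt (real n)) *\<^sub>R k)) \<longlonglongrightarrow> q k" for k
    by (rule filterlim_compose[OF q filterlim_real_sequentially])
   show "(%k. real n * \<Phi> ((1 / sqrt (real n)) *\<^sub>R k)) \<in> borel_measurable borel" for n
    by (intro borel_measurable_times borel_measurable_const measurable_compose[OF _ m\<Phi>]) measurable
  qed
  then show ?thesis by simp
 qed
 have lim: "((%t. \<integral>k. f t z k \<partial>lborel) \<longlongrightarrow> (\<integral>k. exp (- q k) \<partial>lborel)) at_top" for z
 proof (rule integral_dominated_convergence_at_top)
  show "f t z \<in> borel_measurable lborel" for t using mf by simp
  have tends: "((%t. f t z k) \<longlongrightarrow> exp (- q k)) at_top" for k z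
  proof -
   have small: "((%t. (1 / sqrt t) *\<^sub>R k) \<longlongrightarrow> 0 *\<^sub>R k) at_top"
    by (intro tendsto_scaleR tendsto_const) real_asymp
   then have small0: "((%t. (1 / sqrt t) *\<^sub>R k) \<longlongrightarrow> 0) at_top" by simp
   have "\<forall>\<^sub>F t in at_top. norm ((1 / sqrt t) *\<^sub>R k) < pi"
    using tendsto_norm[OF small0] by (rule order_tendstoD) simp
   then have ev: "\<forall>\<^sub>F t in at_top. (1 / sqrt t) *\<^sub>R k \<in> torus"
   proof eventually_elim
    case (elim t)
    then show ?case unfolding mem_torus by (meson component_le_norm_cart less_imp_le order_trans)
   qed
   have "((%t. exp (- (t * \<Phi> ((1 / sqrt t) *\<^sub>R k))) * cos (((1 / sqrt t) *\<^sub>R k) \<bullet> lattice_vec z)) \<longlongrightarrow> exp (- q k) * cos (0 \<bullet> lattice_vec z)) at_top"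
    by (intro tendsto_intros q small0)
   then have "((%t. exp (- t * \<Phi> ((1 / sqrt t) *\<^sub>R k)) * cos (((1 / sqrt t) *\<^sub>R k) \<bullet> lattice_vec z)) \<longlongrightarrow> exp (- q k)) at_top"
    by simp
   then show ?thesis
    by (rule Lim_transform_eventually) (use ev in eventually_elim, simp add: f_def)
  qed
  then show "AE k in lborel. ((%t. f t z k) \<longlongrightarrow> exp (- q k)) at_top" by simp
  show "(%k. exp (- q k)) \<in> borel_measurable lborel" by (rule mq)
  show "integrable lborel (%k::real ^ 'd. exp (- \<gamma> * (norm k)\<^sup>2))" by (rule integrable_gaussian[OF \<gamma>(1)])
  show "\<forall>\<^sub>F t in at_top. AE k in lborel. norm (f t z k) <= exp (- \<gamma> * (norm k)\<^sup>2)"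
   using eventually_gt_at_top[of 0]
  proof eventually_elim
   case (elim t)
   have "norm (f t z k) <= exp (- \<gamma> * (norm k)\<^sup>2)" for k
   proof (cases "(1 / sqrt t) *\<^sub>R k \<in> torus")
    case True
    have "\<gamma> * (norm k)\<^sup>2 = t * (\<gamma> * (norm ((1 / sqrt t) *\<^sub>R k))\<^sup>2)" using elim by (simp add: power_divide)
    also have "... <= t * \<Phi> ((1 / sqrt t) *\<^sub>R k)" using \<gamma>(2)[OF True] elim by (intro mult_left_mono) auto
    finally have "exp (- t * \<Phi> ((1 / sqrt t) *\<^sub>R k)) <= exp (- \<gamma> * (norm k)\<^sup>2)" by simp
    then have "exp (- t * \<Phi> ((1 / sqrt t) *\<^sub>R k)) * \<bar>cos (((1 / sqrt t) *\<^sub>R k) \<bullet> lattice_vec z)\<bar> <= exp (- \<gamma> * (norm k)\<^sup>2) * 1"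
     by (intro mult_mono) auto
    then show ?thesis using True by (simp add: f_def abs_mult)
   qed (simp add: f_def)
   then show ?case by simp
  qed
 qed
 define c where "c = (\<integral>k. exp (- q k) \<partial>lborel) / (2 * pi) ^ CARD('d)"
 have "((%t. t powr (real CARD('d) / 2) * pmf (p t x) y) \<longlongrightarrow> c) at_top" for x y
 proof (rule Lim_transform_eventually)
  show "((%t. (\<integral>k. f t (y - x) k \<partial>lborel) / (2 * pi) ^ CARD('d)) \<longlongrightarrow> c) at_top"
   unfolding c_def by (intro tendsto_intros lim) simp
  show "\<forall>\<^sub>F t in at_top. (\<integral>k. f t (y - x) k \<partial>lborel) / (2 * pi) ^ CARD('d) = t powr (real CARD('d) / 2) * pmf (p t x) y"
   using eventually_gt_at_top[of 0] by eventually_elim (simp add: scale transition_fourier[OF a p])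
 qed
 moreover have "0 < c"
 proof -
  have q0: "0 <= q k" for k unfolding q_def by (intro infsum_nonneg mult_nonneg_nonneg jump_rate_nonneg a) auto
  have qle: "exp (- q k) <= exp (- \<gamma> * (norm k)\<^sup>2)" for k
  proof -
   have "\<gamma> * (norm k)\<^sup>2 <= q k"
   proof (rule tendsto_lowerbound[OF q[of k]])
    have "((%t. (1 / sqrt t) *\<^sub>R k) \<longlongrightarrow> 0 *\<^sub>R k) at_top"
     by (intro tendsto_scaleR tendsto_const) real_asymp
    then have small0: "((%t. (1 / sqrt t) *\<^sub>R k) \<longlongrightarrow> 0) at_top" by simp
    have "\<forall>\<^sub>F t in at_top. norm ((1 / sqrt t) *\<^sub>R k) < pi"
     using tendsto_norm[OF small0] by (rule order_tendstoD) simp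
    then show "\<forall>\<^sub>F t in at_top. \<gamma> * (norm k)\<^sup>2 <= t * \<Phi> ((1 / sqrt t) *\<^sub>R k)"
     using eventually_gt_at_top[of 0]
    proof eventually_elim
     case (elim t)
     have True: "(1 / sqrt t) *\<^sub>R k \<in> torus"
      unfolding mem_torus using elim by (meson component_le_norm_cart less_imp_le order_trans)
     have "\<gamma> * (norm k)\<^sup>2 = t * (\<gamma> * (norm ((1 / sqrt t) *\<^sub>R k))\<^sup>2)" using elim by (simp add: power_divide)
     also have "... <= t * \<Phi> ((1 / sqrt t) *\<^sub>R k)" using \<gamma>(2)[OF True] elim by (intro mult_left_mono) auto
     finally show ?case .
    qed
   qed simp
   then show ?thesis by simp
  qed
  have iq: "integrable lborel (%k. exp (- q k))"
   by (rule Bochner_Integration.integrable_bound[OF integrable_gaussian[OF \<gamma>(1)] mq]) (use qle in simp)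
  have "(\<integral>k. exp (- q k) \<partial>lborel) ~= 0"
  proof
   assume "(\<integral>k. exp (- q k) \<partial>lborel) = 0"
   then have "AE k in (lborel :: (real ^ 'd) measure). exp (- q k) = 0"
    using integral_nonneg_eq_0_iff_AE[OF iq] by simp
   then have "AE k in (lborel :: (real ^ 'd) measure). False" by simp
   then have "emeasure (lborel :: (real ^ 'd) measure) UNIV = 0"
    by (subst (asm) AE_iff_measurable[where N=UNIV]) auto
   then show False by simp
  qed
  moreover have "0 <= (\<integral>k. exp (- q k) \<partial>lborel)" by (rule Bochner_Integration.integral_nonneg) simp
  ultimately have "0 < (\<integral>k. exp (- q k) \<partial>lborel)" by linarith
  moreover have "(0::real) < (2 * pi) ^ CARD('d)" by simp
  ultimately show ?thesis unfolding c_def by (rule divide_pos_pos)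
 qed
 ultimately show thesis by (rule that[rotated])
qed

lemma return_pos:
 fixes a :: "int ^ 'd => int ^ 'd => real"
 assumes a: "walk_intensities a" and p: "walk_transitions a p"
  and var: "(%z. (lattice_norm z)\<^sup>2 * a 0 z) summable_on UNIV" and t: "0 <= t"
 shows "0 < pmf (p t 0) 0"
proof -
 obtain c where c: "0 < c" "((%t. t powr (real CARD('d) / 2) * pmf (p t 0) 0) \<longlongrightarrow> c) at_top"
  using local_limit[OF a p var] by metis
 have "\<forall>\<^sub>F s in at_top. 0 < s powr (real CARD('d) / 2) * pmf (p s 0) 0"
  using c by (intro order_tendstoD) auto
 then have "\<forall>\<^sub>F s in at_top. t <= s & 0 < s powr (real CARD('d) / 2) * pmf (p s 0) 0"
  using eventually_ge_at_top[of t] by eventually_elim auto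
 then obtain s where s: "t <= s" "0 < s powr (real CARD('d) / 2) * pmf (p s 0) 0"
  by (auto simp: eventually_at_top_linorder)
 then have "0 < pmf (p s 0) 0" by (auto simp: zero_less_mult_iff)
 with return_antimono[OF a p t s(1)] show ?thesis by simp
qed

section \<open>Asymptotics of convolutions\<close>

definition hl_integrable :: "(real => real) => bool" where
 "hl_integrable f \<longleftrightarrow> integrable lborel (%s. indicator {0..} s * f s)"

definition mass :: "(real => real) => real" where
 "mass f = (\<integral>s. indicator {0..} s * f s \<partial>lborel)"

abbreviation primitive :: "(real => real) => real => real" where
 "primitive f \<equiv> conv (%_. 1) f"

lemma primitive_eq: "primitive f t = (\<integral>s. indicator {0..t} s * f s \<partial>lborel)"
 by (simp add: conv_def)

lemma primitive_integrable:
 assumes "loc_bounded f"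
 shows "integrable lborel (%s. indicator {0..t} s * f s)"
 using conv_integrable[OF loc_bounded_const[of 1] assms, of t] by simp

lemma loc_bounded_primitive: "loc_bounded f ==> loc_bounded (primitive f)"
 by (rule loc_bounded_conv[OF loc_bounded_const]) simp_all

lemma primitive_mono:
 assumes f: "loc_bounded f" and "s <= t"
 shows "primitive f s <= primitive f t"
 unfolding primitive_eq
 by (rule integral_mono[OF primitive_integrable[OF f] primitive_integrable[OF f]])
  (use assms loc_boundedD(1)[OF f] in \<open>auto simp: indicator_def\<close>)

lemma primitive_le_mass:
 assumes f: "loc_bounded f" and i: "hl_integrable f"
 shows "primitive f t <= mass f"
 unfolding primitive_eq mass_def
 by (rule integral_mono[OF primitive_integrable[OF f] i[unfolded hl_integrable_def]])
  (use loc_boundedD(1)[OF f] in \<open>auto simp: indicator_def\<close>)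

lemma primitive_tendsto_mass:
 assumes f: "loc_bounded f" and i: "hl_integrable f"
 shows "(primitive f \<longlongrightarrow> mass f) at_top"
proof -
 have "((%t. \<integral>s. indicator {0..t} s * f s \<partial>lborel) \<longlongrightarrow> (\<integral>s. indicator {0..} s * f s \<partial>lborel)) at_top"
 proof (rule integral_dominated_convergence_at_top)
  show "integrable lborel (%s. indicator {0..} s * f s)" using i by (simp add: hl_integrable_def)
  then show "(%s. indicator {0..} s * f s) \<in> borel_measurable lborel" by (rule borel_measurable_integrable)
  show "(%s. indicator {0..t} s * f s) \<in> borel_measurable lborel" for t
   by (rule borel_measurable_integrable[OF primitive_integrable[OF f]])
  have "\<forall>\<^sub>F t in at_top. indicator {0..t} s * f s = indicator {0..} s * f s" for s :: real
   using eventually_ge_at_top[of s] by eventually_elim (auto simp: indicator_def)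
  then show "AE s in lborel. ((%t. indicator {0..t} s * f s) \<longlongrightarrow> indicator {0..} s * f s) at_top"
   by (intro AE_I2 tendsto_eventually)
  show "\<forall>\<^sub>F t in at_top. AE s in lborel. norm (indicator {0..t} s * f s) <= indicator {0..} s * f s"
   using loc_boundedD(1)[OF f] by (intro always_eventually allI AE_I2) (auto simp: indicator_def)
 qed
 then show ?thesis by (simp add: primitive_eq[abs_def] mass_def)
qed

lemma hl_integrableI_bounded_primitive:
 assumes f: "loc_bounded f" and b: "!!t. 0 <= t ==> primitive f t <= B"
 shows "hl_integrable f"
 unfolding hl_integrable_def
proof (rule integrableI_nonneg)
 have "(\<integral>\<^sup>+s. ennreal (indicator {0..} s * f s) \<partial>lborel) <= ennreal B"
 proof (rule LIMSEQ_le_const2[OF nn_integral_LIMSEQ[where f="%n s. ennreal (indicator {0..real n} s * f s)"]])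
  show "incseq (%n s. ennreal (indicator {0..real n} s * f s))"
   using loc_boundedD(1)[OF f] by (auto simp: incseq_def le_fun_def indicator_def intro!: ennreal_leI)
  show "(%s. ennreal (indicator {0..real n} s * f s)) \<in> borel_measurable lborel" for n
   using borel_measurable_integrable[OF primitive_integrable[OF f]] by simp
  fix s :: real
  obtain N where N: "s <= real N" using real_arch_simple by blast
  have "\<forall>\<^sub>F n in sequentially. ennreal (indicator {0..real n} s * f s) = ennreal (indicator {0..} s * f s)"
   using eventually_ge_at_top[of N] by eventually_elim (use N in \<open>auto simp: indicator_def\<close>)
  then show "(%n. ennreal (indicator {0..real n} s * f s)) \<longlonglongrightarrow> ennreal (indicator {0..} s * f s)"
   by (rule tendsto_eventually)
 next
  show "\<exists>N. \<forall>n\<ge>N. (\<integral>\<^sup>+s. ennreal (indicator {0..real n} s * f s) \<partial>lborel) <= ennreal B"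
  proof (intro exI allI impI)
   fix n
   have "(\<integral>\<^sup>+s. ennreal (indicator {0..real n} s * f s) \<partial>lborel) = ennreal (primitive f (real n))"
    unfolding primitive_eq
    by (rule nn_integral_eq_integral[OF primitive_integrable[OF f]]) (use loc_boundedD(1)[OF f] in \<open>auto simp: indicator_def\<close>)
   then show "(\<integral>\<^sup>+s. ennreal (indicator {0..real n} s * f s) \<partial>lborel) <= ennreal B"
    using b[of "real n"] by (simp add: ennreal_leI)
  qed
 qed
 then show "(\<integral>\<^sup>+s. ennreal (indicator {0..} s * f s) \<partial>lborel) < \<infinity>" by (auto simp: le_less_trans)
qed (use loc_boundedD(1)[OF f] loc_boundedD(2)[OF f] in \<open>auto simp: indicator_def\<close>)

lemma hl_integrable_mono:
 assumes f: "loc_bounded f" and g: "loc_bounded g" "hl_integrable g" and le: "!!t. 0 <= t ==> f t <= g t"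
 shows "hl_integrable f"
proof (rule hl_integrableI_bounded_primitive[OF f])
 fix t :: real
 have "primitive f t <= primitive g t"
  by (rule conv_mono) (use f g le loc_bounded_const in auto)
 also have "... <= mass g" by (rule primitive_le_mass[OF g])
 finally show "primitive f t <= mass g" .
qed

lemma mass_nonneg: "loc_bounded f ==> 0 <= mass f"
 unfolding mass_def using loc_boundedD(1)[of f] by (intro Bochner_Integration.integral_nonneg) (auto simp: indicator_def)

text \<open>Dominated convergence: a convolution with an integrable function averages the values near time \<open>t\<close>.\<close>
lemma conv_tendsto:
 assumes g: "loc_bounded g" and f: "loc_bounded f" "hl_integrable f"
  and B: "!!t. 0 <= t ==> g t <= B" and lim: "(g \<longlongrightarrow> C) at_top"
 shows "(conv g f \<longlongrightarrow> C * mass f) at_top"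
proof -
 have B0: "0 <= B" using B[of 0] loc_boundedD(1)[OF g, of 0] by simp
 have "((%t. \<integral>s. indicator {0..t} s * (g (t - s) * f s) \<partial>lborel) \<longlongrightarrow> (\<integral>s. C * (indicator {0..} s * f s) \<partial>lborel)) at_top"
 proof (rule integral_dominated_convergence_at_top)
  have i: "integrable lborel (%s. indicator {0..} s * f s)" using f(2) by (simp add: hl_integrable_def)
  show "integrable lborel (%s. B * (indicator {0..} s * f s))" using i by simp
  show "(%s. C * (indicator {0..} s * f s)) \<in> borel_measurable lborel" using borel_measurable_integrable[OF i] by simp
  show "(%s. indicator {0..t} s * (g (t - s) * f s)) \<in> borel_measurable lborel" for t
   using conv_measurable_integrand[OF g f(1)] by simp
  show "\<forall>\<^sub>F t in at_top. AE s in lborel. norm (indicator {0..t} s * (g (t - s) * f s)) <= B * (indicator {0..} s * f s)"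
  proof (intro always_eventually allI AE_I2)
   fix t s :: real
   show "norm (indicator {0..t} s * (g (t - s) * f s)) <= B * (indicator {0..} s * f s)"
   proof (cases "0 <= s & s <= t")
    case True
    then have "g (t - s) * f s <= B * f s" using B loc_boundedD(1)[OF f(1)] by (intro mult_right_mono) auto
    then show ?thesis using True loc_boundedD(1)[OF f(1), of s] loc_boundedD(1)[OF g, of "t - s"] by (simp add: abs_mult)
   next
    case False
    then show ?thesis using B0 loc_boundedD(1)[OF f(1), of s] by (auto simp: indicator_def)
   qed
  qed
  show "AE s in lborel. ((%t. indicator {0..t} s * (g (t - s) * f s)) \<longlongrightarrow> C * (indicator {0..} s * f s)) at_top"
  proof (intro AE_I2)
   fix s :: real
   have "((%t. g (t - s)) \<longlongrightarrow> C) at_top"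
    by (rule filterlim_compose[OF lim]) (use filterlim_tendsto_add_at_top[OF tendsto_const[of "-s"] filterlim_ident] in \<open>simp add: add.commute\<close>)
   then have "((%t. indicator {0..} s * (g (t - s) * f s)) \<longlongrightarrow> indicator {0..} s * (C * f s)) at_top"
    by (intro tendsto_intros)
   moreover have "\<forall>\<^sub>F t in at_top. indicator {0..} s * (g (t - s) * f s) = indicator {0..t} s * (g (t - s) * f s)"
    using eventually_ge_at_top[of s] by eventually_elim (auto simp: indicator_def)
   ultimately show "((%t. indicator {0..t} s * (g (t - s) * f s)) \<longlongrightarrow> C * (indicator {0..} s * f s)) at_top"
    by (simp add: mult.left_commute Lim_transform_eventually)
  qed
 qed
 then show ?thesis by (simp add: conv_def[abs_def] mass_def)
qed

text \<open>The half of a convolution in which the first factor has small argument. On it the second factor is close to its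
value at \<open>t\<close> whenever it varies regularly.\<close>
definition hconv :: "(real => real) => (real => real) => real => real" where
 "hconv f g t = (\<integral>s. indicator {0..t/2} s * (f s * g (t - s)) \<partial>lborel)"

lemma hconv_measurable:
 assumes f: "loc_bounded f" and g: "loc_bounded g"
 shows "(%s. indicator {0..t/2} s * (f s * g (t - s))) \<in> borel_measurable borel"
proof (cases "0 <= t")
 case True
 have "(%s. indicator {0..t/2} s * (f s * g (t - s))) = (%s. indicator {0..t/2} s * (indicator {0..t} s * (g (t - s) * f s)))"
  using True by (auto simp: indicator_def)
 then show ?thesis using conv_measurable_integrand[OF g f, of t] by simp
qed (simp add: indicator_def)

lemma hconv_integrable:
 assumes f: "loc_bounded f" and g: "loc_bounded g"
 shows "integrable lborel (%s. indicator {0..t/2} s * (f s * g (t - s)))"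
 by (rule Bochner_Integration.integrable_bound[OF conv_integrable[OF g f, of t]])
  (use hconv_measurable[OF f g] in \<open>auto simp: indicator_def abs_mult mult.commute\<close>)

lemma conv_eq_hconv:
 assumes f: "loc_bounded f" and g: "loc_bounded g" and "0 <= t"
 shows "conv f g t = hconv f g t + hconv g f t"
proof -
 have 1: "hconv f g t = (\<integral>s. indicator {0..t/2} (t - s) * (f (t - s) * g s) \<partial>lborel)"
  unfolding hconv_def
  by (subst lborel_integral_real_affine[where c="-1" and t=t]) auto
 have i1: "integrable lborel (%s. indicator {0..t/2} (t - s) * (f (t - s) * g s))"
  using lborel_integrable_real_affine[OF hconv_integrable[OF f g], of "-1" t t] by simp
 have i2: "integrable lborel (%s. indicator {0..t/2} s * (g s * f (t - s)))"
  by (rule hconv_integrable[OF g f])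
 have "hconv f g t + hconv g f t = (\<integral>s. indicator {0..t/2} (t - s) * (f (t - s) * g s) + indicator {0..t/2} s * (g s * f (t - s)) \<partial>lborel)"
  unfolding 1 hconv_def[of g f] using Bochner_Integration.integral_add[OF i1 i2] by simp
 also have "... = conv f g t"
  unfolding conv_def
 proof (rule integral_cong_AE)
  show "(%s. indicator {0..t/2} (t - s) * (f (t - s) * g s) + indicator {0..t/2} s * (g s * f (t - s))) \<in> borel_measurable lborel"
   using borel_measurable_integrable[OF Bochner_Integration.integrable_add[OF i1 i2]] .
  show "(%s. indicator {0..t} s * (f (t - s) * g s)) \<in> borel_measurable lborel"
   using conv_measurable_integrand[OF f g] by simp
  have *: "indicator {0..t/2} (t - s) * (f (t - s) * g s) + indicator {0..t/2} s * (g s * f (t - s)) = indicator {0..t} s * (f (t - s) * g s)"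
   if "s ~= t/2" for s
   using that \<open>0 <= t\<close> by (auto simp: indicator_def mult.commute)
  show "AE s in lborel. indicator {0..t/2} (t - s) * (f (t - s) * g s) + indicator {0..t/2} s * (g s * f (t - s)) = indicator {0..t} s * (f (t - s) * g s)"
   using AE_lborel_singleton[of "t/2"] by eventually_elim (rule *)
 qed
 finally show ?thesis ..
qed

lemma hconv_tendsto:
 assumes f: "loc_bounded f" "hl_integrable f" and g: "loc_bounded g"
  and u: "!!t. T0 <= t ==> 0 < u t" and lim: "((%t. g t / u t) \<longlongrightarrow> C) at_top"
  and shift: "!!s. ((%t. u (t - s) / u t) \<longlongrightarrow> 1) at_top"
  and dom: "!!t s. T0 <= t ==> 0 <= s ==> s <= t / 2 ==> u (t - s) <= K * u t"
 shows "((%t. hconv f g t / u t) \<longlongrightarrow> C * mass f) at_top"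
proof -
 have "\<forall>\<^sub>F t in at_top. g t / u t < C + 1" using lim by (rule order_tendstoD) simp
 then have "\<forall>\<^sub>F t in at_top. T0 <= t & 0 <= t & g t / u t < C + 1"
  using eventually_ge_at_top[of T0] eventually_ge_at_top[of 0] by eventually_elim auto
 then obtain T1 where T1: "!!t. T1 <= t ==> T0 <= t & 0 <= t & g t / u t < C + 1"
  by (auto simp: eventually_at_top_linorder)
 have gle: "g t <= (C + 1) * u t" if "T1 <= t" for t
  using T1[OF that] u[of t] by (simp add: field_simps)
 define A where "A = (C + 1) * K"
 have C1: "0 <= C + 1"
  using T1[of T1] u[of T1] loc_boundedD(1)[OF g, of T1] by (smt (verit) divide_nonneg_pos order_refl)
 have "((%t. \<integral>s. indicator {0..t/2} s * (f s * (g (t - s) / u t)) \<partial>lborel) \<longlongrightarrow> (\<integral>s. C * (indicator {0..} s * f s) \<partial>lborel)) at_top"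
 proof (rule integral_dominated_convergence_at_top)
  have i: "integrable lborel (%s. indicator {0..} s * f s)" using f(2) by (simp add: hl_integrable_def)
  show "integrable lborel (%s. A * (indicator {0..} s * f s))" using i by simp
  show "(%s. C * (indicator {0..} s * f s)) \<in> borel_measurable lborel" using borel_measurable_integrable[OF i] by simp
  show "(%s. indicator {0..t/2} s * (f s * (g (t - s) / u t))) \<in> borel_measurable lborel" for t
  proof -
   have "(%s. indicator {0..t/2} s * (f s * g (t - s)) / u t) \<in> borel_measurable lborel"
    using hconv_measurable[OF f(1) g, of t] by simp
   then show ?thesis by simp
  qed
  show "\<forall>\<^sub>F t in at_top. AE s in lborel. norm (indicator {0..t/2} s * (f s * (g (t - s) / u t))) <= A * (indicator {0..} s * f s)"
   using eventually_ge_at_top[of "2 * T1"] eventually_ge_at_top[of T1]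
  proof eventually_elim
   case (elim t)
   have "norm (indicator {0..t/2} s * (f s * (g (t - s) / u t))) <= A * (indicator {0..} s * f s)" for s
   proof (cases "0 <= s & s <= t / 2")
    case True
    have ut: "0 < u t" and tT: "T0 <= t" using T1[OF elim(2)] u by auto
    have ts: "T1 <= t - s" using True elim by (simp add: field_simps)
    have "g (t - s) <= (C + 1) * u (t - s)" using gle[OF ts] .
    also have "... <= (C + 1) * (K * u t)" using dom[OF tT] True C1 by (intro mult_left_mono) auto
    finally have "g (t - s) / u t <= A" using ut by (simp add: A_def field_simps)
    then have "f s * (g (t - s) / u t) <= A * f s"
     using mult_left_mono[of "g (t - s) / u t" A "f s"] loc_boundedD(1)[OF f(1), of s] True by (simp add: mult.commute)
    moreover have "0 <= f s * (g (t - s) / u t)"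
     using True ut loc_boundedD(1)[OF f(1), of s] loc_boundedD(1)[OF g, of "t - s"] T1[OF ts] by simp
    ultimately show ?thesis using True by simp
   next
    case False
    have "0 <= A" 
    proof -
     have "0 < u t" "T0 <= t" "0 <= t" using T1[OF elim(2)] u by auto
     then have "0 <= K" using dom[of t 0] by (smt (verit) diff_zero divide_nonneg_nonneg mult_less_0_iff)
     then show ?thesis using C1 by (simp add: A_def)
    qed
    moreover have "indicator {0..t/2} s = (0::real)" using False by auto
    ultimately show ?thesis using loc_boundedD(1)[OF f(1), of s] by (auto simp: indicator_def)
   qed
   then show ?case by simp
  qed
  show "AE s in lborel. ((%t. indicator {0..t/2} s * (f s * (g (t - s) / u t))) \<longlongrightarrow> C * (indicator {0..} s * f s)) at_top"
  proof (intro AE_I2)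
   fix s :: real
   have sh: "filterlim (%t. t - s) at_top at_top"
    using filterlim_tendsto_add_at_top[OF tendsto_const[of "-s"] filterlim_ident] by (simp add: add.commute)
   have "((%t. g (t - s) / u (t - s) * (u (t - s) / u t)) \<longlongrightarrow> C * 1) at_top"
    by (intro tendsto_mult shift filterlim_compose[OF lim sh])
   moreover have "\<forall>\<^sub>F t in at_top. g (t - s) / u (t - s) * (u (t - s) / u t) = g (t - s) / u t"
    using eventually_ge_at_top[of "T0 + s"]
   proof eventually_elim
    case (elim t)
    then have "u (t - s) ~= 0" using u[of "t - s"] by simp
    then show ?case by simp
   qed
   ultimately have "((%t. g (t - s) / u t) \<longlongrightarrow> C) at_top"
    by (simp add: Lim_transform_eventually)
   then have "((%t. indicator {0..} s * (f s * (g (t - s) / u t))) \<longlongrightarrow> indicator {0..} s * (f s * C)) at_top"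
    by (intro tendsto_intros)
   moreover have "\<forall>\<^sub>F t in at_top. indicator {0..} s * (f s * (g (t - s) / u t)) = indicator {0..t/2} s * (f s * (g (t - s) / u t))"
    using eventually_ge_at_top[of "2 * s"] by eventually_elim (auto simp: indicator_def)
   ultimately show "((%t. indicator {0..t/2} s * (f s * (g (t - s) / u t))) \<longlongrightarrow> C * (indicator {0..} s * f s)) at_top"
    by (simp add: mult_ac Lim_transform_eventually)
  qed
 qed
 moreover have "(%t. \<integral>s. indicator {0..t/2} s * (f s * (g (t - s) / u t)) \<partial>lborel) = (%t. hconv f g t / u t)"
 proof
  fix t show "(\<integral>s. indicator {0..t/2} s * (f s * (g (t - s) / u t)) \<partial>lborel) = hconv f g t / u t"
   unfolding hconv_def by (subst integral_divide_zero[symmetric]) simp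
 qed
 moreover have "(\<integral>s. C * (indicator {0..} s * f s) \<partial>lborel) = C * mass f" by (simp add: mass_def)
 ultimately show ?thesis by (simp only:)
qed

lemma hconv_bound:
 assumes f: "loc_bounded f" and g: "loc_bounded g" and "0 <= t"
  and le: "!!s. t / 2 <= s ==> s <= t ==> f s <= b"
 shows "0 <= hconv g f t" "hconv g f t <= b * primitive g t"
proof -
 show "0 <= hconv g f t"
  unfolding hconv_def using loc_boundedD(1)[OF f] loc_boundedD(1)[OF g]
  by (intro Bochner_Integration.integral_nonneg) (auto simp: indicator_def)
 have "hconv g f t <= (\<integral>s. b * (indicator {0..t} s * g s) \<partial>lborel)"
  unfolding hconv_def
 proof (rule integral_mono[OF hconv_integrable[OF g f]])
  show "integrable lborel (%s. b * (indicator {0..t} s * g s))" using primitive_integrable[OF g] by simp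
  fix s
  have b0: "0 <= b" using le[of t] loc_boundedD(1)[OF f, of t] \<open>0 <= t\<close> by simp
  show "indicator {0..t/2} s * (g s * f (t - s)) <= b * (indicator {0..t} s * g s)"
  proof (cases "0 <= s & s <= t / 2")
   case True
   then have "g s * f (t - s) <= g s * b" using le[of "t - s"] loc_boundedD(1)[OF g, of s] by (intro mult_left_mono) auto
   then show ?thesis using True \<open>0 <= t\<close> by (simp add: mult.commute)
  next
   case False
   then have "indicator {0..t/2} s = (0::real)" by auto
   then show ?thesis using b0 loc_boundedD(1)[OF g, of s] by (auto simp: indicator_def)
  qed
 qed
 then show "hconv g f t <= b * primitive g t" by (simp add: primitive_eq)
qed

lemma primitive_increment_bound:
 fixes V V' :: "real => real"
 assumes g: "loc_bounded g" and T: "0 <= T" "T <= t"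
  and V: "!!s. T <= s ==> (V has_real_derivative V' s) (at s)" "continuous_on {T..} V'"
  and close: "!!s. T < s ==> \<bar>g s - C * V' s\<bar> <= e * V' s"
 shows "\<bar>primitive g t - primitive g T - C * (V t - V T)\<bar> <= e * (V t - V T)"
proof -
 have "has_bochner_integral lborel (%s. indicator {T..t} s *\<^sub>R V' s) (V t - V T)"
 proof (rule has_bochner_integral_FTC_Icc[OF T(2)])
  show "(V has_vector_derivative V' s) (at s within {T..t})" if "T <= s" "s <= t" for s
   using V(1)[of s] that by (auto simp: has_real_derivative_iff_has_vector_derivative[symmetric] intro: has_field_derivative_at_within)
  show "continuous_on {T..t} V'" by (rule continuous_on_subset[OF V(2)]) auto
 qed
 then have iV: "integrable lborel (%s. indicator {T..t} s * V' s)" and VV: "(\<integral>s. indicator {T..t} s * V' s \<partial>lborel) = V t - V T"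
  by (auto simp: has_bochner_integral_iff)
 have ig: "integrable lborel (%s. indicator {0..t} s * g s - indicator {0..T} s * g s)"
  by (intro Bochner_Integration.integrable_diff primitive_integrable[OF g])
 have eq: "primitive g t - primitive g T - C * (V t - V T)
   = (\<integral>s. (indicator {0..t} s * g s - indicator {0..T} s * g s) - C * (indicator {T..t} s * V' s) \<partial>lborel)"
  unfolding primitive_eq VV[symmetric]
  using Bochner_Integration.integral_diff[OF ig integrable_mult_right[OF iV, of C]]
   Bochner_Integration.integral_diff[OF primitive_integrable[OF g, of t] primitive_integrable[OF g, of T]] by simp
 have "\<bar>primitive g t - primitive g T - C * (V t - V T)\<bar> <= (\<integral>s. e * (indicator {T..t} s * V' s) \<partial>lborel)"
  unfolding eq
 proof (rule order_trans[OF integral_abs_bound], rule integral_mono_AE)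
  show "integrable lborel (%s. \<bar>indicator {0..t} s * g s - indicator {0..T} s * g s - C * (indicator {T..t} s * V' s)\<bar>)"
   by (intro integrable_abs Bochner_Integration.integrable_diff[OF ig] integrable_mult_right iV)
  show "integrable lborel (%s. e * (indicator {T..t} s * V' s))" using iV by simp
  have "\<bar>indicator {0..t} s * g s - indicator {0..T} s * g s - C * (indicator {T..t} s * V' s)\<bar> <= e * (indicator {T..t} s * V' s)"
   if "s ~= T" for s
  proof (cases "T < s & s <= t")
   case True
   then show ?thesis using close[of s] T by simp
  next
   case False
   then show ?thesis using that T by (auto simp: indicator_def)
  qed
  then show "AE s in lborel. \<bar>indicator {0..t} s * g s - indicator {0..T} s * g s - C * (indicator {T..t} s * V' s)\<bar> <= e * (indicator {T..t} s * V' s)"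
   using AE_lborel_singleton[of T] by (auto elim: eventually_mono)
 qed
 then show ?thesis by (simp only: integral_mult_right_zero VV)
qed

text \<open>L'Hospital's rule for primitives; integration of the asymptotic relation replaces differentiability.\<close>
lemma primitive_asymp:
 fixes V V' :: "real => real"
 assumes g: "loc_bounded g" and lim: "((%t. g t / V' t) \<longlongrightarrow> C) at_top"
  and V: "!!t. T0 <= t ==> (V has_real_derivative V' t) (at t)" "continuous_on {T0..} V'" "!!t. T0 <= t ==> 0 < V' t"
  and V_top: "filterlim V at_top at_top" and "0 <= T0"
 shows "((%t. primitive g t / V t) \<longlongrightarrow> C) at_top"
 unfolding tendsto_iff
proof (intro allI impI)
 fix e :: real assume e: "0 < e"
 have "\<forall>\<^sub>F t in at_top. dist (g t / V' t) C < e / 3" using lim e by (intro tendstoD) auto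
 then have "\<forall>\<^sub>F t in at_top. T0 <= t & dist (g t / V' t) C < e / 3"
  using eventually_ge_at_top[of T0] by eventually_elim auto
 then obtain T where T: "!!t. T <= t ==> T0 <= t & \<bar>g t / V' t - C\<bar> < e / 3"
  by (auto simp: eventually_at_top_linorder dist_real_def)
 have T0: "0 <= T" "T0 <= T" using T[of T] \<open>0 <= T0\<close> by auto
 have main: "\<bar>primitive g t - primitive g T - C * (V t - V T)\<bar> <= e / 3 * (V t - V T)" if t: "T <= t" for t
 proof (rule primitive_increment_bound[OF g T0(1) t])
  show "(V has_real_derivative V' s) (at s)" if "T <= s" for s using V(1)[of s] that T0 by simp
  show "continuous_on {T..} V'" by (rule continuous_on_subset[OF V(2)]) (use T0 in auto)
  fix s assume s: "T < s"
  then have V': "0 < V' s" using V(3) T0 by auto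
  have "g s - C * V' s = (g s / V' s - C) * V' s" using V' by (simp add: field_simps)
  then have "\<bar>g s - C * V' s\<bar> = \<bar>g s / V' s - C\<bar> * V' s" using V' by (simp only: abs_mult abs_of_pos)
  also have "... <= e / 3 * V' s" using T[of s] s V' by (intro mult_right_mono) auto
  finally show "\<bar>g s - C * V' s\<bar> <= e / 3 * V' s" .
 qed
 define D where "D = \<bar>primitive g T\<bar> + \<bar>C * V T\<bar> + \<bar>e / 3 * V T\<bar>"
 have ev: "\<forall>\<^sub>F t in at_top. 0 < V t" "\<forall>\<^sub>F t in at_top. 3 * D / e < V t"
  using V_top unfolding filterlim_at_top_dense by auto
 show "\<forall>\<^sub>F t in at_top. dist (primitive g t / V t) C < e"
  using ev eventually_ge_at_top[of T]
 proof eventually_elim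
  case (elim t)
  then have Vt: "0 < V t" "3 * D < e * V t" using e by (auto simp: field_simps)
  have "\<bar>primitive g t - C * V t\<bar> <= e / 3 * V t + D"
   using main[OF elim(3)] unfolding D_def right_diff_distrib by linarith
  moreover have "0 < e * V t" using Vt e by simp
  moreover have "e / 3 * V t = e * V t / 3" by simp
  ultimately have "\<bar>primitive g t - C * V t\<bar> < e * V t" using Vt(2) by linarith
  moreover have "primitive g t / V t - C = (primitive g t - C * V t) / V t" using Vt by (simp add: field_simps)
  ultimately show ?case using Vt by (simp add: dist_real_def abs_divide pos_divide_less_eq)
 qed
qed

section \<open>Renewal equations\<close>

text \<open>If a logarithmically convex function increased once, the ratio of consecutive values would stay above one and
the function would grow exponentially.\<close>
lemma log_convex_bounded_antimono:
 fixes w :: "real => real"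
 assumes pos: "!!t. 0 <= t ==> 0 < w t" and bound: "!!t. 0 <= t ==> w t <= B"
  and convex: "!!t h. 0 <= t ==> 0 <= h ==> (w (t + h))\<^sup>2 <= w t * w (t + 2 * h)"
  and st: "0 <= s" "s <= t"
 shows "w t <= w s"
proof (rule ccontr)
 assume "\<not> w t <= w s"
 then have gt: "w s < w t" by simp
 define h where "h = t - s"
 have h: "0 <= h" using st by (simp add: h_def)
 define \<rho> where "\<rho> = w t / w s"
 have \<rho>: "1 < \<rho>" using gt pos[OF st(1)] by (simp add: \<rho>_def)
 have sn: "0 <= s + real n * h" for n using st h by simp
 have step: "\<rho> * w (s + real n * h) <= w (s + real (Suc n) * h)" for n
 proof (induction n)
  case 0
  then show ?case using pos[OF st(1)] by (simp add: \<rho>_def h_def)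
 next
  case (Suc n)
  let ?a = "w (s + real n * h)" and ?b = "w (s + real (Suc n) * h)" and ?c = "w (s + real (Suc (Suc n)) * h)"
  have "?b\<^sup>2 <= ?a * ?c"
   using convex[OF sn h, of n] by (simp add: algebra_simps)
  moreover have "\<rho> * ?a * ?b <= ?b * ?b" using Suc pos[OF sn[of "Suc n"]] by (intro mult_right_mono) auto
  ultimately have "?a * (\<rho> * ?b) <= ?a * ?c" by (simp add: power2_eq_square mult_ac)
  then show ?case using pos[OF sn[of n]] by simp
 qed
 have pow: "\<rho> ^ n * w s <= w (s + real n * h)" for n
 proof (induction n)
  case (Suc n)
  have "\<rho> ^ Suc n * w s <= \<rho> * w (s + real n * h)" using Suc \<rho> by simp
  then show ?case using step[of n] by simp
 qed simp
 obtain n where "B / w s < \<rho> ^ n" using real_arch_pow[OF \<rho>] by blast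
 then have "B < \<rho> ^ n * w s" using pos[OF st(1)] by (simp add: field_simps)
 with pow[of n] bound[OF sn[of n]] show False by simp
qed

text \<open>A Tauberian step: the values of a monotone function are bracketed by difference quotients of its primitive over
intervals of length proportional to \<open>t\<close>.\<close>
lemma antimono_primitive_sqrt:
 fixes w :: "real => real"
 assumes w: "loc_bounded w" and anti: "!!s t. 0 <= s ==> s <= t ==> w t <= w s"
  and lim: "((%t. primitive w t / sqrt t) \<longlongrightarrow> C) at_top"
 shows "((%t. w t * sqrt t) \<longlongrightarrow> C / 2) at_top"
proof -
 have diff: "primitive w t - primitive w s <= w s * (t - s)" "w t * (t - s) <= primitive w t - primitive w s"
  if st: "0 <= s" "s <= t" for s t
 proof -
  have i: "integrable lborel (%r. indicator {0..t} r * w r - indicator {0..s} r * w r)"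
   by (intro Bochner_Integration.integrable_diff primitive_integrable[OF w])
  have eq: "primitive w t - primitive w s = (\<integral>r. indicator {0..t} r * w r - indicator {0..s} r * w r \<partial>lborel)"
   unfolding primitive_eq
   using Bochner_Integration.integral_diff[OF primitive_integrable[OF w, of t] primitive_integrable[OF w, of s]] by simp
  have ic: "integrable lborel (%r. indicator {s<..t} r * c)" "(\<integral>r. indicator {s<..t} r * c \<partial>lborel) = c * (t - s)" for c :: real
   using st by (simp_all add: integrable_real_indicator)
  show "primitive w t - primitive w s <= w s * (t - s)"
   unfolding eq ic(2)[symmetric]
   by (rule integral_mono[OF i ic(1)]) (use st anti in \<open>auto simp: indicator_def\<close>)
  show "w t * (t - s) <= primitive w t - primitive w s"
   unfolding eq ic(2)[symmetric]
   by (rule integral_mono[OF ic(1) i]) (use st anti in \<open>auto simp: indicator_def\<close>)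
 qed
 have scaled: "((%t. primitive w (m\<^sup>2 * t) / sqrt t) \<longlongrightarrow> C * m) at_top" if m: "0 < m" for m
 proof -
  have "filterlim (%t. m\<^sup>2 * t) at_top at_top"
   by (rule filterlim_tendsto_pos_mult_at_top[OF tendsto_const _ filterlim_ident]) (use m in simp)
  from filterlim_compose[OF lim this]
  have "((%t. primitive w (m\<^sup>2 * t) / sqrt (m\<^sup>2 * t) * m) \<longlongrightarrow> C * m) at_top"
   by (intro tendsto_mult tendsto_const)
  moreover have "primitive w (m\<^sup>2 * t) / sqrt (m\<^sup>2 * t) * m = primitive w (m\<^sup>2 * t) / sqrt t" for t
   using m by (simp add: real_sqrt_mult)
  ultimately show ?thesis by simp
 qed
 have lower: "\<forall>\<^sub>F t in at_top. l < w t * sqrt t" if l: "l < C / (2 + d)" and d: "0 < d" "d < 1" for l d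
 proof -
  have pos: "0 < (1 + d)\<^sup>2 - 1" using d by (simp add: power2_eq_square algebra_simps add_pos_pos)
  have "((%t. (primitive w ((1 + d)\<^sup>2 * t) / sqrt t - primitive w (1\<^sup>2 * t) / sqrt t) / ((1 + d)\<^sup>2 - 1)) \<longlongrightarrow> (C * (1 + d) - C * 1) / ((1 + d)\<^sup>2 - 1)) at_top"
   by (intro tendsto_divide tendsto_diff tendsto_const scaled less_imp_neq[OF pos, symmetric]) (use d in auto)
  moreover have "(C * (1 + d) - C * 1) / ((1 + d)\<^sup>2 - 1) = C / (2 + d)"
  proof -
   have 1: "(1 + d)\<^sup>2 - 1 = d * (2 + d)" and 2: "C * (1 + d) - C * 1 = d * C"
    by (simp_all add: power2_eq_square algebra_simps)
   show ?thesis unfolding 1 2 using d by simp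
  qed
  ultimately have "\<forall>\<^sub>F t in at_top. l < (primitive w ((1 + d)\<^sup>2 * t) / sqrt t - primitive w (1\<^sup>2 * t) / sqrt t) / ((1 + d)\<^sup>2 - 1)"
   using l by (intro order_tendstoD(1)) auto
  then show ?thesis using eventually_gt_at_top[of 0]
  proof eventually_elim
   case (elim t)
   have "primitive w ((1 + d)\<^sup>2 * t) - primitive w t <= w t * ((1 + d)\<^sup>2 * t - t)"
    using elim(2) pos by (intro diff) auto
   then have "(primitive w ((1 + d)\<^sup>2 * t) - primitive w t) / sqrt t / ((1 + d)\<^sup>2 - 1) <= w t * (t * ((1 + d)\<^sup>2 - 1)) / sqrt t / ((1 + d)\<^sup>2 - 1)"
    using elim(2) pos by (intro divide_right_mono) (auto simp: algebra_simps)
   also have "... = w t * (t / sqrt t)" using pos by simp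
   also have "... = w t * sqrt t" using elim(2) by (simp add: real_div_sqrt)
   finally show ?case using elim(1) by (simp add: diff_divide_distrib)
  qed
 qed
 have upper: "\<forall>\<^sub>F t in at_top. w t * sqrt t < u" if u: "C / (2 - d) < u" and d: "0 < d" "d < 1" for u d
 proof -
  have pos: "0 < 1 - (1 - d)\<^sup>2" using d by (simp add: power2_eq_square algebra_simps) 
  have "((%t. (primitive w (1\<^sup>2 * t) / sqrt t - primitive w ((1 - d)\<^sup>2 * t) / sqrt t) / (1 - (1 - d)\<^sup>2)) \<longlongrightarrow> (C * 1 - C * (1 - d)) / (1 - (1 - d)\<^sup>2)) at_top"
   by (intro tendsto_divide tendsto_diff tendsto_const scaled less_imp_neq[OF pos, symmetric]) (use d in auto)
  moreover have "(C * 1 - C * (1 - d)) / (1 - (1 - d)\<^sup>2) = C / (2 - d)"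
  proof -
   have 1: "1 - (1 - d)\<^sup>2 = d * (2 - d)" and 2: "C * 1 - C * (1 - d) = d * C"
    by (simp_all add: power2_eq_square algebra_simps)
   show ?thesis unfolding 1 2 using d by simp
  qed
  ultimately have "\<forall>\<^sub>F t in at_top. (primitive w (1\<^sup>2 * t) / sqrt t - primitive w ((1 - d)\<^sup>2 * t) / sqrt t) / (1 - (1 - d)\<^sup>2) < u"
   using u by (intro order_tendstoD(2)) auto
  then show ?thesis using eventually_gt_at_top[of 0]
  proof eventually_elim
   case (elim t)
   have "(1 - d)\<^sup>2 * t <= t" using elim(2) pos by simp
   then have "w t * (t - (1 - d)\<^sup>2 * t) <= primitive w t - primitive w ((1 - d)\<^sup>2 * t)"
    using elim(2) by (intro diff) auto
   then have "w t * (t * (1 - (1 - d)\<^sup>2)) / sqrt t / (1 - (1 - d)\<^sup>2) <= (primitive w t - primitive w ((1 - d)\<^sup>2 * t)) / sqrt t / (1 - (1 - d)\<^sup>2)"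
    using elim(2) pos by (intro divide_right_mono) (auto simp: algebra_simps)
   moreover have "w t * (t * (1 - (1 - d)\<^sup>2)) / sqrt t / (1 - (1 - d)\<^sup>2) = w t * (t / sqrt t)" using pos by simp
   moreover have "w t * (t / sqrt t) = w t * sqrt t" using elim(2) by (simp add: real_div_sqrt)
   ultimately show ?case using elim(1) by (simp add: diff_divide_distrib)
  qed
 qed
 show ?thesis
 proof (rule order_tendstoI)
  fix l assume l: "l < C / 2"
  have "((%d. C / (2 + d)) \<longlongrightarrow> C / (2 + 0)) (at_right 0)" by (intro tendsto_intros) auto
  then have "\<forall>\<^sub>F d in at_right 0. l < C / (2 + d)" using l by (intro order_tendstoD(1)) auto
  moreover have "\<forall>\<^sub>F d in at_right (0::real). 0 < d & d < 1"
   using eventually_at_right_real[of 0 1] by (simp add: greaterThanLessThan_def)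
  ultimately have "\<forall>\<^sub>F d in at_right 0. l < C / (2 + d) & 0 < d & d < 1" by eventually_elim auto
  then obtain d where "l < C / (2 + d)" "0 < d" "d < 1"
   using eventually_happens[of _ "at_right (0::real)"] by auto
  then show "\<forall>\<^sub>F t in at_top. l < w t * sqrt t" by (rule lower)
 next
  fix u assume u: "C / 2 < u"
  have "((%d. C / (2 - d)) \<longlongrightarrow> C / (2 - 0)) (at_right 0)" by (intro tendsto_intros) auto
  then have "\<forall>\<^sub>F d in at_right 0. C / (2 - d) < u" using u by (intro order_tendstoD(2)) auto
  moreover have "\<forall>\<^sub>F d in at_right (0::real). 0 < d & d < 1"
   using eventually_at_right_real[of 0 1] by (simp add: greaterThanLessThan_def)
  ultimately have "\<forall>\<^sub>F d in at_right 0. C / (2 - d) < u & 0 < d & d < 1" by eventually_elim auto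
  then obtain d where "C / (2 - d) < u" "0 < d" "d < 1"
   using eventually_happens[of _ "at_right (0::real)"] by auto
  then show "\<forall>\<^sub>F t in at_top. w t * sqrt t < u" by (rule upper)
 qed
qed

text \<open>A kernel that converges to \<open>e\<close> acts like the constant kernel \<open>e\<close>, up to the
contribution of the last bounded stretch of time.\<close>
lemma conv_minus_primitive:
 assumes E: "loc_bounded E" and v: "loc_bounded v"
  and EB: "!!t. 0 <= t ==> E t <= B" and lim: "(E \<longlongrightarrow> e) at_top"
  and vM: "!!t. 0 <= t ==> v t <= M"
  and V: "filterlim V at_top at_top" and prim: "\<forall>\<^sub>F t in at_top. primitive v t <= A * V t"
 shows "((%t. (conv E v t - e * primitive v t) / V t) \<longlongrightarrow> 0) at_top"
 unfolding tendsto_iff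
proof (intro allI impI)
 fix \<epsilon> :: real assume \<epsilon>: "0 < \<epsilon>"
 have e0: "0 <= e"
  by (rule tendsto_lowerbound[OF lim]) (use loc_boundedD(1)[OF E] in \<open>auto intro: eventually_mono[OF eventually_ge_at_top[of 0]]\<close>)
 have M0: "0 <= M" using vM[of 0] loc_boundedD(1)[OF v, of 0] by simp
 have B0: "0 <= B" using EB[of 0] loc_boundedD(1)[OF E, of 0] by simp
 define A' where "A' = \<bar>A\<bar> + 1"
 have A'_pos: "0 < A'" by (simp add: A'_def)
 define eta where "eta = \<epsilon> / (2 * A')"
 have eta: "0 < eta" using \<epsilon> by (simp add: eta_def A'_def)
 have "\<forall>\<^sub>F t in at_top. dist (E t) e < eta" using lim eta by (rule tendstoD)
 then have "\<forall>\<^sub>F t in at_top. 0 <= t & dist (E t) e < eta" using eventually_ge_at_top[of 0] by eventually_elim auto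
 then obtain T where T: "!!t. T <= t ==> 0 <= t & \<bar>E t - e\<bar> < eta"
  by (auto simp: eventually_at_top_linorder dist_real_def)
 have T0: "0 <= T" using T by auto
 define d where "d t = eta + (B + e) * indicator {0..T} t" for t
 have ind: "loc_bounded (indicator {0..T})"
  unfolding loc_bounded_def by (auto simp: indicator_def intro!: exI[of _ 1])
 have ld: "loc_bounded d"
  unfolding d_def using B0 e0 eta by (intro loc_bounded_add loc_bounded_const loc_bounded_cmult ind) auto
 have Ed: "\<bar>E t - e\<bar> <= d t" if "0 <= t" for t
  using T[of t] EB[OF that] loc_boundedD(1)[OF E that] e0 eta B0 that by (auto simp: d_def indicator_def)
 have Ed': "E t <= e + d t" "e <= E t + d t" if "0 <= t" for t
  using Ed[OF that] by linarith+
 have convd: "conv d v t <= eta * primitive v t + (B + e) * (M * T)" if t: "0 <= t" for t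
 proof -
  have "conv d v t = conv v d t" by (rule conv_commute[OF ld v])
  also have "... = conv v (%_. eta) t + conv v (%t. (B + e) * indicator {0..T} t) t"
   unfolding d_def using B0 e0 eta by (intro conv_add_right v loc_bounded_const loc_bounded_cmult ind) auto
  also have "conv v (%_. eta) t = eta * primitive v t"
   using conv_cmult_left[of eta "%_. 1" v t] conv_commute[OF v loc_bounded_const[of eta], of t] eta by simp
  also have "conv v (%t. (B + e) * indicator {0..T} t) t = (B + e) * conv v (indicator {0..T}) t" by (rule conv_cmult_right)
  also have "conv v (indicator {0..T}) t <= conv (%_. M) (indicator {0..T}) t"
   by (rule conv_mono) (use v ind vM M0 loc_bounded_const in auto)
  also have "... = M * primitive (indicator {0..T}) t" using conv_cmult_left[of M "%_. 1"] by simp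
  also have "primitive (indicator {0..T}) t <= T"
  proof -
   have "primitive (indicator {0..T}) t <= (\<integral>s. indicator {0..T} s \<partial>lborel)"
    unfolding primitive_eq
    by (rule integral_mono[OF primitive_integrable[OF ind] integrable_real_indicator]) (auto simp: indicator_def emeasure_lborel_Icc_eq)
   then show ?thesis using T0 by simp
  qed
  finally show ?thesis using B0 e0 M0 by (simp add: mult_left_mono)
 qed
 have abs: "\<bar>conv E v t - e * primitive v t\<bar> <= conv d v t" if t: "0 <= t" for t
 proof -
  have 1: "conv E v t <= conv (%t. e + d t) v t"
   using Ed' by (intro conv_mono E v loc_bounded_add loc_bounded_const e0 ld) auto
  have 2: "conv (%_. e) v t <= conv (%t. E t + d t) v t"
   using Ed' by (intro conv_mono E v loc_bounded_add loc_bounded_const e0 ld) auto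
  have 3: "conv (%_. e) v t = e * primitive v t" using conv_cmult_left[of e "%_. 1"] by simp
  have 4: "conv (%t. f t + d t) v t = conv f v t + conv d v t" if f: "loc_bounded f" for f
   using conv_add_right[OF v f ld, of t] conv_commute[OF v loc_bounded_add[OF f ld], of t] conv_commute[OF v f, of t] conv_commute[OF v ld, of t] by simp
  show ?thesis using 1 2 3 4[OF E] 4[OF loc_bounded_const[OF e0]] by simp
 qed
 have ev: "\<forall>\<^sub>F t in at_top. 0 < V t" "\<forall>\<^sub>F t in at_top. 2 * ((B + e) * (M * T)) / \<epsilon> < V t"
  using V unfolding filterlim_at_top_dense by auto
 show "\<forall>\<^sub>F t in at_top. dist ((conv E v t - e * primitive v t) / V t) 0 < \<epsilon>"
  using ev prim eventually_ge_at_top[of 0]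
 proof eventually_elim
  case (elim t)
  have "\<bar>conv E v t - e * primitive v t\<bar> <= eta * primitive v t + (B + e) * (M * T)"
   using abs[OF elim(4)] convd[OF elim(4)] by simp
  also have "eta * primitive v t <= eta * (A' * V t)"
  proof -
   have "A * V t <= A' * V t" using elim(1) by (intro mult_right_mono) (auto simp: A'_def)
   then show ?thesis using elim(3) eta by (intro mult_left_mono) auto
  qed
  also have "eta * (A' * V t) = \<epsilon> * V t / 2" using A'_pos by (simp add: eta_def)
  also have "(B + e) * (M * T) < \<epsilon> * V t / 2" using elim(2) \<epsilon> by (simp add: field_simps)
  finally have "\<bar>conv E v t - e * primitive v t\<bar> < \<epsilon> * V t" by simp
  then show ?case using elim(1) by (simp add: dist_real_def abs_divide pos_divide_less_eq)
 qed
qed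

text \<open>Scaling turns the convolution into the Beta integral of \<open>1 / sqrt (x * (1 - x))\<close>.\<close>
lemma self_conv_sqrt:
 assumes F: "loc_bounded F" and lim: "((%t. F t * sqrt t) \<longlongrightarrow> \<kappa>) at_top" and \<kappa>: "0 < \<kappa>"
 obtains e where "0 < e" "(conv F F \<longlongrightarrow> e) at_top"
proof -
 define g where "g r = indicator {0..1} r * (r powr (1/2 - 1) * (1 - r) powr (1/2 - 1))" for r :: real
 have g0: "0 <= g r" for r by (simp add: g_def)
 have gm: "g \<in> borel_measurable borel" unfolding g_def[abs_def] by measurable
 have "((%t. t powr (1/2 - 1) * (1 - t) powr (1/2 - 1)) has_integral Beta (1/2) (1/2 :: real)) {0..1}"
  by (rule has_integral_Beta_real) auto
 then have "((%t. if t \<in> {0..1} then t powr (1/2 - 1) * (1 - t) powr (1/2 - 1) else 0) has_integral Beta (1/2) (1/2 :: real)) UNIV"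
  by (rule has_integral_restrict_UNIV[THEN iffD2])
 moreover have "(%t. if t \<in> {0..1} then t powr (1/2 - 1) * (1 - t) powr (1/2 - 1) else 0) = g"
  by (auto simp: g_def fun_eq_iff)
 ultimately have "(g has_integral Beta (1/2) (1/2)) UNIV" by (simp only:)
 from nn_integral_has_integral_lborel[OF gm g0 this]
 have gI: "(\<integral>\<^sup>+r. ennreal (g r) \<partial>lborel) = ennreal (Beta (1/2) (1/2))" .
 have gint: "integrable lborel g"
  by (rule integrableI_nonneg) (use gm g0 gI in auto)
 have "(0::real) < Beta (1/2) (1/2)" by (simp add: Beta_def)
 then have Gpos: "0 < (\<integral>r. g r \<partial>lborel)"
  using gI nn_integral_eq_integral[OF gint] g0 by (simp add: ennreal_inj Bochner_Integration.integral_nonneg)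
 obtain T where T: "!!t. T <= t ==> F t * sqrt t < \<kappa> + 1"
  using order_tendstoD(2)[OF lim, of "\<kappa> + 1"] by (auto simp: eventually_at_top_linorder)
 obtain B where B: "0 <= B" "!!t. 0 <= t ==> t <= T ==> F t <= B" using loc_bounded_bound[OF F, of T] by metis
 define K where "K = \<kappa> + 1 + B * sqrt \<bar>T\<bar>"
 have FK: "F t * sqrt t <= K" if "0 <= t" for t
 proof (cases "T <= t")
  case True
  have "0 <= B * sqrt \<bar>T\<bar>" using B by simp
  then show ?thesis using T[OF True] unfolding K_def by linarith
 next
  case False
  then have "F t * sqrt t <= B * sqrt \<bar>T\<bar>" using B that by (intro mult_mono) auto
  then show ?thesis using \<kappa> by (simp add: K_def)
 qed
 have sq: "r powr (1/2 - 1) = 1 / sqrt r" if "0 < r" for r :: real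
  using powr_minus_divide[of r "1/2"] powr_half_sqrt[of r] that by simp
 define h where "h t r = indicator {0..1} r * (t * (F (t * (1 - r)) * F (t * r)))" for t r
 have conv_h: "conv F F t = (\<integral>r. h t r \<partial>lborel)" if t: "0 < t" for t
 proof -
  have "conv F F t = \<bar>t\<bar> * (\<integral>r. indicator {0..t} (0 + t * r) * (F (t - (0 + t * r)) * F (0 + t * r)) \<partial>lborel)"
   unfolding conv_def by (subst lborel_integral_real_affine[where c=t and t=0]) (use t in auto)
  also have "... = (\<integral>r. t * (indicator {0..t} (0 + t * r) * (F (t - (0 + t * r)) * F (0 + t * r))) \<partial>lborel)"
   using t by simp
  also have "... = (\<integral>r. h t r \<partial>lborel)"
  proof (rule Bochner_Integration.integral_cong[OF refl])
   fix r
   have "indicator {0..t} (t * r) = (indicator {0..1} r :: real)"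
    using t by (auto simp: indicator_def zero_le_mult_iff mult_le_cancel_left1)
   then show "t * (indicator {0..t} (0 + t * r) * (F (t - (0 + t * r)) * F (0 + t * r))) = h t r"
    by (simp add: h_def right_diff_distrib)
  qed
  finally show ?thesis .
 qed
 have hm: "h t \<in> borel_measurable borel" if t: "0 < t" for t
 proof -
  have "(%r. t * ((%s. indicator {0..t} s * (F (t - s) * F s)) (t * r))) \<in> borel_measurable borel"
   by (intro borel_measurable_times borel_measurable_const measurable_compose[OF _ conv_measurable_integrand[OF F F], of "%r. t * r"]) simp
  moreover have "(%r. t * ((%s. indicator {0..t} s * (F (t - s) * F s)) (t * r))) = h t"
   using t by (auto simp: h_def indicator_def zero_le_mult_iff mult_le_cancel_left1 right_diff_distrib fun_eq_iff)
  ultimately show ?thesis by simp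
 qed
 have h_eq: "h t r = (F (t * (1 - r)) * sqrt (t * (1 - r))) * (F (t * r) * sqrt (t * r)) * g r"
  if t: "0 < t" and r: "0 < r" "r < 1" for t r
 proof -
  have "sqrt (t * (1 - r)) * sqrt (t * r) * (1 / sqrt r * (1 / sqrt (1 - r))) = t"
   using t r by (simp add: real_sqrt_mult)
  then have "F (t * (1 - r)) * F (t * r) * (sqrt (t * (1 - r)) * sqrt (t * r) * (1 / sqrt r * (1 / sqrt (1 - r)))) = F (t * (1 - r)) * F (t * r) * t"
   by (simp only:)
  moreover have "h t r = F (t * (1 - r)) * F (t * r) * t" using r by (simp add: h_def)
  moreover have "g r = 1 / sqrt r * (1 / sqrt (1 - r))" using r sq[of r] sq[of "1 - r"] by (simp add: g_def)
  ultimately show ?thesis by (simp only: mult_ac)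
 qed
 have "((%t. \<integral>r. (if 0 < t then h t r else 0) \<partial>lborel) \<longlongrightarrow> (\<integral>r. \<kappa> * \<kappa> * g r \<partial>lborel)) at_top"
 proof (rule integral_dominated_convergence_at_top)
  show "(%r. \<kappa> * \<kappa> * g r) \<in> borel_measurable lborel" using gm by simp
  show "(%r. if 0 < t then h t r else 0) \<in> borel_measurable lborel" for t using hm[of t] by (cases "0 < t") auto
  show "integrable lborel (%r. K * K * g r)" using gint by simp
  have ae: "AE r in lborel. r ~= (0::real) & r ~= 1"
   using AE_lborel_singleton[of "0::real"] AE_lborel_singleton[of "1::real"] by eventually_elim auto
  have pt: "((%t. if 0 < t then h t r else 0) \<longlongrightarrow> \<kappa> * \<kappa> * g r) at_top" if "r ~= 0 & r ~= 1" for r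
  proof (cases "0 < r & r < 1")
   case True
   have 1: "((%t. F (t * c) * sqrt (t * c)) \<longlongrightarrow> \<kappa>) at_top" if "0 < c" for c
    by (rule filterlim_compose[OF lim]) (use filterlim_tendsto_pos_mult_at_top[OF tendsto_const that filterlim_ident] in \<open>simp add: mult.commute\<close>)
   have "((%t. (F (t * (1 - r)) * sqrt (t * (1 - r))) * (F (t * r) * sqrt (t * r)) * g r) \<longlongrightarrow> \<kappa> * \<kappa> * g r) at_top"
    by (intro tendsto_mult 1 tendsto_const) (use True in auto)
   then show ?thesis
   proof (rule Lim_transform_eventually)
    show "\<forall>\<^sub>F t in at_top. (F (t * (1 - r)) * sqrt (t * (1 - r))) * (F (t * r) * sqrt (t * r)) * g r = (if 0 < t then h t r else 0)"
     using eventually_gt_at_top[of 0] by eventually_elim (use True in \<open>simp add: h_eq\<close>)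
   qed
  next
   case False
   then have "r < 0 \<or> 1 < r" using that by auto
   then have "h t r = 0" "g r = 0" for t by (auto simp: h_def g_def)
   then show ?thesis by (simp cong: if_cong)
  qed
  show "AE r in lborel. ((%t. if 0 < t then h t r else 0) \<longlongrightarrow> \<kappa> * \<kappa> * g r) at_top"
   using ae by eventually_elim (rule pt)
  have bd: "norm (if 0 < t then h t r else 0) <= K * K * g r" if "r ~= 0 & r ~= 1" for t r
  proof (cases "0 < r & r < 1 & 0 < t")
   case True
   have "0 <= F (t * (1 - r)) * sqrt (t * (1 - r))" "0 <= F (t * r) * sqrt (t * r)"
    using True loc_boundedD(1)[OF F] by auto
   moreover have "F (t * (1 - r)) * sqrt (t * (1 - r)) <= K" "F (t * r) * sqrt (t * r) <= K" using True by (auto intro!: FK)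
   ultimately have "(F (t * (1 - r)) * sqrt (t * (1 - r))) * (F (t * r) * sqrt (t * r)) <= K * K"
    and "0 <= (F (t * (1 - r)) * sqrt (t * (1 - r))) * (F (t * r) * sqrt (t * r))"
    by (auto intro!: mult_mono simp del: mult_eq_0_iff)
   then have "\<bar>(F (t * (1 - r)) * sqrt (t * (1 - r))) * (F (t * r) * sqrt (t * r))\<bar> * g r <= K * K * g r"
    using g0[of r] by (intro mult_right_mono) auto
   then show ?thesis using True h_eq[of t r] g0[of r] by (simp only: abs_mult abs_of_nonneg if_True real_norm_def)
  next
   case False
   then have "r < 0 \<or> 1 < r \<or> \<not> 0 < t" using that by auto
   then show ?thesis using g0[of r] by (auto simp: h_def g_def)
  qed
  show "\<forall>\<^sub>F t in at_top. AE r in lborel. norm (if 0 < t then h t r else 0) <= K * K * g r"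
  proof (rule always_eventually, rule allI)
   fix t show "AE r in lborel. norm (if 0 < t then h t r else 0) <= K * K * g r"
    using ae by eventually_elim (rule bd)
  qed
 qed
 then have "(conv F F \<longlongrightarrow> (\<integral>r. \<kappa> * \<kappa> * g r \<partial>lborel)) at_top"
 proof (rule Lim_transform_eventually)
  show "\<forall>\<^sub>F t in at_top. (\<integral>r. (if 0 < t then h t r else 0) \<partial>lborel) = conv F F t"
   using eventually_gt_at_top[of 0] by eventually_elim (simp add: conv_h)
 qed
 moreover have "0 < (\<integral>r. \<kappa> * \<kappa> * g r \<partial>lborel)" using Gpos \<kappa> by simp
 ultimately show thesis by (rule that[rotated])
qed

lemma conv_const_left: "conv (%_. c) f t = c * primitive f t"
 using conv_cmult_left[of c "%_. 1" f t] by simp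

lemma primitive_diff_bounds:
 assumes f: "loc_bounded f" and st: "0 <= s" "s <= t"
 shows "(!!r. s < r ==> r <= t ==> m <= f r) ==> m * (t - s) <= primitive f t - primitive f s"
  and "(!!r. s < r ==> r <= t ==> f r <= m) ==> primitive f t - primitive f s <= m * (t - s)"
proof -
 have i: "integrable lborel (%r. indicator {0..t} r * f r - indicator {0..s} r * f r)"
  by (intro Bochner_Integration.integrable_diff primitive_integrable[OF f])
 have eq: "primitive f t - primitive f s = (\<integral>r. indicator {0..t} r * f r - indicator {0..s} r * f r \<partial>lborel)"
  unfolding primitive_eq
  by (rule Bochner_Integration.integral_diff[symmetric, OF primitive_integrable[OF f] primitive_integrable[OF f]])
 have ic: "integrable lborel (%r. indicator {s<..t} r * m)" "(\<integral>r. indicator {s<..t} r * m \<partial>lborel) = m * (t - s)"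
  using st by (simp_all add: integrable_real_indicator)
 have ind: "indicator {0..t} r * f r - indicator {0..s} r * f r = indicator {s<..t} r * f r" for r
  using st by (auto simp: indicator_def)
 show "m * (t - s) <= primitive f t - primitive f s" if "!!r. s < r ==> r <= t ==> m <= f r"
  unfolding eq ic(2)[symmetric]
  by (rule integral_mono[OF ic(1) i]) (unfold ind, use that in \<open>simp add: indicator_def\<close>)
 show "primitive f t - primitive f s <= m * (t - s)" if "!!r. s < r ==> r <= t ==> f r <= m"
  unfolding eq ic(2)[symmetric]
  by (rule integral_mono[OF i ic(1)]) (unfold ind, use that in \<open>simp add: indicator_def\<close>)
qed

text \<open>With \<open>b * mass p = 1\<close> the function \<open>b * p\<close> is a probability density of waiting times,
\<open>b * w\<close> is the renewal density, and \<open>tail\<close> is the survival function of the waiting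
time.\<close>
locale renewal =
 fixes p w :: "real => real" and b :: real
 assumes p: "loc_bounded p" "hl_integrable p" and w: "loc_bounded w" and b: "0 < b"
  and p_pos: "!!t. 0 <= t ==> 0 < p t" and p_anti: "!!s t. 0 <= s ==> s <= t ==> p t <= p s"
  and total: "b * mass p = 1"
  and renewal_eq: "!!t. 0 <= t ==> w t = p t + b * conv p w t"
begin

definition tail :: "real => real" where "tail t = 1 - b * primitive p t"

lemma tail_le_1: "tail t <= 1"
 unfolding tail_def using b conv_nonneg[OF loc_bounded_const[of 1] p(1), of t] by simp

lemma tail_nonneg: "0 <= tail t"
 unfolding tail_def using mult_left_mono[OF primitive_le_mass[OF p, of t], of b] b total by simp

lemma tail_antimono: "s <= t ==> tail t <= tail s"
 unfolding tail_def using mult_left_mono[OF primitive_mono[OF p(1), of s t], of b] b by simp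

lemma tail_tendsto: "(tail \<longlongrightarrow> 0) at_top"
proof -
 have "((%t. 1 - b * primitive p t) \<longlongrightarrow> 1 - b * mass p) at_top"
  by (intro tendsto_intros primitive_tendsto_mass p)
 then show ?thesis using total by (simp add: tail_def[abs_def])
qed

lemma tail_loc_bounded: "loc_bounded tail"
 unfolding loc_bounded_def
proof (intro conjI allI impI)
 have "(%t. indicator {0..} t * tail t) = (%t. indicator {0..} t - b * (indicator {0..} t * primitive p t))"
  by (auto simp: tail_def indicator_def)
 also have "... \<in> borel_measurable borel"
  using loc_boundedD(2)[OF loc_bounded_primitive[OF p(1)]] by simp
 finally show "(%t. indicator {0..} t * tail t) \<in> borel_measurable borel" .
 show "\<exists>B. \<forall>t. 0 <= t --> t <= T --> tail t <= B" for T using tail_le_1 by blast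
qed (rule tail_nonneg)

lemma tail_pos: "0 <= t ==> 0 < tail t"
proof -
 assume t: "0 <= t"
 have "p (t+1) * (t + 1 - t) <= primitive p (t+1) - primitive p t"
  by (rule primitive_diff_bounds(1)[OF p(1)]) (use t p_anti in auto)
 then have "primitive p t < primitive p (t + 1)" using p_pos[of "t+1"] t by simp
 then have "tail (t + 1) < tail t" unfolding tail_def using b by simp
 with tail_nonneg[of "t+1"] show ?thesis by simp
qed

text \<open>The time since the last renewal is finite almost surely: integrating the renewal equation leaves no other term.\<close>
lemma conv_tail:
 assumes t: "0 <= t"
 shows "conv w tail t = (1 - tail t) / b" "conv tail w t = (1 - tail t) / b"
proof -
 have one: "loc_bounded (%_. 1)" by (rule loc_bounded_const) simp
 have lpr: "loc_bounded (%t. b * primitive p t)" using loc_bounded_cmult[OF _ loc_bounded_primitive[OF p(1)]] b by simp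
 have "conv w (%_. 1) t = conv w (%t. tail t + b * primitive p t) t"
  by (intro conv_cong) (auto simp: tail_def)
 also have "... = conv w tail t + b * conv w (primitive p) t"
  using conv_add_right[OF w tail_loc_bounded lpr] by (simp add: conv_cmult_right)
 finally have 1: "conv w (%_. 1) t = conv w tail t + b * conv w (primitive p) t" .
 have "primitive w t = conv (%_. 1) (%t. p t + b * conv p w t) t"
  by (rule conv_cong) (auto simp: renewal_eq)
 also have "... = primitive p t + b * conv (%_. 1) (conv p w) t"
  using conv_add_right[OF one p(1) loc_bounded_cmult[OF less_imp_le[OF b] loc_bounded_conv[OF p(1) w]]]
  by (simp add: conv_cmult_right)
 also have "conv (%_. 1) (conv p w) t = conv (primitive p) w t" by (rule conv_assoc[OF one p(1) w, symmetric])
 also have "... = conv w (primitive p) t" by (rule conv_commute[OF loc_bounded_primitive[OF p(1)] w])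
 finally have 2: "primitive w t = primitive p t + b * conv w (primitive p) t" .
 have "conv w tail t = primitive p t" using 1 2 conv_commute[OF w one, of t] by simp
 then show "conv w tail t = (1 - tail t) / b" using b by (simp add: tail_def)
 then show "conv tail w t = (1 - tail t) / b" using conv_commute[OF w tail_loc_bounded] by simp
qed

lemma conv_tail_le: "0 <= t ==> conv w tail t <= 1 / b"
 using conv_tail(1)[of t] tail_nonneg[of t] b by (simp add: divide_right_mono)

text \<open>A large value of \<open>w\<close> would persist for a unit of time and violate the bound on the convolution with
\<open>tail\<close>.\<close>
lemma bounded_of_lower_growth:
 assumes r: "0 < r" and growth: "!!t h. 0 <= t ==> 0 <= h ==> h <= 1 ==> r * w t <= w (t + h)"
 obtains B where "!!t. 0 <= t ==> w t <= B"
proof (rule that)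
 fix t :: real assume t: "0 <= t"
 have m: "0 < tail 1" by (rule tail_pos) simp
 have "r * w t * tail 1 = (\<integral>s. indicator {0..1::real} s * (r * w t * tail 1) \<partial>lborel)" by simp
 also have "... <= (\<integral>s. indicator {0..t+1} s * (w (t + 1 - s) * tail s) \<partial>lborel)"
 proof (rule integral_mono[OF _ conv_integrable[OF w tail_loc_bounded]])
  show "integrable lborel (%s. indicator {0..1::real} s * (r * w t * tail 1))"
   by (intro integrable_mult_left integrable_real_indicator) (auto simp: emeasure_lborel_Icc_eq)
  fix s
  show "indicator {0..1} s * (r * w t * tail 1) <= indicator {0..t+1} s * (w (t + 1 - s) * tail s)"
  proof (cases "0 <= s & s <= 1")
   case True
   have "r * w t <= w (t + (1 - s))" using growth[OF t, of "1 - s"] True by simp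
   moreover have "tail 1 <= tail s" using tail_antimono True by simp
   ultimately have "r * w t * tail 1 <= w (t + (1 - s)) * tail s"
    using loc_boundedD(1)[OF w t] loc_boundedD(1)[OF w, of "t + (1 - s)"] True m r t by (intro mult_mono) auto
   then show ?thesis using True t by (simp add: add_diff_eq)
  next
   case False
   then have "indicator {0..1} s = (0::real)" by auto
   moreover have "0 <= indicator {0..t+1} s * (w (t + 1 - s) * tail s)"
    using loc_boundedD(1)[OF w, of "t + 1 - s"] tail_nonneg[of s] by (auto simp: indicator_def)
   ultimately show ?thesis by simp
  qed
 qed
 also have "... = conv w tail (t + 1)" by (simp add: conv_def)
 also have "... <= 1 / b" using t by (intro conv_tail_le) simp
 finally show "w t <= 1 / b / (r * tail 1)" using m r b by (simp add: field_simps)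
qed

end

text \<open>Monotonicity of the renewal density turns bounds on its convolutions and primitives into pointwise bounds.\<close>
locale antimono_renewal = renewal +
 assumes w_anti: "!!s t. 0 <= s ==> s <= t ==> w t <= w s"
begin

lemma w_le_0: "0 <= t ==> w t <= w 0" using w_anti[of 0 t] by simp

lemma w_tail_primitive_le: "0 <= t ==> w t * primitive tail t <= 1 / b"
proof -
 assume t: "0 <= t"
 have "w t * primitive tail t = conv (%_. w t) tail t" by (rule conv_const_left[symmetric])
 also have "... <= conv w tail t"
  by (rule conv_mono[OF loc_bounded_const[OF loc_boundedD(1)[OF w t]] w tail_loc_bounded tail_loc_bounded]) (auto intro: w_anti)
 also have "... <= 1 / b" by (rule conv_tail_le[OF t])
 finally show ?thesis .
qed

lemma w_primitive_tail_le: "0 <= t ==> tail t * primitive w t <= 1 / b"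
proof -
 assume t: "0 <= t"
 have "tail t * primitive w t = conv (%_. tail t) w t" by (rule conv_const_left[symmetric])
 also have "... <= conv tail w t"
  by (rule conv_mono[OF loc_bounded_const[OF tail_nonneg] tail_loc_bounded w w]) (auto intro: tail_antimono)
 also have "... = conv w tail t" by (rule conv_commute[OF tail_loc_bounded w])
 also have "... <= 1 / b" by (rule conv_tail_le[OF t])
 finally show ?thesis .
qed

text \<open>The monotone function \<open>w\<close> has a limit \<open>L\<close>, and the identity \<open>conv w tail = (1 -
tail) / b\<close> forces \<open>L * mass tail = 1 / b\<close>.\<close>
theorem finite_mean:
 assumes "hl_integrable tail"
 obtains L where "0 < L" "(w \<longlongrightarrow> L) at_top"
proof -
 define L where "L = (INF t\<in>{0..}. w t)"
 have bdd: "bdd_below (w ` {0..})" using loc_boundedD(1)[OF w] by (intro bdd_belowI[of _ 0]) auto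
 have lim: "(w \<longlongrightarrow> L) at_top"
 proof (rule order_tendstoI)
  fix l assume "l < L"
  have "l < w t" if "0 <= t" for t
   using cINF_lower[OF bdd, of t] that \<open>l < L\<close> by (simp add: L_def)
  then show "\<forall>\<^sub>F t in at_top. l < w t" by (rule eventually_mono[OF eventually_ge_at_top[of 0]])
 next
  fix u assume "L < u"
  then obtain s where s: "0 <= s" "w s < u" using cINF_less_iff[OF _ bdd] by (auto simp: L_def)
  show "\<forall>\<^sub>F t in at_top. w t < u"
   using eventually_ge_at_top[of s] by eventually_elim (use w_anti[OF s(1)] s(2) in force)
 qed
 have "(conv w tail \<longlongrightarrow> L * mass tail) at_top"
  by (rule conv_tendsto[OF w tail_loc_bounded assms w_le_0 lim])
 moreover have "(conv w tail \<longlongrightarrow> (1 - 0) / b) at_top"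
 proof (rule Lim_transform_eventually)
  show "((%t. (1 - tail t) / b) \<longlongrightarrow> (1 - 0) / b) at_top" by (intro tendsto_intros tail_tendsto) (use b in simp)
  show "\<forall>\<^sub>F t in at_top. (1 - tail t) / b = conv w tail t"
   using eventually_ge_at_top[of 0] by eventually_elim (simp add: conv_tail)
 qed
 ultimately have "L * mass tail = 1 / b" using tendsto_unique[of at_top "conv w tail"] by simp
 then have "0 < L * mass tail" using b by simp
 moreover have "0 <= mass tail" by (rule mass_nonneg[OF tail_loc_bounded])
 ultimately have "0 < L" by (simp add: zero_less_mult_iff)
 with lim show thesis by (rule that[rotated])
qed

text \<open>The primitive of \<open>tail\<close> grows like \<open>\<kappa> * ln t\<close>, hence varies slowly. For
\<open>conv w tail\<close>, monotonicity of \<open>w\<close> bounds it from below by \<open>w t\<close> times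
this primitive; in the other direction one half of the convolution is negligible, and in the remaining half
\<open>w\<close> is at most its value at \<open>t / 2\<close>.\<close>
theorem tail_inverse:
 assumes \<kappa>: "0 < \<kappa>" "((%t. tail t * t) \<longlongrightarrow> \<kappa>) at_top"
 shows "((%t. w t * ln t) \<longlongrightarrow> 1 / (b * \<kappa>)) at_top"
proof -
 let ?I = "primitive tail"
 have I: "((%t. ?I t / ln t) \<longlongrightarrow> \<kappa>) at_top"
 proof (rule primitive_asymp[OF tail_loc_bounded, where ?T0.0=1 and V'="%t. 1 / t"])
  show "((%t. tail t / (1 / t)) \<longlongrightarrow> \<kappa>) at_top" using \<kappa>(2) by simp
  show "(ln has_real_derivative 1 / t) (at t)" if "1 <= t" for t :: real
   using that by (auto intro!: derivative_eq_intros)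
  show "continuous_on {1..} (%t::real. 1 / t)" by (intro continuous_intros) auto
  show "filterlim (ln :: real => real) at_top at_top" by (rule ln_at_top)
 qed auto
 have ln_pos: "\<forall>\<^sub>F t in at_top. 0 < ln (t::real)" using eventually_gt_at_top[of 1] by eventually_elim simp
 have "\<forall>\<^sub>F t in at_top. \<kappa> / 2 < ?I t / ln t" using I \<kappa>(1) by (intro order_tendstoD(1)) auto
 then have Ipos: "\<forall>\<^sub>F t in at_top. 0 < ?I t"
  using ln_pos by eventually_elim (use \<kappa>(1) in \<open>smt (verit) divide_nonpos_pos half_gt_zero\<close>)
 have lnI: "((%t. ln t / ?I t) \<longlongrightarrow> 1 / \<kappa>) at_top"
  using tendsto_inverse[OF I] \<kappa>(1) by (simp add: field_simps)
 have upper_lim: "((%t. 1 / b * (ln t / ?I t)) \<longlongrightarrow> 1 / (b * \<kappa>)) at_top"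
  using tendsto_mult_left[OF lnI, of "1 / b"] by simp
 have upper: "\<forall>\<^sub>F t in at_top. w t * ln t <= 1 / b * (ln t / ?I t)"
  using Ipos ln_pos eventually_ge_at_top[of 0]
 proof eventually_elim
  case (elim t)
  have "w t <= 1 / b / ?I t" using w_tail_primitive_le[OF elim(3)] elim(1) by (simp only: pos_le_divide_eq)
  from mult_right_mono[OF this, of "ln t"] elim show ?case by simp
 qed
 have w0: "(w \<longlongrightarrow> 0) at_top"
 proof (rule tendsto_sandwich)
  show "\<forall>\<^sub>F t in at_top. 0 <= w t" using eventually_ge_at_top[of 0] by eventually_elim (rule loc_boundedD(1)[OF w])
  show "\<forall>\<^sub>F t in at_top. w t <= 1 / b * (ln t / ?I t) / ln t"
   using upper ln_pos by eventually_elim (simp only: pos_le_divide_eq)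
  show "((%t. 1 / b * (ln t / ?I t) / ln t) \<longlongrightarrow> 0) at_top"
   by (rule tendsto_divide_0[OF upper_lim]) (rule filterlim_at_top_imp_at_infinity[OF ln_at_top])
 qed simp
 have prim0: "((%t. primitive w t / t) \<longlongrightarrow> 0) at_top"
  by (rule primitive_asymp[OF w, where V="%t. t" and V'="%_. 1" and ?T0.0=0])
   (use w0 in \<open>auto intro!: filterlim_ident\<close>)
 have half: "filterlim (%t::real. t / 2) at_top at_top" by real_asymp
 have h0: "((%t. hconv w tail t) \<longlongrightarrow> 0) at_top"
 proof (rule tendsto_sandwich)
  show "\<forall>\<^sub>F t in at_top. 0 <= hconv w tail t"
   using eventually_ge_at_top[of 0] by eventually_elim (rule hconv_bound(1)[OF tail_loc_bounded w, where b=1], auto simp: tail_le_1)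
  show "\<forall>\<^sub>F t in at_top. hconv w tail t <= 2 * (tail (t/2) * (t/2)) * (primitive w t / t)"
   using eventually_gt_at_top[of 0]
  proof eventually_elim
   case (elim t)
   have "hconv w tail t <= tail (t/2) * primitive w t"
    by (rule hconv_bound(2)[OF tail_loc_bounded w]) (use elim tail_antimono in auto)
   also have "... = 2 * (tail (t/2) * (t/2)) * (primitive w t / t)" using elim by simp
   finally show ?case .
  qed
  have "((%t. 2 * (tail (t/2) * (t/2)) * (primitive w t / t)) \<longlongrightarrow> 2 * \<kappa> * 0) at_top"
   by (intro tendsto_intros prim0 filterlim_compose[OF \<kappa>(2) half])
  then show "((%t. 2 * (tail (t/2) * (t/2)) * (primitive w t / t)) \<longlongrightarrow> 0) at_top" by simp
 qed simp
 define low where "low t = ((1 - tail t) / b - hconv w tail t) * (ln (t/2) / ln t) * (ln t / ?I t)" for t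
 have "((%t. ln (t/2) / ln t) \<longlongrightarrow> (1::real)) at_top" by real_asymp
 then have "(low \<longlongrightarrow> ((1 - 0) / b - 0) * 1 * (1 / \<kappa>)) at_top"
  unfolding low_def by (intro tendsto_intros tail_tendsto h0 lnI) (use b in auto)
 moreover have "filterlim (%t::real. 2 * t) at_top at_top" by real_asymp
 ultimately have low_lim: "((%t. low (2 * t)) \<longlongrightarrow> ((1 - 0) / b - 0) * 1 * (1 / \<kappa>)) at_top"
  by (rule filterlim_compose)
 have "\<forall>\<^sub>F t in at_top. low t <= w (t/2) * ln (t/2)"
  using Ipos ln_pos eventually_ge_at_top[of 2]
 proof eventually_elim
  case (elim t)
  have "hconv tail w t <= w (t/2) * ?I t"
   by (rule hconv_bound(2)[OF w tail_loc_bounded]) (use elim w_anti in auto)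
  moreover have "conv w tail t = hconv w tail t + hconv tail w t"
   by (rule conv_eq_hconv[OF w tail_loc_bounded]) (use elim in simp)
  ultimately have "(1 - tail t) / b - hconv w tail t <= w (t/2) * ?I t"
   using conv_tail(1)[of t] elim by simp
  then have "((1 - tail t) / b - hconv w tail t) * (ln (t/2) / ?I t) <= (w (t/2) * ?I t) * (ln (t/2) / ?I t)"
   using elim by (intro mult_right_mono) auto
  then show ?case using elim by (simp add: low_def)
 qed
 then have "\<forall>\<^sub>F t in at_top. low (2 * t) <= w (2 * t / 2) * ln (2 * t / 2)"
  using \<open>filterlim (%t::real. 2 * t) at_top at_top\<close> unfolding filterlim_iff by blast
 then have lower: "\<forall>\<^sub>F t in at_top. low (2 * t) <= w t * ln t" by simp
 show ?thesis
  by (rule tendsto_sandwich[OF lower upper _ upper_lim]) (use low_lim in simp)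
qed

text \<open>Convolving the identity for \<open>tail\<close> once more with \<open>tail\<close> produces the kernel
\<open>conv tail tail\<close>, which converges to a positive constant. Hence the primitive of \<open>w\<close>
is asymptotic to a multiple of the primitive of \<open>tail\<close>, that is of \<open>sqrt t\<close>, and
monotonicity passes from the primitive to \<open>w\<close>.\<close>
theorem tail_sqrt:
 assumes \<kappa>: "0 < \<kappa>" "((%t. tail t * sqrt t) \<longlongrightarrow> \<kappa>) at_top"
 obtains C where "0 < C" "((%t. w t * sqrt t) \<longlongrightarrow> C) at_top"
proof -
 obtain e where e: "0 < e" "(conv tail tail \<longlongrightarrow> e) at_top"
  using self_conv_sqrt[OF tail_loc_bounded \<kappa>(2,1)] .
 let ?E = "conv tail tail"
 have E: "loc_bounded ?E" by (rule loc_bounded_conv[OF tail_loc_bounded tail_loc_bounded])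
 have "\<forall>\<^sub>F t in at_top. ?E t < e + 1" using e(2) by (rule order_tendstoD) simp
 then obtain T where T: "!!t. T <= t ==> ?E t < e + 1" by (auto simp: eventually_at_top_linorder)
 obtain B0 where B0: "0 <= B0" "!!t. 0 <= t ==> t <= T ==> ?E t <= B0" using loc_bounded_bound[OF E, of T] by metis
 have EB: "?E t <= max B0 (e + 1)" if "0 <= t" for t
  using T[of t] B0(2)[OF that] by (cases "T <= t") (auto simp: max_def)
 have one: "loc_bounded (%_. 1)" by (rule loc_bounded_const) simp
 have conv_E: "conv ?E w t = (primitive tail t - ?E t) / b" if t: "0 <= t" for t
 proof -
  have one_eq: "b * conv tail w s + tail s = 1" if "0 <= s" for s
   unfolding conv_tail(2)[OF that] using b by simp
  have assoc: "conv ?E w t = conv tail (conv tail w) t" by (rule conv_assoc[OF tail_loc_bounded tail_loc_bounded w])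
  have "b * conv ?E w t + ?E t = conv tail (%t. b * conv tail w t) t + ?E t"
   by (simp only: assoc conv_cmult_right)
  also have "... = conv tail (%t. b * conv tail w t + tail t) t"
   by (rule conv_add_right[symmetric, OF tail_loc_bounded loc_bounded_cmult[OF less_imp_le[OF b] loc_bounded_conv[OF tail_loc_bounded w]] tail_loc_bounded])
  also have "... = conv tail (%_. 1) t" by (rule conv_cong[OF refl one_eq])
  also have "... = primitive tail t" by (rule conv_commute[OF tail_loc_bounded one])
  finally have "b * conv ?E w t + ?E t = primitive tail t" .
  then show ?thesis using b by (simp add: field_simps)
 qed
 have prim_tail: "((%t. primitive tail t / sqrt t) \<longlongrightarrow> 2 * \<kappa>) at_top"
 proof (rule primitive_asymp[OF tail_loc_bounded, where ?T0.0=1 and V'="%t. 1 / (2 * sqrt t)"])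
  have "((%t. 2 * (tail t * sqrt t)) \<longlongrightarrow> 2 * \<kappa>) at_top" by (intro tendsto_intros \<kappa>)
  then show "((%t. tail t / (1 / (2 * sqrt t))) \<longlongrightarrow> 2 * \<kappa>) at_top" by (simp add: mult_ac)
  show "(sqrt has_real_derivative 1 / (2 * sqrt t)) (at t)" if "1 <= t" for t :: real
   by (rule DERIV_cong[OF DERIV_real_sqrt]) (use that in \<open>auto simp: divide_simps\<close>)
  show "continuous_on {1..} (%t::real. 1 / (2 * sqrt t))" by (intro continuous_intros) auto
  show "filterlim sqrt at_top at_top" by (rule sqrt_at_top)
 qed auto
 have "((%t. conv ?E w t / sqrt t) \<longlongrightarrow> 2 * \<kappa> / b) at_top"
 proof (rule Lim_transform_eventually)
  have "((%t. ?E t / sqrt t) \<longlongrightarrow> 0) at_top"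
   by (rule tendsto_divide_0[OF e(2)]) (rule filterlim_at_top_imp_at_infinity[OF sqrt_at_top])
  then have "((%t. (primitive tail t / sqrt t - ?E t / sqrt t) / b) \<longlongrightarrow> (2 * \<kappa> - 0) / b) at_top"
   by (intro tendsto_intros prim_tail) (use b in auto)
  then show "((%t. (primitive tail t / sqrt t - ?E t / sqrt t) / b) \<longlongrightarrow> 2 * \<kappa> / b) at_top" by simp
  show "\<forall>\<^sub>F t in at_top. (primitive tail t / sqrt t - ?E t / sqrt t) / b = conv ?E w t / sqrt t"
   using eventually_ge_at_top[of 0] by eventually_elim (simp add: conv_E diff_divide_distrib divide_divide_eq_left mult.commute)
 qed
 note A = this
 have "((%t. (conv ?E w t - e * primitive w t) / sqrt t) \<longlongrightarrow> 0) at_top"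
 proof (rule conv_minus_primitive[OF E w EB e(2) w_le_0 sqrt_at_top])
  have "\<forall>\<^sub>F t in at_top. \<kappa> / 2 < tail t * sqrt t" using \<kappa> by (intro order_tendstoD(1)) auto
  then show "\<forall>\<^sub>F t in at_top. primitive w t <= 2 / (b * \<kappa>) * sqrt t"
   using eventually_gt_at_top[of 0]
  proof eventually_elim
   case (elim t)
   have U: "0 <= primitive w t" by (rule conv_nonneg[OF one w])
   have "\<kappa> / 2 * primitive w t <= tail t * sqrt t * primitive w t" using elim U by (intro mult_right_mono) auto
   also have "... = sqrt t * (tail t * primitive w t)" by simp
   also have "... <= sqrt t * (1 / b)" using elim by (intro mult_left_mono w_primitive_tail_le) auto
   finally show ?case using \<kappa>(1) b by (simp add: field_simps)
  qed
 qed
 from tendsto_divide[OF tendsto_diff[OF A this] tendsto_const less_imp_neq[OF e(1), symmetric]]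
 have "((%t. (conv ?E w t / sqrt t - (conv ?E w t - e * primitive w t) / sqrt t) / e) \<longlongrightarrow> (2 * \<kappa> / b - 0) / e) at_top" .
 moreover have "(conv ?E w t / sqrt t - (conv ?E w t - e * primitive w t) / sqrt t) / e = primitive w t / sqrt t" for t
  using e(1) by (simp add: diff_divide_distrib)
 ultimately have "((%t. primitive w t / sqrt t) \<longlongrightarrow> 2 * \<kappa> / b / e) at_top" by simp
 from antimono_primitive_sqrt[OF w w_anti this]
 have "((%t. w t * sqrt t) \<longlongrightarrow> 2 * \<kappa> / b / e / 2) at_top" .
 moreover have "0 < 2 * \<kappa> / b / e / 2" using \<kappa>(1) b e(1) by simp
 ultimately show thesis by (rule that[rotated])
qed

end

text \<open>L'Hospital's rule for tails of integrals.\<close>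
lemma mass_minus_primitive_asymp:
 fixes V v :: "real => real"
 assumes g: "loc_bounded g" "hl_integrable g" and lim: "((%t. g t / v t) \<longlongrightarrow> C) at_top"
  and V: "!!t. T0 <= t ==> (V has_real_derivative - v t) (at t)" "continuous_on {T0..} v" "!!t. T0 <= t ==> 0 < v t"
   "!!t. T0 <= t ==> 0 < V t"
  and V0: "(V \<longlongrightarrow> 0) at_top" and "0 <= T0"
 shows "((%t. (mass g - primitive g t) / V t) \<longlongrightarrow> C) at_top"
 unfolding tendsto_iff
proof (intro allI impI)
 fix e :: real assume e: "0 < e"
 have "\<forall>\<^sub>F t in at_top. dist (g t / v t) C < e / 2" using lim e by (intro tendstoD) auto
 then have "\<forall>\<^sub>F t in at_top. T0 <= t & dist (g t / v t) C < e / 2"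
  using eventually_ge_at_top[of T0] by eventually_elim auto
 then obtain T where T: "!!t. T <= t ==> T0 <= t & \<bar>g t / v t - C\<bar> < e / 2"
  by (auto simp: eventually_at_top_linorder dist_real_def)
 show "\<forall>\<^sub>F t in at_top. dist ((mass g - primitive g t) / V t) C < e"
  using eventually_ge_at_top[of T]
 proof eventually_elim
  case (elim t)
  have t: "T0 <= t" "0 <= t" using T[OF elim] \<open>0 <= T0\<close> by auto
  have close: "\<bar>g s - C * v s\<bar> <= e / 2 * v s" if "t < s" for s
  proof -
   have v: "0 < v s" using V(3)[of s] that t by auto
   have "g s - C * v s = (g s / v s - C) * v s" using v by (simp add: field_simps)
   then have "\<bar>g s - C * v s\<bar> = \<bar>g s / v s - C\<bar> * v s" using v by (simp only: abs_mult abs_of_pos)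
   also have "... <= e / 2 * v s" using T[of s] elim that v by (intro mult_right_mono) auto
   finally show ?thesis .
  qed
  have inc: "\<bar>primitive g r - primitive g t - C * (- V r - - V t)\<bar> <= e / 2 * (- V r - - V t)" if "t <= r" for r
  proof (rule primitive_increment_bound[OF g(1) t(2) that, where V'=v])
   show "((%s. - V s) has_real_derivative v s) (at s)" if "t <= s" for s
    using DERIV_minus[OF V(1)[of s]] that t by simp
   show "continuous_on {t..} v" by (rule continuous_on_subset[OF V(2)]) (use t in auto)
  qed (rule close)
  have "\<bar>mass g - primitive g t - C * (- 0 - - V t)\<bar> <= e / 2 * (- 0 - - V t)"
  proof (rule tendsto_le)
   show "((%r. e / 2 * (- V r - - V t)) \<longlongrightarrow> e / 2 * (- 0 - - V t)) at_top"
    by (intro tendsto_intros V0)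
   show "((%r. \<bar>primitive g r - primitive g t - C * (- V r - - V t)\<bar>) \<longlongrightarrow> \<bar>mass g - primitive g t - C * (- 0 - - V t)\<bar>) at_top"
    by (intro tendsto_intros V0 primitive_tendsto_mass g)
   show "\<forall>\<^sub>F r in at_top. \<bar>primitive g r - primitive g t - C * (- V r - - V t)\<bar> <= e / 2 * (- V r - - V t)"
    using eventually_ge_at_top[of t] by eventually_elim (rule inc)
  qed simp
  then have main: "\<bar>mass g - primitive g t - C * V t\<bar> <= e / 2 * V t" by simp
  have Vt: "0 < V t" using V(4) t by simp
  have "(mass g - primitive g t) / V t - C = (mass g - primitive g t - C * V t) / V t" using Vt by (simp add: field_simps)
  then have "\<bar>(mass g - primitive g t) / V t - C\<bar> <= e / 2"
   using main Vt by (simp add: abs_divide pos_divide_le_eq)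
  then show ?case using e by (simp add: dist_real_def)
 qed
qed

section \<open>The subcritical case\<close>

text \<open>The upper limit of \<open>e\<close> is at most \<open>x\<close> times itself.\<close>
lemma contraction_tendsto_0:
 fixes e :: "real => real"
 assumes nn: "\<forall>\<^sub>F t in at_top. 0 <= e t" and B: "\<forall>\<^sub>F t in at_top. e t <= B" and x: "0 <= x" "x < 1"
  and contr: "!!B \<epsilon>. 0 < B ==> 0 < \<epsilon> ==> \<forall>\<^sub>F t in at_top. e t <= B ==> \<forall>\<^sub>F t in at_top. e t <= x * B + \<epsilon>"
 shows "(e \<longlongrightarrow> 0) at_top"
proof -
 define B0 where "B0 = \<bar>B\<bar> + 1"
 define y where "y = (1 + x) / 2"
 have y: "0 < y" "y < 1" using x by (auto simp: y_def)
 have B0: "0 < B0" by (simp add: B0_def)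
 have iter: "\<forall>\<^sub>F t in at_top. e t <= y ^ n * B0" for n
 proof (induction n)
  case 0
  show ?case using B by eventually_elim (simp add: B0_def)
 next
  case (Suc n)
  have p: "0 < y ^ n * B0" using y B0 by simp
  have "\<forall>\<^sub>F t in at_top. e t <= x * (y ^ n * B0) + (1 - x) / 2 * (y ^ n * B0)"
   by (rule contr[OF p _ Suc]) (use x p in simp)
  moreover have "x * (y ^ n * B0) + (1 - x) / 2 * (y ^ n * B0) = y ^ Suc n * B0" by (simp add: y_def field_simps)
  ultimately show ?case by simp
 qed
 show ?thesis
 proof (rule order_tendstoI)
  fix l :: real assume "l < 0"
  show "\<forall>\<^sub>F t in at_top. l < e t" using nn by eventually_elim (use \<open>l < 0\<close> in simp)
 next
  fix u :: real assume u: "0 < u"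
  have "(%n. y ^ n * B0) \<longlonglongrightarrow> 0 * B0" by (intro tendsto_intros LIMSEQ_power_zero) (use y in simp)
  then have "\<forall>\<^sub>F n in sequentially. y ^ n * B0 < u" using u by (intro order_tendstoD(2)) auto
  then obtain n where n: "y ^ n * B0 < u" by (auto simp: eventually_sequentially)
  show "\<forall>\<^sub>F t in at_top. e t < u" using iter[of n] by eventually_elim (use n in simp)
 qed
qed

lemma power_weight:
 fixes \<theta> :: real
 assumes \<theta>: "0 <= \<theta>"
 defines "u \<equiv> %t::real. (1 + t) powr (- \<theta>)"
 shows "loc_bounded u" "!!t. 0 <= t ==> 0 < u t" "!!s t. 0 <= s ==> s <= t ==> u t <= u s"
  "((%t. u (t - s) / u t) \<longlongrightarrow> 1) at_top"
  "!!r s t. 0 < r ==> r <= 1 ==> 0 <= t ==> r * t <= s ==> u s <= r powr (- \<theta>) * u t"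
proof -
 show "loc_bounded u" unfolding u_def
  by (rule continuous_on_loc_bounded) (auto intro!: continuous_intros)
 show "0 < u t" if "0 <= t" for t using that by (simp add: u_def)
 show "u t <= u s" if "0 <= s" "s <= t" for s t using that \<theta> unfolding u_def by (intro powr_mono2') auto
 show "u s <= r powr (- \<theta>) * u t" if "0 < r" "r <= 1" "0 <= t" "r * t <= s" for r s t
 proof -
  have "r * (1 + t) <= 1 + s" using that by (simp add: algebra_simps)
  moreover have "0 < r * (1 + t)" using that by simp
  ultimately have "(1 + s) powr (- \<theta>) <= (r * (1 + t)) powr (- \<theta>)" using \<theta> by (intro powr_mono2') auto
  then show ?thesis using that by (simp add: u_def powr_mult)
 qed
 have "((%t. ((1 + (t - s)) / (1 + t)) powr (- \<theta>)) \<longlongrightarrow> 1 powr (- \<theta>)) at_top"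
 proof (rule tendsto_powr)
  show "((%t. (1 + (t - s)) / (1 + t)) \<longlongrightarrow> 1) at_top" by real_asymp
 qed auto
 moreover have "\<forall>\<^sub>F t in at_top. ((1 + (t - s)) / (1 + t)) powr (- \<theta>) = u (t - s) / u t"
  using eventually_ge_at_top[of 0] eventually_ge_at_top[of s]
  by eventually_elim (simp add: u_def powr_divide)
 ultimately show "((%t. u (t - s) / u t) \<longlongrightarrow> 1) at_top"
  by (simp add: Lim_transform_eventually)
qed

text \<open>Since \<open>b * mass p < 1\<close>, the renewal equation is a contraction in the norm weighted with \<open>1 /
u\<close>: first for the bound \<open>w \<le> D * u\<close>, then for the distance of \<open>w / u\<close> from
the limit, which is the fixed point of the equation satisfied by the limits.\<close>
theorem subcritical_renewal:
 fixes p w :: "real => real" and b \<theta> c :: real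
 defines "u \<equiv> %t::real. (1 + t) powr (- \<theta>)"
 assumes p: "loc_bounded p" "hl_integrable p" and w: "loc_bounded w" and b: "0 < b" and \<theta>: "0 <= \<theta>"
  and sub: "b * mass p < 1"
  and renewal_eq: "!!t. 0 <= t ==> w t = p t + b * conv p w t"
  and lim: "((%t. p t / u t) \<longlongrightarrow> c) at_top" and c: "0 < c"
 obtains L where "0 < L" "hl_integrable w" "((%t. w t / u t) \<longlongrightarrow> L) at_top"
proof -
 have u1: "loc_bounded u" unfolding u_def by (rule power_weight(1)[OF \<theta>])
 have u2: "0 < u t" if "0 <= t" for t unfolding u_def by (rule power_weight(2)[OF \<theta> that])
 have u3: "u t <= u s" if "0 <= s" "s <= t" for s t unfolding u_def by (rule power_weight(3)[OF \<theta> that])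
 have u4: "((%t. u (t - s) / u t) \<longlongrightarrow> 1) at_top" for s unfolding u_def by (rule power_weight(4)[OF \<theta>])
 have u5: "u s <= r powr (- \<theta>) * u t" if "0 < r" "r <= 1" "0 <= t" "r * t <= s" for r s t
  unfolding u_def by (rule power_weight(5)[OF \<theta> that])
 note u = u1 u2 u3 u4 u5
 define x where "x = b * mass p"
 have x: "0 <= x" "x < 1" using b sub mass_nonneg[OF p(1)] by (auto simp: x_def)
 have one: "loc_bounded (%_. 1)" by (rule loc_bounded_const) simp
 define M where "M = mass p / (1 - x)"
 have prim_w: "primitive w t <= M" if t: "0 <= t" for t
 proof -
  have "primitive w t = conv (%_. 1) (%t. p t + b * conv p w t) t"
   by (rule conv_cong) (auto intro: renewal_eq)
  also have "... = primitive p t + b * conv (%_. 1) (conv p w) t"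
   using conv_add_right[OF one p(1) loc_bounded_cmult[OF less_imp_le[OF b] loc_bounded_conv[OF p(1) w]]]
   by (simp add: conv_cmult_right)
  also have "conv (%_. 1) (conv p w) t = conv (conv (%_. 1) p) w t" by (rule conv_assoc[OF one p(1) w, symmetric])
  also have "conv (conv (%_. 1) p) w t = conv (conv p (%_. 1)) w t"
   by (rule conv_cong) (auto intro: conv_commute one p)
  also have "... = conv p (primitive w) t" by (rule conv_assoc[OF p(1) one w])
  also have "conv p (primitive w) t <= conv p (%_. primitive w t) t"
   by (rule conv_mono[OF p(1) p(1) loc_bounded_primitive[OF w] loc_bounded_const[OF conv_nonneg[OF one w]]])
    (auto intro: primitive_mono[OF w])
  also have "... = conv (%_. primitive w t) p t" by (rule conv_commute[OF p(1) loc_bounded_const[OF conv_nonneg[OF one w]]])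
  also have "... = primitive w t * primitive p t" by (rule conv_const_left)
  also have "... <= primitive w t * mass p" by (intro mult_left_mono primitive_le_mass p conv_nonneg one w)
  finally have "primitive w t <= primitive p t + b * (primitive w t * mass p)" using b by simp
  also have "primitive p t <= mass p" by (rule primitive_le_mass[OF p])
  finally have "primitive w t * (1 - x) <= mass p" by (simp add: x_def algebra_simps)
  then show ?thesis using x by (simp add: M_def pos_le_divide_eq)
 qed
 have wi: "hl_integrable w" by (rule hl_integrableI_bounded_primitive[OF w prim_w])
 have M0: "0 <= M" using x mass_nonneg[OF p(1)] by (simp add: M_def)
 obtain A where A: "0 <= A" "!!t. 0 <= t ==> p t <= A * u t"
 proof -
  have "\<forall>\<^sub>F t in at_top. p t / u t < c + 1" using lim by (rule order_tendstoD) simp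
  then have "\<forall>\<^sub>F t in at_top. 0 <= t & p t / u t < c + 1" using eventually_ge_at_top[of 0] by eventually_elim auto
  then obtain T where T: "!!t. T <= t ==> 0 <= t & p t / u t < c + 1" by (auto simp: eventually_at_top_linorder)
  have T0: "0 <= T" using T by auto
  obtain B where B: "0 <= B" "!!t. 0 <= t ==> t <= T ==> p t <= B" using loc_bounded_bound[OF p(1), of T] by metis
  show thesis
  proof (rule that[of "c + 1 + B / u T"])
   have BT: "0 <= B / u T" using B(1) u(2)[OF T0] by simp
   then show "0 <= c + 1 + B / u T" using c by simp
   fix t :: real assume t: "0 <= t"
   show "p t <= (c + 1 + B / u T) * u t"
   proof (cases "T <= t")
    case True
    then have "p t <= (c + 1) * u t" using T[OF True] u(2)[OF t] by (simp add: pos_divide_less_eq)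
    moreover have "0 <= B / u T * u t" by (intro mult_nonneg_nonneg BT less_imp_le[OF u(2)[OF t]])
    ultimately show ?thesis unfolding distrib_right[of "c + 1"] by linarith
   next
    case False
    then have "p t <= B" using B(2)[OF t] by simp
    also have "B = B / u T * u T" using u(2)[OF T0] by simp
    also have "... <= B / u T * u t" using u(3)[OF t] False BT by (intro mult_left_mono) auto
    also have "... <= (c + 1 + B / u T) * u t" using c u(2)[OF t] by (intro mult_right_mono) auto
    finally show ?thesis .
   qed
  qed
 qed
 define y where "y = (1 + x) / 2"
 have y: "x < y" "0 < y" "y < 1" using x by (auto simp: y_def)
 have "((%d. x * (1 - d) powr (- \<theta>)) \<longlongrightarrow> x * (1 - 0) powr (- \<theta>)) (at_right 0)"
  by (intro tendsto_intros) auto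
 then have "\<forall>\<^sub>F d in at_right 0. x * (1 - d) powr (- \<theta>) < y" using y by (intro order_tendstoD(2)) auto
 moreover have "\<forall>\<^sub>F d in at_right (0::real). 0 < d & d < 1"
  using eventually_at_right_real[of 0 1] by (simp add: greaterThanLessThan_def)
 ultimately have "\<forall>\<^sub>F d in at_right 0. x * (1 - d) powr (- \<theta>) < y & 0 < d & d < 1" by eventually_elim auto
 then obtain d where d: "x * (1 - d) powr (- \<theta>) < y" "0 < d" "d < 1"
  using eventually_happens[of _ "at_right (0::real)"] by auto
 define A2 where "A2 = A + b * (A * d powr (- \<theta>)) * M"
 have A2: "0 <= A2" using A(1) b M0 by (simp add: A2_def)
 have step: "w t <= (A2 + y * D) * u t"
  if D: "0 <= D" "!!s. 0 <= s ==> s <= T ==> w s <= D * u s" and t: "0 <= t" "t <= T" for D t T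
 proof -
  define k1 where "k1 = D * ((1 - d) powr (- \<theta>) * u t)"
  define k2 where "k2 = A * (d powr (- \<theta>) * u t)"
  have k: "0 <= k1" "0 <= k2" using D(1) A(1) u(2)[OF t(1)] by (simp_all add: k1_def k2_def)
  have "conv p w t <= conv p (%_. k1) t + conv (%_. k2) w t"
  proof -
   have i: "integrable lborel (%s. indicator {0..t} s * (p (t - s) * k1))" "integrable lborel (%s. indicator {0..t} s * (k2 * w s))"
    using conv_integrable[OF p(1) loc_bounded_const[OF k(1)], of t] conv_integrable[OF loc_bounded_const[OF k(2)] w, of t] by auto
   have "conv p w t <= (\<integral>s. indicator {0..t} s * (p (t - s) * k1) + indicator {0..t} s * (k2 * w s) \<partial>lborel)"
    unfolding conv_def
   proof (rule integral_mono[OF conv_integrable[OF p(1) w] Bochner_Integration.integrable_add[OF i]])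
    fix s
    show "indicator {0..t} s * (p (t - s) * w s) <= indicator {0..t} s * (p (t - s) * k1) + indicator {0..t} s * (k2 * w s)"
    proof (cases "0 <= s & s <= t")
     case True
     have nn: "0 <= p (t - s)" "0 <= w s" using loc_boundedD(1)[OF p(1), of "t - s"] loc_boundedD(1)[OF w, of s] True by auto
     have "p (t - s) * w s <= p (t - s) * k1 + k2 * w s"
     proof (cases "(1 - d) * t <= s")
      case True': True
      have "w s <= D * u s" using D(2)[of s] True t by simp
      also have "u s <= (1 - d) powr (- \<theta>) * u t" by (rule u(5)) (use d t True' in auto)
      finally have "w s <= k1" using D(1) by (simp add: k1_def mult_left_mono)
      then have "p (t - s) * w s <= p (t - s) * k1" using nn by (intro mult_left_mono)
      moreover have "0 <= k2 * w s" using k nn by simp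
      ultimately show ?thesis by linarith
     next
      case False
      have "p (t - s) <= A * u (t - s)" using A(2)[of "t - s"] True by simp
      also have "u (t - s) <= d powr (- \<theta>) * u t" by (rule u(5)) (use d t False in \<open>auto simp: algebra_simps\<close>)
      finally have "p (t - s) <= k2" using A(1) by (simp add: k2_def mult_left_mono)
      then have "p (t - s) * w s <= k2 * w s" using nn by (intro mult_right_mono)
      moreover have "0 <= p (t - s) * k1" using k nn by simp
      ultimately show ?thesis by linarith
     qed
     then show ?thesis using True by simp
    qed simp
   qed
   also have "... = conv p (%_. k1) t + conv (%_. k2) w t"
    unfolding conv_def by (rule Bochner_Integration.integral_add[OF i])
   finally show ?thesis .
  qed
  also have "conv p (%_. k1) t = k1 * primitive p t"
   by (rule trans[OF conv_commute[OF p(1) loc_bounded_const[OF k(1)]] conv_const_left])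
  also have "conv (%_. k2) w t = k2 * primitive w t" by (rule conv_const_left)
  also have "k1 * primitive p t + k2 * primitive w t <= k1 * mass p + k2 * M"
   by (intro add_mono mult_left_mono primitive_le_mass p prim_w t k)
  finally have "b * conv p w t <= b * (k1 * mass p + k2 * M)" using b by simp
  then have "w t <= A * u t + b * (k1 * mass p + k2 * M)"
   using renewal_eq[OF t(1)] A(2)[OF t(1)] by linarith
  also have "... = (A2 + x * (1 - d) powr (- \<theta>) * D) * u t"
   by (simp add: A2_def k1_def k2_def x_def algebra_simps)
  also have "... <= (A2 + y * D) * u t"
   using d(1) D(1) u(2)[OF t(1)] by (intro mult_right_mono add_left_mono) auto
  finally show ?thesis .
 qed
 define D where "D = A2 / (1 - y)"
 have D0: "0 <= D" using A2 y by (simp add: D_def)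
 have D_fix: "A2 = (1 - y) * D" using y by (simp add: D_def)
 have w_le: "w t <= D * u t" if t: "0 <= t" for t
 proof -
  obtain B where B: "0 <= B" "!!s. 0 <= s ==> s <= t ==> w s <= B" using loc_bounded_bound[OF w, of t] by metis
  define B1 where "B1 = B / u t"
  have B1: "0 <= B1" using B(1) u(2)[OF t] by (simp add: B1_def)
  have iter: "w s <= (D + y ^ n * B1) * u s" if "0 <= s" "s <= t" for s n
   using that
  proof (induction n arbitrary: s)
   case 0
   have "w s <= B1 * u t" using B(2)[OF 0] u(2)[OF t] by (simp add: B1_def)
   also have "... <= B1 * u s" using u(3)[OF 0] B1 by (intro mult_left_mono)
   also have "... <= (D + y ^ 0 * B1) * u s" using D0 u(2)[OF 0(1)] by (intro mult_right_mono) auto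
   finally show ?case .
  next
   case (Suc n)
   have "w s <= (A2 + y * (D + y ^ n * B1)) * u s"
    by (rule step[OF _ Suc.IH Suc.prems]) (use D0 y B1 in auto)
   also have "A2 + y * (D + y ^ n * B1) = D + y ^ Suc n * B1" by (simp add: D_fix algebra_simps)
   finally show ?case .
  qed
  have "(%n. (D + y ^ n * B1) * u t) \<longlonglongrightarrow> (D + 0 * B1) * u t"
   by (intro tendsto_intros LIMSEQ_power_zero) (use y in simp)
  then have "w t <= (D + 0 * B1) * u t" by (rule LIMSEQ_le_const) (use iter[OF t] in auto)
  then show ?thesis by simp
 qed
 define L where "L = c * (1 + b * mass w) / (1 - x)"
 have L0: "0 < L" using c b mass_nonneg[OF w] x by (simp add: L_def add_pos_nonneg)
 have L_fix: "L = c + b * (c * mass w) + x * L"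
 proof -
  have "(1 - x) * L = c * (1 + b * mass w)" using x by (simp add: L_def)
  then show ?thesis by (simp add: algebra_simps)
 qed
 have dom: "u (t - s) <= 2 powr \<theta> * u t" if "0 <= t" "0 <= s" "s <= t / 2" for t s
 proof -
  have "u (t - s) <= (1 / 2) powr (- \<theta>) * u t" by (rule u5) (use that in auto)
  moreover have "(1 / 2 :: real) powr (- \<theta>) = 2 powr \<theta>" by (simp add: powr_divide powr_minus)
  ultimately show ?thesis by simp
 qed
 have hu: "((%t. hconv p u t / u t) \<longlongrightarrow> 1 * mass p) at_top"
 proof (rule hconv_tendsto[OF p u(1), where ?T0.0=0 and K="2 powr \<theta>"])
  have "\<forall>\<^sub>F t in at_top. 1 = u t / u t"
   using eventually_ge_at_top[of 0] by eventually_elim (use u(2) in force)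
  then show "((%t. u t / u t) \<longlongrightarrow> 1) at_top" by (rule Lim_transform_eventually[OF tendsto_const])
 qed (use u(2,4) dom in auto)
 have hw: "((%t. hconv w p t / u t) \<longlongrightarrow> c * mass w) at_top"
  by (rule hconv_tendsto[OF w wi p(1), where ?T0.0=0 and K="2 powr \<theta>"]) (use u(2,4) dom lim in auto)
 define e where "e t = \<bar>w t / u t - L\<bar>" for t
 have "(e \<longlongrightarrow> 0) at_top"
 proof (rule contraction_tendsto_0[where x=x and B="D + L"])
  show "\<forall>\<^sub>F t in at_top. 0 <= e t" by (simp add: e_def)
  show "\<forall>\<^sub>F t in at_top. e t <= D + L"
   using eventually_ge_at_top[of 0]
  proof eventually_elim
   case (elim t)
   have "w t / u t <= D" using w_le[OF elim] u(2)[OF elim] by (simp add: pos_divide_le_eq)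
   moreover have "0 <= w t / u t" using loc_boundedD(1)[OF w elim] u(2)[OF elim] by simp
   ultimately show ?case using L0 D0 unfolding e_def by linarith
  qed
  fix B \<epsilon> :: real assume B: "0 < B" and \<epsilon>: "0 < \<epsilon>" and ev: "\<forall>\<^sub>F t in at_top. e t <= B"
  obtain T where T: "!!t. T <= t ==> e t <= B" using ev by (auto simp: eventually_at_top_linorder)
  define R where "R t = \<bar>p t / u t - c\<bar> + b * \<bar>hconv w p t / u t - c * mass w\<bar> + b * (B * (hconv p u t / u t) + L * \<bar>hconv p u t / u t - mass p\<bar>)" for t
  have "(R \<longlongrightarrow> \<bar>c - c\<bar> + b * \<bar>c * mass w - c * mass w\<bar> + b * (B * (1 * mass p) + L * \<bar>1 * mass p - mass p\<bar>)) at_top"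
   unfolding R_def by (intro tendsto_intros lim hw hu)
  then have "(R \<longlongrightarrow> x * B) at_top" by (simp add: x_def mult_ac)
  then have "\<forall>\<^sub>F t in at_top. R t < x * B + \<epsilon>" using \<epsilon> by (intro order_tendstoD(2)) auto
  then show "\<forall>\<^sub>F t in at_top. e t <= x * B + \<epsilon>"
   using eventually_ge_at_top[of 0] eventually_ge_at_top[of "2 * T"]
  proof eventually_elim
   case (elim t)
   have ut: "0 < u t" by (rule u(2)[OF elim(2)])
   have "\<bar>hconv p w t - L * hconv p u t\<bar> <= B * hconv p u t"
   proof -
    have i1: "integrable lborel (%s. indicator {0..t/2} s * (p s * w (t - s)))" by (rule hconv_integrable[OF p(1) w])
    have i2: "integrable lborel (%s. indicator {0..t/2} s * (p s * u (t - s)))" by (rule hconv_integrable[OF p(1) u(1)])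
    have eq: "hconv p w t - L * hconv p u t = (\<integral>s. indicator {0..t/2} s * (p s * w (t - s)) - L * (indicator {0..t/2} s * (p s * u (t - s))) \<partial>lborel)"
     unfolding hconv_def using Bochner_Integration.integral_diff[OF i1 integrable_mult_right[OF i2, of L]] by simp
    have eq2: "B * hconv p u t = (\<integral>s. B * (indicator {0..t/2} s * (p s * u (t - s))) \<partial>lborel)"
     unfolding hconv_def by (rule integral_mult_right_zero[symmetric])
    show ?thesis
     unfolding eq eq2
    proof (rule order_trans[OF integral_abs_bound], rule integral_mono)
     show "integrable lborel (%s. \<bar>indicator {0..t/2} s * (p s * w (t - s)) - L * (indicator {0..t/2} s * (p s * u (t - s)))\<bar>)"
      by (intro integrable_abs Bochner_Integration.integrable_diff integrable_mult_right i1 i2)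
     show "integrable lborel (%s. B * (indicator {0..t/2} s * (p s * u (t - s))))" by (intro integrable_mult_right i2)
     fix s
     show "\<bar>indicator {0..t/2} s * (p s * w (t - s)) - L * (indicator {0..t/2} s * (p s * u (t - s)))\<bar> <= B * (indicator {0..t/2} s * (p s * u (t - s)))"
     proof (cases "0 <= s & s <= t / 2")
      case True
      have us: "0 < u (t - s)" using True elim by (intro u(2)) auto
      have "e (t - s) <= B" by (rule T) (use True elim in auto)
      then have "\<bar>w (t - s) / u (t - s) - L\<bar> * u (t - s) <= B * u (t - s)" using us by (simp add: e_def mult_right_mono)
      moreover have "\<bar>w (t - s) / u (t - s) - L\<bar> * u (t - s) = \<bar>w (t - s) - L * u (t - s)\<bar>"
      proof -
       have "w (t - s) - L * u (t - s) = (w (t - s) / u (t - s) - L) * u (t - s)" using us by (simp add: field_simps)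
       then show ?thesis using us by (simp only: abs_mult abs_of_pos)
      qed
      ultimately have "p s * \<bar>w (t - s) - L * u (t - s)\<bar> <= p s * (B * u (t - s))"
       using loc_boundedD(1)[OF p(1), of s] True by (intro mult_left_mono) auto
      moreover have "p s * \<bar>w (t - s) - L * u (t - s)\<bar> = \<bar>p s * w (t - s) - L * (p s * u (t - s))\<bar>"
      proof -
       have "p s * w (t - s) - L * (p s * u (t - s)) = p s * (w (t - s) - L * u (t - s))" by (simp add: algebra_simps)
       then show ?thesis using loc_boundedD(1)[OF p(1), of s] True by (simp only: abs_mult abs_of_nonneg)
      qed
      ultimately show ?thesis using True by (simp add: mult.left_commute)
     qed simp
    qed
   qed
   then have hc: "\<bar>hconv p w t / u t - L * (hconv p u t / u t)\<bar> <= B * (hconv p u t / u t)"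
    using ut by (simp add: diff_divide_distrib[symmetric] abs_divide divide_right_mono)
   have "w t / u t = p t / u t + b * (hconv w p t / u t) + b * (hconv p w t / u t)"
    using renewal_eq[OF elim(2)] conv_eq_hconv[OF p(1) w elim(2)] by (simp add: add_divide_distrib distrib_left)
   then have eqW: "w t / u t - L = (p t / u t - c) + b * (hconv w p t / u t - c * mass w)
     + b * ((hconv p w t / u t - L * (hconv p u t / u t)) + L * (hconv p u t / u t - mass p))"
    by (subst L_fix) (simp add: x_def algebra_simps)
   have tri: "\<bar>\<alpha> + \<beta> + \<gamma>\<bar> <= \<bar>\<alpha>\<bar> + \<bar>\<beta>\<bar> + \<bar>\<gamma>\<bar>" for \<alpha> \<beta> \<gamma> :: real by linarith
   have "e t <= \<bar>p t / u t - c\<bar> + \<bar>b * (hconv w p t / u t - c * mass w)\<bar>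
     + \<bar>b * ((hconv p w t / u t - L * (hconv p u t / u t)) + L * (hconv p u t / u t - mass p))\<bar>"
    unfolding e_def eqW by (rule tri)
   also have "... <= R t"
   proof -
    have "\<bar>(hconv p w t / u t - L * (hconv p u t / u t)) + L * (hconv p u t / u t - mass p)\<bar>
      <= B * (hconv p u t / u t) + L * \<bar>hconv p u t / u t - mass p\<bar>"
     using hc abs_triangle_ineq[of "hconv p w t / u t - L * (hconv p u t / u t)" "L * (hconv p u t / u t - mass p)"] L0
     by (simp only: abs_mult abs_of_pos)
    then show ?thesis unfolding R_def abs_mult using b by (simp add: mult_left_mono)
   qed
   finally show ?case using elim(1) by simp
  qed
 qed (use x in auto)
 then have "((%t. w t / u t - L) \<longlongrightarrow> 0) at_top" unfolding e_def by (rule tendsto_rabs_zero_cancel)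
 then have "((%t. w t / u t) \<longlongrightarrow> L) at_top" by (simp add: LIM_zero_iff)
 with L0 wi show thesis by (rule that)
qed

section \<open>Rank-one perturbations of a symmetric generator\<close>

lemma l2_bounded:
 assumes "phi \<in> l2"
 obtains B where "0 <= B" "!!x. \<bar>phi x\<bar> <= B"
proof
 let ?S = "\<Sum>\<^sub>\<infinity>x. (phi x)\<^sup>2"
 show "0 <= sqrt ?S" by (simp add: infsum_nonneg)
 show "\<bar>phi x\<bar> <= sqrt ?S" for x
 proof (rule real_le_rsqrt)
  show "\<bar>phi x\<bar>\<^sup>2 <= ?S"
   using finite_sum_le_infsum[of "%x. (phi x)\<^sup>2" UNIV "{x}"] assms by (simp add: l2_def)
 qed
qed

lemma l2_add_scaled:
 assumes "phi \<in> l2" "\<psi> \<in> l2"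
 shows "(%x. phi x + c * \<psi> x) \<in> l2"
proof -
 have s: "(%x. 2 * (phi x)\<^sup>2 + 2 * c\<^sup>2 * (\<psi> x)\<^sup>2) summable_on UNIV"
  using assms by (intro summable_on_add summable_on_cmult_right) (auto simp: l2_def)
 have "(phi x + c * \<psi> x)\<^sup>2 <= 2 * (phi x)\<^sup>2 + 2 * c\<^sup>2 * (\<psi> x)\<^sup>2" for x
  using zero_le_power2[of "phi x - c * \<psi> x"] by (simp add: power2_eq_square algebra_simps)
 then show ?thesis unfolding l2_def mem_Collect_eq by (intro summable_on_bounded[OF s]) simp
qed

lemma bounded_kernel_summable:
 fixes k :: "'s => 's => real"
 assumes k: "!!x y. 0 <= k x y" "!!x. (k x has_sum c) UNIV" and phi: "!!x. \<bar>phi x\<bar> <= B"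
 shows "(%y. k x y * phi y) summable_on UNIV" "\<bar>\<Sum>\<^sub>\<infinity>y. k x y * phi y\<bar> <= c * B"
proof -
 have le: "\<bar>k x y * phi y\<bar> <= k x y * B" for y using k(1)[of x y] phi[of y] by (simp add: abs_mult mult_left_mono)
 have s: "((%y. k x y * B) has_sum c * B) UNIV" by (rule has_sum_cmult_left[OF k(2)])
 show 1: "(%y. k x y * phi y) summable_on UNIV"
  by (rule summable_on_bounded[OF has_sum_imp_summable[OF s] le])
 have "(\<Sum>\<^sub>\<infinity>y. k x y * phi y) <= c * B" using le
  by (intro has_sum_mono[OF has_sum_infsum[OF 1] s]) (simp add: abs_le_iff)
 moreover have "(\<Sum>\<^sub>\<infinity>y. - (k x y * B)) <= (\<Sum>\<^sub>\<infinity>y. k x y * phi y)"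
  using le by (intro infsum_mono 1 summable_on_uminus[THEN iffD2] has_sum_imp_summable[OF s]) (simp add: abs_le_iff minus_le_iff)
 moreover have "(\<Sum>\<^sub>\<infinity>y. - (k x y * B)) = - (c * B)" using infsumI[OF s] by (simp add: infsum_uminus)
 ultimately show "\<bar>\<Sum>\<^sub>\<infinity>y. k x y * phi y\<bar> <= c * B" by linarith
qed

text \<open>Schur's test. The pointwise estimate is the Cauchy-Schwarz inequality with respect to the measure \<open>k
x\<close>, obtained from the square \<open>(m / c - phi y)\<^sup>2\<close>.\<close>
lemma symmetric_kernel_l2:
 fixes k :: "'s => 's => real"
 assumes k: "!!x y. 0 <= k x y" "!!x y. k x y = k y x" "!!x. (k x has_sum c) UNIV" and c: "0 < c"
  and phi: "phi \<in> l2"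
 shows "(%x. \<Sum>\<^sub>\<infinity>y. k x y * phi y) \<in> l2"
proof -
 obtain B where B: "!!x. \<bar>phi x\<bar> <= B" using l2_bounded[OF phi] by metis
 have "\<bar>(phi x)\<^sup>2\<bar> <= B\<^sup>2" for x using power_mono[OF B[of x], of 2] by simp
 then have sq: "(%y. k x y * (phi y)\<^sup>2) summable_on UNIV" for x by (rule bounded_kernel_summable(1)[OF k(1,3)])
 have le: "(\<Sum>\<^sub>\<infinity>y. k x y * phi y)\<^sup>2 <= c * (\<Sum>\<^sub>\<infinity>y. k x y * (phi y)\<^sup>2)" for x
 proof -
  define m where "m = (\<Sum>\<^sub>\<infinity>y. k x y * phi y)"
  have "((%y. 2 * (m / c) * (k x y * phi y)) has_sum 2 * (m / c) * m) UNIV"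
   unfolding m_def by (intro has_sum_cmult_right has_sum_infsum bounded_kernel_summable(1)[OF k(1,3) B])
  moreover have "((%y. (m / c)\<^sup>2 * k x y + k x y * (phi y)\<^sup>2) has_sum (m / c)\<^sup>2 * c + (\<Sum>\<^sub>\<infinity>y. k x y * (phi y)\<^sup>2)) UNIV"
   by (intro has_sum_add has_sum_cmult_right k(3) has_sum_infsum sq)
  moreover have "2 * (m / c) * (k x y * phi y) <= (m / c)\<^sup>2 * k x y + k x y * (phi y)\<^sup>2" for y
  proof -
   have "0 <= k x y * (m / c - phi y)\<^sup>2" using k(1) by simp
   then show ?thesis by (simp add: power2_eq_square algebra_simps)
  qed
  ultimately have "2 * (m / c) * m <= (m / c)\<^sup>2 * c + (\<Sum>\<^sub>\<infinity>y. k x y * (phi y)\<^sup>2)" by (rule has_sum_mono)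
  moreover have "(m / c)\<^sup>2 * c = m\<^sup>2 / c" "2 * (m / c) * m = 2 * (m\<^sup>2 / c)" using c by (simp_all add: power2_eq_square)
  ultimately have "m\<^sup>2 / c <= (\<Sum>\<^sub>\<infinity>y. k x y * (phi y)\<^sup>2)" by linarith
  then show ?thesis using c by (simp add: m_def pos_divide_le_eq mult.commute)
 qed
 have "(%(y, x). k x y * (phi y)\<^sup>2) summable_on UNIV \<times> UNIV"
 proof (rule summable_on_SigmaI[where g="%y. c * (phi y)\<^sup>2"])
  show "((%x. case (y, x) of (y, x) => k x y * (phi y)\<^sup>2) has_sum c * (phi y)\<^sup>2) UNIV" for y
   using has_sum_cmult_left[OF k(3)[of y], of "(phi y)\<^sup>2"] k(2) by simp
  show "(%y. c * (phi y)\<^sup>2) summable_on UNIV" using phi by (intro summable_on_cmult_right) (simp add: l2_def)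
 qed (use k(1) in auto)
 then have "(%(x, y). k x y * (phi y)\<^sup>2) summable_on UNIV \<times> UNIV"
  using has_sum_swap[where f="%(y, x). k x y * (phi y)\<^sup>2" and A=UNIV and B=UNIV]
  by (auto simp: summable_on_def case_prod_unfold)
 then have "(%x. \<Sum>\<^sub>\<infinity>y. k x y * (phi y)\<^sup>2) summable_on UNIV" by (rule summable_on_Sigma_banach)
 then have s: "(%x. c * (\<Sum>\<^sub>\<infinity>y. k x y * (phi y)\<^sup>2)) summable_on UNIV" by (rule summable_on_cmult_right)
 show ?thesis unfolding l2_def mem_Collect_eq by (rule summable_on_bounded[OF s]) (use le in simp)
qed

text \<open>A symmetric Markov generator \<open>Q - q\<close> together with its Green's function \<open>g\<close> at the
spectral parameter \<open>mu\<close>. The spectrum of a rank-one perturbation on the positive half line is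
then read off from the number \<open>g z z\<close>.\<close>
locale resolvent_kernel =
 fixes Q g :: "'s => 's => real" and q mu :: real
 assumes Q: "!!x y. 0 <= Q x y" "!!x y. Q x y = Q y x" "!!x. (Q x has_sum q) UNIV" and q: "0 < q"
  and g: "!!x y. 0 <= g x y" "!!x y. g x y = g y x" "!!x. (g x has_sum 1 / mu) UNIV" and mu: "0 < mu"
  and resolvent: "!!x y. (\<Sum>\<^sub>\<infinity>z. Q x z * g z y) = (mu + q) * g x y - (if x = y then 1 else 0)"
begin

definition shifted :: "('s => real) => 's => real" where
 "shifted phi x = (\<Sum>\<^sub>\<infinity>y. Q x y * phi y) - (mu + q) * phi x"

definition potential :: "('s => real) => 's => real" where
 "potential phi x = (\<Sum>\<^sub>\<infinity>y. g x y * phi y)"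

lemma shifted_add_scaled:
 assumes "!!x. \<bar>phi x\<bar> <= B" "!!x. \<bar>\<psi> x\<bar> <= B'"
 shows "shifted (%x. phi x + c * \<psi> x) x = shifted phi x + c * shifted \<psi> x"
proof -
 have "((%y. Q x y * phi y + c * (Q x y * \<psi> y)) has_sum (\<Sum>\<^sub>\<infinity>y. Q x y * phi y) + c * (\<Sum>\<^sub>\<infinity>y. Q x y * \<psi> y)) UNIV"
  by (intro has_sum_add has_sum_cmult_right has_sum_infsum bounded_kernel_summable(1)[OF Q(1,3) assms(1)]
    bounded_kernel_summable(1)[OF Q(1,3) assms(2)])
 then have "(\<Sum>\<^sub>\<infinity>y. Q x y * (phi y + c * \<psi> y)) = (\<Sum>\<^sub>\<infinity>y. Q x y * phi y) + c * (\<Sum>\<^sub>\<infinity>y. Q x y * \<psi> y)"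
  by (intro infsumI) (simp add: algebra_simps)
 then show ?thesis by (simp add: shifted_def algebra_simps)
qed

text \<open>Maximum principle: averaging with total weight \<open>q\<close> cannot reproduce \<open>mu + q\<close> times
the supremum.\<close>
lemma shifted_eq_0:
 assumes phi: "!!x. \<bar>phi x\<bar> <= B" and eq: "!!x. shifted phi x = 0"
 shows "phi x = 0"
proof -
 define S where "S = (SUP x. \<bar>phi x\<bar>)"
 have bdd: "bdd_above (range (%x. \<bar>phi x\<bar>))" using phi by (intro bdd_aboveI2)
 have le: "\<bar>phi x\<bar> <= S" for x unfolding S_def by (rule cSUP_upper[OF _ bdd]) simp
 have "(mu + q) * \<bar>phi x\<bar> <= q * S" for x
 proof -
  have "\<bar>\<Sum>\<^sub>\<infinity>y. Q x y * phi y\<bar> <= q * S" by (rule bounded_kernel_summable(2)[OF Q(1,3) le])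
  also have "(\<Sum>\<^sub>\<infinity>y. Q x y * phi y) = (mu + q) * phi x" using eq[of x] by (simp add: shifted_def)
  finally show ?thesis using q mu by (simp add: abs_mult)
 qed
 then have "\<bar>phi x\<bar> <= q * S / (mu + q)" for x using q mu by (simp add: pos_le_divide_eq mult.commute)
 then have "S <= q * S / (mu + q)" unfolding S_def by (intro cSUP_least) auto
 then have "mu * S <= 0" using q mu by (simp add: pos_le_divide_eq algebra_simps)
 then have "S <= 0" using mu by (simp add: mult_le_0_iff)
 then show ?thesis using le[of x] by simp
qed

lemma g_le: "g x y <= 1 / mu"
 using finite_sum_le_has_sum[OF g(3)[of x], of "{y}"] g(1) by simp

lemma g_bounded: "\<bar>g x y\<bar> <= 1 / mu" using g_le g(1) by simp

lemma shifted_g: "shifted (%x. g x y) x = - (if x = y then 1 else 0)"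
 by (simp add: shifted_def resolvent)

lemma g_l2: "(%x. g x y) \<in> l2"
proof -
 have s: "(%x. 1 / mu * g x y) summable_on UNIV"
  using g(2) by (intro summable_on_cmult_right) (metis (no_types, lifting) ext g(3) has_sum_imp_summable)
 have "(g x y)\<^sup>2 <= 1 / mu * g x y" for x unfolding power2_eq_square by (rule mult_right_mono[OF g_le g(1)])
 then show ?thesis unfolding l2_def mem_Collect_eq by (intro summable_on_bounded[OF s]) simp
qed

lemma potential_l2: "phi \<in> l2 ==> potential phi \<in> l2"
 using symmetric_kernel_l2[OF g] mu unfolding potential_def by simp

lemma shifted_l2:
 assumes "phi \<in> l2"
 shows "shifted phi \<in> l2"
 using l2_add_scaled[OF symmetric_kernel_l2[OF Q q assms] assms, of "- (mu + q)"]
 by (rule back_subst[of "%f. f \<in> l2"]) (auto simp: shifted_def algebra_simps)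

lemma shifted_potential:
 assumes phi: "!!x. \<bar>phi x\<bar> <= B"
 shows "shifted (potential phi) x = - phi x"
proof -
 have g_sum: "((%y. g z y * B) has_sum 1 / mu * B) UNIV" for z by (rule has_sum_cmult_left[OF g(3)])
 have s: "(%(z, y). Q x z * (g z y * B)) summable_on UNIV \<times> UNIV"
 proof (rule summable_on_SigmaI[where g="%z. Q x z * (1 / mu * B)"])
  show "((%y. case (z, y) of (z, y) => Q x z * (g z y * B)) has_sum Q x z * (1 / mu * B)) UNIV" for z
   using has_sum_cmult_right[OF g_sum] by simp
  show "(%z. Q x z * (1 / mu * B)) summable_on UNIV"
   by (rule summable_on_cmult_left[OF has_sum_imp_summable[OF Q(3)]])
  show "0 <= (case zy of (z, y) => Q x z * (g z y * B))" for zy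
   using Q(1) g(1) order_trans[OF abs_ge_zero phi[of x]] by (auto split: prod.split)
 qed
 have "(%(z, y). Q x z * (g z y * phi y)) summable_on UNIV \<times> UNIV"
 proof (rule summable_on_bounded[OF s])
  fix zy :: "'s \<times> 's"
  show "\<bar>case zy of (z, y) => Q x z * (g z y * phi y)\<bar> <= (case zy of (z, y) => Q x z * (g z y * B))"
   using Q(1) g(1) phi by (auto simp: abs_mult split: prod.split intro!: mult_left_mono)
 qed
 then have "(\<Sum>\<^sub>\<infinity>z. \<Sum>\<^sub>\<infinity>y. Q x z * (g z y * phi y)) = (\<Sum>\<^sub>\<infinity>y. \<Sum>\<^sub>\<infinity>z. Q x z * (g z y * phi y))"
  by (rule infsum_swap_banach)
 also have "(\<Sum>\<^sub>\<infinity>z. \<Sum>\<^sub>\<infinity>y. Q x z * (g z y * phi y)) = (\<Sum>\<^sub>\<infinity>z. Q x z * potential phi z)"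
  by (simp add: infsum_cmult_right' potential_def)
 also have "(\<Sum>\<^sub>\<infinity>y. \<Sum>\<^sub>\<infinity>z. Q x z * (g z y * phi y)) = (\<Sum>\<^sub>\<infinity>y. (\<Sum>\<^sub>\<infinity>z. Q x z * g z y) * phi y)"
  by (simp add: mult.assoc[symmetric] infsum_cmult_left')
 also have "... = (\<Sum>\<^sub>\<infinity>y. (mu + q) * (g x y * phi y) + (if y = x then - phi x else 0))"
  by (intro infsum_cong) (auto simp: resolvent algebra_simps)
 also have "... = (mu + q) * potential phi x + - phi x"
 proof (rule infsumI, rule has_sum_add)
  show "((%y. (mu + q) * (g x y * phi y)) has_sum (mu + q) * potential phi x) UNIV"
   unfolding potential_def
   by (intro has_sum_cmult_right has_sum_infsum bounded_kernel_summable(1)[OF g(1,3) phi])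
  show "((%y. if y = x then - phi x else 0) has_sum - phi x) UNIV"
   using has_sum_finite_neutralI[of "{x}" UNIV "%y. if y = x then - phi x else 0" "- phi x"] by simp
 qed
 finally show ?thesis by (simp add: shifted_def)
qed

lemma point_source_unique:
 assumes phi: "!!x. \<bar>phi x\<bar> <= B" and eq: "!!x. shifted phi x = (if x = z then - c else 0)"
 shows "phi x = c * g x z"
proof -
 have "\<bar>phi x + - c * g x z\<bar> <= B + \<bar>c\<bar> * (1 / mu)" for x
  using phi[of x] mult_left_mono[OF g_bounded[of x z], of "\<bar>c\<bar>"] abs_triangle_ineq[of "phi x" "- c * g x z"] by (simp add: abs_mult)
 moreover have "shifted (%x. phi x + - c * g x z) x = 0" for x
  unfolding shifted_add_scaled[where phi=phi and \<psi>="%x. g x z", OF phi g_bounded] eq shifted_g by simp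
 ultimately have "phi x + - c * g x z = 0" by (rule shifted_eq_0)
 then show ?thesis by simp
qed

text \<open>An eigenfunction of the perturbed operator solves the unperturbed equation with a point source, so it is a
multiple of the Green's function; evaluation at the source gives the condition.\<close>
theorem rank_one_eigenvalue:
 "(\<exists>phi\<in>l2. phi ~= (%x. 0) & (\<forall>x. shifted phi x + \<beta> * (if x = z then phi z else 0) = 0)) \<longleftrightarrow> \<beta> * g z z = 1"
proof
 assume "\<exists>phi\<in>l2. phi ~= (%x. 0) & (\<forall>x. shifted phi x + \<beta> * (if x = z then phi z else 0) = 0)"
 then obtain phi where phi: "phi \<in> l2" "phi ~= (%x. 0)" "!!x. shifted phi x + \<beta> * (if x = z then phi z else 0) = 0" by blast
 obtain B where B: "!!x. \<bar>phi x\<bar> <= B" using l2_bounded[OF phi(1)] by metis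
 have phi_eq: "phi x = \<beta> * phi z * g x z" for x
  by (rule point_source_unique[OF B]) (use phi(3) in \<open>auto simp: add_eq_0_iff2\<close>)
 then have "phi z ~= 0" using phi(2) by (metis mult_eq_0_iff ext)
 then show "\<beta> * g z z = 1" using phi_eq[of z] by simp
next
 assume \<beta>: "\<beta> * g z z = 1"
 have "shifted (%x. g x z) x + \<beta> * (if x = z then g z z else 0) = 0" for x using \<beta> by (simp add: shifted_g)
 moreover have "(%x. g x z) ~= (%x. 0)" using \<beta> by (metis mult_zero_right zero_neq_one)
 ultimately show "\<exists>phi\<in>l2. phi ~= (%x. 0) & (\<forall>x. shifted phi x + \<beta> * (if x = z then phi z else 0) = 0)"
  using g_l2 by blast
qed

text \<open>The preimage of \<open>\<psi>\<close> is minus the potential of \<open>\<psi>\<close>, corrected by a multiple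
of \<open>g\<close> that is chosen to cancel the perturbation; the correction exists because \<open>1 - \<beta>
* g z z\<close> is nonzero.\<close>
theorem rank_one_bijective:
 assumes \<beta>: "\<beta> * g z z ~= 1"
 shows "bij_betw (%phi x. shifted phi x + \<beta> * (if x = z then phi z else 0)) l2 l2"
 unfolding bij_betw_def
proof
 let ?H = "%phi x. shifted phi x + \<beta> * (if x = z then phi z else 0)"
 show "inj_on ?H l2"
 proof (rule inj_onI)
  fix phi \<psi> assume h: "phi \<in> l2" "\<psi> \<in> l2" "?H phi = ?H \<psi>"
  obtain B where B: "!!x. \<bar>phi x\<bar> <= B" using l2_bounded[OF h(1)] by metis
  obtain B' where B': "!!x. \<bar>\<psi> x\<bar> <= B'" using l2_bounded[OF h(2)] by metis
  let ?\<delta> = "%x. phi x + -1 * \<psi> x"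
  have "shifted ?\<delta> x + \<beta> * (if x = z then ?\<delta> z else 0) = 0" for x
   using fun_cong[OF h(3), of x] unfolding shifted_add_scaled[where phi=phi and \<psi>=\<psi>, OF B B'] by (auto simp: algebra_simps split: if_splits)
  then have "?\<delta> = (%x. 0)" using \<beta> rank_one_eigenvalue[where z=z and \<beta>=\<beta>] l2_add_scaled[OF h(1,2), of "-1"] by blast
  then show "phi = \<psi>" by (auto simp: fun_eq_iff)
 qed
 show "?H ` l2 = l2"
 proof
  show "?H ` l2 \<subseteq> l2"
  proof
   fix \<psi> assume "\<psi> \<in> ?H ` l2"
   then obtain phi where phi: "phi \<in> l2" "\<psi> = ?H phi" by blast
   have "(%x. (indicator {z} x :: real)\<^sup>2) summable_on UNIV"
    using has_sum_finite_neutralI[of "{z}" UNIV "%x. (indicator {z} x :: real)\<^sup>2" 1] by (auto intro: has_sum_imp_summable)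
   then have "(%x. indicator {z} x) \<in> l2" by (simp add: l2_def)
   from l2_add_scaled[OF shifted_l2[OF phi(1)] this, of "\<beta> * phi z"]
   show "\<psi> \<in> l2" unfolding phi(2) by (rule back_subst[of "%f. f \<in> l2"]) (auto simp: indicator_def)
  qed
  show "l2 \<subseteq> ?H ` l2"
  proof
   fix \<psi> :: "'s => real" assume \<psi>: "\<psi> \<in> l2"
   obtain B where B: "!!x. \<bar>\<psi> x\<bar> <= B" using l2_bounded[OF \<psi>] by metis
   define r where "r = potential \<psi>"
   have rb: "\<bar>r x\<bar> <= 1 / mu * B" for x unfolding r_def potential_def by (rule bounded_kernel_summable(2)[OF g(1,3) B])
   define c where "c = - \<beta> * r z / (1 - \<beta> * g z z)"
   have c: "c - \<beta> * (c * g z z) = - \<beta> * r z"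
   proof -
    have "c * (1 - \<beta> * g z z) = - \<beta> * r z" using \<beta> by (simp add: c_def)
    then show ?thesis by (simp add: algebra_simps)
   qed
   define phi where "phi x = c * g x z + -1 * r x" for x
   have "(%x. c * g x z) \<in> l2" using l2_add_scaled[OF g_l2[of z] g_l2[of z], of "c - 1"] by (simp add: algebra_simps)
   then have phi_l2: "phi \<in> l2" unfolding phi_def[abs_def] r_def by (rule l2_add_scaled[OF _ potential_l2[OF \<psi>]])
   have phi_eq: "phi = (%x. -1 * r x + c * g x z)" by (simp add: phi_def fun_eq_iff)
   have r_neg: "shifted (%x. -1 * r x) x = \<psi> x" for x
    using shifted_add_scaled[where phi="%_. 0" and \<psi>=r and c="-1" and B=0, OF _ rb] shifted_potential[OF B]
    by (simp add: r_def shifted_def[of "%_. 0"])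
   have rb': "\<bar>-1 * r x\<bar> <= 1 / mu * B" for x using rb[of x] by simp
   have "?H phi x = \<psi> x" for x
    unfolding phi_eq shifted_add_scaled[where phi="%x. -1 * r x" and \<psi>="%x. g x z", OF rb' g_bounded] r_neg shifted_g
    using c by (auto simp: algebra_simps)
   then have "?H phi = \<psi>" by (rule ext)
   then show "\<psi> \<in> ?H ` l2" using phi_l2 by blast
  qed
 qed
qed

end

section \<open>Laplace transforms\<close>

lemma mass_add:
 assumes "hl_integrable f" "hl_integrable g"
 shows "hl_integrable (%t. f t + g t)" "mass (%t. f t + g t) = mass f + mass g"
 using assms unfolding hl_integrable_def mass_def by (simp_all add: distrib_left)

lemma mass_cmult:
 assumes "hl_integrable f"
 shows "hl_integrable (%t. c * f t)" "mass (%t. c * f t) = c * mass f"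
 using assms unfolding hl_integrable_def mass_def by (simp_all add: mult.left_commute)

lemma mass_mono:
 assumes "hl_integrable f" "hl_integrable g" "!!t. 0 <= t ==> f t <= g t"
 shows "mass f <= mass g"
 unfolding mass_def
 by (rule integral_mono[OF assms(1)[unfolded hl_integrable_def] assms(2)[unfolded hl_integrable_def]])
  (use assms(3) in \<open>auto simp: indicator_def\<close>)

lemma mass_pos:
 assumes f: "loc_bounded f" "hl_integrable f" and pos: "!!t. T < t ==> 0 < f t"
 shows "0 < mass f"
proof (rule ccontr)
 assume "\<not> 0 < mass f"
 then have "(\<integral>s. indicator {0..} s * f s \<partial>lborel) = 0" using mass_nonneg[OF f(1)] by (simp add: mass_def)
 moreover have "AE s in lborel. 0 <= indicator {0..} s * f s"
  using loc_boundedD(1)[OF f(1)] by (auto simp: indicator_def)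
 ultimately have "AE s in lborel. indicator {0..} s * f s = 0"
  using integral_nonneg_eq_0_iff_AE[OF f(2)[unfolded hl_integrable_def]] by simp
 then have "AE s in lborel. s \<notin> {max 0 T<..<max 0 T + 1}"
  by eventually_elim (use pos in \<open>force simp: indicator_def split: if_splits\<close>)
 then have "{max 0 T<..<max 0 T + 1} \<in> null_sets lborel" by (subst AE_iff_null_sets) auto
 then have "emeasure lborel {max 0 T<..<max 0 T + 1} = 0" by (rule null_setsD1)
 then show False by simp
qed

lemma ennreal_mass:
 assumes "loc_bounded f" "hl_integrable f"
 shows "ennreal (mass f) = (\<integral>\<^sup>+t. halfline f t \<partial>lborel)"
 unfolding mass_def halfline_def
 by (rule nn_integral_eq_integral[symmetric]) (use assms loc_boundedD(1)[OF assms(1)] in \<open>auto simp: hl_integrable_def indicator_def\<close>)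

lemma mass_has_sum:
 fixes f :: "'i::countable => real => real"
 assumes f: "!!i. loc_bounded (f i)" "!!i. hl_integrable (f i)" and S: "loc_bounded S" "hl_integrable S"
  and sum: "!!t. 0 <= t ==> ((%i. f i t) has_sum S t) UNIV"
 shows "((%i. mass (f i)) has_sum mass S) UNIV"
proof (rule has_sum_of_nn_integral_count_space)
 have "(\<integral>\<^sup>+i. ennreal (mass (f i)) \<partial>count_space UNIV) = (\<integral>\<^sup>+i. \<integral>\<^sup>+t. halfline (f i) t \<partial>lborel \<partial>count_space UNIV)"
  by (simp add: ennreal_mass f)
 also have "... = (\<integral>\<^sup>+t. \<integral>\<^sup>+i. halfline (f i) t \<partial>count_space UNIV \<partial>lborel)"
  by (rule nn_integral_count_space_nn_integral[symmetric]) (use loc_boundedD(3)[OF f(1)] in auto)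
 also have "... = (\<integral>\<^sup>+t. halfline S t \<partial>lborel)"
 proof (rule nn_integral_cong)
  fix t
  show "(\<integral>\<^sup>+i. halfline (f i) t \<partial>count_space UNIV) = halfline S t"
  proof (cases "0 <= t")
   case True
   then show ?thesis
    using nn_integral_count_space_has_sum[OF sum[OF True]] loc_boundedD(1)[OF f(1)] by (simp add: halfline_def)
  qed (simp add: halfline_def)
 qed
 finally show "(\<integral>\<^sup>+i. ennreal (mass (f i)) \<partial>count_space UNIV) = ennreal (mass S)" by (simp add: ennreal_mass S)
qed (use mass_nonneg f S in auto)

definition laplace :: "(real => real) => real => real" where
 "laplace f mu = mass (%t. exp (- mu * t) * f t)"

lemma mass_exp:
 assumes "0 < mu"
 shows "hl_integrable (%t. exp (- mu * t))" "mass (%t. exp (- mu * t)) = 1 / mu"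
proof -
 have p: "primitive (%t. exp (- mu * t)) t = (1 - exp (- mu * t)) / mu" if "0 <= t" for t
 proof -
  have "primitive (%t. exp (- mu * t)) t = (exp (- mu * t) - 1) / (- mu)"
   unfolding primitive_eq by (rule integral_exp_Icc) (use that assms in auto)
  also have "... = (1 - exp (- mu * t)) / mu" using assms by (simp only: divide_minus_right minus_divide_left minus_diff_eq)
  finally show ?thesis .
 qed
 show i: "hl_integrable (%t. exp (- mu * t))"
  by (rule hl_integrableI_bounded_primitive[where B="1 / mu", OF loc_bounded_exp])
   (use p assms in \<open>simp add: divide_right_mono\<close>)
 have "((%t. exp (- mu * t)) \<longlongrightarrow> 0) at_top" using assms by real_asymp
 then have "((%t. (1 - exp (- mu * t)) / mu) \<longlongrightarrow> (1 - 0) / mu) at_top" by (intro tendsto_intros) (use assms in auto)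
 then have "((%t. (1 - exp (- mu * t)) / mu) \<longlongrightarrow> 1 / mu) at_top" by simp
 then have "(primitive (%t. exp (- mu * t)) \<longlongrightarrow> 1 / mu) at_top"
  by (rule Lim_transform_eventually) (rule eventually_mono[OF eventually_ge_at_top[of 0] p[symmetric]])
 then show "mass (%t. exp (- mu * t)) = 1 / mu"
  by (rule tendsto_unique[OF _ primitive_tendsto_mass[OF loc_bounded_exp i], rotated]) simp
qed

context
 fixes f :: "real => real"
 assumes f: "loc_bounded f" and f_le: "!!t. 0 <= t ==> f t <= 1"
begin

lemma laplace_integrand:
 assumes mu: "0 < mu"
 shows "loc_bounded (%t. exp (- mu * t) * f t)" "hl_integrable (%t. exp (- mu * t) * f t)"
proof -
 show 1: "loc_bounded (%t. exp (- mu * t) * f t)" by (rule loc_bounded_mult[OF loc_bounded_exp f])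
 show "hl_integrable (%t. exp (- mu * t) * f t)"
  by (rule hl_integrable_mono[OF 1 loc_bounded_exp mass_exp(1)[OF mu]]) (use f_le in simp)
qed

lemma laplace_nonneg: "0 < mu ==> 0 <= laplace f mu"
 unfolding laplace_def by (rule mass_nonneg[OF laplace_integrand(1)])

lemma laplace_le:
 assumes mu: "0 < mu"
 shows "laplace f mu <= 1 / mu"
 unfolding laplace_def mass_exp(2)[OF mu, symmetric]
 by (rule mass_mono[OF laplace_integrand(2)[OF mu] mass_exp(1)[OF mu]]) (use f_le in simp)

lemma laplace_lipschitz:
 assumes "0 < m" "m <= mu" "mu <= \<nu>"
 shows "\<bar>laplace f mu - laplace f \<nu>\<bar> <= (\<nu> - mu) * (4 / m\<^sup>2)"
proof -
 have pos: "0 < mu" "0 < \<nu>" using assms by auto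
 have diff: "laplace f mu - laplace f \<nu> = mass (%t. exp (- mu * t) * f t + (-1) * (exp (- \<nu> * t) * f t))"
  unfolding laplace_def mass_add(2)[OF laplace_integrand(2)[OF pos(1)] mass_cmult(1)[OF laplace_integrand(2)[OF pos(2)]]]
    mass_cmult(2)[OF laplace_integrand(2)[OF pos(2)]] by simp
 have i: "hl_integrable (%t. exp (- mu * t) * f t + (-1) * (exp (- \<nu> * t) * f t))"
  by (intro mass_add(1) mass_cmult(1) laplace_integrand pos)
 have le: "exp (- mu * t) * f t + (-1) * (exp (- \<nu> * t) * f t) <= ((\<nu> - mu) * (2 / m)) * exp (- (m / 2) * t)"
  and ge: "0 <= exp (- mu * t) * f t + (-1) * (exp (- \<nu> * t) * f t)" if t: "0 <= t" for t
 proof -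
  have "exp (- \<nu> * t) <= exp (- mu * t)" using assms t by (simp add: mult_right_mono)
  then have "0 <= (exp (- mu * t) - exp (- \<nu> * t)) * f t" using loc_boundedD(1)[OF f t] by simp
  then show "0 <= exp (- mu * t) * f t + (-1) * (exp (- \<nu> * t) * f t)" by (simp add: algebra_simps)
  have "(exp (- mu * t) - exp (- \<nu> * t)) * f t <= (exp (- mu * t) - exp (- \<nu> * t)) * 1"
   using f_le[OF t] \<open>exp (- \<nu> * t) <= exp (- mu * t)\<close> by (intro mult_left_mono) auto
  also have "... = exp (- mu * t) * (1 - exp (- ((\<nu> - mu) * t)))" by (simp add: algebra_simps exp_add[symmetric])
  also have "... <= exp (- m * t) * ((\<nu> - mu) * t)"
  proof (rule mult_mono)
   show "exp (- mu * t) <= exp (- m * t)" using assms t by (simp add: mult_right_mono)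
   show "1 - exp (- ((\<nu> - mu) * t)) <= (\<nu> - mu) * t" using exp_ge_add_one_self[of "- ((\<nu> - mu) * t)"] by linarith
  qed (use assms t in auto)
  also have "... = (\<nu> - mu) * (2 / m) * (exp (- m * t) * (m / 2 * t))" using assms by (simp add: field_simps)
  also have "... <= (\<nu> - mu) * (2 / m) * (exp (- m * t) * exp (m / 2 * t))"
   using exp_ge_add_one_self[of "m / 2 * t"] assms by (intro mult_left_mono) (auto simp del: exp_ge_add_one_self)
  also have "exp (- m * t) * exp (m / 2 * t) = exp (- (m / 2) * t)" by (simp add: exp_add[symmetric] field_simps)
  finally show "exp (- mu * t) * f t + (-1) * (exp (- \<nu> * t) * f t) <= ((\<nu> - mu) * (2 / m)) * exp (- (m / 2) * t)"
   by (simp add: algebra_simps)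
 qed
 have m2: "0 < m / 2" using assms by simp
 have "0 <= laplace f mu - laplace f \<nu>"
  unfolding diff mass_def by (rule Bochner_Integration.integral_nonneg) (use ge in \<open>auto simp: indicator_def\<close>)
 moreover have "laplace f mu - laplace f \<nu> <= mass (%t. ((\<nu> - mu) * (2 / m)) * exp (- (m / 2) * t))"
  unfolding diff by (rule mass_mono[OF i mass_cmult(1)[OF mass_exp(1)[OF m2]] le])
 moreover have "mass (%t. ((\<nu> - mu) * (2 / m)) * exp (- (m / 2) * t)) = (\<nu> - mu) * (4 / m\<^sup>2)"
  unfolding mass_cmult(2)[OF mass_exp(1)[OF m2]] mass_exp(2)[OF m2] by (simp add: power2_eq_square)
 ultimately show ?thesis by linarith
qed

lemma laplace_continuous:
 assumes "0 < m"
 shows "continuous_on {m..} (laplace f)"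
proof (rule lipschitz_on_continuous_on[OF lipschitz_onI])
 show "0 <= 4 / m\<^sup>2" by simp
 show "dist (laplace f mu) (laplace f \<nu>) <= 4 / m\<^sup>2 * dist mu \<nu>" if "mu \<in> {m..}" "\<nu> \<in> {m..}" for mu \<nu>
  using laplace_lipschitz[OF assms, of mu \<nu>] laplace_lipschitz[OF assms, of \<nu> mu] that
  by (cases "mu <= \<nu>") (auto simp: dist_real_def abs_minus_commute mult.commute)
qed

lemma laplace_strict_antimono:
 assumes pos: "!!t. 0 <= t ==> 0 < f t" and "0 < mu" "mu < \<nu>"
 shows "laplace f \<nu> < laplace f mu"
proof -
 have \<nu>: "0 < \<nu>" using assms by simp
 define h where "h t = exp (- mu * t) * ((1 - exp (- ((\<nu> - mu) * t))) * f t)" for t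
 have g: "loc_bounded (%t. (1 - exp (- ((\<nu> - mu) * t))) * f t)"
 proof (rule loc_bounded_mult[OF continuous_on_loc_bounded f])
  show "continuous_on {0..} (%t. 1 - exp (- ((\<nu> - mu) * t)))" by (intro continuous_intros)
 qed (use assms in simp)
 have h: "loc_bounded h" unfolding h_def by (rule loc_bounded_mult[OF loc_bounded_exp g])
 have hi: "hl_integrable h"
 proof (rule hl_integrable_mono[OF h laplace_integrand[OF \<open>0 < mu\<close>]])
  show "h t <= exp (- mu * t) * f t" if "0 <= t" for t
   unfolding h_def using loc_boundedD(1)[OF f that] by (intro mult_left_mono mult_left_le_one_le) (use assms that in auto)
 qed
 have "0 < mass h"
  by (rule mass_pos[OF h hi, of 0]) (use assms in \<open>simp add: h_def\<close>)
 moreover have "laplace f mu = mass (%t. h t + exp (- \<nu> * t) * f t)"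
  unfolding laplace_def h_def by (intro arg_cong[where f=mass] ext) (simp add: algebra_simps exp_add[symmetric])
 moreover have "mass (%t. h t + exp (- \<nu> * t) * f t) = mass h + laplace f \<nu>"
  unfolding laplace_def by (rule mass_add(2)[OF hi laplace_integrand(2)[OF \<nu>]])
 ultimately show ?thesis by simp
qed

lemma laplace_ge_primitive:
 assumes mu: "0 < mu" and "0 <= T"
 shows "exp (- mu * T) * primitive f T <= laplace f mu"
proof -
 have "exp (- mu * T) * primitive f T = primitive (%t. exp (- mu * T) * f t) T" by (simp add: conv_cmult_right)
 also have "... <= primitive (%t. exp (- mu * t) * f t) T"
 proof (rule conv_mono)
  show "exp (- mu * T) * f s <= exp (- mu * s) * f s" if "0 <= s" "s <= T" for s
   by (rule mult_right_mono) (use that mu loc_boundedD(1)[OF f that(1)] in simp_all)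
 qed (simp_all only: loc_bounded_const[OF zero_le_one] loc_bounded_cmult[OF exp_ge_zero f] laplace_integrand(1)[OF mu] order_refl)
 also have "... <= laplace f mu" unfolding laplace_def by (rule primitive_le_mass[OF laplace_integrand[OF mu]])
 finally show ?thesis .
qed

text \<open>Intermediate value theorem: the transform is continuous, at most \<open>1 / mu\<close> at
\<open>mu\<close>, and close to zero it exceeds \<open>1 / \<beta>\<close> by monotone approximation.\<close>
lemma laplace_root:
 assumes \<beta>: "0 < \<beta>" and T: "0 <= T" "1 < \<beta> * primitive f T"
 obtains mu where "0 < mu" "\<beta> * laplace f mu = 1"
proof -
 have "((%mu. exp (- mu * T) * (\<beta> * primitive f T)) \<longlongrightarrow> exp (- 0 * T) * (\<beta> * primitive f T)) (at_right 0)"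
  by (intro tendsto_intros)
 then have "\<forall>\<^sub>F mu in at_right 0. 1 < exp (- mu * T) * (\<beta> * primitive f T)" using T(2) by (intro order_tendstoD(1)) auto
 moreover have "\<forall>\<^sub>F mu in at_right (0::real). 0 < mu & mu < \<beta>"
  using eventually_at_right_real[OF \<beta>] by (simp add: greaterThanLessThan_def)
 ultimately have "\<forall>\<^sub>F mu in at_right 0. 1 < exp (- mu * T) * (\<beta> * primitive f T) & 0 < mu & mu < \<beta>" by eventually_elim auto
 then obtain m where m: "1 < exp (- m * T) * (\<beta> * primitive f T)" "0 < m" "m < \<beta>"
  using eventually_happens[of _ "at_right (0::real)"] by auto
 have "1 <= \<beta> * laplace f m"
 proof -
  have "\<beta> * (exp (- m * T) * primitive f T) <= \<beta> * laplace f m"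
   using \<beta> by (intro mult_left_mono laplace_ge_primitive m T) simp
  moreover have "exp (- m * T) * (\<beta> * primitive f T) = \<beta> * (exp (- m * T) * primitive f T)" by (rule mult.left_commute)
  ultimately show ?thesis using m(1) by linarith
 qed
 moreover have "\<beta> * laplace f \<beta> <= 1" using laplace_le[OF \<beta>] \<beta> by (simp add: pos_le_divide_eq mult.commute)
 moreover have "continuous_on {m..\<beta>} (%mu. \<beta> * laplace f mu)"
  by (intro continuous_on_mult continuous_on_const continuous_on_subset[OF laplace_continuous[OF m(2)]]) auto
 ultimately obtain mu where "m <= mu" "mu <= \<beta>" "\<beta> * laplace f mu = 1"
  using IVT2'[of "%mu. \<beta> * laplace f mu" \<beta> 1 m] m by auto
 then show thesis using that[of mu] m by linarith
qed

end

section \<open>The leading eigenvalue\<close>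

lemma pmf_has_sum: "(pmf M has_sum 1) UNIV"
 by (rule has_sum_of_nn_integral_count_space) (simp_all add: nn_integral_pmf measure_pmf.emeasure_space_1[of M, simplified])

definition green :: "(real => int ^ 'd => (int ^ 'd) pmf) => real => int ^ 'd => int ^ 'd => real" where
 "green p mu x y = laplace (%t. pmf (p t x) y) mu"

text \<open>Integration by parts: the Laplace transform of the backward equation.\<close>
lemma transition_laplace_equation:
 fixes a :: "int ^ 'd => int ^ 'd => real"
 assumes a: "walk_intensities a" and p: "walk_transitions a p" and mu: "0 < mu"
 shows "(\<Sum>\<^sub>\<infinity>z. jump_rate a x z * green p mu z y) = (mu - a 0 0) * green p mu x y - (if x = y then 1 else 0)"
proof -
 define r where "r = jump_rate a x"
 define u where "u t z = exp (- mu * t) * pmf (p t z) y" for t z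
 define S where "S t = (\<Sum>\<^sub>\<infinity>z. r z * u t z)" for t
 have r: "!!z. 0 <= r z" "(r has_sum - a 0 0) UNIV"
  unfolding r_def by (auto intro: jump_rate_nonneg[OF a] jump_rate_has_sum[OF a])
 have \<alpha>: "0 <= - a 0 0" using a by (auto simp: walk_intensities_def less_imp_le)
 have pc: "continuous_on {0..} (%t. pmf (p t z) y)" for z
  using walk_prob_continuous[OF a p, of z "{y}"] by (simp add: measure_pmf_single)
 have uc: "continuous_on {0..} (%t. u t z)" for z
  unfolding u_def by (intro continuous_on_mult pc continuous_intros)
 have u01: "0 <= u t z" "u t z <= exp (- mu * t)" "0 <= t ==> u t z <= 1" for t z
 proof -
  show "0 <= u t z" by (simp add: u_def)
  show *: "u t z <= exp (- mu * t)" by (simp add: u_def pmf_le_1)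
  show "u t z <= 1" if "0 <= t"
  proof -
   have "exp (- mu * t) <= 1" using mu that by simp
   then show ?thesis using * by linarith
  qed
 qed
 have summ: "(%z. r z * u t z) summable_on UNIV" if "0 <= t" for t
  by (rule summable_on_bounded[OF has_sum_imp_summable[OF r(2)]]) (use u01 r that in \<open>simp add: abs_mult mult_left_le\<close>)
 have Sc: "continuous_on {0..} S"
  unfolding S_def
 proof (rule continuous_on_infsum[where B=r])
  show "continuous_on {0..} (%t. r z * u t z)" for z by (intro continuous_on_mult continuous_on_const uc)
  show "\<bar>r z * u t z\<bar> <= r z" if "t \<in> {0..}" for z t using u01[of t z] r that by (simp add: abs_mult mult_left_le)
  show "r summable_on UNIV" by (rule has_sum_imp_summable[OF r(2)])
 qed
 have S0: "0 <= S t" for t unfolding S_def by (rule infsum_nonneg) (use u01 r in auto)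
 have Sb: "S t <= - a 0 0 * exp (- mu * t)" if "0 <= t" for t
  unfolding S_def
  by (rule has_sum_mono[OF has_sum_infsum[OF summ[OF that]] has_sum_cmult_left[OF r(2)]]) (use u01 r in \<open>auto intro: mult_left_mono\<close>)
 have Sl: "loc_bounded S" by (rule continuous_on_loc_bounded[OF Sc S0])
 have el: "loc_bounded (%t. - a 0 0 * exp (- mu * t))" by (rule loc_bounded_cmult[OF \<alpha> loc_bounded_exp])
 have Si: "hl_integrable S" by (rule hl_integrable_mono[OF Sl el mass_cmult(1)[OF mass_exp(1)[OF mu]] Sb])
 have kl: "loc_bounded (%t. pmf (p t z) y)" for z by (rule walk_kernel_loc_bounded[OF a p])
 have ul: "loc_bounded (%t. u t z)" "hl_integrable (%t. u t z)" for z
  unfolding u_def using laplace_integrand[OF kl pmf_le_1 mu] by auto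
 have mass_u: "mass (%t. u t z) = green p mu z y" for z by (simp add: u_def green_def laplace_def)
 have "((%z. mass (%t. r z * u t z)) has_sum mass S) UNIV"
 proof (rule mass_has_sum[OF _ _ Sl Si])
  show "loc_bounded (%t. r z * u t z)" "hl_integrable (%t. r z * u t z)" for z
   by (auto intro: loc_bounded_cmult mass_cmult ul r)
  show "((%z. r z * u t z) has_sum S t) UNIV" if "0 <= t" for t unfolding S_def by (rule has_sum_infsum[OF summ[OF that]])
 qed
 then have mass_S: "(\<Sum>\<^sub>\<infinity>z. r z * green p mu z y) = mass S"
  by (intro infsumI) (simp add: mass_cmult(2)[OF ul(2)] mass_u)
 have deriv: "((%t. u t x) has_real_derivative S t - (mu - a 0 0) * u t x) (at t within {0..})" if t: "0 <= t" for t
 proof -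
  have d: "((%t. exp (- a 0 0 * t) * pmf (p t x) y) has_real_derivative
   (\<Sum>\<^sub>\<infinity>z. r z * (exp (- a 0 0 * t) * pmf (p t z) y))) (at t within {0..})"
   using walk_backward[OF a p, of "indicator {y}" t x] t by (simp add: r_def measure_pmf_single)
  have e: "((%t. exp ((a 0 0 - mu) * t)) has_real_derivative exp ((a 0 0 - mu) * t) * (a 0 0 - mu)) (at t within {0..})"
   by (auto intro!: derivative_eq_intros)
  have ee: "exp ((a 0 0 - mu) * s) * (exp (- a 0 0 * s) * c) = exp (- mu * s) * c" for s c :: real
   by (simp add: mult.assoc[symmetric] exp_add[symmetric] algebra_simps)
  have SE: "(\<Sum>\<^sub>\<infinity>z. r z * (exp (- a 0 0 * t) * pmf (p t z) y)) * exp ((a 0 0 - mu) * t) = S t"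
   unfolding S_def infsum_cmult_left'[symmetric] u_def using ee[of t] by (intro infsum_cong) (metis mult.assoc mult.commute)
  show ?thesis
  proof (intro DERIV_cong[OF DERIV_mult[OF e d, unfolded ee, folded u_def]])
   have "exp ((a 0 0 - mu) * t) * (a 0 0 - mu) * (exp (- a 0 0 * t) * c) = (a 0 0 - mu) * (exp (- mu * t) * c)" for c
    using ee[of t c] by (metis mult.assoc mult.commute)
   then show "exp ((a 0 0 - mu) * t) * (a 0 0 - mu) * (exp (- a 0 0 * t) * pmf (p t x) y) +
     (\<Sum>\<^sub>\<infinity>z. r z * (exp (- a 0 0 * t) * pmf (p t z) y)) * exp ((a 0 0 - mu) * t) = S t - (mu - a 0 0) * u t x"
    using SE by (simp add: u_def left_diff_distrib)
  qed
 qed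
 have FTC: "u t x - u 0 x = primitive S t - (mu - a 0 0) * primitive (%t. u t x) t" if t: "0 <= t" for t
 proof -
  have "has_bochner_integral lborel (%s. indicator {0..t} s *\<^sub>R (S s - (mu - a 0 0) * u s x)) (u t x - u 0 x)"
  proof (rule has_bochner_integral_FTC_Icc[OF t])
   show "((%t. u t x) has_vector_derivative S s - (mu - a 0 0) * u s x) (at s within {0..t})" if "0 <= s" for s
    using DERIV_subset[OF deriv[OF that], of "{0..t}"] by (auto simp: has_real_derivative_iff_has_vector_derivative)
   show "continuous_on {0..t} (%s. S s - (mu - a 0 0) * u s x)"
    by (rule continuous_on_subset[of "{0..}"]) (auto intro!: continuous_on_diff continuous_on_mult continuous_on_const Sc uc)
  qed
  then have "u t x - u 0 x = (\<integral>s. indicator {0..t} s * S s - (mu - a 0 0) * (indicator {0..t} s * u s x) \<partial>lborel)"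
   by (simp add: has_bochner_integral_iff algebra_simps)
  also have "... = primitive S t - (mu - a 0 0) * primitive (%t. u t x) t"
   unfolding primitive_eq
   using Bochner_Integration.integral_diff[OF primitive_integrable[OF Sl, of t] integrable_mult_right[OF primitive_integrable[OF ul(1)[of x], of t]], of "mu - a 0 0"]
   by simp
  finally show ?thesis .
 qed
 have "((%t. primitive S t - (mu - a 0 0) * primitive (%t. u t x) t) \<longlongrightarrow> mass S - (mu - a 0 0) * green p mu x y) at_top"
  unfolding mass_u[symmetric] by (intro tendsto_intros primitive_tendsto_mass Sl Si ul)
 moreover have "\<forall>\<^sub>F t in at_top. primitive S t - (mu - a 0 0) * primitive (%t. u t x) t = u t x - u 0 x"
  using eventually_ge_at_top[of 0] by eventually_elim (simp only: FTC)
 ultimately have "((%t. u t x - u 0 x) \<longlongrightarrow> mass S - (mu - a 0 0) * green p mu x y) at_top"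
  by (rule Lim_transform_eventually)
 moreover have "((%t. u t x - u 0 x) \<longlongrightarrow> 0 - u 0 x) at_top"
 proof (intro tendsto_diff tendsto_const tendsto_sandwich[of "%_. 0" "%t. u t x" at_top "%t. exp (- mu * t)" 0])
  show "((%t. exp (- mu * t)) \<longlongrightarrow> 0) at_top" using mu by real_asymp
 qed (use u01 in auto)
 ultimately have "mass S - (mu - a 0 0) * green p mu x y = 0 - u 0 x" by (rule tendsto_unique[rotated 1]) simp
 moreover have "u 0 x = (if x = y then 1 else 0)"
  using p by (auto simp: u_def walk_transitions_def transition_semigroup_def)
 ultimately show ?thesis using mass_S unfolding r_def by linarith
qed

lemma green_resolvent_kernel:
 fixes a :: "int ^ 'd => int ^ 'd => real"
 assumes a: "walk_intensities a" and p: "walk_transitions a p" and mu: "0 < mu"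
 shows "resolvent_kernel (jump_rate a) (green p mu) (- a 0 0) mu"
proof
 have kl: "loc_bounded (%t. pmf (p t x) y)" for x y by (rule walk_kernel_loc_bounded[OF a p])
 show "jump_rate a x y = jump_rate a y x" for x y
  using a by (simp add: jump_rate_def walk_intensities_def)
 show "0 <= green p mu x y" for x y unfolding green_def by (rule laplace_nonneg[OF kl pmf_le_1 mu])
 show "green p mu x y = green p mu y x" for x y
  unfolding green_def laplace_def mass_def
  by (rule Bochner_Integration.integral_cong[OF refl]) (use transition_symmetric[OF a p] in \<open>auto simp: indicator_def\<close>)
 show "(green p mu x has_sum 1 / mu) UNIV" for x
  unfolding green_def laplace_def mass_exp(2)[OF mu, symmetric]
 proof (rule mass_has_sum[OF laplace_integrand[OF kl pmf_le_1 mu] loc_bounded_exp mass_exp(1)[OF mu]])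
  show "((%y. exp (- mu * t) * pmf (p t x) y) has_sum exp (- mu * t)) UNIV" for t
   using has_sum_cmult_right[OF pmf_has_sum[of "p t x"], of "exp (- mu * t)"] by simp
 qed
 show "(\<Sum>\<^sub>\<infinity>z. jump_rate a x z * green p mu z y) = (mu + - a 0 0) * green p mu x y - (if x = y then 1 else 0)" for x y
  using transition_laplace_equation[OF a p mu] by simp
qed (use a mu jump_rate_nonneg[OF a] jump_rate_has_sum[OF a] in \<open>auto simp: walk_intensities_def\<close>)

lemma perturbed_operator_shifted:
 fixes a :: "int ^ 'd => int ^ 'd => real"
 assumes a: "walk_intensities a" and k: "resolvent_kernel (jump_rate a) g (- a 0 0) mu" and phi: "phi \<in> l2"
 shows "perturbed_operator a \<beta> phi x - mu * phi x
  = resolvent_kernel.shifted (jump_rate a) (- a 0 0) mu phi x + \<beta> * (if x = 0 then phi 0 else 0)"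
proof -
 obtain B where "!!x. \<bar>phi x\<bar> <= B" using l2_bounded[OF phi] by metis
 from infsumI[OF walk_generator_eq(2)[where f=phi, OF a this]] show ?thesis
  by (simp add: perturbed_operator_def walk_operator_def resolvent_kernel.shifted_def[OF k] algebra_simps)
qed

text \<open>Every positive \<open>\<nu>\<close> with \<open>\<beta> * laplace _ \<nu> \<noteq> 1\<close> is a regular point,
and strict monotonicity of the Laplace transform leaves \<open>mu\<close> as the only other one. So the
positive half line isolates \<open>mu\<close> in the spectrum.\<close>
theorem lambda_0_eq:
 fixes a :: "int ^ 'd => int ^ 'd => real"
 assumes a: "walk_intensities a" and p: "walk_transitions a p"
  and pos: "!!t. 0 <= t ==> 0 < pmf (p t 0) 0"
  and mu: "0 < mu" "\<beta> * laplace (%t. pmf (p t 0) 0) mu = 1"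
 shows "lambda_0 a \<beta> = mu"
proof -
 let ?T = "perturbed_operator a \<beta>"
 let ?g = "%\<nu>. laplace (%t. pmf (p t 0) 0) \<nu>"
 have kl: "loc_bounded (%t. pmf (p t 0) 0)" by (rule walk_kernel_loc_bounded[OF a p])
 have \<beta>: "\<beta> ~= 0" using mu(2) by auto
 have uniq: "\<nu> = mu" if "0 < \<nu>" "\<beta> * ?g \<nu> = 1" for \<nu>
 proof -
  have "?g \<nu> = ?g mu" using that(2) mu(2) \<beta> by (metis mult_left_cancel)
  then show ?thesis
   using laplace_strict_antimono[OF kl pmf_le_1 pos that(1), of mu] laplace_strict_antimono[OF kl pmf_le_1 pos mu(1), of \<nu>]
   by (cases mu \<nu> rule: linorder_cases) auto
 qed
 have eig: "eigenvalue_l2 ?T \<nu> \<longleftrightarrow> \<beta> * ?g \<nu> = 1" if "0 < \<nu>" for \<nu>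
 proof -
  note k = green_resolvent_kernel[OF a p that]
  have "eigenvalue_l2 ?T \<nu> \<longleftrightarrow> (\<exists>phi\<in>l2. phi ~= (%x. 0) & (\<forall>x. ?T phi x - \<nu> * phi x = 0))"
   unfolding eigenvalue_l2_def by (simp add: fun_eq_iff)
  also have "... \<longleftrightarrow> (\<exists>phi\<in>l2. phi ~= (%x. 0) &
    (\<forall>x. resolvent_kernel.shifted (jump_rate a) (- a 0 0) \<nu> phi x + \<beta> * (if x = 0 then phi 0 else 0) = 0))"
   by (intro bex_cong refl conj_cong) (simp only: perturbed_operator_shifted[OF a k])
  also have "... \<longleftrightarrow> \<beta> * green p \<nu> 0 0 = 1" by (rule resolvent_kernel.rank_one_eigenvalue[OF k])
  finally show ?thesis by (simp add: green_def)
 qed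
 have regular: "\<nu> \<notin> spectrum_l2 ?T" if "0 < \<nu>" "\<nu> ~= mu" for \<nu>
 proof -
  note k = green_resolvent_kernel[OF a p that(1)]
  have "\<beta> * green p \<nu> 0 0 ~= 1" using uniq[OF that(1)] that(2) by (auto simp: green_def)
  from resolvent_kernel.rank_one_bijective[OF k this]
  have "bij_betw (%phi x. ?T phi x - \<nu> * phi x) l2 l2"
   by (rule bij_betw_cong[THEN iffD1, rotated]) (auto simp: perturbed_operator_shifted[OF a k] fun_eq_iff)
  then show ?thesis by (simp add: spectrum_l2_def)
 qed
 have singular: "mu \<in> spectrum_l2 ?T"
 proof -
  obtain phi where phi: "phi \<in> l2" "phi ~= (%x. 0)" "?T phi = (%x. mu * phi x)"
   using eig[OF mu(1)] mu(2) by (auto simp: eigenvalue_l2_def)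
  have "(%x. ?T phi x - mu * phi x) = (%x. ?T (%x. 0) x - mu * 0)"
   by (simp add: phi(3) perturbed_operator_def walk_operator_def)
  moreover have "(%x. 0) \<in> l2" by (simp add: l2_def)
  ultimately have "\<not> inj_on (%phi x. ?T phi x - mu * phi x) l2"
   using phi(1,2) by (auto dest!: inj_onD[where x=phi and y="%x. 0"])
  then show ?thesis by (auto simp: spectrum_l2_def bij_betw_def)
 qed
 have "mu isolated_in spectrum_l2 ?T"
  unfolding isolated_in_def
 proof (intro conjI exI[of _ "{0<..}"])
  show "{0<..} \<inter> spectrum_l2 ?T = {mu}" using regular singular mu(1) by auto
 qed (use singular in auto)
 moreover have "eigenvalue_l2 ?T mu" by (rule eig[OF mu(1), THEN iffD2, OF mu(2)])
 moreover have "\<nu> = mu" if "0 < \<nu>" "eigenvalue_l2 ?T \<nu>" for \<nu>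
  by (rule uniq[OF that(1) eig[OF that(1), THEN iffD1, OF that(2)]])
 ultimately show ?thesis
  unfolding lambda_0_def using mu(1) by (intro the_equality) blast+
qed

lemma beta_crit_eq:
 assumes k: "loc_bounded (%t. pmf (p t 0) 0)"
 shows "beta_crit p = (if hl_integrable (%t. pmf (p t 0) 0) then 1 / mass (%t. pmf (p t 0) 0) else 0)"
proof -
 have G: "Green p 0 0 0 = (\<integral>\<^sup>+t. halfline (%t. pmf (p t 0) 0) t \<partial>lborel)"
  unfolding Green_def halfline_def by (intro nn_integral_cong) (simp add: indicator_def)
 show ?thesis
 proof (cases "hl_integrable (%t. pmf (p t 0) 0)")
  case True
  then show ?thesis unfolding beta_crit_def G ennreal_mass[OF k True, symmetric] using mass_nonneg[OF k] by simp
 next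
  case False
  have "Green p 0 0 0 = \<infinity>"
  proof (rule ccontr)
   assume "Green p 0 0 0 ~= \<infinity>"
   then have "integrable lborel (%t. indicator {0..} t * pmf (p t 0) 0)"
    using loc_boundedD(2)[OF k] by (intro integrableI_nonneg) (auto simp: G halfline_def less_top)
   then show False using False by (simp add: hl_integrable_def)
  qed
  then show ?thesis using False by (simp add: beta_crit_def)
 qed
qed

section \<open>Structure of the first moments\<close>

lemma pop_singleton: "pop {z} eta = count eta z"
 by (induction eta) (auto simp: pop_def)

lemma pop_UNIV: "pop UNIV eta = size eta"
 by (simp add: pop_def)

lemma pop_add: "pop B (eta + eta') = pop B eta + pop B eta'"
 by (simp add: pop_def)

text \<open>Moments involve the process at a single time only. Its law there is carried by the countable support of the
transition probability, where paths of length one give the weights.\<close>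
lemma one_particle_law:
 assumes brw: "branching_random_walk a b M X"
 obtains K where "branching_transitions a b K"
  and "!!t x F. 0 <= t ==> (\<integral>\<omega>. F (X t \<omega>) \<partial>M x) = measure_pmf.expectation (K t {#x#}) (F :: _ => real)"
proof -
 from brw obtain K where K: "branching_transitions a b K"
  and prob: "!!x. prob_space (M x)" and meas: "!!x t. 0 <= t ==> X t \<in> measurable (M x) (count_space UNIV)"
  and paths: "!!x ps. sorted (0 # map fst ps) ==>
   measure (M x) {\<omega> \<in> space (M x). \<forall>(t, \<zeta>) \<in> set ps. X t \<omega> = \<zeta>} = path_prob K 0 {#x#} ps"
  unfolding branching_random_walk_def by blast
 have "(\<integral>\<omega>. F (X t \<omega>) \<partial>M x) = measure_pmf.expectation (K t {#x#}) F" if t: "0 <= t" for t x and F :: "_ => real"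
 proof -
  interpret M: prob_space "M x" by (rule prob)
  let ?N = "distr (M x) (count_space UNIV) (X t)" and ?\<Omega> = "set_pmf (K t {#x#})"
  have point: "emeasure ?N {\<zeta>} = ennreal (pmf (K t {#x#}) \<zeta>)" for \<zeta>
  proof -
   have "emeasure ?N {\<zeta>} = emeasure (M x) (X t -` {\<zeta>} \<inter> space (M x))" by (rule emeasure_distr[OF meas[OF t]]) simp
   also have "X t -` {\<zeta>} \<inter> space (M x) = {\<omega> \<in> space (M x). X t \<omega> = \<zeta>}" by auto
   also have "emeasure (M x) ... = ennreal (pmf (K t {#x#}) \<zeta>)"
    using paths[of "[(t, \<zeta>)]" x] t by (simp add: M.emeasure_eq_measure)
   finally show ?thesis .
  qed
  have "emeasure ?N ?\<Omega> = (\<integral>\<^sup>+\<zeta>. emeasure ?N {\<zeta>} \<partial>count_space ?\<Omega>)"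
   by (rule emeasure_countable_singleton) auto
  also have "... = emeasure (measure_pmf (K t {#x#})) ?\<Omega>" by (simp add: point nn_integral_pmf)
  also have "... = 1" by (simp add: measure_pmf.emeasure_eq_measure measure_pmf.prob_eq_1 AE_measure_pmf)
  finally have "AE \<zeta> in ?N. \<zeta> \<in> ?\<Omega>"
   using prob_space.AE_in_set_eq_1[OF M.prob_space_distr[OF meas[OF t]], of ?\<Omega>]
   by (simp add: measure_def)
  then have "?N = measure_pmf (K t {#x#})"
   by (intro measure_eqI_countable_AE[of _ _ ?\<Omega>]) (auto simp: AE_measure_pmf point emeasure_pmf_single)
  moreover have "(\<integral>\<omega>. F (X t \<omega>) \<partial>M x) = (\<integral>\<zeta>. F \<zeta> \<partial>?N)" by (rule integral_distr[symmetric, OF meas[OF t]]) simp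
  ultimately show ?thesis by simp
 qed
 with K show thesis by (rule that)
qed

definition mean_pop ::
  "(real => (int ^ 'd) multiset => (int ^ 'd) multiset pmf) => (int ^ 'd) set => real => (int ^ 'd) multiset => ennreal" where
 "mean_pop K B t eta = (\<integral>\<^sup>+\<zeta>. ennreal (real (pop B \<zeta>)) \<partial>measure_pmf (K t eta))"

lemma mean_pop_empty:
 assumes K: "branching_transitions a b K" and t: "0 <= t"
 shows "mean_pop K B t {#} = 0"
proof -
 let ?f = "%\<zeta>. (1 - 1/2 :: real) ^ pop B \<zeta>"
 have i: "integrable (K t {#}) ?f" by (rule gen_fun_bounds(3)) auto
 have "measure_pmf.expectation (K t {#}) (%\<zeta>. 1 - ?f \<zeta>) = 0"
  using gen_fun_empty[OF K _ _ t, of "1/2" B] i by (simp add: gen_fun_def)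
 then have "AE \<zeta> in K t {#}. 1 - ?f \<zeta> = 0"
  by (subst (asm) integral_nonneg_eq_0_iff_AE) (use i in \<open>auto simp: power_le_one\<close>)
 then have "AE \<zeta> in K t {#}. pop B \<zeta> = 0"
 proof eventually_elim
  case (elim \<zeta>)
  then have "(1 / 2 :: real) ^ pop B \<zeta> = 1" by simp
  then show ?case using power_less_one_iff[of "1 / 2 :: real" "pop B \<zeta>"] by fastforce
 qed
 then have "mean_pop K B t {#} = (\<integral>\<^sup>+\<zeta>. 0 \<partial>measure_pmf (K t {#}))"
  unfolding mean_pop_def by (intro nn_integral_cong_AE) (auto elim: eventually_mono)
 then show ?thesis by simp
qed

lemma mean_pop_add:
 assumes K: "branching_transitions a b K" and t: "0 <= t"
 shows "mean_pop K B t (eta + eta') = mean_pop K B t eta + mean_pop K B t eta'"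
proof -
 have "mean_pop K B t (eta + eta') = (\<integral>\<^sup>+\<zeta>. \<integral>\<^sup>+\<zeta>'. ennreal (real (pop B \<zeta>)) + ennreal (real (pop B \<zeta>')) \<partial>measure_pmf (K t eta') \<partial>measure_pmf (K t eta))"
  using K t unfolding mean_pop_def branching_transitions_def
  by (simp add: nn_integral_pair_pmf' pop_add)
 also have "... = mean_pop K B t eta + mean_pop K B t eta'"
  by (simp add: mean_pop_def nn_integral_add measure_pmf.emeasure_space_1[simplified])
 finally show ?thesis .
qed

text \<open>Particles evolve independently, hence means add over the initial configuration.\<close>
lemma mean_pop_eq_sum:
 assumes K: "branching_transitions a b K" and t: "0 <= t"
 shows "mean_pop K B t eta = (\<integral>\<^sup>+z. ennreal (real (count eta z)) * mean_pop K B t {#z#} \<partial>count_space UNIV)"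
proof (induction eta)
 case empty
 show ?case by (simp add: mean_pop_empty[OF K t])
next
 case (add x eta)
 have "(\<integral>\<^sup>+z. ennreal (real (count (add_mset x eta) z)) * mean_pop K B t {#z#} \<partial>count_space UNIV)
   = (\<integral>\<^sup>+z. indicator {x} z * mean_pop K B t {#z#} + ennreal (real (count eta z)) * mean_pop K B t {#z#} \<partial>count_space UNIV)"
  by (intro nn_integral_cong) (auto simp: indicator_def distrib_right ennreal_plus)
 also have "... = mean_pop K B t {#x#} + mean_pop K B t eta"
  by (simp add: nn_integral_add add.IH mult.commute[of "indicator {x} _"])
 also have "... = mean_pop K B t (add_mset x eta)"
  using mean_pop_add[OF K t, of B "{#x#}" eta] by simp
 finally show ?case by (rule sym)
qed

lemma mean_pop_Chapman_Kolmogorov: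
 fixes B :: "(int ^ 'd) set"
 assumes K: "branching_transitions a b K" and s: "0 <= s" and t: "0 <= t"
 shows "mean_pop K B (s + t) eta = (\<integral>\<^sup>+z. mean_pop K {z} s eta * mean_pop K B t {#z#} \<partial>count_space UNIV)"
proof -
 have "transition_semigroup K" using K unfolding branching_transitions_def by (rule conjunct1)
 then have "K (s + t) eta = bind_pmf (K s eta) (K t)" using s t by (simp add: transition_semigroup_def)
 then have "mean_pop K B (s + t) eta = (\<integral>\<^sup>+\<zeta>. mean_pop K B t \<zeta> \<partial>measure_pmf (K s eta))"
  by (simp add: mean_pop_def)
 also have "... = (\<integral>\<^sup>+\<zeta>. (\<integral>\<^sup>+z. ennreal (real (count \<zeta> z)) * mean_pop K B t {#z#} \<partial>count_space UNIV) \<partial>measure_pmf (K s eta))"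
  by (intro nn_integral_cong mean_pop_eq_sum[OF K t])
 also have "... = (\<integral>\<^sup>+z. (\<integral>\<^sup>+\<zeta>. ennreal (real (count \<zeta> z)) * mean_pop K B t {#z#} \<partial>measure_pmf (K s eta)) \<partial>count_space UNIV)"
  by (rule nn_integral_count_space_nn_integral) auto
 also have "... = (\<integral>\<^sup>+z. mean_pop K {z} s eta * mean_pop K B t {#z#} \<partial>count_space UNIV)"
  by (simp add: nn_integral_multc mean_pop_def pop_singleton)
 finally show ?thesis .
qed

text \<open>The resolvent of the kernel \<open>p\<close> can be applied to the source \<open>f\<close> or to the kernel
itself; both orders give the unique solution.\<close>
lemma renewal_swap:
 assumes p: "loc_bounded p" and f: "loc_bounded f" and w: "loc_bounded w" and v: "loc_bounded v" and \<beta>: "0 <= \<beta>"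
  and w_eq: "!!t. 0 <= t ==> w t = p t + \<beta> * conv p w t"
  and v_eq: "!!t. 0 <= t ==> v t = f t + \<beta> * conv p v t"
  and t: "0 <= t"
 shows "v t = f t + \<beta> * conv f w t"
proof (rule volterra_unique[OF loc_bounded_cmult[OF \<beta> p] v, where f=f and v="%t. f t + \<beta> * conv f w t"])
 have fw: "loc_bounded (conv f w)" by (rule loc_bounded_conv[OF f w])
 show "loc_bounded (%t. f t + \<beta> * conv f w t)" by (intro loc_bounded_add loc_bounded_cmult f fw \<beta>)
 show "v t = f t + conv (%t. \<beta> * p t) v t" if "0 <= t" for t using v_eq[OF that] by (simp only: conv_cmult_left)
 fix t :: real assume t: "0 <= t"
 have "conv p (%t. f t + \<beta> * conv f w t) t = conv p f t + \<beta> * conv p (conv f w) t"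
  using conv_add_right[OF p f loc_bounded_cmult[OF \<beta> fw]] by (simp add: conv_cmult_right)
 also have "conv p (conv f w) t = conv (conv p f) w t" by (rule conv_assoc[OF p f w, symmetric])
 also have "... = conv (conv f p) w t" by (rule conv_cong) (auto intro: conv_commute p f)
 also have "... = conv f (conv p w) t" by (rule conv_assoc[OF f p w])
 also have "conv p f t + \<beta> * conv f (conv p w) t = conv f (%t. p t + \<beta> * conv p w t) t"
  using conv_add_right[OF f p loc_bounded_cmult[OF \<beta> loc_bounded_conv[OF p w]]] conv_commute[OF p f] by (simp add: conv_cmult_right)
 also have "... = conv f w t" by (rule conv_cong) (auto intro: w_eq[symmetric])
 finally show "f t + \<beta> * conv f w t = f t + conv (%t. \<beta> * p t) (%t. f t + \<beta> * conv f w t) t"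
  by (simp only: conv_cmult_left)
qed (rule t)

text \<open>Everything is expressed through the mean \<open>w\<close> of the population at the origin started from the
origin. The symmetry of the walk makes the means from \<open>0\<close> to \<open>y\<close> and from
\<open>y\<close> to \<open>0\<close> agree. Together with the Chapman-Kolmogorov equation and the Cauchy-Schwarz
inequality this yields the logarithmic convexity of \<open>w\<close>, a trace of self-adjointness of the
evolution operator that replaces its spectral theorem.\<close>
theorem first_moment_structure:
 fixes a :: "int ^ 'd => int ^ 'd => real"
 assumes a: "walk_intensities a" and p: "walk_transitions a p" and b: "branching_intensities b"
  and brw: "branching_random_walk a b M X" and beta: "0 < beta_star b"
 obtains w where "loc_bounded w"
  and "!!t. 0 <= t ==> w t = pmf (p t 0) 0 + beta_star b * conv (%t. pmf (p t 0) 0) w t"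
  and "!!t x y. 0 <= t ==> exp (b 0 * t) * local_moment M X 1 t x y = pmf (p t x) y
   + beta_star b * conv (%t. pmf (p t x) 0) (%t. pmf (p t y) 0 + beta_star b * conv (%t. pmf (p t y) 0) w t) t"
  and "!!t x. 0 <= t ==> exp (b 0 * t) * total_moment M X 1 t x = 1
   + beta_star b * primitive (%t. pmf (p t x) 0 + beta_star b * conv (%t. pmf (p t x) 0) w t) t"
  and "!!t h. 0 <= t ==> 0 <= h ==> (w (t + h))\<^sup>2 <= w t * w (t + 2 * h)"
  and "!!t h. 0 <= t ==> 0 <= h ==> w t * pmf (p h 0) 0 <= w (t + h)"
proof -
 let ?\<beta> = "beta_star b"
 obtain K where K: "branching_transitions a b K"
  and law: "!!t x F. 0 <= t ==> (\<integral>\<omega>. F (X t \<omega>) \<partial>M x) = measure_pmf.expectation (K t {#x#}) (F :: _ => real)"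
  using one_particle_law[OF brw] by metis
 define m where "m B t x = exp (b 0 * t) * measure_pmf.expectation (K t {#x#}) (%eta. real (pop B eta))" for B t x
 note moment = first_moment_renewal[OF a p b K beta, folded m_def]
 define w where "w t = m {0} t 0" for t
 define k where "k x t = pmf (p t x) 0" for x t
 define u where "u x t = k x t + ?\<beta> * conv (k x) w t" for x t
 have k: "loc_bounded (k x)" for x unfolding k_def by (rule walk_kernel_loc_bounded[OF a p])
 have m: "loc_bounded (%t. m B t x)" for B x by (rule moment(2))
 have w: "loc_bounded w" unfolding w_def by (rule m)
 have \<beta>: "0 <= ?\<beta>" using beta by simp
 have m_eq: "m B t x = measure_pmf.prob (p t x) B + ?\<beta> * conv (k x) (%t. m B t 0) t" if "0 <= t" for B t x
  unfolding k_def by (rule moment(3)[OF that])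
 have w_eq: "w t = k 0 t + ?\<beta> * conv (k 0) w t" if "0 <= t" for t
  using m_eq[OF that, of "{0}" 0] by (simp add: w_def[abs_def] k_def measure_pmf_single)
 have m0: "m {0} t y = u y t" if "0 <= t" for t y
  using m_eq[OF that, of "{0}" y] by (simp add: w_def[abs_def] u_def k_def measure_pmf_single)
 have my: "m {y} t 0 = u y t" if "0 <= t" for t y
  unfolding u_def
 proof (rule renewal_swap[OF k[of 0] k[of y] w m[of "{y}" 0] \<beta> w_eq _ that])
  show "m {y} t 0 = k y t + ?\<beta> * conv (k 0) (%t. m {y} t 0) t" if "0 <= t" for t
   using m_eq[OF that, of "{y}" 0] transition_symmetric[OF a p that, of 0 y] by (simp add: k_def measure_pmf_single)
 qed
 have one: "loc_bounded (%_. 1)" by (rule loc_bounded_const) simp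
 have total0: "m UNIV t 0 = 1 + ?\<beta> * primitive w t" if "0 <= t" for t
 proof (rule renewal_swap[OF k[of 0] one w m[of UNIV 0] \<beta> w_eq _ that])
  show "m UNIV t 0 = 1 + ?\<beta> * conv (k 0) (%t. m UNIV t 0) t" if "0 <= t" for t
   using m_eq[OF that, of UNIV 0] by simp
 qed
 have ub: "loc_bounded (u x)" for x unfolding u_def by (intro loc_bounded_add loc_bounded_cmult loc_bounded_conv k w \<beta>)
 have total: "m UNIV t x = 1 + ?\<beta> * primitive (u x) t" if t: "0 <= t" for t x
 proof -
  have "m UNIV t x = 1 + ?\<beta> * conv (k x) (%t. m UNIV t 0) t" using m_eq[OF t, of UNIV x] by simp
  also have "conv (k x) (%t. m UNIV t 0) t = conv (k x) (%t. 1 + ?\<beta> * primitive w t) t"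
   by (rule conv_cong) (auto intro: total0)
  also have "... = conv (k x) (%_. 1) t + ?\<beta> * conv (k x) (primitive w) t"
   using conv_add_right[OF k one loc_bounded_cmult[OF \<beta> loc_bounded_primitive[OF w]]] by (simp add: conv_cmult_right)
  also have "conv (k x) (%_. 1) t = primitive (k x) t" by (rule conv_commute[OF k one])
  also have "conv (k x) (primitive w) t = conv (conv (k x) (%_. 1)) w t" by (rule conv_assoc[OF k one w, symmetric])
  also have "... = conv (primitive (k x)) w t" by (rule conv_cong) (auto intro: conv_commute k one)
  also have "... = primitive (conv (k x) w) t" by (rule conv_assoc[OF one k w])
  also have "primitive (k x) t + ?\<beta> * primitive (conv (k x) w) t = primitive (u x) t"
   unfolding u_def[abs_def]
   using conv_add_right[OF one k loc_bounded_cmult[OF \<beta> loc_bounded_conv[OF k w]]] by (simp add: conv_cmult_right)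
  finally show ?thesis .
 qed
 have ennreal_m: "ennreal (m B t x) = ennreal (exp (b 0 * t)) * mean_pop K B t {#x#}" if "0 <= t" for B t x
  unfolding mean_pop_def m_def using moment(1)[OF that, of x B]
  by (subst nn_integral_eq_integral) (auto simp: ennreal_mult')
 have semigroup: "ennreal (w (s + t)) = (\<integral>\<^sup>+z. ennreal (u z s) * ennreal (u z t) \<partial>count_space UNIV)" if s: "0 <= s" and t: "0 <= t" for s t
 proof -
  have "ennreal (w (s + t)) = (ennreal (exp (b 0 * s)) * ennreal (exp (b 0 * t))) * mean_pop K {0} (s + t) {#0#}"
   unfolding w_def ennreal_m[OF add_nonneg_nonneg[OF s t]] by (simp add: ennreal_mult[symmetric] exp_add[symmetric] distrib_left)
  also have "... = (\<integral>\<^sup>+z. ennreal (m {z} s 0) * ennreal (m {0} t z) \<partial>count_space UNIV)"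
   unfolding mean_pop_Chapman_Kolmogorov[OF K s t] ennreal_m[OF s] ennreal_m[OF t]
   by (subst nn_integral_cmult[symmetric]) (auto intro!: nn_integral_cong simp: mult_ac)
  finally show ?thesis by (simp only: my[OF s] m0[OF t])
 qed
 have w_nonneg: "0 <= w t" if "0 <= t" for t using loc_boundedD(1)[OF w that] .
 have u_nonneg: "0 <= u z t" if "0 <= t" for z t using loc_boundedD(1)[OF ub that] .
 have convex: "(w (t + h))\<^sup>2 <= w t * w (t + 2 * h)" if t: "0 <= t" and h: "0 <= h" for t h
 proof -
  let ?s = "t / 2" and ?r = "(t + 2 * h) / 2"
  have "ennreal ((w (?s + ?r))\<^sup>2) = (\<integral>\<^sup>+z. ennreal (u z ?s) * ennreal (u z ?r) \<partial>count_space UNIV)\<^sup>2"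
   using semigroup[of ?s ?r] t h w_nonneg[of "?s + ?r"] by (simp add: ennreal_power[symmetric])
  also have "... <= (\<integral>\<^sup>+z. (ennreal (u z ?s))\<^sup>2 \<partial>count_space UNIV) * (\<integral>\<^sup>+z. (ennreal (u z ?r))\<^sup>2 \<partial>count_space UNIV)"
   by (rule Cauchy_Schwarz_nn_integral) auto
  also have "... = ennreal (w (?s + ?s)) * ennreal (w (?r + ?r))"
   using semigroup[of ?s ?s] semigroup[of ?r ?r] t h by (simp add: power2_eq_square)
  also have "... = ennreal (w t * w (t + 2 * h))"
   using w_nonneg t h by (simp add: ennreal_mult)
  finally have "(w (?s + ?r))\<^sup>2 <= w t * w (t + 2 * h)" using w_nonneg t h by (simp add: ennreal_le_iff)
  moreover have "?s + ?r = t + h" by (simp add: field_simps)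
  ultimately show ?thesis by simp
 qed
 have growth: "w t * pmf (p h 0) 0 <= w (t + h)" if t: "0 <= t" and h: "0 <= h" for t h
 proof -
  have "ennreal (u 0 t) * ennreal (u 0 h) = (\<integral>\<^sup>+z. (ennreal (u z t) * ennreal (u z h)) * indicator {0} z \<partial>count_space UNIV)" by simp
  also have "... <= (\<integral>\<^sup>+z. ennreal (u z t) * ennreal (u z h) \<partial>count_space UNIV)"
   by (intro nn_integral_mono) (auto simp: indicator_def)
  also have "... = ennreal (w (t + h))" by (rule semigroup[OF t h, symmetric])
  finally have "u 0 t * u 0 h <= w (t + h)"
   using u_nonneg[OF t] u_nonneg[OF h] w_nonneg t h by (simp add: ennreal_mult[symmetric] ennreal_le_iff)
  moreover have "u 0 t = w t" "k 0 h <= u 0 h"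
   using my[OF t, of 0] \<beta> conv_nonneg[OF k w] by (auto simp: w_def u_def)
  ultimately show ?thesis
   using mult_left_mono[of "k 0 h" "u 0 h" "w t"] w_nonneg[OF t] by (simp add: k_def)
 qed
 show thesis
 proof (rule that[OF w _ _ _ convex growth])
  show "w t = pmf (p t 0) 0 + ?\<beta> * conv (%t. pmf (p t 0) 0) w t" if "0 <= t" for t
   using w_eq[OF that] unfolding k_def[abs_def] .
  show "exp (b 0 * t) * local_moment M X 1 t x y = pmf (p t x) y
   + ?\<beta> * conv (%t. pmf (p t x) 0) (%t. pmf (p t y) 0 + ?\<beta> * conv (%t. pmf (p t y) 0) w t) t" if t: "0 <= t" for t x y
  proof -
   have "exp (b 0 * t) * local_moment M X 1 t x y = m {y} t x"
    unfolding local_moment_def m_def power_one_right using law[OF t, where F="%eta. real (count eta y)"] by (simp add: pop_singleton)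
   also have "... = pmf (p t x) y + ?\<beta> * conv (k x) (%t. m {y} t 0) t" using m_eq[OF t, of "{y}" x] by (simp add: measure_pmf_single)
   also have "conv (k x) (%t. m {y} t 0) t = conv (k x) (u y) t" by (rule conv_cong) (auto intro: my)
   finally show ?thesis unfolding k_def[abs_def] u_def[abs_def] .
  qed
  show "exp (b 0 * t) * total_moment M X 1 t x = 1
   + ?\<beta> * primitive (%t. pmf (p t x) 0 + ?\<beta> * conv (%t. pmf (p t x) 0) w t) t" if t: "0 <= t" for t x
  proof -
   have "exp (b 0 * t) * total_moment M X 1 t x = m UNIV t x"
    unfolding total_moment_def m_def power_one_right using law[OF t, where F="%eta. real (size eta)"] by (simp add: pop_UNIV)
   also note total[OF t]
   finally show ?thesis unfolding k_def[abs_def] u_def[abs_def] .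
  qed
 qed
qed

section \<open>Convolutions of regularly varying functions\<close>

lemma loc_bounded_convergent_bounded:
 assumes g: "loc_bounded g" and lim: "(g \<longlongrightarrow> C) at_top"
 obtains B where "0 <= B" "!!t. 0 <= t ==> g t <= B"
proof -
 have "\<forall>\<^sub>F t in at_top. g t < C + 1" using lim by (rule order_tendstoD) simp
 then obtain T where T: "!!t. T <= t ==> g t < C + 1" by (auto simp: eventually_at_top_linorder)
 obtain B where B: "0 <= B" "!!t. 0 <= t ==> t <= T ==> g t <= B" using loc_bounded_bound[OF g, of T] by metis
 show thesis
 proof (rule that[of "max B (C + 1)"])
  fix t :: real assume t: "0 <= t"
  show "g t <= max B (C + 1)" using T[of t] B(2)[OF t] by (cases "T <= t") auto
 qed (use B in simp)
qed

lemma hl_integrable_power: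
 assumes "1 < \<theta>"
 shows "hl_integrable (%t. (1 + t) powr (- \<theta>))"
proof (rule hl_integrableI_bounded_primitive[where B="1 / (\<theta> - 1)"])
 show "loc_bounded (%t. (1 + t) powr (- \<theta>))" using power_weight(1)[of \<theta>] assms by simp
 fix t :: real assume t: "0 <= t"
 have "has_bochner_integral lborel (%s. indicator {0..t} s *\<^sub>R (1 + s) powr (- \<theta>))
   (- (1 / (\<theta> - 1)) * (1 + t) powr (1 - \<theta>) - - (1 / (\<theta> - 1)) * (1 + 0) powr (1 - \<theta>))"
 proof (rule has_bochner_integral_FTC_Icc[OF t])
  fix s :: real assume s: "0 <= s" "s <= t"
  have "((%s. (1 + s) powr (1 - \<theta>)) has_real_derivative (1 - \<theta>) * (1 + s) powr (1 - \<theta> - 1) * (0 + 1)) (at s within {0..t})"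
   by (rule DERIV_chain2[OF has_real_derivative_powr DERIV_add[OF DERIV_const DERIV_ident]]) (use s in simp)
  from DERIV_cmult[OF this, of "- (1 / (\<theta> - 1))"]
  have "((%s. - (1 / (\<theta> - 1)) * (1 + s) powr (1 - \<theta>)) has_real_derivative
    - (1 / (\<theta> - 1)) * ((1 - \<theta>) * (1 + s) powr (1 - \<theta> - 1) * (0 + 1))) (at s within {0..t})" .
  moreover have "- (1 / (\<theta> - 1)) * (1 - \<theta>) = 1" using assms by (simp add: field_simps)
  then have "- (1 / (\<theta> - 1)) * ((1 - \<theta>) * (1 + s) powr (1 - \<theta> - 1) * (0 + 1)) = (1 + s) powr (- \<theta>)"
   by (simp only: mult.assoc[symmetric]) simp
  ultimately show "((%s. - (1 / (\<theta> - 1)) * (1 + s) powr (1 - \<theta>)) has_vector_derivative (1 + s) powr (- \<theta>)) (at s within {0..t})"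
   by (simp only: has_real_derivative_iff_has_vector_derivative)
 next
  show "continuous_on {0..t} (%s. (1 + s) powr (- \<theta>))" by (auto intro!: continuous_intros)
 qed
 then have "primitive (%t. (1 + t) powr (- \<theta>)) t = 1 / (\<theta> - 1) - (1 + t) powr (1 - \<theta>) / (\<theta> - 1)"
  unfolding primitive_eq by (simp add: has_bochner_integral_iff)
 moreover have "0 <= (1 + t) powr (1 - \<theta>) / (\<theta> - 1)" using assms by simp
 ultimately show "primitive (%t. (1 + t) powr (- \<theta>)) t <= 1 / (\<theta> - 1)" by linarith
qed

lemma hl_integrable_of_power_decay:
 assumes f: "loc_bounded f" and \<theta>: "1 < \<theta>" and lim: "((%t. f t / (1 + t) powr (- \<theta>)) \<longlongrightarrow> c) at_top"
 shows "hl_integrable f"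
proof -
 have e: "loc_bounded (%t. (1 + t) powr \<theta>)" by (rule continuous_on_loc_bounded) (auto intro!: continuous_intros)
 have "((%t. f t * (1 + t) powr \<theta>) \<longlongrightarrow> c) at_top" using lim by (simp add: powr_minus divide_inverse)
 then obtain M where M: "0 <= M" "!!t. 0 <= t ==> f t * (1 + t) powr \<theta> <= M"
  using loc_bounded_convergent_bounded[OF loc_bounded_mult[OF f e]] by metis
 have bound: "f t <= M * (1 + t) powr (- \<theta>)" if "0 <= t" for t
  using M(2)[OF that] that by (simp add: powr_minus field_simps)
 have "loc_bounded (%t. (1 + t) powr (- \<theta>))" using power_weight(1)[of \<theta>] \<theta> by simp
 then show ?thesis
  by (intro hl_integrable_mono[OF f loc_bounded_cmult[OF M(1)] mass_cmult(1)[OF hl_integrable_power[OF \<theta>]] bound])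
qed

lemma power_ratio:
 fixes \<theta> c :: real
 assumes "((%t. t powr \<theta> * f t) \<longlongrightarrow> c) at_top"
 shows "((%t. f t / (1 + t) powr (- \<theta>)) \<longlongrightarrow> c) at_top"
proof -
 have "((%t. ((1 + t) / t) powr \<theta> * (t powr \<theta> * f t)) \<longlongrightarrow> 1 powr \<theta> * c) at_top"
 proof (intro tendsto_mult assms tendsto_powr tendsto_const)
  show "((%t. (1 + t) / t) \<longlongrightarrow> (1::real)) at_top" by real_asymp
 qed simp
 moreover have "\<forall>\<^sub>F t in at_top. ((1 + t) / t) powr \<theta> * (t powr \<theta> * f t) = f t / (1 + t) powr (- \<theta>)"
  using eventually_gt_at_top[of 0]
 proof eventually_elim
  case (elim t)
  have "((1 + t) / t) powr \<theta> * t powr \<theta> = ((1 + t) / t * t) powr \<theta>" by (rule powr_mult[symmetric])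
  also have "(1 + t) / t * t = 1 + t" using elim by simp
  finally show ?case by (simp add: mult.assoc[symmetric] powr_minus divide_inverse mult.commute)
 qed
 ultimately show ?thesis using Lim_transform_eventually by fastforce
qed

lemma conv_asymp_integrable:
 assumes f: "loc_bounded f" "hl_integrable f" and g: "loc_bounded g" "hl_integrable g"
  and v: "!!t. T0 <= t ==> 0 < v t" "!!s. ((%t. v (t - s) / v t) \<longlongrightarrow> 1) at_top"
   "!!t s. T0 <= t ==> 0 <= s ==> s <= t / 2 ==> v (t - s) <= K * v t"
  and lim: "((%t. f t / v t) \<longlongrightarrow> A) at_top" "((%t. g t / v t) \<longlongrightarrow> B) at_top"
 shows "((%t. conv f g t / v t) \<longlongrightarrow> B * mass f + A * mass g) at_top"
proof -
 have "((%t. hconv f g t / v t + hconv g f t / v t) \<longlongrightarrow> B * mass f + A * mass g) at_top"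
  by (intro tendsto_add hconv_tendsto[OF f g(1) v(1) lim(2) v(2,3)] hconv_tendsto[OF g f(1) v(1) lim(1) v(2,3)])
 moreover have "\<forall>\<^sub>F t in at_top. hconv f g t / v t + hconv g f t / v t = conv f g t / v t"
  using eventually_ge_at_top[of 0] by eventually_elim (simp add: conv_eq_hconv[OF f(1) g(1)] add_divide_distrib)
 ultimately show ?thesis by (rule Lim_transform_eventually)
qed

text \<open>Here \<open>g\<close> need not be integrable. The half in which \<open>g\<close> has small argument is at most
\<open>r t\<close> times the primitive of \<open>g\<close>, and the latter is \<open>o(t)\<close> because
\<open>g\<close> tends to zero.\<close>
lemma conv_asymp_heavy:
 assumes f: "loc_bounded f" "hl_integrable f" and g: "loc_bounded g" "(g \<longlongrightarrow> 0) at_top"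
  and v: "!!t. T0 <= t ==> 0 < v t" "!!s. ((%t. v (t - s) / v t) \<longlongrightarrow> 1) at_top"
   "!!t s. T0 <= t ==> 0 <= s ==> s <= t / 2 ==> v (t - s) <= K * v t"
  and lim: "((%t. g t / v t) \<longlongrightarrow> C) at_top"
  and r: "!!s t. 0 <= t ==> t / 2 <= s ==> s <= t ==> f s <= r t" and r_small: "\<forall>\<^sub>F t in at_top. r t * t / v t <= A"
 shows "((%t. conv f g t / v t) \<longlongrightarrow> C * mass f) at_top"
proof -
 have P: "((%t. primitive g t / t) \<longlongrightarrow> 0) at_top"
  by (rule primitive_asymp[OF g(1), where V'="%_. 1" and ?T0.0=0])
   (use g(2) filterlim_ident in \<open>auto intro!: derivative_eq_intros continuous_intros\<close>)
 have ev: "\<forall>\<^sub>F t in at_top. 0 <= hconv g f t / v t & hconv g f t / v t <= A * (primitive g t / t)"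
  using r_small eventually_ge_at_top[of 1] eventually_ge_at_top[of T0]
 proof eventually_elim
  case (elim t)
  have vt: "0 < v t" by (rule v(1)[OF elim(3)])
  have t: "0 <= t" using elim by simp
  have h: "0 <= hconv g f t" "hconv g f t <= r t * primitive g t"
   by (rule hconv_bound[OF f(1) g(1) t r[OF t]]; assumption)+
  have "hconv g f t / v t <= r t * primitive g t / v t" using h(2) vt by (simp add: divide_right_mono)
  also have "... = r t * t / v t * (primitive g t / t)" using elim by simp
  also have "... <= A * (primitive g t / t)"
   using elim conv_nonneg[OF loc_bounded_const[of 1] g(1)] by (intro mult_right_mono) auto
  finally show ?case using h(1) vt by simp
 qed
 have "((%t. hconv g f t / v t) \<longlongrightarrow> 0) at_top"
 proof (rule tendsto_sandwich[of "%_. 0" _ _ "%t. A * (primitive g t / t)"])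
  show "((%t. A * (primitive g t / t)) \<longlongrightarrow> 0) at_top" using tendsto_mult_left[OF P, of A] by simp
 qed (use ev in \<open>auto elim: eventually_mono\<close>)
 then have "((%t. hconv f g t / v t + hconv g f t / v t) \<longlongrightarrow> C * mass f + 0) at_top"
  by (intro tendsto_add hconv_tendsto[OF f g(1) v(1) lim v(2,3)])
 moreover have "\<forall>\<^sub>F t in at_top. hconv f g t / v t + hconv g f t / v t = conv f g t / v t"
  using eventually_ge_at_top[of 0] by eventually_elim (simp add: conv_eq_hconv[OF f(1) g(1)] add_divide_distrib)
 ultimately show ?thesis using Lim_transform_eventually by fastforce
qed

section \<open>Asymptotics of the moments\<close>

text \<open>The analytic content of the first moments: \<open>k x\<close> is the transition probability from
\<open>x\<close> to the source, \<open>q x y\<close> the one from \<open>x\<close> to \<open>y\<close>, and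
\<open>w\<close> the mean at the source. The death rate has been removed from all moments.\<close>
locale walk_moments =
 fixes k :: "'s => real => real" and q :: "'s => 's => real => real" and orig :: 's and w :: "real => real"
  and \<beta> \<theta> c :: real
 assumes k: "!!x. loc_bounded (k x)" and k_le: "!!x t. 0 <= t ==> k x t <= k orig t" and k_le_1: "!!t. 0 <= t ==> k orig t <= 1"
  and k_pos: "!!t. 0 <= t ==> 0 < k orig t" and k_anti: "!!s t. 0 <= s ==> s <= t ==> k orig t <= k orig s"
  and k_lim: "!!x. ((%t. t powr \<theta> * k x t) \<longlongrightarrow> c) at_top" and c: "0 < c" and \<theta>: "0 < \<theta>"
  and q: "!!x y t. 0 <= q x y t" "!!x y t. 0 <= t ==> q x y t <= k orig t" "!!x y. ((%t. t powr \<theta> * q x y t) \<longlongrightarrow> c) at_top"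
  and w: "loc_bounded w" and \<beta>: "0 < \<beta>" and renewal_eq: "!!t. 0 <= t ==> w t = k orig t + \<beta> * conv (k orig) w t"
  and convex: "!!t h. 0 <= t ==> 0 <= h ==> (w (t + h))\<^sup>2 <= w t * w (t + 2 * h)"
  and growth: "!!t h. 0 <= t ==> 0 <= h ==> w t * k orig h <= w (t + h)"
begin

definition u :: "'s => real => real" where "u x t = k x t + \<beta> * conv (k x) w t"
definition loc :: "'s => 's => real => real" where "loc x y t = q x y t + \<beta> * conv (k x) (u y) t"
definition tot :: "'s => real => real" where "tot x t = 1 + \<beta> * primitive (u x) t"

lemma \<beta>_nonneg: "0 <= \<beta>" using \<beta> by simp

lemma k_nonneg: "0 <= t ==> 0 <= k x t" by (rule loc_boundedD(1)[OF k])

lemma u: "loc_bounded (u x)"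
 unfolding u_def[abs_def] by (intro loc_bounded_add loc_bounded_cmult loc_bounded_conv k w \<beta>_nonneg)

lemma w_pos: "0 <= t ==> 0 < w t"
 unfolding renewal_eq using k_pos[of t] mult_nonneg_nonneg[OF \<beta>_nonneg conv_nonneg[OF k[of orig] w, of t]] by linarith

lemma power_limit_tendsto_0:
 assumes "((%t. t powr \<theta> * f t) \<longlongrightarrow> c) at_top"
 shows "(f \<longlongrightarrow> 0) at_top"
proof -
 have "((%t. t powr (- \<theta>)) \<longlongrightarrow> 0) at_top" using \<theta> by (intro tendsto_neg_powr filterlim_ident) simp
 then have "((%t. t powr (- \<theta>) * (t powr \<theta> * f t)) \<longlongrightarrow> 0 * c) at_top" by (intro tendsto_mult assms)
 moreover have "\<forall>\<^sub>F t in at_top. t powr (- \<theta>) * (t powr \<theta> * f t) = f t"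
  using eventually_gt_at_top[of 0] by eventually_elim (simp add: powr_minus)
 ultimately show ?thesis using Lim_transform_eventually by fastforce
qed

lemma k_eventually_pos: obtains T where "!!t. T < t ==> 0 < k x t"
proof -
 have "\<forall>\<^sub>F t in at_top. 0 < t powr \<theta> * k x t" by (rule order_tendstoD(1)[OF k_lim c])
 then obtain T where "!!t. T <= t ==> 0 < t powr \<theta> * k x t" by (auto simp: eventually_at_top_linorder)
 then have "0 < k x t" if "T < t" for t
  using that by (metis less_imp_le powr_ge_zero zero_less_mult_pos mult_zero_left order_le_less)
 then show thesis by (rule that)
qed

lemma k_integrable: "1 < \<theta> ==> hl_integrable (k x)"
 by (rule hl_integrable_of_power_decay[OF k _ power_ratio[OF k_lim]])

definition tilt :: "real => (real => real) => real => real" where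
 "tilt mu f t = exp (- mu * t) * f t"

lemma tilt_loc_bounded: "loc_bounded f ==> loc_bounded (tilt mu f)"
 unfolding tilt_def[abs_def] by (rule loc_bounded_mult[OF loc_bounded_exp])

lemma conv_tilt: "conv (tilt mu f) (tilt mu g) t = exp (- mu * t) * conv f g t"
 unfolding tilt_def[abs_def] by (rule conv_exp)

lemma tilt_0: "tilt 0 f = f" by (simp add: tilt_def[abs_def])

lemma tilt_tendsto_0:
 assumes "0 <= mu" "(f \<longlongrightarrow> 0) at_top" "!!t. 0 <= t ==> 0 <= f t"
 shows "(tilt mu f \<longlongrightarrow> 0) at_top"
proof (rule tendsto_sandwich[of "%_. 0" _ _ f])
 show "\<forall>\<^sub>F t in at_top. 0 <= tilt mu f t"
  using eventually_ge_at_top[of 0] by eventually_elim (simp add: tilt_def assms(3))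
 show "\<forall>\<^sub>F t in at_top. tilt mu f t <= f t"
  using eventually_ge_at_top[of 0]
 proof eventually_elim
  case (elim t)
  then have "exp (- mu * t) <= 1" using assms(1) by simp
  then show ?case unfolding tilt_def using assms(3)[OF elim] by (rule mult_left_le_one_le[OF _ exp_ge_zero, rotated])
 qed
qed (use assms in auto)

text \<open>Tilting by the factor \<open>exp (- mu * t)\<close> preserves renewal equations and logarithmic convexity.
With the right \<open>mu\<close> the kernel becomes a probability density; boundedness and then monotonicity
of the tilted mean follow.\<close>
lemma tilted_renewal:
 assumes mu: "0 <= mu" and i: "hl_integrable (tilt mu (k orig))" and total: "\<beta> * mass (tilt mu (k orig)) = 1"
 shows "antimono_renewal (tilt mu (k orig)) (tilt mu w) \<beta>"
proof -
 interpret renewal "tilt mu (k orig)" "tilt mu w" \<beta>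
 proof
  show "tilt mu (k orig) t <= tilt mu (k orig) s" if "0 <= s" "s <= t" for s t
   unfolding tilt_def using mu that k_anti[OF that] k_nonneg[of t] by (intro mult_mono) (auto simp: mult_left_mono)
  show "tilt mu w t = tilt mu (k orig) t + \<beta> * conv (tilt mu (k orig)) (tilt mu w) t" if "0 <= t" for t
   unfolding conv_tilt using renewal_eq[OF that] by (simp add: tilt_def algebra_simps)
 qed (use i total \<beta> k_pos in \<open>auto intro: tilt_loc_bounded k w simp: tilt_def\<close>)
 have "0 < exp (- mu) * k orig 1" using k_pos by simp
 moreover have "exp (- mu) * k orig 1 * tilt mu w t <= tilt mu w (t + h)" if t: "0 <= t" and h: "0 <= h" "h <= 1" for t h
 proof -
  have "exp (- mu) * k orig 1 * tilt mu w t = exp (- mu * (t + 1)) * (w t * k orig 1)"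
   by (simp add: tilt_def exp_add[symmetric] algebra_simps)
  also have "... <= exp (- mu * (t + h)) * (w t * k orig h)"
   using mu t h k_anti[of h 1] w_pos[OF t] k_nonneg[of 1 orig] by (intro mult_mono) (auto intro: mult_left_mono mult_nonneg_nonneg less_imp_le)
  also have "... <= tilt mu w (t + h)" unfolding tilt_def using growth[OF t h(1)] by (intro mult_left_mono) auto
  finally show ?thesis .
 qed
 ultimately obtain B where B: "!!t. 0 <= t ==> tilt mu w t <= B" using bounded_of_lower_growth by blast
 show ?thesis
 proof unfold_locales
  fix s t :: real assume "0 <= s" "s <= t"
  then show "tilt mu w t <= tilt mu w s"
  proof (rule log_convex_bounded_antimono[OF _ B, rotated -2])
   show "0 < tilt mu w t" if "0 <= t" for t unfolding tilt_def using w_pos[OF that] by simp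
   fix t h :: real assume th: "0 <= t" "0 <= h"
   have "(tilt mu w (t + h))\<^sup>2 = exp (- mu * (2 * t + 2 * h)) * (w (t + h))\<^sup>2"
    by (simp add: tilt_def power_mult_distrib exp_double[symmetric] algebra_simps)
   also have "... <= exp (- mu * (2 * t + 2 * h)) * (w t * w (t + 2 * h))" using convex[OF th] by (intro mult_left_mono) auto
   also have "... = tilt mu w t * tilt mu w (t + 2 * h)" by (simp add: tilt_def exp_add[symmetric] algebra_simps)
   finally show "(tilt mu w (t + h))\<^sup>2 <= tilt mu w t * tilt mu w (t + 2 * h)" .
  qed
 qed
qed

text \<open>The functions \<open>u\<close> and \<open>loc\<close> arise from \<open>w\<close> by one and two convolutions
with integrable kernels, each of which multiplies the limit by the mass of the kernel.\<close>
lemma finite_limit_case: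
 assumes mu: "0 <= mu" and i: "!!x. hl_integrable (tilt mu (k x))" and lim: "(tilt mu w \<longlongrightarrow> L) at_top" and L: "0 < L"
 obtains U C where "!!x. 0 < U x" "!!x. (tilt mu (u x) \<longlongrightarrow> U x) at_top"
  "!!x y. 0 < C x y" "!!x y. (tilt mu (loc x y) \<longlongrightarrow> C x y) at_top"
proof -
 have m: "0 < mass (tilt mu (k x))" for x
 proof -
  obtain T where "!!t. T < t ==> 0 < k x t" using k_eventually_pos[of x] by blast
  then show ?thesis by (intro mass_pos[OF tilt_loc_bounded[OF k] i, of T]) (simp add: tilt_def)
 qed
 have step: "((%t. exp (- mu * t) * conv (k x) g t) \<longlongrightarrow> C * mass (tilt mu (k x))) at_top"
  if g: "loc_bounded g" "(tilt mu g \<longlongrightarrow> C) at_top" for g C x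
 proof -
  obtain B where B: "!!t. 0 <= t ==> tilt mu g t <= B" using loc_bounded_convergent_bounded[OF tilt_loc_bounded[OF g(1)] g(2)] by metis
  have "(conv (tilt mu g) (tilt mu (k x)) \<longlongrightarrow> C * mass (tilt mu (k x))) at_top"
   by (rule conv_tendsto[OF tilt_loc_bounded[OF g(1)] tilt_loc_bounded[OF k] i B g(2)])
  moreover have "conv (tilt mu g) (tilt mu (k x)) = (%t. exp (- mu * t) * conv (k x) g t)"
   by (rule ext) (rule trans[OF conv_commute[OF tilt_loc_bounded[OF g(1)] tilt_loc_bounded[OF k]] conv_tilt])
  ultimately show ?thesis by (simp only:)
 qed
 define U where "U x = \<beta> * (L * mass (tilt mu (k x)))" for x
 have U: "(tilt mu (u x) \<longlongrightarrow> U x) at_top" for x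
 proof -
  have "((%t. tilt mu (k x) t + \<beta> * (exp (- mu * t) * conv (k x) w t)) \<longlongrightarrow> 0 + U x) at_top"
   unfolding U_def by (intro tendsto_intros step w lim tilt_tendsto_0 mu power_limit_tendsto_0 k_lim k_nonneg)
  then show ?thesis by (simp add: tilt_def[abs_def] u_def algebra_simps)
 qed
 have "(tilt mu (loc x y) \<longlongrightarrow> \<beta> * (U y * mass (tilt mu (k x)))) at_top" for x y
 proof -
  have "((%t. tilt mu (q x y) t + \<beta> * (exp (- mu * t) * conv (k x) (u y) t)) \<longlongrightarrow> 0 + \<beta> * (U y * mass (tilt mu (k x)))) at_top"
   by (intro tendsto_intros step u U tilt_tendsto_0 mu power_limit_tendsto_0 q)
  then show ?thesis by (simp add: tilt_def[abs_def] loc_def algebra_simps)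
 qed
 then show thesis using U \<beta> L m by (intro that[of U "%x y. \<beta> * (U y * mass (tilt mu (k x)))"]) (auto simp: U_def)
qed

text \<open>Tilting by the leading eigenvalue makes the waiting time exponentially integrable, hence of finite mean.\<close>
theorem supercritical:
 assumes T: "0 <= T" "1 < \<beta> * primitive (k orig) T"
 obtains mu C C' where "0 < mu" "\<beta> * laplace (k orig) mu = 1" "!!x y. 0 < C x y" "!!x. 0 < C' x"
  "!!x y. ((%t. loc x y t / exp (mu * t)) \<longlongrightarrow> C x y) at_top"
  "!!x. ((%t. tot x t / exp (mu * t)) \<longlongrightarrow> C' x) at_top"
proof -
 obtain mu where mu: "0 < mu" "\<beta> * laplace (k orig) mu = 1" using laplace_root[OF k k_le_1 \<beta> T] by blast
 have mu0: "0 <= mu" using mu by simp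
 have i: "hl_integrable (tilt mu (k x))" for x
  unfolding tilt_def[abs_def] by (rule laplace_integrand(2)[OF k _ mu(1)]) (use k_le k_le_1 order_trans in blast)
 have total: "\<beta> * mass (tilt mu (k orig)) = 1" using mu(2) by (simp add: laplace_def tilt_def[abs_def])
 interpret R: antimono_renewal "tilt mu (k orig)" "tilt mu w" \<beta> by (rule tilted_renewal[OF mu0 i total])
 have "hl_integrable R.tail"
 proof (rule hl_integrable_of_power_decay[OF R.tail_loc_bounded, of 2])
  let ?V = "%t. 2 / mu * exp (- (mu / 2) * t)"
  have "((%t. (mass (tilt mu (k orig)) - primitive (tilt mu (k orig)) t) / ?V t) \<longlongrightarrow> 0) at_top"
  proof (rule mass_minus_primitive_asymp[OF tilt_loc_bounded[OF k] i, where v="%t. exp (- (mu / 2) * t)" and ?T0.0=0])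
   have "tilt mu (k orig) t / exp (- (mu / 2) * t) = tilt (mu / 2) (k orig) t" for t
    by (simp add: tilt_def exp_minus exp_diff[symmetric] field_simps exp_add[symmetric])
   then show "((%t. tilt mu (k orig) t / exp (- (mu / 2) * t)) \<longlongrightarrow> 0) at_top"
    using tilt_tendsto_0[OF _ power_limit_tendsto_0[OF k_lim] k_nonneg, of "mu / 2" orig] mu by simp
   show "(?V has_real_derivative - exp (- (mu / 2) * t)) (at t)" for t
    using mu by (auto intro!: derivative_eq_intros)
   show "(?V \<longlongrightarrow> 0) at_top" using mu(1) by real_asymp
  qed (use mu in \<open>auto intro!: continuous_intros\<close>)
  moreover have "((%t. ?V t / (1 + t) powr (- 2)) \<longlongrightarrow> 0) at_top" using mu(1) by real_asymp
  ultimately have "((%t. \<beta> * ((mass (tilt mu (k orig)) - primitive (tilt mu (k orig)) t) / ?V t * (?V t / (1 + t) powr (- 2)))) \<longlongrightarrow> \<beta> * (0 * 0)) at_top"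
   by (intro tendsto_intros)
  moreover have "\<beta> * ((mass (tilt mu (k orig)) - primitive (tilt mu (k orig)) t) / ?V t * (?V t / (1 + t) powr (- 2)))
    = R.tail t / (1 + t) powr (- 2)" for t
  proof -
   have "?V t ~= 0" using mu by simp
   moreover have "R.tail t = \<beta> * (mass (tilt mu (k orig)) - primitive (tilt mu (k orig)) t)"
    unfolding R.tail_def right_diff_distrib total ..
   ultimately show ?thesis by simp
  qed
  ultimately show "((%t. R.tail t / (1 + t) powr (- 2)) \<longlongrightarrow> 0) at_top" by simp
 qed simp
 then obtain L where L: "0 < L" "(tilt mu w \<longlongrightarrow> L) at_top" using R.finite_mean by blast
 obtain U C where U: "!!x. 0 < U x" "!!x. (tilt mu (u x) \<longlongrightarrow> U x) at_top"
  and C: "!!x y. 0 < C x y" "!!x y. (tilt mu (loc x y) \<longlongrightarrow> C x y) at_top"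
  using finite_limit_case[OF mu0 i L(2,1)] by metis
 have "((%t. tot x t / exp (mu * t)) \<longlongrightarrow> \<beta> * (U x * (1 / mu))) at_top" for x
 proof -
  obtain B where B: "!!t. 0 <= t ==> tilt mu (u x) t <= B" using loc_bounded_convergent_bounded[OF tilt_loc_bounded[OF u] U(2)] by metis
  have e: "tilt mu (%_. 1) = (%t. exp (- mu * t))" by (simp add: tilt_def[abs_def])
  have one: "loc_bounded (%_. 1)" by (rule loc_bounded_const) simp
  have "(conv (tilt mu (u x)) (tilt mu (%_. 1)) \<longlongrightarrow> U x * (1 / mu)) at_top"
   unfolding e mass_exp(2)[OF mu(1), symmetric]
   by (rule conv_tendsto[OF tilt_loc_bounded[OF u] loc_bounded_exp mass_exp(1)[OF mu(1)] B U(2)])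
  moreover have "conv (tilt mu (u x)) (tilt mu (%_. 1)) = (%t. exp (- mu * t) * primitive (u x) t)"
   by (rule ext) (rule trans[OF conv_commute[OF tilt_loc_bounded[OF u] tilt_loc_bounded[OF one]] conv_tilt])
  ultimately have P: "((%t. exp (- mu * t) * primitive (u x) t) \<longlongrightarrow> U x * (1 / mu)) at_top" by (simp only:)
  have "((%t. exp (- mu * t)) \<longlongrightarrow> 0) at_top" using mu(1) by real_asymp
  then have "((%t. exp (- mu * t) + \<beta> * (exp (- mu * t) * primitive (u x) t)) \<longlongrightarrow> 0 + \<beta> * (U x * (1 / mu))) at_top"
   by (rule tendsto_add[OF _ tendsto_mult_left[OF P]])
  moreover have "exp (- mu * t) + \<beta> * (exp (- mu * t) * primitive (u x) t) = tot x t / exp (mu * t)" for t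
   by (simp add: tot_def exp_minus field_simps)
  ultimately show ?thesis by simp
 qed
 moreover have "((%t. loc x y t / exp (mu * t)) \<longlongrightarrow> C x y) at_top" for x y
  using C(2)[of x y] by (simp add: tilt_def[abs_def] exp_minus field_simps)
 ultimately show thesis using mu C(1) U(1)
  by (intro that[of mu C "%x. \<beta> * (U x * (1 / mu))"]) (auto simp: \<beta>)
qed

end

context walk_moments
begin

text \<open>The local limit theorem, integrated.\<close>
lemma critical_tail:
 assumes \<theta>1: "1 < \<theta>" and total: "\<beta> * mass (k orig) = 1"
 shows "((%t. (1 - \<beta> * primitive (k orig) t) * t powr (\<theta> - 1)) \<longlongrightarrow> \<beta> * c / (\<theta> - 1)) at_top"
proof -
 let ?V = "%t. 1 / (\<theta> - 1) * t powr (1 - \<theta>)"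
 have "((%t. (mass (k orig) - primitive (k orig) t) / ?V t) \<longlongrightarrow> c) at_top"
 proof (rule mass_minus_primitive_asymp[OF k k_integrable[OF \<theta>1], where v="%t. t powr (- \<theta>)" and ?T0.0=1])
  have "\<forall>\<^sub>F t in at_top. t powr \<theta> * k orig t = k orig t / t powr (- \<theta>)"
   by (rule always_eventually) (simp add: powr_minus divide_inverse mult.commute)
  then show "((%t. k orig t / t powr (- \<theta>)) \<longlongrightarrow> c) at_top" by (rule Lim_transform_eventually[OF k_lim])
  show "(?V has_real_derivative - (t powr (- \<theta>))) (at t)" if "1 <= t" for t
  proof (rule DERIV_cong[OF DERIV_cmult[OF has_real_derivative_powr]])
   have "1 / (\<theta> - 1) * (1 - \<theta>) = -1" using \<theta>1 by (simp add: field_simps)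
   then show "1 / (\<theta> - 1) * ((1 - \<theta>) * t powr (1 - \<theta> - 1)) = - (t powr (- \<theta>))"
    by (simp only: mult.assoc[symmetric]) simp
  qed (use that in simp)
  show "continuous_on {1..} (%t. t powr (- \<theta>))" by (auto intro!: continuous_intros)
  have "((%t. t powr (1 - \<theta>)) \<longlongrightarrow> 0) at_top" using \<theta>1 by (intro tendsto_neg_powr filterlim_ident) simp
  from tendsto_mult_left[OF this, of "1 / (\<theta> - 1)"] show "(?V \<longlongrightarrow> 0) at_top" by simp
 qed (use \<theta>1 in auto)
 from tendsto_mult_left[OF this, of "\<beta> / (\<theta> - 1)"]
 have "((%t. \<beta> / (\<theta> - 1) * ((mass (k orig) - primitive (k orig) t) / ?V t)) \<longlongrightarrow> \<beta> * c / (\<theta> - 1)) at_top" by simp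
 moreover have "\<forall>\<^sub>F t in at_top. \<beta> / (\<theta> - 1) * ((mass (k orig) - primitive (k orig) t) / ?V t)
   = (1 - \<beta> * primitive (k orig) t) * t powr (\<theta> - 1)"
  using eventually_gt_at_top[of 0]
 proof eventually_elim
  case (elim t)
  have "1 - \<beta> * primitive (k orig) t = \<beta> * (mass (k orig) - primitive (k orig) t)"
   unfolding right_diff_distrib total ..
  moreover have "t powr (1 - \<theta>) = inverse (t powr (\<theta> - 1))" using powr_minus[of t "\<theta> - 1"] by simp
  moreover have "\<beta> / (\<theta> - 1) * (D / (1 / (\<theta> - 1) * inverse r)) = \<beta> * D * r" for D r :: real
   using \<theta>1 by (simp add: divide_inverse)
  ultimately show ?case by (simp only:)
 qed
 ultimately show ?thesis by (rule Lim_transform_eventually)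
qed

lemma critical_renewal:
 assumes "1 < \<theta>" "\<beta> * mass (k orig) = 1"
 shows "antimono_renewal (k orig) w \<beta>"
 using tilted_renewal[of 0, unfolded tilt_0] k_integrable assms by simp

text \<open>For \<open>\<theta> > 2\<close> the survival function decays like a power of exponent larger than one, so the
waiting time has finite mean.\<close>
theorem critical_light:
 assumes \<theta>2: "2 < \<theta>" and total: "\<beta> * mass (k orig) = 1"
 obtains C C' where "!!x y. 0 < C x y" "!!x. 0 < C' x" "!!x y. (loc x y \<longlongrightarrow> C x y) at_top"
  "!!x. ((%t. tot x t / t) \<longlongrightarrow> C' x) at_top"
proof -
 have \<theta>1: "1 < \<theta>" "1 < \<theta> - 1" using \<theta>2 by auto
 interpret R: antimono_renewal "k orig" w \<beta> by (rule critical_renewal[OF \<theta>1(1) total])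
 have "((%t. t powr (\<theta> - 1) * R.tail t) \<longlongrightarrow> \<beta> * c / (\<theta> - 1)) at_top"
  using critical_tail[OF \<theta>1(1) total] by (simp add: R.tail_def mult.commute)
 then have "hl_integrable R.tail"
  by (rule hl_integrable_of_power_decay[OF R.tail_loc_bounded \<theta>1(2) power_ratio])
 then obtain L where L: "0 < L" "(w \<longlongrightarrow> L) at_top" using R.finite_mean by blast
 obtain U C where U: "!!x. 0 < U x" "!!x. (u x \<longlongrightarrow> U x) at_top"
  and C: "!!x y. 0 < C x y" "!!x y. (loc x y \<longlongrightarrow> C x y) at_top"
  using finite_limit_case[of 0 L, unfolded tilt_0, OF order_refl k_integrable[OF \<theta>1(1)] L(2,1)] by metis
 have "((%t. tot x t / t) \<longlongrightarrow> \<beta> * U x) at_top" for x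
 proof -
  have "((%t. primitive (u x) t / t) \<longlongrightarrow> U x) at_top"
   by (rule primitive_asymp[OF u, where V'="%_. 1" and ?T0.0=0])
    (use U(2) filterlim_ident in \<open>auto intro!: derivative_eq_intros continuous_intros\<close>)
  then have "((%t. 1 / t + \<beta> * (primitive (u x) t / t)) \<longlongrightarrow> 0 + \<beta> * U x) at_top"
   by (intro tendsto_add tendsto_mult_left) real_asymp
  then show ?thesis by (simp add: tot_def add_divide_distrib)
 qed
 then show thesis using C U(1) \<beta> by (intro that[of C "%x. \<beta> * U x"]) auto
qed

text \<open>If the waiting time has infinite mean, \<open>w\<close> still decays more slowly than the transition
probabilities, and this slower decay passes through the convolutions.\<close>
lemma heavy_case:
 assumes i: "!!x. hl_integrable (k x)"
  and v: "!!t. T0 <= t ==> 0 < v t" "!!s. ((%t. v (t - s) / v t) \<longlongrightarrow> 1) at_top"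
   "!!t s. T0 <= t ==> 0 <= s ==> s <= t / 2 ==> v (t - s) <= K * v t"
  and v0: "(v \<longlongrightarrow> 0) at_top" and small: "\<forall>\<^sub>F t in at_top. k orig (t / 2) * t / v t <= A"
  and L: "0 < L" "((%t. w t / v t) \<longlongrightarrow> L) at_top"
 obtains U C where "!!x. 0 < U x" "!!x. ((%t. u x t / v t) \<longlongrightarrow> U x) at_top"
  "!!x y. 0 < C x y" "!!x y. ((%t. loc x y t / v t) \<longlongrightarrow> C x y) at_top"
proof -
 have m: "0 < mass (k x)" for x using k_eventually_pos[of x] mass_pos[OF k i] by blast
 have negligible: "((%t. f t / v t) \<longlongrightarrow> 0) at_top" if f: "!!t. 0 <= t ==> 0 <= f t" "!!t. 0 <= t ==> f t <= k orig t" for f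
 proof (rule tendsto_sandwich[of "%_. 0" _ _ "%t. A / t"])
  show "((%t. A / t) \<longlongrightarrow> 0) at_top" by real_asymp
  show "\<forall>\<^sub>F t in at_top. 0 <= f t / v t"
   using eventually_ge_at_top[of 0] eventually_ge_at_top[of T0]
   by eventually_elim (use f(1) v(1) in \<open>simp add: less_imp_le\<close>)
  show "\<forall>\<^sub>F t in at_top. f t / v t <= A / t"
   using small eventually_ge_at_top[of 1] eventually_ge_at_top[of T0]
  proof eventually_elim
   case (elim t)
   have "f t <= k orig (t / 2)" using f(2)[of t] k_anti[of "t / 2" t] elim by simp
   then have "f t / v t <= k orig (t / 2) / v t" using v(1)[OF elim(3)] by (simp add: divide_right_mono)
   also have "... = k orig (t / 2) * t / v t / t" using elim by simp
   also have "... <= A / t" using elim by (intro divide_right_mono) auto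
   finally show ?case .
  qed
 qed simp
 have step: "((%t. conv (k x) g t / v t) \<longlongrightarrow> B * mass (k x)) at_top"
  if g: "loc_bounded g" "((%t. g t / v t) \<longlongrightarrow> B) at_top" for g B x
 proof (rule conv_asymp_heavy[OF k i g(1) _ v g(2) _ small])
  have "((%t. g t / v t * v t) \<longlongrightarrow> B * 0) at_top" by (intro tendsto_mult g v0)
  moreover have "\<forall>\<^sub>F t in at_top. g t / v t * v t = g t"
   using eventually_ge_at_top[of T0] by eventually_elim (use v(1) in force)
  ultimately show "(g \<longlongrightarrow> 0) at_top" using Lim_transform_eventually by fastforce
  show "k x s <= k orig (t / 2)" if "0 <= t" "t / 2 <= s" "s <= t" for s t
   using k_le[of s x] k_anti[of "t / 2" s] that by simp
 qed
 define U where "U x = \<beta> * (L * mass (k x))" for x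
 have U: "((%t. u x t / v t) \<longlongrightarrow> U x) at_top" for x
 proof -
  have "((%t. k x t / v t + \<beta> * (conv (k x) w t / v t)) \<longlongrightarrow> 0 + U x) at_top"
   unfolding U_def by (intro tendsto_add tendsto_mult_left step w L negligible k_le k_nonneg)
  then show ?thesis by (simp add: u_def add_divide_distrib)
 qed
 have "((%t. loc x y t / v t) \<longlongrightarrow> \<beta> * (U y * mass (k x))) at_top" for x y
 proof -
  have "((%t. q x y t / v t + \<beta> * (conv (k x) (u y) t / v t)) \<longlongrightarrow> 0 + \<beta> * (U y * mass (k x))) at_top"
   by (intro tendsto_add tendsto_mult_left step u U negligible q)
  then show ?thesis by (simp add: loc_def add_divide_distrib)
 qed
 then show thesis using U \<beta> L m by (intro that[of U "%x y. \<beta> * (U y * mass (k x))"]) (auto simp: U_def)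
qed

lemma k_half_lim: "((%t. (t / 2) powr \<theta> * k orig (t / 2)) \<longlongrightarrow> c) at_top"
proof -
 have "filterlim (%t::real. t / 2) at_top at_top" by real_asymp
 from filterlim_compose[OF k_lim this] show ?thesis .
qed

theorem critical_dim_3:
 assumes \<theta>3: "\<theta> = 3 / 2" and total: "\<beta> * mass (k orig) = 1"
 obtains C C' where "!!x y. 0 < C x y" "!!x. 0 < C' x"
  "!!x y. ((%t. loc x y t / t powr (- 1 / 2)) \<longlongrightarrow> C x y) at_top"
  "!!x. ((%t. tot x t / t powr (1 / 2)) \<longlongrightarrow> C' x) at_top"
proof -
 let ?v = "%t::real. t powr (- 1 / 2)"
 have v_eq: "?v t = inverse (t powr (1 / 2))" for t using powr_minus[of t "1 / 2"] by simp
 have div: "x / inverse y = x * y" for x y :: real by (simp add: divide_inverse)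
 have \<theta>1: "1 < \<theta>" using \<theta>3 by simp
 interpret R: antimono_renewal "k orig" w \<beta> by (rule critical_renewal[OF \<theta>1 total])
 have "((%t. R.tail t * t powr (1 / 2)) \<longlongrightarrow> \<beta> * c / (1 / 2)) at_top"
  using critical_tail[OF \<theta>1 total] by (simp add: R.tail_def \<theta>3)
 moreover have "\<forall>\<^sub>F t in at_top. R.tail t * t powr (1 / 2) = R.tail t * sqrt t"
  using eventually_ge_at_top[of 0] by eventually_elim (simp add: powr_half_sqrt)
 ultimately have tail: "((%t. R.tail t * sqrt t) \<longlongrightarrow> \<beta> * c / (1 / 2)) at_top" by (rule Lim_transform_eventually)
 have \<kappa>: "0 < \<beta> * c / (1 / 2)" using \<beta> c by simp
 obtain L where L: "0 < L" "((%t. w t * sqrt t) \<longlongrightarrow> L) at_top" by (rule R.tail_sqrt[OF \<kappa> tail])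
 have "\<forall>\<^sub>F t in at_top. w t * sqrt t = w t / ?v t"
  using eventually_gt_at_top[of 0] by eventually_elim (simp only: v_eq div powr_half_sqrt less_imp_le)
 with L(2) have L': "((%t. w t / ?v t) \<longlongrightarrow> L) at_top" by (rule Lim_transform_eventually)
 have "((%t. 2 powr (3 / 2) * ((t / 2) powr \<theta> * k orig (t / 2))) \<longlongrightarrow> 2 powr (3 / 2) * c) at_top"
  by (intro tendsto_mult_left k_half_lim)
 then have "\<forall>\<^sub>F t in at_top. 2 powr (3 / 2) * ((t / 2) powr \<theta> * k orig (t / 2)) < 2 powr (3 / 2) * c + 1"
  by (rule order_tendstoD) simp
 then have small: "\<forall>\<^sub>F t in at_top. k orig (t / 2) * t / ?v t <= 2 powr (3 / 2) * c + 1"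
  using eventually_gt_at_top[of 0]
 proof eventually_elim
  case (elim t)
  have "t / ?v t = t powr 1 * t powr (1 / 2)" unfolding v_eq div using elim by simp
  also have "... = t powr (3 / 2)" by (simp only: powr_add[symmetric]) simp
  also have "... = 2 powr (3 / 2) * (t / 2) powr (3 / 2)" using elim by (simp add: powr_mult[symmetric])
  finally have TV: "t / ?v t = 2 powr (3 / 2) * (t / 2) powr (3 / 2)" .
  have "k orig (t / 2) * t / ?v t = k orig (t / 2) * (t / ?v t)" by simp
  also have "... = 2 powr (3 / 2) * ((t / 2) powr \<theta> * k orig (t / 2))" unfolding TV \<theta>3 by (simp only: mult_ac)
  finally have "k orig (t / 2) * t / ?v t = 2 powr (3 / 2) * ((t / 2) powr \<theta> * k orig (t / 2))" .
  then show ?case using elim by simp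
 qed
 have pos: "0 < ?v t" if "1 <= t" for t :: real using that by simp
 have shift: "((%t. ?v (t - s) / ?v t) \<longlongrightarrow> 1) at_top" for s by real_asymp
 have dom: "?v (t - s) <= 2 powr (1 / 2) * ?v t" if "1 <= t" "0 <= s" "s <= t / 2" for t s
 proof -
  have "?v (t - s) <= ?v (t / 2)" using that by (intro powr_mono2') auto
  also have "?v (t / 2) = 2 powr (1 / 2) * ?v t" unfolding v_eq by (simp add: powr_divide inverse_eq_divide)
  finally show ?thesis .
 qed
 have v0: "(?v \<longlongrightarrow> 0) at_top" by real_asymp
 obtain U C where U: "!!x. 0 < U x" "!!x. ((%t. u x t / ?v t) \<longlongrightarrow> U x) at_top"
  and C: "!!x y. 0 < C x y" "!!x y. ((%t. loc x y t / ?v t) \<longlongrightarrow> C x y) at_top"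
  by (rule heavy_case[where v="?v" and ?T0.0=1, OF k_integrable[OF \<theta>1] pos shift dom v0 small L(1) L']) (assumption | (rule that; blast))+
 have "((%t. tot x t / t powr (1 / 2)) \<longlongrightarrow> 2 * \<beta> * U x) at_top" for x
 proof -
  have "((%t. primitive (u x) t / (2 * t powr (1 / 2))) \<longlongrightarrow> U x) at_top"
  proof (rule primitive_asymp[OF u U(2), where ?T0.0=1])
   show "((%t. 2 * t powr (1 / 2)) has_real_derivative ?v t) (at t)" if "1 <= t" for t
    by (rule DERIV_cong[OF DERIV_cmult[OF has_real_derivative_powr]]) (use that in auto)
   show "continuous_on {1..} ?v" by (auto intro!: continuous_intros)
   show "filterlim (%t::real. 2 * t powr (1 / 2)) at_top at_top" by real_asymp
  qed auto
  then have "((%t. 1 / t powr (1 / 2) + (2 * \<beta>) * (primitive (u x) t / (2 * t powr (1 / 2)))) \<longlongrightarrow> 0 + 2 * \<beta> * U x) at_top"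
   by (intro tendsto_add tendsto_mult_left) real_asymp
  then show ?thesis by (simp add: tot_def add_divide_distrib)
 qed
 then show thesis using C U(1) \<beta> by (intro that[of C "%x. 2 * \<beta> * U x"]) auto
qed

theorem critical_dim_4:
 assumes \<theta>4: "\<theta> = 2" and total: "\<beta> * mass (k orig) = 1"
 obtains C C' where "!!x y. 0 < C x y" "!!x. 0 < C' x"
  "!!x y. ((%t. loc x y t / inverse (ln t)) \<longlongrightarrow> C x y) at_top"
  "!!x. ((%t. tot x t / (t * inverse (ln t))) \<longlongrightarrow> C' x) at_top"
proof -
 let ?v = "%t::real. inverse (ln t)"
 have \<theta>1: "1 < \<theta>" using \<theta>4 by simp
 interpret R: antimono_renewal "k orig" w \<beta> by (rule critical_renewal[OF \<theta>1 total])
 have "((%t. R.tail t * t powr 1) \<longlongrightarrow> \<beta> * c) at_top"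
  using critical_tail[OF \<theta>1 total] by (simp add: R.tail_def \<theta>4)
 moreover have "\<forall>\<^sub>F t in at_top. R.tail t * t powr 1 = R.tail t * t"
  using eventually_ge_at_top[of 0] by eventually_elim simp
 ultimately have "((%t. R.tail t * t) \<longlongrightarrow> \<beta> * c) at_top" by (rule Lim_transform_eventually)
 moreover have \<beta>c: "0 < \<beta> * c" using \<beta> c by simp
 ultimately have "((%t. w t * ln t) \<longlongrightarrow> 1 / (\<beta> * (\<beta> * c))) at_top" by (intro R.tail_inverse)
 then have L: "((%t. w t / ?v t) \<longlongrightarrow> 1 / (\<beta> * (\<beta> * c))) at_top" by (simp only: divide_inverse inverse_inverse_eq)
 have L0: "0 < 1 / (\<beta> * (\<beta> * c))" using \<beta> \<beta>c by simp
 have "((%t. (t / 2) powr \<theta> * k orig (t / 2) * (4 * ln t / t)) \<longlongrightarrow> c * 0) at_top"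
  by (intro tendsto_mult k_half_lim) real_asymp
 then have "\<forall>\<^sub>F t in at_top. (t / 2) powr \<theta> * k orig (t / 2) * (4 * ln t / t) < 1"
  by (rule order_tendstoD) simp
 then have small: "\<forall>\<^sub>F t in at_top. k orig (t / 2) * t / ?v t <= 1"
  using eventually_gt_at_top[of 0]
 proof eventually_elim
  case (elim t)
  have half: "(t / 2) powr \<theta> = t * t / 4" unfolding \<theta>4 using elim by (simp add: power2_eq_square)
  have "(t / 2) powr \<theta> * k orig (t / 2) * (4 * ln t / t) = k orig (t / 2) * t * ln t"
   unfolding half using elim(2) by simp
  also have "... = k orig (t / 2) * t / ?v t" by (simp only: divide_inverse inverse_inverse_eq)
  finally have "(t / 2) powr \<theta> * k orig (t / 2) * (4 * ln t / t) = k orig (t / 2) * t / ?v t" .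
  then show ?case using elim by simp
 qed
 have pos: "0 < ?v t" if "4 <= t" for t :: real using that by simp
 have shift: "((%t. ?v (t - s) / ?v t) \<longlongrightarrow> 1) at_top" for s by real_asymp
 have dom: "?v (t - s) <= 2 * ?v t" if "4 <= t" "0 <= s" "s <= t / 2" for t s
 proof -
  have "t <= (t / 2) * (t / 2)" using that mult_right_mono[of 4 t t] by simp
  also have "... <= (t - s) * (t - s)" using that by (intro mult_mono) auto
  finally have "ln t <= ln ((t - s) * (t - s))" using that by (intro ln_mono) auto
  then have "ln t <= 2 * ln (t - s)" using that by (simp add: ln_mult)
  moreover have "0 < ln t" "0 < ln (t - s)" using that by simp_all
  ultimately show ?thesis by (simp add: field_simps)
 qed
 have v0: "(?v \<longlongrightarrow> 0) at_top" by real_asymp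
 obtain U C where U: "!!x. 0 < U x" "!!x. ((%t. u x t / ?v t) \<longlongrightarrow> U x) at_top"
  and C: "!!x y. 0 < C x y" "!!x y. ((%t. loc x y t / ?v t) \<longlongrightarrow> C x y) at_top"
  by (rule heavy_case[where v="?v" and ?T0.0=4, OF k_integrable[OF \<theta>1] pos shift dom v0 small L0 L]) (assumption | (rule that; blast))+
 have "((%t. tot x t / (t * ?v t)) \<longlongrightarrow> \<beta> * U x) at_top" for x
 proof -
  let ?V' = "%t::real. 1 / ln t - 1 / (ln t)\<^sup>2"
  have lnt: "2 <= ln t" if "exp 2 <= t" for t :: real
   using that by (metis exp_gt_zero ln_exp ln_mono order_less_le_trans)
  have nz: "t ~= 0" "ln t ~= 0" if "exp 2 <= t" for t :: real
   using exp_gt_zero[of "2::real"] that lnt[OF that] by linarith+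
  have "((%t. primitive (u x) t / (t / ln t)) \<longlongrightarrow> U x) at_top"
  proof (rule primitive_asymp[OF u, where V'="?V'" and ?T0.0="exp 2"])
   have "((%t. ?v t / ?V' t) \<longlongrightarrow> 1) at_top" by real_asymp
   from tendsto_mult[OF U(2) this] have "((%t. u x t / ?v t * (?v t / ?V' t)) \<longlongrightarrow> U x) at_top" by simp
   moreover have "\<forall>\<^sub>F t in at_top. u x t / ?v t * (?v t / ?V' t) = u x t / ?V' t"
    using eventually_ge_at_top[of 4] by eventually_elim (use pos in force)
   ultimately show "((%t. u x t / ?V' t) \<longlongrightarrow> U x) at_top" by (rule Lim_transform_eventually)
   show "((%t. t / ln t) has_real_derivative ?V' t) (at t)" if "exp 2 <= t" for t :: real
   proof -
    have t: "0 < t" using that exp_gt_zero[of "2::real"] by linarith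
    have "((%t. t / ln t) has_real_derivative (1 * ln t - t * (1 / t)) / (ln t * ln t)) (at t)"
     by (rule DERIV_divide[OF DERIV_ident DERIV_ln_divide[OF t]]) (use lnt[OF that] in simp)
    moreover have "(1 * ln t - t * (1 / t)) / (ln t * ln t) = ?V' t"
     using t lnt[OF that] by (simp add: diff_divide_distrib power2_eq_square)
    ultimately show ?thesis by (simp only:)
   qed
   show "continuous_on {exp 2..} ?V'"
    by (intro continuous_intros ballI) (simp_all add: nz)
   show "0 < ?V' t" if "exp 2 <= t" for t
    using lnt[OF that] by (simp add: power2_eq_square field_simps)
   show "filterlim (%t::real. t / ln t) at_top at_top" by real_asymp
  qed simp
  then have "((%t. ln t / t + \<beta> * (primitive (u x) t / (t / ln t))) \<longlongrightarrow> 0 + \<beta> * U x) at_top"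
   by (intro tendsto_add tendsto_mult_left) real_asymp
  moreover have "ln t / t + \<beta> * (primitive (u x) t / (t / ln t)) = tot x t / (t * ?v t)" for t
   by (simp add: tot_def divide_inverse algebra_simps)
  ultimately show ?thesis by simp
 qed
 then show thesis using C U(1) \<beta> by (intro that[of C "%x. \<beta> * U x"]) auto
qed

text \<open>All functions decay like the transition probabilities, and both halves of each convolution contribute to the
constants.\<close>
theorem subcritical:
 assumes \<theta>1: "1 < \<theta>" and total: "\<beta> * mass (k orig) < 1"
 obtains C C' where "!!x y. 0 < C x y" "!!x. 0 < C' x"
  "!!x y. ((%t. loc x y t / t powr (- \<theta>)) \<longlongrightarrow> C x y) at_top"
  "!!x. (tot x \<longlongrightarrow> C' x) at_top"
proof -
 let ?v = "%t::real. (1 + t) powr (- \<theta>)"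
 have \<theta>0: "0 <= \<theta>" using \<theta>1 by simp
 note ki = k_integrable[OF \<theta>1]
 obtain L where L: "0 < L" "hl_integrable w" "((%t. w t / ?v t) \<longlongrightarrow> L) at_top"
  using subcritical_renewal[OF k ki w \<beta> \<theta>0 total renewal_eq power_ratio[OF k_lim] c] by blast
 have pos: "0 < ?v t" if "0 <= t" for t by (rule power_weight(2)[OF \<theta>0 that])
 have shift: "((%t. ?v (t - s) / ?v t) \<longlongrightarrow> 1) at_top" for s by (rule power_weight(4)[OF \<theta>0])
 have dom: "?v (t - s) <= (1 / 2) powr (- \<theta>) * ?v t" if "0 <= t" "0 <= s" "s <= t / 2" for t s
  by (rule power_weight(5)[OF \<theta>0]) (use that in auto)
 note both = conv_asymp_integrable[where v="?v" and ?T0.0=0, OF k ki _ _ pos shift dom power_ratio[OF k_lim]]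
 have m: "0 <= mass f" if "loc_bounded f" for f by (rule mass_nonneg[OF that])
 define U where "U x = c + \<beta> * (L * mass (k x) + c * mass w)" for x
 have U: "((%t. u x t / ?v t) \<longlongrightarrow> U x) at_top" for x
 proof -
  have "((%t. k x t / ?v t + \<beta> * (conv (k x) w t / ?v t)) \<longlongrightarrow> U x) at_top"
   unfolding U_def by (intro tendsto_add tendsto_mult_left power_ratio[OF k_lim] both w L)
  then show ?thesis by (simp add: u_def add_divide_distrib)
 qed
 have U0: "0 < U x" for x
  unfolding U_def using c \<beta> L m[OF k[of x]] m[OF w] by (intro add_pos_nonneg mult_nonneg_nonneg add_nonneg_nonneg) auto
 have ui: "hl_integrable (u x)" for x by (rule hl_integrable_of_power_decay[OF u \<theta>1 U])
 define C where "C x y = c + \<beta> * (U y * mass (k x) + c * mass (u y))" for x y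
 have C0: "0 < C x y" for x y
  unfolding C_def using c \<beta> less_imp_le[OF U0[of y]] m[OF k[of x]] m[OF u[of y]]
  by (intro add_pos_nonneg mult_nonneg_nonneg add_nonneg_nonneg) auto
 have "((%t. loc x y t / t powr (- \<theta>)) \<longlongrightarrow> C x y) at_top" for x y
 proof -
  have "((%t. q x y t / ?v t + \<beta> * (conv (k x) (u y) t / ?v t)) \<longlongrightarrow> C x y) at_top"
   unfolding C_def by (intro tendsto_add tendsto_mult_left power_ratio[OF q(3)] both u ui U)
  then have "((%t. loc x y t / ?v t) \<longlongrightarrow> C x y) at_top" by (simp add: loc_def add_divide_distrib)
  moreover have "((%t. ((1 + t) / t) powr (- \<theta>)) \<longlongrightarrow> 1 powr (- \<theta>)) at_top"
  proof (intro tendsto_powr tendsto_const)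
   show "((%t. (1 + t) / t) \<longlongrightarrow> (1::real)) at_top" by real_asymp
  qed simp
  ultimately have "((%t. loc x y t / ?v t * ((1 + t) / t) powr (- \<theta>)) \<longlongrightarrow> C x y * 1 powr (- \<theta>)) at_top"
   by (rule tendsto_mult)
  moreover have "\<forall>\<^sub>F t in at_top. loc x y t / ?v t * ((1 + t) / t) powr (- \<theta>) = loc x y t / t powr (- \<theta>)"
   using eventually_gt_at_top[of 0] by eventually_elim (simp add: powr_divide)
  ultimately show ?thesis using Lim_transform_eventually by fastforce
 qed
 moreover have "(tot x \<longlongrightarrow> 1 + \<beta> * mass (u x)) at_top" for x
  unfolding tot_def[abs_def] by (intro tendsto_intros primitive_tendsto_mass u ui)
 moreover have "0 < 1 + \<beta> * mass (u x)" for x using \<beta> m[OF u[of x]] by (intro add_pos_nonneg) auto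
 ultimately show thesis using C0 by (intro that[of C "%x. 1 + \<beta> * mass (u x)"])
qed

end

section \<open>Asymptotics for the branching random walk\<close>

theorem theorem4p1:
  fixes a :: "int ^ 'd \<Rightarrow> int ^ 'd \<Rightarrow> real"
    and p :: "real \<Rightarrow> int ^ 'd \<Rightarrow> (int ^ 'd) pmf"
    and b :: "nat \<Rightarrow> real"
    and M :: "int ^ 'd \<Rightarrow> 'w measure"
    and X :: "real \<Rightarrow> 'w \<Rightarrow> (int ^ 'd) multiset"
  assumes "walk_intensities a"
    and "walk_transitions a p"
    and "branching_intensities b"
    and "branching_random_walk a b M X"
    and "beta_star b > 0"
    and "(\<lambda>z. (lattice_norm z)\<^sup>2 * a 0 z) summable_on UNIV"
  shows "\<exists>(C :: int ^ 'd \<Rightarrow> int ^ 'd \<Rightarrow> real) (C' :: int ^ 'd \<Rightarrow> real).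
    (\<forall>x y. C x y > 0) \<and> (\<forall>x. C' x > 0) \<and>
    (\<forall>u v :: real \<Rightarrow> real.
       beta_star b > beta_crit p \<and>
         u = (\<lambda>t. exp (lambda_E a b * t)) \<and>
         v = (\<lambda>t. exp (lambda_E a b * t)) \<or>
       beta_star b = beta_crit p \<and> CARD('d) = 3 \<and>
         u = (\<lambda>t. t powr (- 1 / 2) * exp (- b 0 * t)) \<and>
         v = (\<lambda>t. t powr (1 / 2) * exp (- b 0 * t)) \<or>
       beta_star b = beta_crit p \<and> CARD('d) = 4 \<and>
         u = (\<lambda>t. inverse (ln t) * exp (- b 0 * t)) \<and>
         v = (\<lambda>t. t * inverse (ln t) * exp (- b 0 * t)) \<or>
       beta_star b = beta_crit p \<and> CARD('d) \<ge> 5 \<and>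
         u = (\<lambda>t. exp (- b 0 * t)) \<and>
         v = (\<lambda>t. t * exp (- b 0 * t)) \<or>
       beta_star b < beta_crit p \<and> CARD('d) \<ge> 3 \<and>
         u = (\<lambda>t. t powr (- real CARD('d) / 2) * exp (- b 0 * t)) \<and>
         v = (\<lambda>t. exp (- b 0 * t))
       \<longrightarrow> (\<forall>x y. (\<lambda>t. local_moment M X 1 t x y) \<sim>[at_top] (\<lambda>t. C x y * u t)) \<and>
           (\<forall>x. (\<lambda>t. total_moment M X 1 t x) \<sim>[at_top] (\<lambda>t. C' x * v t)))"
proof -
 note a = assms(1) and p = assms(2) and beta = assms(5) and var = assms(6)
 let ?\<beta> = "beta_star b"
 obtain c where c: "0 < c" and lim: "!!x y. ((%t. t powr (real CARD('d) / 2) * pmf (p t x) y) \<longlongrightarrow> c) at_top"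
  by (rule local_limit[OF a p var]) (rule that; blast)
 obtain w where w: "loc_bounded w"
  and w_eq: "!!t. 0 <= t ==> w t = pmf (p t 0) 0 + ?\<beta> * conv (%t. pmf (p t 0) 0) w t"
  and local_eq: "!!t x y. 0 <= t ==> exp (b 0 * t) * local_moment M X 1 t x y = pmf (p t x) y
   + ?\<beta> * conv (%t. pmf (p t x) 0) (%t. pmf (p t y) 0 + ?\<beta> * conv (%t. pmf (p t y) 0) w t) t"
  and total_eq: "!!t x. 0 <= t ==> exp (b 0 * t) * total_moment M X 1 t x = 1
   + ?\<beta> * primitive (%t. pmf (p t x) 0 + ?\<beta> * conv (%t. pmf (p t x) 0) w t) t"
  and convex: "!!t h. 0 <= t ==> 0 <= h ==> (w (t + h))\<^sup>2 <= w t * w (t + 2 * h)"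
  and growth: "!!t h. 0 <= t ==> 0 <= h ==> w t * pmf (p h 0) 0 <= w (t + h)"
 proof (rule first_moment_structure[OF a p assms(3,4) beta], goal_cases)
  case (1 w)
  show ?case by (rule that[OF 1(2-7)])
 qed
 define \<theta> where "\<theta> = real CARD('d) / 2"
 interpret W: walk_moments "%x t. pmf (p t x) 0" "%x y t. pmf (p t x) y" 0 w ?\<beta> \<theta> c
 proof
  show "0 < \<theta>" by (simp add: \<theta>_def)
  show "((%t. t powr \<theta> * pmf (p t x) 0) \<longlongrightarrow> c) at_top" for x unfolding \<theta>_def by (rule lim)
  show "((%t. t powr \<theta> * pmf (p t x) y) \<longlongrightarrow> c) at_top" for x y unfolding \<theta>_def by (rule lim)
  show "loc_bounded (%t. pmf (p t x) 0)" for x by (rule walk_kernel_loc_bounded[OF a p])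
  show "pmf (p t x) 0 <= pmf (p t 0) 0" if "0 <= t" for x t by (rule transition_le_return[OF a p that])
  show "pmf (p t x) y <= pmf (p t 0) 0" if "0 <= t" for x y t by (rule transition_le_return[OF a p that])
  show "0 < pmf (p t 0) 0" if "0 <= t" for t by (rule return_pos[OF a p var that])
  show "pmf (p t 0) 0 <= pmf (p s 0) 0" if "0 <= s" "s <= t" for s t by (rule return_antimono[OF a p that])
  show "w t = pmf (p t 0) 0 + ?\<beta> * conv (%t. pmf (p t 0) 0) w t" if "0 <= t" for t by (rule w_eq[OF that])
  show "(w (t + h))\<^sup>2 <= w t * w (t + 2 * h)" if "0 <= t" "0 <= h" for t h by (rule convex[OF that])
  show "w t * pmf (p h 0) 0 <= w (t + h)" if "0 <= t" "0 <= h" for t h by (rule growth[OF that])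
 qed (rule pmf_le_1 pmf_nonneg c w beta)+
 let ?k = "%t. pmf (p t 0) 0"
 have equiv: "f \<sim>[at_top] (%t. C * (g t * exp (- b 0 * t)))"
  if "0 < C" and lim: "((%t. F t / g t) \<longlongrightarrow> C) at_top" and F: "!!t. 0 <= t ==> exp (b 0 * t) * f t = F t"
  for C :: real and f F g :: "real => real"
 proof (rule asymp_equivI')
  have "((%t. F t / g t / C) \<longlongrightarrow> C / C) at_top" by (intro tendsto_divide lim tendsto_const) (use that(1) in simp)
  then have "((%t. F t / g t / C) \<longlongrightarrow> 1) at_top" using that(1) by simp
  moreover have "\<forall>\<^sub>F t in at_top. F t / g t / C = f t / (C * (g t * exp (- b 0 * t)))"
   using eventually_ge_at_top[of 0]
  proof eventually_elim
   case (elim t)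
   show ?case unfolding F[OF elim, symmetric] by (simp add: exp_minus divide_inverse mult_ac)
  qed
  ultimately show "((%t. f t / (C * (g t * exp (- b 0 * t)))) \<longlongrightarrow> 1) at_top" by (rule Lim_transform_eventually)
 qed
 have local: "(%t. local_moment M X 1 t x y) \<sim>[at_top] (%t. C * (g t * exp (- b 0 * t)))"
  if "0 < C" "((%t. W.loc x y t / g t) \<longlongrightarrow> C) at_top" for C g x y
  by (rule equiv[OF that]) (simp only: local_eq W.loc_def W.u_def[abs_def])
 have total: "(%t. total_moment M X 1 t x) \<sim>[at_top] (%t. C * (g t * exp (- b 0 * t)))"
  if "0 < C" "((%t. W.tot x t / g t) \<longlongrightarrow> C) at_top" for C g x
  by (rule equiv[OF that]) (simp only: total_eq W.tot_def W.u_def[abs_def])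
 have crit: "beta_crit p = (if hl_integrable ?k then 1 / mass ?k else 0)" by (rule beta_crit_eq[OF W.k])
 have integrable_case: "beta_crit p = 1 / mass ?k" "0 < mass ?k" "1 < \<theta>" if "3 <= CARD('d)"
 proof -
  have "real 3 <= real CARD('d)" using that by (rule of_nat_mono)
  then show \<theta>: "1 < \<theta>" by (simp add: \<theta>_def)
  show "beta_crit p = 1 / mass ?k" using crit W.k_integrable[OF \<theta>] by simp
  show "0 < mass ?k" by (rule mass_pos[OF W.k W.k_integrable[OF \<theta>], of 0]) (simp add: W.k_pos)
 qed
 have critical: "?\<beta> * mass ?k = 1" if "?\<beta> = beta_crit p" "3 <= CARD('d)"
  using integrable_case[OF that(2)] that(1) by simp
 have subcritical: "?\<beta> * mass ?k < 1" if "?\<beta> < beta_crit p" "3 <= CARD('d)"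
  using integrable_case[OF that(2)] that(1) by (simp add: pos_less_divide_eq)
 consider (super) "beta_crit p < ?\<beta>" | (three) "?\<beta> = beta_crit p" "CARD('d) = 3" | (four) "?\<beta> = beta_crit p" "CARD('d) = 4"
  | (five) "?\<beta> = beta_crit p" "5 <= CARD('d)" | (sub) "?\<beta> < beta_crit p" "3 <= CARD('d)"
  | (none) "?\<beta> <= beta_crit p" "CARD('d) < 3" by linarith
 then obtain C C' g h where pos: "\<forall>x y. 0 < C x y" "\<forall>x. 0 < C' x"
  and good: "\<not> (?\<beta> <= beta_crit p & CARD('d) < 3) ==>
   (\<forall>x y. ((%t. W.loc x y t / g t) \<longlongrightarrow> C x y) at_top) & (\<forall>x. ((%t. W.tot x t / h t) \<longlongrightarrow> C' x) at_top)"
  and form: "!!u v. beta_star b > beta_crit p &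
    u = (%t. exp (lambda_E a b * t)) &
    v = (%t. exp (lambda_E a b * t)) \<or>
   beta_star b = beta_crit p & CARD('d) = 3 &
    u = (%t. t powr (- 1 / 2) * exp (- b 0 * t)) &
    v = (%t. t powr (1 / 2) * exp (- b 0 * t)) \<or>
   beta_star b = beta_crit p & CARD('d) = 4 &
    u = (%t. inverse (ln t) * exp (- b 0 * t)) &
    v = (%t. t * inverse (ln t) * exp (- b 0 * t)) \<or>
   beta_star b = beta_crit p & CARD('d) \<ge> 5 &
    u = (%t. exp (- b 0 * t)) &
    v = (%t. t * exp (- b 0 * t)) \<or>
   beta_star b < beta_crit p & CARD('d) \<ge> 3 &
    u = (%t. t powr (- real CARD('d) / 2) * exp (- b 0 * t)) &
    v = (%t. exp (- b 0 * t)) ==>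
   u = (%t. g t * exp (- b 0 * t)) & v = (%t. h t * exp (- b 0 * t))"
 proof cases
  case super
  have "\<exists>T\<ge>0. 1 < ?\<beta> * primitive ?k T"
  proof (rule ccontr)
   assume "\<not> ?thesis"
   then have le: "primitive ?k T <= 1 / ?\<beta>" if "0 <= T" for T
    using that beta by (force simp: pos_le_divide_eq mult.commute not_less)
   have i: "hl_integrable ?k" by (rule hl_integrableI_bounded_primitive[OF W.k le])
   have "mass ?k <= 1 / ?\<beta>"
    by (rule tendsto_upperbound[OF primitive_tendsto_mass[OF W.k i]])
     (auto intro: eventually_mono[OF eventually_ge_at_top[of 0] le])
   moreover have "0 < mass ?k" by (rule mass_pos[OF W.k i, of 0]) (simp add: W.k_pos)
   ultimately have "?\<beta> <= 1 / mass ?k" using beta by (simp add: field_simps)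
   then show False using super crit i by simp
  qed
  then obtain T where T: "0 <= T" "1 < ?\<beta> * primitive ?k T" by blast
  obtain mu C C' where mu: "0 < mu" "?\<beta> * laplace ?k mu = 1" and C: "!!x y. 0 < C x y" "!!x. 0 < C' x"
   "!!x y. ((%t. W.loc x y t / exp (mu * t)) \<longlongrightarrow> C x y) at_top"
   "!!x. ((%t. W.tot x t / exp (mu * t)) \<longlongrightarrow> C' x) at_top"
   by (rule W.supercritical[OF T]) (rule that; blast)
  have "lambda_E a b = mu - b 0"
   unfolding lambda_E_def by (simp only: lambda_0_eq[OF a p W.k_pos mu])
  then have e: "exp (lambda_E a b * t) = exp (mu * t) * exp (- b 0 * t)" for t
   by (simp add: left_diff_distrib exp_diff exp_minus divide_inverse)
  show thesis
   by (rule that[of C C' "%t. exp (mu * t)" "%t. exp (mu * t)"]) (use C super in \<open>auto simp: e\<close>)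
 next
  case three
  have d3: "3 <= CARD('d)" using three(2) by linarith
  have \<theta>3: "\<theta> = 3 / 2" by (simp add: \<theta>_def three)
  obtain C C' where C: "!!x y. 0 < C x y" "!!x. 0 < C' x"
   "!!x y. ((%t. W.loc x y t / t powr (- 1 / 2)) \<longlongrightarrow> C x y) at_top"
   "!!x. ((%t. W.tot x t / t powr (1 / 2)) \<longlongrightarrow> C' x) at_top"
   by (rule W.critical_dim_3[OF \<theta>3 critical[OF three(1) d3]]) (rule that; blast)
  show thesis
   by (rule that[of C C' "%t. t powr (- 1 / 2)" "%t. t powr (1 / 2)"]) (use C three in auto)
 next
  case four
  have d3: "3 <= CARD('d)" using four(2) by linarith
  have \<theta>4: "\<theta> = 2" by (simp add: \<theta>_def four)
  obtain C C' where C: "!!x y. 0 < C x y" "!!x. 0 < C' x"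
   "!!x y. ((%t. W.loc x y t / inverse (ln t)) \<longlongrightarrow> C x y) at_top"
   "!!x. ((%t. W.tot x t / (t * inverse (ln t))) \<longlongrightarrow> C' x) at_top"
   by (rule W.critical_dim_4[OF \<theta>4 critical[OF four(1) d3]]) (rule that; blast)
  show thesis
   by (rule that[of C C' "%t. inverse (ln t)" "%t. t * inverse (ln t)"]) (use C four in auto)
 next
  case five
  have d3: "3 <= CARD('d)" using five(2) by linarith
  have "real 5 <= real CARD('d)" using five(2) by (rule of_nat_mono)
  then have \<theta>5: "2 < \<theta>" by (simp add: \<theta>_def)
  obtain C C' where C: "!!x y. 0 < C x y" "!!x. 0 < C' x" "!!x y. (W.loc x y \<longlongrightarrow> C x y) at_top"
   "!!x. ((%t. W.tot x t / t) \<longlongrightarrow> C' x) at_top"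
   by (rule W.critical_light[OF \<theta>5 critical[OF five(1) d3]]) (rule that; blast)
  show thesis
   by (rule that[of C C' "%t. 1" "%t. t"]) (use C five in auto)
 next
  case sub
  obtain C C' where C: "!!x y. 0 < C x y" "!!x. 0 < C' x"
   "!!x y. ((%t. W.loc x y t / t powr (- \<theta>)) \<longlongrightarrow> C x y) at_top" "!!x. (W.tot x \<longlongrightarrow> C' x) at_top"
   by (rule W.subcritical[OF integrable_case(3)[OF sub(2)] subcritical[OF sub]]) (rule that; blast)
  show thesis
   by (rule that[of C C' "%t. t powr (- \<theta>)" "%t. 1"]) (use C sub in \<open>auto simp: \<theta>_def\<close>)
 next
  case none
  show thesis
   by (rule that[of "%_ _. 1" "%_. 1" "%_. 1" "%_. 1"]) (use none in auto)
 qed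
 show ?thesis
 proof (intro exI[of _ C] exI[of _ C'] conjI pos allI impI)
  fix u v :: "real => real" and x y :: "int ^ 'd"
  assume hyp: "beta_star b > beta_crit p &
    u = (%t. exp (lambda_E a b * t)) &
    v = (%t. exp (lambda_E a b * t)) \<or>
   beta_star b = beta_crit p & CARD('d) = 3 &
    u = (%t. t powr (- 1 / 2) * exp (- b 0 * t)) &
    v = (%t. t powr (1 / 2) * exp (- b 0 * t)) \<or>
   beta_star b = beta_crit p & CARD('d) = 4 &
    u = (%t. inverse (ln t) * exp (- b 0 * t)) &
    v = (%t. t * inverse (ln t) * exp (- b 0 * t)) \<or>
   beta_star b = beta_crit p & CARD('d) \<ge> 5 &
    u = (%t. exp (- b 0 * t)) &
    v = (%t. t * exp (- b 0 * t)) \<or>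
   beta_star b < beta_crit p & CARD('d) \<ge> 3 &
    u = (%t. t powr (- real CARD('d) / 2) * exp (- b 0 * t)) &
    v = (%t. exp (- b 0 * t))"
  then have "\<not> (?\<beta> <= beta_crit p & CARD('d) < 3)" by linarith
  note lims = good[OF this]
  have uv: "u = (%t. g t * exp (- b 0 * t))" "v = (%t. h t * exp (- b 0 * t))" using form[OF hyp] by blast+
  show "(%t. local_moment M X 1 t x y) \<sim>[at_top] (%t. C x y * u t)"
   unfolding uv by (rule local) (use pos lims in blast)+
  show "(%t. total_moment M X 1 t x) \<sim>[at_top] (%t. C' x * v t)"
   unfolding uv by (rule total) (use pos lims in blast)+
 qed
qed

end
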